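(* Let $\mathbf k$ be a field, let $A$ be a (not necessarily unital) associative $\mathbf k$-algebra and $I\subseteq A$ a two-sided ideal, and let $(I,A,inc)$ be the corresponding inclusion crossed module of algebras. Suppose that $H_n^{bar}(I,A,inc)=0$ for all $n\ge 0$. Then the crossed module $(I,A,inc)$ is excisive for Hochschild homology in the category of crossed modules of algebras.
   Context: All algebras are not-necessarily-unital associative algebras over a fixed field $\mathbf k$ (any characteristic); tensor products are over $\mathbf k$; ideals are two-sided. Crossed modules. An action of an algebra $A$ on an algebra $R$ is an $A$-bimodule structure on $R$ with $a(rr')=(ar)r'$, $(ra)r'=r(ar')$, $(rr')a=r(r'a)$. A crossed module $(R,A,\rho)$ is an algebra homomorphism $\rho:R\to A$ with an action of $A$ on $R$ such that $\rho(ar)=a\rho(r)$, $\rho(ra)=\rho(r)a$, and $\rho(r)r'=rr'=r\rho(r')$. A morphism $(\mu,\nu):(R,A,\rho)\to(R',A',\rho')$ is a pair of algebra homomorphisms $\mu:R\to R'$, $\nu:A\to A'$ with $\rho'\mu=\nu\rho$, $\mu(ar)=\nu(a)\mu(r)$, $\mu(ra)=\mu(r)\nu(a)$. If $I$ is an ideal of $A$, the inclusion $I\hookrightarrow A$, with $A$ acting by multiplication, is a crossed module $(I,A,inc)$, called an inclusion crossed module. Nerve. $R\rtimes A$ is $R\oplus A$ with $(r,a)(r',a')=(rr'+ar'+ra',aa')$. The nerve $\mathfrak N_*(R,A,\rho)$ is the simplicial algebra with $\mathfrak N_n=R\rtimes(\cdots(R\rtimes A)\cdots)$ ($n$ factors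 $R$), where $A$ acts on $R$ as given and a tuple $(r_1,\dots,r_n,a)$ acts on $R$ through $\rho(r_1)+\cdots+\rho(r_n)+a$; $d_0(r_1,\dots,r_n,a)=(r_2,\dots,r_n,a)$, $d_i(r_1,\dots,r_n,a)=(r_1,\dots,r_i+r_{i+1},\dots,r_n,a)$ for $0<i<n$, $d_n(r_1,\dots,r_n,a)=(r_1,\dots,r_{n-1},\rho(r_n)+a)$, $s_i(r_1,\dots,r_n,a)=(r_1,\dots,r_i,0,r_{i+1},\dots,r_n,a)$. Complexes. For an algebra $A$, $C^{bar}_n(A)=C_n(A)=A^{\otimes(n+1)}$ with boundaries $b'(a_0\otimes\cdots\otimes a_n)=\sum_{i=0}^{n-1}(-1)^i a_0\otimes\cdots\otimes a_ia_{i+1}\otimes\cdots\otimes a_n$ and $b=b'+(-1)^n(a_na_0\otimes a_1\otimes\cdots\otimes a_{n-1})$ respectively. Let $t(a_0\otimes\cdots\otimes a_n)=(-1)^n a_n\otimes a_0\otimes\cdots\otimes a_{n-1}$. $CC^{\{2\}}(A)$ is the total complex of the two-column bicomplex with column $0$ equal to $(A^{\otimes(\ast+1)},b)$, column $1$ equal to $(A^{\otimes(\ast+1)},-b')$, and horizontal differential $1-t$ from column $1$ to column $0$. For $\Phi\in\{C^{bar},CC^{\{2\}}\}$, $\Phi(R,A,\rho)$ is the total complex of the bicomplex obtained by applying $\Phi$ dimension-wise to $\mathfrak N_*(R,A,\rho)$, with simplicial-direction differentials given by alternating sums of faces. Put $H^{bar}_n(R,A,\rho)=H_n(C^{bar}(R,A,\rho))$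 and $HH_n(R,A,\rho)=H_n(CC^{\{2\}}(R,A,\rho))$. Excision. A linearly split extension $0\to(R,A,\rho)\xrightarrow{(\mu,\nu)}(S,B,\sigma)\xrightarrow{(\eta,\theta)}(T,C,\tau)\to0$ is a sequence of morphisms of crossed modules such that $0\to R\to S\to T\to0$ and $0\to A\to B\to C\to0$ are exact and there are linear maps $\gamma:T\to S$, $\delta:C\to B$ with $\eta\gamma=1_T$, $\theta\delta=1_C$, $\sigma\gamma=\delta\tau$. The crossed module $(R,A,\rho)$ is excisive for Hochschild homology if for every such extension the induced natural long homology sequence $\cdots\to HH_n(R,A,\rho)\to HH_n(S,B,\sigma)\to HH_n(T,C,\tau)\to HH_{n-1}(R,A,\rho)\to\cdots$ is exact; precisely, if for every such extension the natural map $CC^{\{2\}}(R,A,\rho)\to\operatorname{Ker}\big(CC^{\{2\}}(S,B,\sigma)\to CC^{\{2\}}(T,C,\tau)\big)$ is a quasi-isomorphism. *)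

theory Defs
  imports "HOL.Vector_Spaces" "HOL-Algebra.Module" "HOL-Algebra.AbelCoset" "HOL-Algebra.Product_Groups"
    "HOL-Library.Poly_Mapping"
begin

section \<open>Non-unital algebras over a field\<close>

text \<open>
  The ground field is a type \<open>'k :: field\<close>. To reuse the locale \<^locale>\<open>Module.module\<close> it is
  turned into a ring object. An algebra is a record of type \<open>('k, 'v) module\<close>; its field
  \<^const>\<open>one\<close> is never used.
\<close>

definition ground_field :: "'k::field ring" where
  "ground_field = \<lparr>carrier = UNIV, monoid.mult = (*), one = 1, ring.zero = 0, ring.add = (+)\<rparr>"

locale nonunital_algebra = Module.module ground_field A
  for A :: "('k::field, 'v) module" (structure) +
  assumes mult_closed: "\<lbrakk>x \<in> carrier A; y \<in> carrier A\<rbrakk> \<Longrightarrow> x \<otimes> y \<in> carrier A"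
    and mult_assoc: "\<lbrakk>x \<in> carrier A; y \<in> carrier A; z \<in> carrier A\<rbrakk>
          \<Longrightarrow> (x \<otimes> y) \<otimes> z = x \<otimes> (y \<otimes> z)"
    and mult_l_distr: "\<lbrakk>x \<in> carrier A; y \<in> carrier A; z \<in> carrier A\<rbrakk>
          \<Longrightarrow> (x \<oplus> y) \<otimes> z = x \<otimes> z \<oplus> y \<otimes> z"
    and mult_r_distr: "\<lbrakk>x \<in> carrier A; y \<in> carrier A; z \<in> carrier A\<rbrakk>
          \<Longrightarrow> z \<otimes> (x \<oplus> y) = z \<otimes> x \<oplus> z \<otimes> y"
    and smult_mult_l: "\<lbrakk>x \<in> carrier A; y \<in> carrier A\<rbrakk> \<Longrightarrow> (c \<odot> x) \<otimes> y = c \<odot> (x \<otimes> y)"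
    and smult_mult_r: "\<lbrakk>x \<in> carrier A; y \<in> carrier A\<rbrakk> \<Longrightarrow> x \<otimes> (c \<odot> y) = c \<odot> (x \<otimes> y)"

locale algebra_ideal = submodule I ground_field A
  for I :: "'v set" and A :: "('k::field, 'v) module" (structure) +
  assumes ideal_l: "\<lbrakk>a \<in> carrier A; x \<in> I\<rbrakk> \<Longrightarrow> a \<otimes> x \<in> I"
    and ideal_r: "\<lbrakk>a \<in> carrier A; x \<in> I\<rbrakk> \<Longrightarrow> x \<otimes> a \<in> I"

definition linear_map ::
  "('k::field, 'v) module \<Rightarrow> ('k, 'w) module \<Rightarrow> ('v \<Rightarrow> 'w) \<Rightarrow> bool" where
  "linear_map V W f \<longleftrightarrow> f \<in> hom (add_monoid V) (add_monoid W) \<and>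
     (\<forall>c. \<forall>x\<in>carrier V. f (c \<odot>\<^bsub>V\<^esub> x) = c \<odot>\<^bsub>W\<^esub> f x)"

definition algebra_hom ::
  "('k::field, 'v) module \<Rightarrow> ('k, 'w) module \<Rightarrow> ('v \<Rightarrow> 'w) \<Rightarrow> bool" where
  "algebra_hom A B f \<longleftrightarrow> linear_map A B f \<and>
     (\<forall>x\<in>carrier A. \<forall>y\<in>carrier A. f (x \<otimes>\<^bsub>A\<^esub> y) = f x \<otimes>\<^bsub>B\<^esub> f y)"


section \<open>Crossed modules\<close>

record ('k, 'r, 'a) crossed_mod =
  cm_top :: "('k, 'r) module"
  cm_base :: "('k, 'a) module"
  cm_map :: "'r \<Rightarrow> 'a"
  cm_lact :: "'a \<Rightarrow> 'r \<Rightarrow> 'r"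
  cm_ract :: "'r \<Rightarrow> 'a \<Rightarrow> 'r"

locale algebra_action = A: nonunital_algebra A + R: nonunital_algebra R
  for A :: "('k::field, 'a) module" and R :: "('k, 'r) module" +
  fixes lact :: "'a \<Rightarrow> 'r \<Rightarrow> 'r" (infixr \<open>\<rhd>\<close> 72)
    and ract :: "'r \<Rightarrow> 'a \<Rightarrow> 'r" (infixl \<open>\<lhd>\<^sub>r\<close> 72)
  assumes lact_closed: "\<lbrakk>a \<in> carrier A; r \<in> carrier R\<rbrakk> \<Longrightarrow> a \<rhd> r \<in> carrier R"
    and lact_add_l: "\<lbrakk>a \<in> carrier A; a' \<in> carrier A; r \<in> carrier R\<rbrakk>
          \<Longrightarrow> (a \<oplus>\<^bsub>A\<^esub> a') \<rhd> r = (a \<rhd> r) \<oplus>\<^bsub>R\<^esub> (a' \<rhd> r)"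
    and lact_add_r: "\<lbrakk>a \<in> carrier A; r \<in> carrier R; r' \<in> carrier R\<rbrakk>
          \<Longrightarrow> a \<rhd> (r \<oplus>\<^bsub>R\<^esub> r') = (a \<rhd> r) \<oplus>\<^bsub>R\<^esub> (a \<rhd> r')"
    and lact_smult_l: "\<lbrakk>a \<in> carrier A; r \<in> carrier R\<rbrakk> \<Longrightarrow> (c \<odot>\<^bsub>A\<^esub> a) \<rhd> r = c \<odot>\<^bsub>R\<^esub> (a \<rhd> r)"
    and lact_smult_r: "\<lbrakk>a \<in> carrier A; r \<in> carrier R\<rbrakk> \<Longrightarrow> a \<rhd> (c \<odot>\<^bsub>R\<^esub> r) = c \<odot>\<^bsub>R\<^esub> (a \<rhd> r)"
    and lact_assoc: "\<lbrakk>a \<in> carrier A; a' \<in> carrier A; r \<in> carrier R\<rbrakk>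
          \<Longrightarrow> (a \<otimes>\<^bsub>A\<^esub> a') \<rhd> r = a \<rhd> (a' \<rhd> r)"
    and ract_closed: "\<lbrakk>a \<in> carrier A; r \<in> carrier R\<rbrakk> \<Longrightarrow> r \<lhd>\<^sub>r a \<in> carrier R"
    and ract_add_l: "\<lbrakk>a \<in> carrier A; a' \<in> carrier A; r \<in> carrier R\<rbrakk>
          \<Longrightarrow> r \<lhd>\<^sub>r (a \<oplus>\<^bsub>A\<^esub> a') = (r \<lhd>\<^sub>r a) \<oplus>\<^bsub>R\<^esub> (r \<lhd>\<^sub>r a')"
    and ract_add_r: "\<lbrakk>a \<in> carrier A; r \<in> carrier R; r' \<in> carrier R\<rbrakk>
          \<Longrightarrow> (r \<oplus>\<^bsub>R\<^esub> r') \<lhd>\<^sub>r a = (r \<lhd>\<^sub>r a) \<oplus>\<^bsub>R\<^esub> (r' \<lhd>\<^sub>r a)"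
    and ract_smult_l: "\<lbrakk>a \<in> carrier A; r \<in> carrier R\<rbrakk> \<Longrightarrow> r \<lhd>\<^sub>r (c \<odot>\<^bsub>A\<^esub> a) = c \<odot>\<^bsub>R\<^esub> (r \<lhd>\<^sub>r a)"
    and ract_smult_r: "\<lbrakk>a \<in> carrier A; r \<in> carrier R\<rbrakk> \<Longrightarrow> (c \<odot>\<^bsub>R\<^esub> r) \<lhd>\<^sub>r a = c \<odot>\<^bsub>R\<^esub> (r \<lhd>\<^sub>r a)"
    and ract_assoc: "\<lbrakk>a \<in> carrier A; a' \<in> carrier A; r \<in> carrier R\<rbrakk>
          \<Longrightarrow> r \<lhd>\<^sub>r (a \<otimes>\<^bsub>A\<^esub> a') = (r \<lhd>\<^sub>r a) \<lhd>\<^sub>r a'"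
    and act_assoc: "\<lbrakk>a \<in> carrier A; a' \<in> carrier A; r \<in> carrier R\<rbrakk>
          \<Longrightarrow> (a \<rhd> r) \<lhd>\<^sub>r a' = a \<rhd> (r \<lhd>\<^sub>r a')"
    and lact_mult: "\<lbrakk>a \<in> carrier A; r \<in> carrier R; r' \<in> carrier R\<rbrakk>
          \<Longrightarrow> a \<rhd> (r \<otimes>\<^bsub>R\<^esub> r') = (a \<rhd> r) \<otimes>\<^bsub>R\<^esub> r'"
    and act_mult: "\<lbrakk>a \<in> carrier A; r \<in> carrier R; r' \<in> carrier R\<rbrakk>
          \<Longrightarrow> (r \<lhd>\<^sub>r a) \<otimes>\<^bsub>R\<^esub> r' = r \<otimes>\<^bsub>R\<^esub> (a \<rhd> r')"
    and ract_mult: "\<lbrakk>a \<in> carrier A; r \<in> carrier R; r' \<in> carrier R\<rbrakk>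
          \<Longrightarrow> (r \<otimes>\<^bsub>R\<^esub> r') \<lhd>\<^sub>r a = r \<otimes>\<^bsub>R\<^esub> (r' \<lhd>\<^sub>r a)"

definition crossed_module :: "('k::field, 'r, 'a) crossed_mod \<Rightarrow> bool" where
  "crossed_module X \<longleftrightarrow>
     (let R = cm_top X; A = cm_base X; \<rho> = cm_map X; l = cm_lact X; r = cm_ract X in
      algebra_action A R l r \<and> algebra_hom R A \<rho> \<and>
      (\<forall>a\<in>carrier A. \<forall>x\<in>carrier R. \<rho> (l a x) = a \<otimes>\<^bsub>A\<^esub> \<rho> x \<and> \<rho> (r x a) = \<rho> x \<otimes>\<^bsub>A\<^esub> a) \<and>
      (\<forall>x\<in>carrier R. \<forall>y\<in>carrier R. l (\<rho> x) y = x \<otimes>\<^bsub>R\<^esub> y \<and> r x (\<rho> y) = x \<otimes>\<^bsub>R\<^esub> y))"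

definition crossed_module_morphism ::
  "('k::field, 'r, 'a) crossed_mod \<Rightarrow> ('k, 's, 'b) crossed_mod \<Rightarrow> ('r \<Rightarrow> 's) \<Rightarrow> ('a \<Rightarrow> 'b) \<Rightarrow> bool"
  where
  "crossed_module_morphism X Y \<mu> \<nu> \<longleftrightarrow>
     algebra_hom (cm_top X) (cm_top Y) \<mu> \<and> algebra_hom (cm_base X) (cm_base Y) \<nu> \<and>
     (\<forall>x\<in>carrier (cm_top X). cm_map Y (\<mu> x) = \<nu> (cm_map X x)) \<and>
     (\<forall>a\<in>carrier (cm_base X). \<forall>x\<in>carrier (cm_top X).
        \<mu> (cm_lact X a x) = cm_lact Y (\<nu> a) (\<mu> x) \<and>
        \<mu> (cm_ract X x a) = cm_ract Y (\<mu> x) (\<nu> a))"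

definition inclusion_crossed_module ::
  "'a set \<Rightarrow> ('k::field, 'a) module \<Rightarrow> ('k, 'a, 'a) crossed_mod" where
  "inclusion_crossed_module I A =
     \<lparr>cm_top = A\<lparr>carrier := I\<rparr>, cm_base = A, cm_map = (\<lambda>x. x),
      cm_lact = (\<lambda>a x. a \<otimes>\<^bsub>A\<^esub> x), cm_ract = (\<lambda>x a. x \<otimes>\<^bsub>A\<^esub> a)\<rparr>"

lemma crossed_module_inclusion:
  assumes A: "nonunital_algebra A" and I: "algebra_ideal I A"
  shows "crossed_module (inclusion_crossed_module I A)"
proof -
  interpret A: nonunital_algebra A by fact
  interpret I: algebra_ideal I A by fact
  have sub: "x \<in> I \<Longrightarrow> x \<in> carrier A" for x using I.subset by auto
  have mo: "Module.module ground_field (A\<lparr>carrier := I\<rparr>)"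
    by (rule I.submodule_is_module) unfold_locales
  have na: "nonunital_algebra (A\<lparr>carrier := I\<rparr>)"
    using mo unfolding nonunital_algebra_def nonunital_algebra_axioms_def
    by (auto simp: sub I.ideal_l A.mult_assoc A.mult_l_distr A.mult_r_distr A.smult_mult_l A.smult_mult_r)
  have "algebra_action A (A\<lparr>carrier := I\<rparr>) (\<lambda>a x. a \<otimes>\<^bsub>A\<^esub> x) (\<lambda>x a. x \<otimes>\<^bsub>A\<^esub> a)"
    using A na unfolding algebra_action_def algebra_action_axioms_def
    by (auto simp: sub I.ideal_l I.ideal_r A.mult_assoc A.mult_l_distr A.mult_r_distr A.smult_mult_l A.smult_mult_r)
  then show ?thesis
    unfolding crossed_module_def inclusion_crossed_module_def Let_def
    by (auto simp: algebra_hom_def linear_map_def hom_def sub)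
qed


section \<open>The nerve of a crossed module\<close>

text \<open>
  The element \<open>(r\<^sub>1, \<dots>, r\<^sub>n, a)\<close> of the \<open>n\<close>-th algebra of the nerve is encoded as
  \<open>([r\<^sub>1, \<dots>, r\<^sub>n], a)\<close>. Accordingly \<open>nerve_semidirect\<close> is the semidirect product \<open>R \<rtimes> N\<close>
  where \<open>N\<close> consists of encoded tuples \<open>x = (rs, a)\<close>, and the pair \<open>(r, x)\<close> is encoded as
  \<open>(r # rs, a)\<close>.
\<close>

definition tuple_cons :: "'r \<Rightarrow> 'r list \<times> 'a \<Rightarrow> 'r list \<times> 'a" where
  "tuple_cons r x = (r # fst x, snd x)"

definition tuple_hd :: "'r list \<times> 'a \<Rightarrow> 'r" where
  "tuple_hd x = hd (fst x)"

definition tuple_tl :: "'r list \<times> 'a \<Rightarrow> 'r list \<times> 'a" where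
  "tuple_tl x = (tl (fst x), snd x)"

definition nerve_semidirect ::
  "('k::field, 'r) module \<Rightarrow> ('k, 'r list \<times> 'a) module \<Rightarrow> ('r list \<times> 'a \<Rightarrow> 'r \<Rightarrow> 'r) \<Rightarrow>
   ('r \<Rightarrow> 'r list \<times> 'a \<Rightarrow> 'r) \<Rightarrow> ('k, 'r list \<times> 'a) module" where
  "nerve_semidirect R N l r =
     \<lparr>carrier = {tuple_cons u x | u x. u \<in> carrier R \<and> x \<in> carrier N},
      monoid.mult = (\<lambda>u v. tuple_cons
         (tuple_hd u \<otimes>\<^bsub>R\<^esub> tuple_hd v
            \<oplus>\<^bsub>R\<^esub> l (tuple_tl u) (tuple_hd v) \<oplus>\<^bsub>R\<^esub> r (tuple_hd u) (tuple_tl v))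
         (tuple_tl u \<otimes>\<^bsub>N\<^esub> tuple_tl v)),
      one = undefined,
      ring.zero = tuple_cons \<zero>\<^bsub>R\<^esub> \<zero>\<^bsub>N\<^esub>,
      ring.add = (\<lambda>u v. tuple_cons (tuple_hd u \<oplus>\<^bsub>R\<^esub> tuple_hd v) (tuple_tl u \<oplus>\<^bsub>N\<^esub> tuple_tl v)),
      smult = (\<lambda>c u. tuple_cons (c \<odot>\<^bsub>R\<^esub> tuple_hd u) (c \<odot>\<^bsub>N\<^esub> tuple_tl u))\<rparr>"

text \<open>\<open>(r\<^sub>1, \<dots>, r\<^sub>n, a)\<close> acts on \<open>R\<close> through \<open>\<rho>(r\<^sub>1) + \<dots> + \<rho>(r\<^sub>n) + a\<close>.\<close>

definition nerve_total :: "('k::field, 'r, 'a) crossed_mod \<Rightarrow> 'r list \<times> 'a \<Rightarrow> 'a" where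
  "nerve_total X x = foldr (\<lambda>r b. cm_map X r \<oplus>\<^bsub>cm_base X\<^esub> b) (fst x) (snd x)"

primrec nerve :: "('k::field, 'r, 'a) crossed_mod \<Rightarrow> nat \<Rightarrow> ('k, 'r list \<times> 'a) module" where
  "nerve X 0 =
     (let A = cm_base X in
      \<lparr>carrier = {[]} \<times> carrier A,
       monoid.mult = (\<lambda>u v. ([], snd u \<otimes>\<^bsub>A\<^esub> snd v)),
       one = undefined,
       ring.zero = ([], \<zero>\<^bsub>A\<^esub>),
       ring.add = (\<lambda>u v. ([], snd u \<oplus>\<^bsub>A\<^esub> snd v)),
       smult = (\<lambda>c u. ([], c \<odot>\<^bsub>A\<^esub> snd u))\<rparr>)"
| "nerve X (Suc n) =
     nerve_semidirect (cm_top X) (nerve X n)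
       (\<lambda>x. cm_lact X (nerve_total X x)) (\<lambda>r x. cm_ract X r (nerve_total X x))"

text \<open>
  The faces \<open>d\<^sub>0, \<dots>, d\<^sub>n\<close> from level \<open>n \<ge> 1\<close> to level \<open>n - 1\<close>; the entry \<open>r\<^sub>i\<close> of
  \<open>(r\<^sub>1, \<dots>, r\<^sub>n, a)\<close> is \<open>rs ! (i - 1)\<close>. Degeneracies do not enter the unnormalized complexes
  below.
\<close>

definition nerve_face ::
  "('k::field, 'r, 'a) crossed_mod \<Rightarrow> nat \<Rightarrow> nat \<Rightarrow> 'r list \<times> 'a \<Rightarrow> 'r list \<times> 'a" where
  "nerve_face X n i x =
     (let rs = fst x; a = snd x in
      if i = 0 then (tl rs, a)
      else if i < n then
        (take (i - 1) rs @ [rs ! (i - 1) \<oplus>\<^bsub>cm_top X\<^esub> rs ! i] @ drop (i + 1) rs, a)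
      else (butlast rs, cm_map X (last rs) \<oplus>\<^bsub>cm_base X\<^esub> a))"

definition nerve_map :: "('r \<Rightarrow> 's) \<Rightarrow> ('a \<Rightarrow> 'b) \<Rightarrow> 'r list \<times> 'a \<Rightarrow> 's list \<times> 'b" where
  "nerve_map \<mu> \<nu> x = (map \<mu> (fst x), \<nu> (snd x))"


section \<open>Tensor powers\<close>

text \<open>
  The \<open>m\<close>-th tensor power of \<open>V\<close> is the free vector space on the lists of length \<open>m\<close> over
  \<^term>\<open>carrier V\<close> modulo the span of the multilinearity relations. Homology only involves the
  underlying abelian groups, which are written multiplicatively as objects of type
  \<^typ>\<open>'c monoid\<close>.
\<close>

definition scale_chain :: "'k::field \<Rightarrow> ('x \<Rightarrow>\<^sub>0 'k) \<Rightarrow> ('x \<Rightarrow>\<^sub>0 'k)" where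
  "scale_chain c = Poly_Mapping.map (\<lambda>a. c * a)"

lemma vector_space_scale_chain: "vector_space (scale_chain :: 'k::field \<Rightarrow> ('x \<Rightarrow>\<^sub>0 'k) \<Rightarrow> _)"
  unfolding scale_chain_def
  by unfold_locales
    (auto intro!: poly_mapping_eqI simp: lookup_add algebra_simps when_def Poly_Mapping.map.rep_eq simp flip: distrib_left)

definition free_space :: "'x set \<Rightarrow> ('x \<Rightarrow>\<^sub>0 'k::field) monoid" where
  "free_space B = \<lparr>carrier = {c. Poly_Mapping.keys c \<subseteq> B}, monoid.mult = (+), one = 0\<rparr>"

definition words :: "('k::field, 'v) module \<Rightarrow> nat \<Rightarrow> 'v list set" where
  "words V m = {xs. length xs = m \<and> set xs \<subseteq> carrier V}"

abbreviation word :: "'x \<Rightarrow> ('x \<Rightarrow>\<^sub>0 'k::field)" where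
  "word x \<equiv> Poly_Mapping.single x 1"

definition multilinear_relations ::
  "('k::field, 'v) module \<Rightarrow> nat \<Rightarrow> ('v list \<Rightarrow>\<^sub>0 'k) set" where
  "multilinear_relations V m =
     {word (xs @ [x \<oplus>\<^bsub>V\<^esub> y] @ ys) - word (xs @ [x] @ ys) - word (xs @ [y] @ ys) | xs x y ys.
        xs @ [x] @ ys \<in> words V m \<and> y \<in> carrier V} \<union>
     {word (xs @ [c \<odot>\<^bsub>V\<^esub> x] @ ys) - scale_chain c (word (xs @ [x] @ ys)) | xs c x ys.
        xs @ [x] @ ys \<in> words V m}"

definition tensor_relations ::
  "('k::field, 'v) module \<Rightarrow> nat \<Rightarrow> ('v list \<Rightarrow>\<^sub>0 'k) set" where
  "tensor_relations V m = Modules.module.span scale_chain (multilinear_relations V m)"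

definition tensor_power ::
  "('k::field, 'v) module \<Rightarrow> nat \<Rightarrow> ('v list \<Rightarrow>\<^sub>0 'k) set monoid" where
  "tensor_power V m = free_space (words V m) Mod tensor_relations V m"

definition linear_extension :: "('x \<Rightarrow> ('y \<Rightarrow>\<^sub>0 'k::field)) \<Rightarrow> ('x \<Rightarrow>\<^sub>0 'k) \<Rightarrow> ('y \<Rightarrow>\<^sub>0 'k)" where
  "linear_extension f c =
     (\<Sum>x\<in>Poly_Mapping.keys c. scale_chain (Poly_Mapping.lookup c x) (f x))"

text \<open>
  The map between quotient groups induced by \<open>f\<close>, with target \<^term>\<open>G Mod N\<close>: if \<open>f\<close> is a
  homomorphism sending the subgroup divided out in the source into \<open>N\<close>, then the coset of \<open>x\<close>
  is sent to the coset of \<^term>\<open>f x\<close>.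
\<close>

definition quotient_hom :: "'d monoid \<Rightarrow> 'd set \<Rightarrow> ('c \<Rightarrow> 'd) \<Rightarrow> 'c set \<Rightarrow> 'd set" where
  "quotient_hom G N f X = N <#>\<^bsub>G\<^esub> (f ` X)"

text \<open>The homomorphism into \<^term>\<open>tensor_power V m\<close> given on pure tensors by \<open>f\<close>.\<close>

definition tensor_hom ::
  "('k::field, 'w) module \<Rightarrow> nat \<Rightarrow> ('v list \<Rightarrow> ('w list \<Rightarrow>\<^sub>0 'k)) \<Rightarrow>
   ('v list \<Rightarrow>\<^sub>0 'k) set \<Rightarrow> ('w list \<Rightarrow>\<^sub>0 'k) set" where
  "tensor_hom W m f =
     quotient_hom (free_space (words W m)) (tensor_relations W m) (linear_extension f)"

definition tensor_map ::
  "('k::field, 'w) module \<Rightarrow> nat \<Rightarrow> ('v \<Rightarrow> 'w) \<Rightarrow> ('v list \<Rightarrow>\<^sub>0 'k) set \<Rightarrow> ('w list \<Rightarrow>\<^sub>0 'k) set"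
  where
  "tensor_map W m f = tensor_hom W m (\<lambda>xs. word (map f xs))"


section \<open>Chain complexes and bicomplexes\<close>

text \<open>
  Complexes are concentrated in degrees \<open>\<ge> 0\<close>. The boundary \<^term>\<open>chain_bd C n\<close> goes from degree
  \<open>n\<close> to degree \<open>n - 1\<close> and is only meaningful for \<open>n \<ge> 1\<close>; likewise for the differentials of a
  bicomplex.
\<close>

record 'c chain_complex =
  chain_grp :: "nat \<Rightarrow> 'c monoid"
  chain_bd :: "nat \<Rightarrow> 'c \<Rightarrow> 'c"

definition cycles :: "'c chain_complex \<Rightarrow> nat \<Rightarrow> 'c set" where
  "cycles C n = (if n = 0 then carrier (chain_grp C 0)
     else kernel (chain_grp C n) (chain_grp C (n - 1)) (chain_bd C n))"

definition boundaries :: "'c chain_complex \<Rightarrow> nat \<Rightarrow> 'c set" where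
  "boundaries C n = chain_bd C (Suc n) ` carrier (chain_grp C (Suc n))"

definition homology :: "'c chain_complex \<Rightarrow> nat \<Rightarrow> 'c set monoid" where
  "homology C n = (chain_grp C n)\<lparr>carrier := cycles C n\<rparr> Mod boundaries C n"

definition is_chain_map ::
  "'c chain_complex \<Rightarrow> 'd chain_complex \<Rightarrow> (nat \<Rightarrow> 'c \<Rightarrow> 'd) \<Rightarrow> bool" where
  "is_chain_map C D f \<longleftrightarrow>
     (\<forall>n. f n \<in> hom (chain_grp C n) (chain_grp D n)) \<and>
     (\<forall>n. \<forall>x\<in>carrier (chain_grp C (Suc n)).
        f n (chain_bd C (Suc n) x) = chain_bd D (Suc n) (f (Suc n) x))"

definition homology_map ::
  "'d chain_complex \<Rightarrow> (nat \<Rightarrow> 'c \<Rightarrow> 'd) \<Rightarrow> nat \<Rightarrow> 'c set \<Rightarrow> 'd set" where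
  "homology_map D f n = quotient_hom (chain_grp D n) (boundaries D n) (f n)"

definition quasi_isomorphism ::
  "'c chain_complex \<Rightarrow> 'd chain_complex \<Rightarrow> (nat \<Rightarrow> 'c \<Rightarrow> 'd) \<Rightarrow> bool" where
  "quasi_isomorphism C D f \<longleftrightarrow> is_chain_map C D f \<and>
     (\<forall>n. homology_map D f n \<in> iso (homology C n) (homology D n))"

definition kernel_complex ::
  "'c chain_complex \<Rightarrow> 'd chain_complex \<Rightarrow> (nat \<Rightarrow> 'c \<Rightarrow> 'd) \<Rightarrow> 'c chain_complex" where
  "kernel_complex C D f =
     \<lparr>chain_grp = (\<lambda>n. (chain_grp C n)
        \<lparr>carrier := kernel (chain_grp C n) (chain_grp D n) (f n)\<rparr>),
      chain_bd = chain_bd C\<rparr>"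

text \<open>
  In a bicomplex, \<^term>\<open>bi_h B p q\<close> maps position \<open>(p, q)\<close> to \<open>(p - 1, q)\<close> and
  \<^term>\<open>bi_v B p q\<close> maps it to \<open>(p, q - 1)\<close>. Their squares are supposed to anticommute, so the
  total differential is their sum without further signs.
\<close>

record 'c bicomplex =
  bi_grp :: "nat \<Rightarrow> nat \<Rightarrow> 'c monoid"
  bi_h :: "nat \<Rightarrow> nat \<Rightarrow> 'c \<Rightarrow> 'c"
  bi_v :: "nat \<Rightarrow> nat \<Rightarrow> 'c \<Rightarrow> 'c"

definition total_complex :: "'c bicomplex \<Rightarrow> (nat \<Rightarrow> 'c) chain_complex" where
  "total_complex B =
     \<lparr>chain_grp = (\<lambda>n. product_group {..n} (\<lambda>p. bi_grp B p (n - p))),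
      chain_bd = (\<lambda>n z. \<lambda>p\<in>{..<n}.
         bi_h B (p + 1) (n - 1 - p) (z (p + 1))
           \<otimes>\<^bsub>bi_grp B p (n - 1 - p)\<^esub> bi_v B p (n - p) (z p))\<rparr>"

definition total_map :: "(nat \<Rightarrow> nat \<Rightarrow> 'c \<Rightarrow> 'd) \<Rightarrow> nat \<Rightarrow> (nat \<Rightarrow> 'c) \<Rightarrow> (nat \<Rightarrow> 'd)" where
  "total_map f n z = (\<lambda>p\<in>{..n}. f p (n - p) (z p))"

text \<open>
  The bicomplex of a simplicial chain complex with levels \<open>C p\<close> and faces \<open>d p i\<close> from level \<open>p\<close>
  to level \<open>p - 1\<close>. The alternating sum of the faces commutes with the internal boundaries;
  these receive the customary sign \<open>(- 1) ^ p\<close>.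
\<close>

definition simplicial_bicomplex ::
  "(nat \<Rightarrow> 'c chain_complex) \<Rightarrow> (nat \<Rightarrow> nat \<Rightarrow> nat \<Rightarrow> 'c \<Rightarrow> 'c) \<Rightarrow> 'c bicomplex" where
  "simplicial_bicomplex C d =
     \<lparr>bi_grp = (\<lambda>p q. chain_grp (C p) q),
      bi_h = (\<lambda>p q x. \<Otimes>\<^bsub>chain_grp (C (p - 1)) q\<^esub>i\<in>{..p}.
                d p i q x [^]\<^bsub>chain_grp (C (p - 1)) q\<^esub> ((- 1) ^ i :: int)),
      bi_v = (\<lambda>p q x. chain_bd (C p) q x [^]\<^bsub>chain_grp (C p) (q - 1)\<^esub> ((- 1) ^ p :: int))\<rparr>"


section \<open>Bar and Hochschild complexes of an algebra\<close>

text \<open>On words \<open>[a\<^sub>0, \<dots>, a\<^sub>n]\<close>, the operators \<open>b'\<close>, \<open>b\<close> and \<open>t\<close>.\<close>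

definition word_b' :: "('k::field, 'v) module \<Rightarrow> nat \<Rightarrow> 'v list \<Rightarrow> ('v list \<Rightarrow>\<^sub>0 'k)" where
  "word_b' A n xs =
     (\<Sum>i<n. scale_chain ((- 1) ^ i)
        (word (take i xs @ [xs ! i \<otimes>\<^bsub>A\<^esub> xs ! (i + 1)] @ drop (i + 2) xs)))"

definition word_b :: "('k::field, 'v) module \<Rightarrow> nat \<Rightarrow> 'v list \<Rightarrow> ('v list \<Rightarrow>\<^sub>0 'k)" where
  "word_b A n xs = word_b' A n xs +
     scale_chain ((- 1) ^ n) (word ((last xs \<otimes>\<^bsub>A\<^esub> hd xs) # tl (butlast xs)))"

definition word_t :: "nat \<Rightarrow> 'v list \<Rightarrow> ('v list \<Rightarrow>\<^sub>0 'k::field)" where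
  "word_t n xs = scale_chain ((- 1) ^ n) (word (last xs # butlast xs))"

definition bar_complex ::
  "('k::field, 'v) module \<Rightarrow> ('v list \<Rightarrow>\<^sub>0 'k) set chain_complex" where
  "bar_complex A =
     \<lparr>chain_grp = (\<lambda>n. tensor_power A (n + 1)),
      chain_bd = (\<lambda>n. tensor_hom A n (word_b' A n))\<rparr>"

definition bar_map ::
  "('k::field, 'w) module \<Rightarrow> ('v \<Rightarrow> 'w) \<Rightarrow> nat \<Rightarrow> ('v list \<Rightarrow>\<^sub>0 'k) set \<Rightarrow> ('w list \<Rightarrow>\<^sub>0 'k) set"
  where
  "bar_map B f n = tensor_map B (n + 1) f"

definition cc2_bicomplex ::
  "('k::field, 'v) module \<Rightarrow> ('v list \<Rightarrow>\<^sub>0 'k) set bicomplex" where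
  "cc2_bicomplex A =
     \<lparr>bi_grp = (\<lambda>p q. if p \<le> 1 then tensor_power A (q + 1)
                 else singleton_group \<one>\<^bsub>tensor_power A (q + 1)\<^esub>),
      bi_h = (\<lambda>p q. if p = 1 then tensor_hom A (q + 1) (\<lambda>xs. word xs - word_t q xs)
                 else (\<lambda>_. \<one>\<^bsub>tensor_power A (q + 1)\<^esub>)),
      bi_v = (\<lambda>p q. if p = 0 then tensor_hom A q (word_b A q)
                 else if p = 1 then tensor_hom A q (\<lambda>xs. - word_b' A q xs)
                 else (\<lambda>_. \<one>\<^bsub>tensor_power A q\<^esub>))\<rparr>"

definition cc2_complex ::
  "('k::field, 'v) module \<Rightarrow> (nat \<Rightarrow> ('v list \<Rightarrow>\<^sub>0 'k) set) chain_complex" where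
  "cc2_complex A = total_complex (cc2_bicomplex A)"

definition cc2_map ::
  "('k::field, 'w) module \<Rightarrow> ('v \<Rightarrow> 'w) \<Rightarrow> nat \<Rightarrow>
   (nat \<Rightarrow> ('v list \<Rightarrow>\<^sub>0 'k) set) \<Rightarrow> (nat \<Rightarrow> ('w list \<Rightarrow>\<^sub>0 'k) set)" where
  "cc2_map B f = total_map (\<lambda>p q. if p \<le> 1 then tensor_map B (q + 1) f
                                  else (\<lambda>_. \<one>\<^bsub>tensor_power B (q + 1)\<^esub>))"


section \<open>Bar and Hochschild complexes of a crossed module\<close>

definition bar_complex_cm ::
  "('k::field, 'r, 'a) crossed_mod \<Rightarrow> (nat \<Rightarrow> (('r list \<times> 'a) list \<Rightarrow>\<^sub>0 'k) set) chain_complex"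
  where
  "bar_complex_cm X = total_complex (simplicial_bicomplex
     (\<lambda>p. bar_complex (nerve X p)) (\<lambda>p i. bar_map (nerve X (p - 1)) (nerve_face X p i)))"

definition cc2_complex_cm ::
  "('k::field, 'r, 'a) crossed_mod \<Rightarrow>
   (nat \<Rightarrow> nat \<Rightarrow> (('r list \<times> 'a) list \<Rightarrow>\<^sub>0 'k) set) chain_complex" where
  "cc2_complex_cm X = total_complex (simplicial_bicomplex
     (\<lambda>p. cc2_complex (nerve X p)) (\<lambda>p i. cc2_map (nerve X (p - 1)) (nerve_face X p i)))"

definition cc2_map_cm ::
  "('k::field, 's, 'b) crossed_mod \<Rightarrow> ('r \<Rightarrow> 's) \<Rightarrow> ('a \<Rightarrow> 'b) \<Rightarrow> nat \<Rightarrow>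
   (nat \<Rightarrow> nat \<Rightarrow> (('r list \<times> 'a) list \<Rightarrow>\<^sub>0 'k) set) \<Rightarrow>
   (nat \<Rightarrow> nat \<Rightarrow> (('s list \<times> 'b) list \<Rightarrow>\<^sub>0 'k) set)" where
  "cc2_map_cm Y \<mu> \<nu> = total_map (\<lambda>p. cc2_map (nerve Y p) (nerve_map \<mu> \<nu>))"

definition bar_homology ::
  "('k::field, 'r, 'a) crossed_mod \<Rightarrow> nat \<Rightarrow> (nat \<Rightarrow> (('r list \<times> 'a) list \<Rightarrow>\<^sub>0 'k) set) set monoid"
  where
  "bar_homology X n = homology (bar_complex_cm X) n"


section \<open>Excision\<close>

definition short_exact ::
  "('k::field, 'u) module \<Rightarrow> ('k, 'v) module \<Rightarrow> ('k, 'w) module \<Rightarrow> ('u \<Rightarrow> 'v) \<Rightarrow> ('v \<Rightarrow> 'w) \<Rightarrow> bool"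
  where
  "short_exact U V W f g \<longleftrightarrow>
     f \<in> mon (add_monoid U) (add_monoid V) \<and> g \<in> epi (add_monoid V) (add_monoid W) \<and>
     f ` carrier U = a_kernel V W g"

definition linearly_split_extension ::
  "('k::field, 'r, 'a) crossed_mod \<Rightarrow> ('k, 's, 'b) crossed_mod \<Rightarrow> ('k, 't, 'c) crossed_mod \<Rightarrow>
   ('r \<Rightarrow> 's) \<Rightarrow> ('a \<Rightarrow> 'b) \<Rightarrow> ('s \<Rightarrow> 't) \<Rightarrow> ('b \<Rightarrow> 'c) \<Rightarrow> bool" where
  "linearly_split_extension X Y Z \<mu> \<nu> \<eta> \<theta> \<longleftrightarrow>
     crossed_module X \<and> crossed_module Y \<and> crossed_module Z \<and>
     crossed_module_morphism X Y \<mu> \<nu> \<and> crossed_module_morphism Y Z \<eta> \<theta> \<and>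
     short_exact (cm_top X) (cm_top Y) (cm_top Z) \<mu> \<eta> \<and>
     short_exact (cm_base X) (cm_base Y) (cm_base Z) \<nu> \<theta> \<and>
     (\<exists>\<gamma> \<delta>. linear_map (cm_top Z) (cm_top Y) \<gamma> \<and> linear_map (cm_base Z) (cm_base Y) \<delta> \<and>
        (\<forall>t\<in>carrier (cm_top Z). \<eta> (\<gamma> t) = t) \<and>
        (\<forall>c\<in>carrier (cm_base Z). \<theta> (\<delta> c) = c) \<and>
        (\<forall>t\<in>carrier (cm_top Z). cm_map Y (\<gamma> t) = \<delta> (cm_map Z t)))"

text \<open>
  HOL cannot quantify over types inside a formula, so the types in which the extending crossed
  modules \<open>(S, B, \<sigma>)\<close> and \<open>(T, C, \<tau>)\<close> live are parameters; a theorem that leaves them as type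
  variables speaks about all extensions.
\<close>

definition excisive_HH ::
  "'s itself \<Rightarrow> 'b itself \<Rightarrow> 't itself \<Rightarrow> 'c itself \<Rightarrow> ('k::field, 'r, 'a) crossed_mod \<Rightarrow> bool" where
  "excisive_HH _ _ _ _ X \<longleftrightarrow> crossed_module X \<and>
     (\<forall>(Y :: ('k, 's, 'b) crossed_mod) (Z :: ('k, 't, 'c) crossed_mod) \<mu> \<nu> \<eta> \<theta>.
        linearly_split_extension X Y Z \<mu> \<nu> \<eta> \<theta> \<longrightarrow>
        quasi_isomorphism (cc2_complex_cm X)
          (kernel_complex (cc2_complex_cm Y) (cc2_complex_cm Z) (cc2_map_cm Z \<eta> \<theta>))
          (cc2_map_cm Y \<mu> \<nu>))"

end

(*
  In bases adapted to the inclusions all complexes become spans of words. A word in the p-th nerve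
  algebra of Y has letters of three types: I (coming from I, in any entry of a tuple), W (a
  complement of I in A, in the last entry) and Z (lifted from the quotient crossed module). The words
  all of whose letters are of type I or W span the complex of (I, A), those with at least one such
  letter span the kernel to the complex of Z; what has to be shown is that the quotient of the two is
  acyclic.

  The I-part of the nerve is a simplicially contractible ideal. Applied to the bar complex of (I, A)
  this shows that the words in W alone, multiplied in A/I, form an acyclic bar complex; over a field
  it has a contraction h. A mixed word is then contracted by sliding its first letter of type I up
  in the simplicial direction if there is one, and otherwise by applying h to its last run of
  letters of type W, after a rotation if a word of column 0 starts with such a letter. For the
  resulting operator H the map 1 - dH - Hd lowers a rank of words, so finitely many iterations give
  acyclicity.
*)
theory Submission
  imports Defs "HOL-Library.Product_Lexorder"
begin

text \<open>The types of the letters encode the hypotheses. As the structure map of (I, A) is an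
  inclusion, a letter of type I in the last entry of a tuple is the image of one in the other
  entries; hence these letters span an ideal of the nerve of Y that is the nerve of the identity of
  I, and this nerve is contractible. As the splitting commutes with the structure maps, faces send
  lifted letters to lifted letters; so faces preserve the type of every letter.

  The obstacle is multiplication. Sliding in the simplicial direction does not commute with b and
  b', the contraction h only knows the product of A/I, and the last Hochschild face joins the end of
  a word to its beginning. The homotopies are therefore correct only up to defects. Each defect
  shortens a word that has a letter of type I, creates such a letter, uses up a lifted letter,
  leaves column 1, or shortens the leading run of letters of type W. The rank measures exactly these
  quantities.\<close>

section \<open>Linear algebra of chains\<close>

text \<open>Lists form a monoid under concatenation, so that the chains on lists are the tensor algebra.\<close>

instantiation list :: (type) monoid_add
begin
definition zero_list :: "'a list" where "zero_list = []"
definition plus_list :: "'a list \<Rightarrow> 'a list \<Rightarrow> 'a list" where "plus_list xs ys = xs @ ys"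
instance by standard (simp_all add: zero_list_def plus_list_def)
end

notation scale_chain (infixr \<open>\<star>\<close> 75)

interpretation chain: vector_space scale_chain
  by (rule vector_space_scale_chain)

interpretation chains: vector_space_pair scale_chain scale_chain
  by unfold_locales

abbreviation lin :: "(('x \<Rightarrow>\<^sub>0 'k::field) \<Rightarrow> ('y \<Rightarrow>\<^sub>0 'k)) \<Rightarrow> bool" where
  "lin f \<equiv> Vector_Spaces.linear scale_chain scale_chain f"

lemma lookup_scale_chain [simp]: "Poly_Mapping.lookup (c \<star> u) x = c * Poly_Mapping.lookup u x"
  by (simp add: scale_chain_def Poly_Mapping.map.rep_eq when_def)

lemma scale_chain_single [simp]: "c \<star> Poly_Mapping.single x d = Poly_Mapping.single x (c * d)"
  by (rule poly_mapping_eqI) (simp add: lookup_single when_def)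

lemma keys_scale_chain: "Poly_Mapping.keys (c \<star> u) \<subseteq> Poly_Mapping.keys u"
  by (auto simp: in_keys_iff)

lemma linI:
  assumes "\<And>x y. f (x + y) = f x + f y" "\<And>c x. f (c \<star> x) = c \<star> f x"
  shows "lin f"
  using assms by (auto simp: Vector_Spaces.linear_iff vector_space_scale_chain)

named_theorems lin_intros

lemma lin_id [lin_intros]: "lin (\<lambda>x. x)"
  by (rule linI) auto

lemma lin_zero [lin_intros]: "lin (\<lambda>x. 0)"
  by (rule linI) auto

lemma lin_comp: "lin f \<Longrightarrow> lin g \<Longrightarrow> lin (\<lambda>x. f (g x))"
  by (rule linI) (simp_all add: chains.linear_add chains.linear_scale)

lemma lin_add [lin_intros]: "lin f \<Longrightarrow> lin g \<Longrightarrow> lin (\<lambda>x. f x + g x)"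
  by (rule linI) (simp_all add: chains.linear_add chains.linear_scale chain.scale_right_distrib)

lemma lin_neg [lin_intros]: "lin f \<Longrightarrow> lin (\<lambda>x. - f x)"
  by (rule linI) (simp_all add: chains.linear_add chains.linear_scale chain.scale_minus_right)

lemma lin_diff [lin_intros]: "lin f \<Longrightarrow> lin g \<Longrightarrow> lin (\<lambda>x. f x - g x)"
  by (rule linI) (simp_all add: chains.linear_add chains.linear_scale chain.scale_right_diff_distrib)

lemma lin_scale [lin_intros]: "lin f \<Longrightarrow> lin (\<lambda>x. c \<star> f x)"
  by (rule linI) (simp_all add: chains.linear_add chains.linear_scale chain.scale_right_distrib mult.commute)

lemma lin_sum [lin_intros]: "(\<And>i. i \<in> I \<Longrightarrow> lin (f i)) \<Longrightarrow> lin (\<lambda>x. \<Sum>i\<in>I. f i x)"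
  by (induction I rule: infinite_finite_induct) (auto intro!: lin_intros)

lemma lin_if [lin_intros]: "(b \<Longrightarrow> lin f) \<Longrightarrow> (\<not> b \<Longrightarrow> lin g) \<Longrightarrow> lin (\<lambda>x. if b then f x else g x)"
  by (cases b) auto

lemma chain_decomp:
  "finite S \<Longrightarrow> Poly_Mapping.keys u \<subseteq> S \<Longrightarrow> u = (\<Sum>x\<in>S. Poly_Mapping.lookup u x \<star> word x)"
  by (rule poly_mapping_eqI)
    (auto simp: lookup_sum lookup_single when_def in_keys_iff sum.delta if_distrib cong: if_cong)

lemma linear_extension_superset:
  assumes "finite S" "Poly_Mapping.keys u \<subseteq> S"
  shows "linear_extension f u = (\<Sum>x\<in>S. Poly_Mapping.lookup u x \<star> f x)"
  unfolding linear_extension_def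
  by (rule sum.mono_neutral_left) (use assms in \<open>auto simp: in_keys_iff\<close>)

lemma lin_linear_extension [lin_intros]:
  fixes f :: "'x \<Rightarrow> ('y \<Rightarrow>\<^sub>0 'k::field)"
  shows "lin (linear_extension f)"
proof (rule linI)
  fix u v :: "'x \<Rightarrow>\<^sub>0 'k::field"
  let ?S = "Poly_Mapping.keys u \<union> Poly_Mapping.keys v"
  have "linear_extension f (u + v) = (\<Sum>x\<in>?S. Poly_Mapping.lookup (u + v) x \<star> f x)"
    by (rule linear_extension_superset) (use keys_add[of u v] in auto)
  also have "\<dots> = linear_extension f u + linear_extension f v"
    by (subst (1 2) linear_extension_superset[where S = ?S])
      (auto simp: lookup_add chain.scale_left_distrib sum.distrib)
  finally show "linear_extension f (u + v) = linear_extension f u + linear_extension f v" .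
next
  fix c and u :: "'x \<Rightarrow>\<^sub>0 'k::field"
  have "linear_extension f (c \<star> u) = (\<Sum>x\<in>Poly_Mapping.keys u. Poly_Mapping.lookup (c \<star> u) x \<star> f x)"
    by (rule linear_extension_superset) (auto simp: keys_scale_chain)
  then show "linear_extension f (c \<star> u) = c \<star> linear_extension f u"
    by (simp add: linear_extension_def chain.scale_sum_right)
qed

lemmas lin_linear_extension_comp [lin_intros] = lin_comp[OF lin_linear_extension]

lemma linear_extension_single [simp]: "linear_extension f (Poly_Mapping.single x c) = c \<star> f x"
  by (cases "c = 0") (simp_all add: linear_extension_def)

lemma lin_apply:
  assumes "lin f"
  shows "f u = (\<Sum>x\<in>Poly_Mapping.keys u. Poly_Mapping.lookup u x \<star> f (word x))"
proof -
  have "f u = f (\<Sum>x\<in>Poly_Mapping.keys u. Poly_Mapping.lookup u x \<star> word x)"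
    by (metis chain_decomp finite_keys order_refl)
  also have "\<dots> = (\<Sum>x\<in>Poly_Mapping.keys u. f (Poly_Mapping.lookup u x \<star> word x))"
    using chains.linear_sum[OF assms] by blast
  finally show ?thesis
    by (simp only: chains.linear_scale[OF assms])
qed

lemma lin_eq_on:
  assumes "lin f" "lin g" "\<And>x. x \<in> Poly_Mapping.keys u \<Longrightarrow> f (word x) = g (word x)"
  shows "f u = g u"
  using lin_apply[OF assms(1), of u] lin_apply[OF assms(2), of u] assms(3) by simp

lemma lin_eqI:
  assumes "lin f" "lin g" "\<And>x. f (word x) = g (word x)"
  shows "f u = g u"
  by (rule lin_eq_on) (use assms in auto)

lemma linear_extension_eqI: "lin f \<Longrightarrow> linear_extension (\<lambda>x. f (word x)) u = f u"
  by (rule lin_eqI) (auto intro: lin_intros)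

section \<open>Chains supported on a given set of generators\<close>

definition supp :: "'x set \<Rightarrow> ('x \<Rightarrow>\<^sub>0 'k::field) set" where
  "supp B = {u. Poly_Mapping.keys u \<subseteq> B}"

lemma supp_zero [simp]: "0 \<in> supp B"
  and supp_add: "u \<in> supp B \<Longrightarrow> v \<in> supp B \<Longrightarrow> u + v \<in> supp B"
  and supp_neg: "u \<in> supp B \<Longrightarrow> - u \<in> supp B"
  and supp_diff: "u \<in> supp B \<Longrightarrow> v \<in> supp B \<Longrightarrow> u - v \<in> supp B"
  and supp_scale: "u \<in> supp B \<Longrightarrow> c \<star> u \<in> supp B"
  and supp_mono: "u \<in> supp B \<Longrightarrow> B \<subseteq> B' \<Longrightarrow> u \<in> supp B'"
  using keys_add[of u v] keys_diff[of u v] keys_scale_chain[of c u]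
  by (auto simp: supp_def in_keys_iff lookup_single lookup_add lookup_minus when_def split: if_splits)

lemma supp_word [simp]: "word x \<in> supp B \<longleftrightarrow> x \<in> B"
  by (auto simp: supp_def)

lemma supp_sum: "(\<And>i. i \<in> I \<Longrightarrow> f i \<in> supp B) \<Longrightarrow> sum f I \<in> supp B"
  by (induction I rule: infinite_finite_induct) (auto intro: supp_add)

lemma supp_UNIV [simp]: "u \<in> supp UNIV"
  by (simp add: supp_def)

lemma supp_empty [simp]: "u \<in> supp {} \<longleftrightarrow> u = 0"
  by (auto simp: supp_def)

lemmas supp_intros = supp_zero supp_add supp_neg supp_diff supp_scale supp_sum

lemma lin_supp:
  assumes "lin f" "u \<in> supp B" "\<And>x. x \<in> B \<Longrightarrow> f (word x) \<in> supp B'"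
  shows "f u \<in> supp B'"
  unfolding lin_apply[OF assms(1), of u]
  using assms by (intro supp_sum supp_scale) (auto simp: supp_def)

lemma lin_eq_supp:
  assumes "lin f" "lin g" "u \<in> supp B" "\<And>x. x \<in> B \<Longrightarrow> f (word x) = g (word x)"
  shows "f u = g u"
  by (rule lin_eq_on) (use assms in \<open>auto simp: supp_def\<close>)

definition restrict_chain :: "'x set \<Rightarrow> ('x \<Rightarrow>\<^sub>0 'k::field) \<Rightarrow> ('x \<Rightarrow>\<^sub>0 'k)" where
  "restrict_chain B = linear_extension (\<lambda>x. if x \<in> B then word x else 0)"

lemma lin_restrict_chain [lin_intros]: "lin (restrict_chain B)"
  by (auto simp: restrict_chain_def intro: lin_intros)

lemma restrict_chain_word: "restrict_chain B (word x) = (if x \<in> B then word x else 0)"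
  by (simp add: restrict_chain_def)

lemma restrict_chain_supp: "restrict_chain B u \<in> supp B"
  by (rule lin_supp[OF lin_restrict_chain supp_UNIV]) (auto simp: restrict_chain_word)

lemma restrict_chain_id: "u \<in> supp B \<Longrightarrow> restrict_chain B u = u"
  by (rule lin_eq_supp[where B = B]) (auto simp: restrict_chain_word intro: lin_intros)

lemma restrict_chain_zero: "u \<in> supp B' \<Longrightarrow> B \<inter> B' = {} \<Longrightarrow> restrict_chain B u = 0"
  by (rule lin_eq_supp[where B = B']) (auto simp: restrict_chain_word intro: lin_intros)

lemma restrict_chain_diff: "u - restrict_chain B u \<in> supp (- B)"
  by (rule lin_supp[OF _ supp_UNIV]) (auto simp: restrict_chain_word intro!: lin_intros)

lemma restrict_chain_eq_0_iff: "restrict_chain B u = 0 \<longleftrightarrow> u \<in> supp (- B)"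
  using restrict_chain_diff[of u B] restrict_chain_zero[of u "- B" B] by auto

lemma supp_split: "u \<in> supp (B \<union> B') \<Longrightarrow> \<exists>v w. u = v + w \<and> v \<in> supp B \<and> w \<in> supp B'"
proof -
  assume u: "u \<in> supp (B \<union> B')"
  have "u - restrict_chain B u \<in> supp B'"
    by (rule lin_supp[OF _ u]) (auto simp: restrict_chain_word intro!: lin_intros)
  then show ?thesis
    using restrict_chain_supp[of B u] by (metis add_diff_cancel_left' diff_add_cancel add.commute)
qed

section \<open>Transport of chains along maps of generators\<close>

definition relabel :: "('x \<Rightarrow> 'y) \<Rightarrow> ('x \<Rightarrow>\<^sub>0 'k::field) \<Rightarrow> ('y \<Rightarrow>\<^sub>0 'k)" where
  "relabel f = linear_extension (\<lambda>x. word (f x))"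

lemma lin_relabel [lin_intros]: "lin (relabel f)"
  by (auto simp: relabel_def intro: lin_intros)

lemmas lin_relabel_comp [lin_intros] = lin_comp[OF lin_relabel]

lemma relabel_single [simp]: "relabel f (Poly_Mapping.single x c) = Poly_Mapping.single (f x) c"
  by (simp add: relabel_def)

lemma relabel_zero [simp]: "relabel f 0 = 0"
  by (simp add: relabel_def linear_extension_def)

lemma relabel_supp: "u \<in> supp B \<Longrightarrow> relabel f u \<in> supp (f ` B)"
  by (rule lin_supp[OF lin_relabel]) auto

lemma relabel_comp: "relabel f (relabel g u) = relabel (\<lambda>x. f (g x)) u"
  by (rule lin_eqI) (auto intro!: lin_intros)

definition unlabel :: "('x \<Rightarrow> 'y) \<Rightarrow> ('y \<Rightarrow>\<^sub>0 'k::field) \<Rightarrow> ('x \<Rightarrow>\<^sub>0 'k)" where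
  "unlabel f = linear_extension (\<lambda>y. if y \<in> range f then word (inv_into UNIV f y) else 0)"

lemma lin_unlabel [lin_intros]: "lin (unlabel f)"
  by (auto simp: unlabel_def intro: lin_intros)

lemmas lin_unlabel_comp [lin_intros] = lin_comp[OF lin_unlabel]

lemma unlabel_word: "unlabel f (word y) = (if y \<in> range f then word (inv_into UNIV f y) else 0)"
  by (simp add: unlabel_def)

lemma unlabel_relabel: "inj f \<Longrightarrow> unlabel f (relabel f u) = u"
  by (rule lin_eqI) (auto intro!: lin_intros simp: unlabel_word)

lemma relabel_unlabel: "inj f \<Longrightarrow> u \<in> supp (range f) \<Longrightarrow> relabel f (unlabel f u) = u"
  by (rule lin_eq_supp[where B = "range f"]) (auto intro!: lin_intros simp: unlabel_word)

subsection \<open>The tensor algebra\<close>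

lemma scale_mult_left [simp]: "(c \<star> u) * v = c \<star> (u * v)" for u v :: "'x list \<Rightarrow>\<^sub>0 'k::field"
  by (simp add: scale_chain_def mult_map_scale_conv_mult mult.assoc)

lemma word_mult: "word xs * word ys = (word (xs @ ys) :: 'x list \<Rightarrow>\<^sub>0 'k::field)"
  by (simp add: mult_single plus_list_def)

lemma one_chain: "1 = (word [] :: 'x list \<Rightarrow>\<^sub>0 'k::field)"
  by (metis single_one zero_list_def)

lemma scale_mult_right [simp]: "u * (c \<star> v) = c \<star> (u * v)" for u v :: "'x list \<Rightarrow>\<^sub>0 'k::field"
proof -
  \<comment> \<open>The product is not commutative, so the scalar is moved past \<open>u\<close> as
    a multiple of the empty word, which is central.\<close>
  have com: "u * Poly_Mapping.single [] c = c \<star> u" for u :: "'x list \<Rightarrow>\<^sub>0 'k"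
  proof (rule lin_eqI[of "\<lambda>u. u * Poly_Mapping.single [] c"])
    show "lin (\<lambda>u :: 'x list \<Rightarrow>\<^sub>0 'k. u * Poly_Mapping.single [] c)"
      by (rule linI) (simp_all add: distrib_right)
    show "lin (\<lambda>u :: 'x list \<Rightarrow>\<^sub>0 'k. c \<star> u)"
      by (intro lin_intros)
  qed (simp add: mult_single plus_list_def)
  have "c \<star> v = Poly_Mapping.single [] c * v"
    by (simp add: scale_chain_def mult_map_scale_conv_mult zero_list_def)
  then have "u * (c \<star> v) = u * Poly_Mapping.single [] c * v"
    by (simp add: mult.assoc)
  also have "\<dots> = c \<star> (u * v)"
    by (simp add: com)
  finally show ?thesis .
qed

lemma lin_mult_left [lin_intros]: "lin g \<Longrightarrow> lin (\<lambda>u. a * g u)" for a :: "'x list \<Rightarrow>\<^sub>0 'k::field"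
  by (rule linI) (simp_all add: chains.linear_add chains.linear_scale distrib_left)

lemma lin_mult_right [lin_intros]: "lin g \<Longrightarrow> lin (\<lambda>u. g u * a)" for a :: "'x list \<Rightarrow>\<^sub>0 'k::field"
  by (rule linI) (simp_all add: chains.linear_add chains.linear_scale distrib_right)

definition letter :: "('b \<Rightarrow>\<^sub>0 'k::field) \<Rightarrow> ('b list \<Rightarrow>\<^sub>0 'k)" where
  "letter = relabel (\<lambda>b. [b])"

lemma lin_letter [lin_intros]: "lin letter"
  by (auto simp: letter_def intro: lin_intros)

lemmas lin_letter_comp [lin_intros] = lin_comp[OF lin_letter]

lemma letter_word [simp]: "letter (word b) = word [b]"
  by (simp add: letter_def)

lemma letter_supp: "v \<in> supp B \<Longrightarrow> letter v \<in> supp ((\<lambda>b. [b]) ` B)"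
  by (simp add: letter_def relabel_supp)

lemma mult_supp:
  fixes u v :: "'b list \<Rightarrow>\<^sub>0 'k::field"
  assumes "u \<in> supp B" "v \<in> supp B'" "\<And>x y. x \<in> B \<Longrightarrow> y \<in> B' \<Longrightarrow> x @ y \<in> C"
  shows "u * v \<in> supp C"
proof (rule lin_supp[OF _ assms(1), of "\<lambda>u. u * v"])
  fix x assume "x \<in> B"
  then show "word x * v \<in> supp C"
    using assms(3) by - (rule lin_supp[OF _ assms(2)], auto intro!: lin_intros simp: word_mult)
qed (auto intro!: lin_intros)

primrec tensor :: "('b \<Rightarrow>\<^sub>0 'k::field) list \<Rightarrow> ('b list \<Rightarrow>\<^sub>0 'k)" where
  "tensor [] = word []"
| "tensor (v # vs) = letter v * tensor vs"

lemma tensor_append: "tensor (us @ vs) = tensor us * tensor vs"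
  by (induction us) (simp_all add: mult.assoc flip: one_chain)

lemma tensor_words: "tensor (map (\<lambda>b. word b) w) = word w"
  by (induction w) (simp_all add: word_mult)

definition words_on :: "'b set \<Rightarrow> nat \<Rightarrow> 'b list set" where
  "words_on B m = {w. length w = m \<and> set w \<subseteq> B}"

lemma tensor_supp: "set vs \<subseteq> supp B \<Longrightarrow> tensor vs \<in> supp (words_on B (length vs))"
proof (induction vs)
  case (Cons v vs)
  show ?case
    by (simp, rule mult_supp[of _ "(\<lambda>b. [b]) ` B" _ "words_on B (length vs)"])
      (use Cons in \<open>auto simp: letter_supp words_on_def\<close>)
qed (simp add: words_on_def)

text \<open>Every word is the tensor of its letters, so tensors of arbitrary vectors suffice as test
  elements; on them the boundary operators are sums of faces.\<close>

lemma tensor_eqI: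
  assumes "lin f" "lin g" "\<And>vs. f (tensor vs) = g (tensor vs)"
  shows "f u = g u"
  by (rule lin_eqI[OF assms(1,2)]) (metis assms(3) tensor_words)

section \<open>The differentials on words of letters\<close>

subsection \<open>Faces of a semigroup word\<close>

definition merge :: "('x \<Rightarrow> 'x \<Rightarrow> 'x) \<Rightarrow> nat \<Rightarrow> 'x list \<Rightarrow> 'x list" where
  "merge f i xs = take i xs @ [f (xs ! i) (xs ! (i + 1))] @ drop (i + 2) xs"

definition wrap :: "('x \<Rightarrow> 'x \<Rightarrow> 'x) \<Rightarrow> 'x list \<Rightarrow> 'x list" where
  "wrap f xs = f (last xs) (hd xs) # tl (butlast xs)"

definition hface :: "('x \<Rightarrow> 'x \<Rightarrow> 'x) \<Rightarrow> nat \<Rightarrow> nat \<Rightarrow> 'x list \<Rightarrow> 'x list" where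
  "hface f n i xs = (if i < n then merge f i xs else wrap f xs)"

lemma merge_0 [simp]: "merge f 0 (x # y # xs) = f x y # xs"
  and merge_Suc [simp]: "merge f (Suc i) (x # xs) = x # merge f i xs"
  by (simp_all add: merge_def)

lemma merge_append: "i + 1 < length xs \<Longrightarrow> merge f i (xs @ ys) = merge f i xs @ ys"
  by (simp add: merge_def nth_append)

lemma length_merge: "i + 1 < length xs \<Longrightarrow> length (merge f i xs) = length xs - 1"
  by (simp add: merge_def)

lemma merge_last: "i = length xs \<Longrightarrow> merge f i (xs @ [y, z]) = xs @ [f y z]"
  by (simp add: merge_def nth_append)

lemma merge_merge:
  assumes assoc: "\<And>x y z. f (f x y) z = f x (f y z)"
  shows "i < j \<Longrightarrow> j + 1 < length xs \<Longrightarrow> merge f i (merge f j xs) = merge f (j - 1) (merge f i xs)"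
proof (induction i arbitrary: j xs)
  case 0
  then obtain a b r j' where xs: "xs = a # b # r" "j = Suc j'"
    by (cases xs; cases "tl xs"; cases j) auto
  show ?case
  proof (cases j')
    case 0
    with "0.prems" xs obtain c r' where "r = c # r'" by (cases r) auto
    with 0 xs show ?thesis by (simp add: assoc)
  qed (use xs in simp)
next
  case (Suc i)
  then obtain a r j' where xs: "xs = a # r" "j = Suc j'" "i < j'"
    by (cases xs; cases j) auto
  moreover obtain j'' where "j' = Suc j''" using xs(3) by (cases j') auto
  ultimately show ?case using Suc.IH[of j' r] Suc.prems by simp
qed

text \<open>Associativity enters only where the two multiplied pairs overlap: for adjacent inner
  faces, and for the cyclic face \<open>j = Suc n\<close> together with \<open>i = 0\<close> or
  \<open>i = n\<close>. The condition \<open>n \<ge> 1\<close> is forced: on a word with one letter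
  the cyclic face would multiply the letter with itself.\<close>

lemma hface_hface:
  assumes assoc: "\<And>x y z. f (f x y) z = f x (f y z)"
    and "i < j" "j \<le> Suc n" "length xs = Suc (Suc n)" "n \<ge> 1"
  shows "hface f n i (hface f (Suc n) j xs) = hface f n (j - 1) (hface f (Suc n) i xs)"
proof (cases "j = Suc n")
  case False
  then show ?thesis using assms merge_merge[OF assoc, of i j xs]
    by (auto simp: hface_def)
next
  case j: True
  consider "i = 0" | "i = n" "i \<noteq> 0" | "0 < i" "i < n" using assms j by linarith
  then show ?thesis
  proof cases
    case 1
    obtain a b ys where xs: "xs = a # b # ys" "ys \<noteq> []"
      using assms by (cases xs; cases "tl xs"; cases "tl (tl xs)") auto
    then show ?thesis using 1 assms j by (simp add: hface_def wrap_def assoc)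
  next
    case 2
    obtain a ys y z where xs: "xs = a # ys @ [y, z]"
    proof -
      obtain a xs' where 1: "xs = a # xs'" using assms by (cases xs) auto
      moreover obtain ys' z where 2: "xs' = ys' @ [z]" using 1 assms by (cases xs' rule: rev_cases) auto
      moreover obtain ys y where "ys' = ys @ [y]" using 1 2 assms by (cases ys' rule: rev_cases) auto
      ultimately show ?thesis using that by simp
    qed
    have "merge f n xs = a # ys @ [f y z]"
      using assms xs by (cases n) (simp_all add: merge_last)
    then show ?thesis using 2 assms j xs by (simp add: hface_def wrap_def assoc butlast_append)
  next
    case 3
    obtain a ys z where xs: "xs = a # ys @ [z]"
      by (metis assms(4) length_Suc_conv length_0_conv nat.distinct(1) rev_exhaust)
    obtain i' where i: "i = Suc i'" using 3 by (cases i) auto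
    have "merge f i' (ys @ [z]) = merge f i' ys @ [z]"
      by (rule merge_append) (use xs i 3 assms in auto)
    then show ?thesis using 3 assms j xs i by (simp add: hface_def wrap_def butlast_append)
  qed
qed

text \<open>Pairing (j, i) with (i, j - 1) matches the terms with \<open>i < j\<close> against those
  with \<open>j \<le> i\<close> and flips the sign, so the cancellation is valid in every
  characteristic.\<close>

lemma alternating_double_sum_zero:
  fixes F :: "nat \<Rightarrow> nat \<Rightarrow> ('x \<Rightarrow>\<^sub>0 'k::field)"
  assumes "\<And>i j. i < j \<Longrightarrow> j \<le> Suc n \<Longrightarrow> F i j = F (j - 1) i"
  shows "(\<Sum>j\<le>Suc n. \<Sum>i\<le>n. (- 1) ^ (i + j) \<star> F i j) = 0"
proof -
  let ?g = "\<lambda>(j, i). (- 1) ^ (i + j) \<star> F i j"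
  let ?L = "{(j, i). i < j \<and> j \<le> Suc n}" and ?U = "{(j, i). j \<le> i \<and> i \<le> n}"
  have fin: "finite ?L" "finite ?U"
    by (rule finite_subset[of _ "{..Suc n} \<times> {..Suc n}"]; auto)+
  have "(\<Sum>j\<le>Suc n. \<Sum>i\<le>n. (- 1) ^ (i + j) \<star> F i j) = sum ?g ({..Suc n} \<times> {..n})"
    by (rule sum.cartesian_product)
  also have "{..Suc n} \<times> {..n} = ?L \<union> ?U" by auto
  also have "sum ?g (?L \<union> ?U) = sum ?g ?L + sum ?g ?U"
    by (rule sum.union_disjoint) (use fin in auto)
  also have "sum ?g ?L = (\<Sum>x\<in>?U. - ?g x)"
  proof (rule sum.reindex_bij_witness[of _ "\<lambda>(j, i). (Suc i, j)" "\<lambda>(j, i). (i, j - 1)"])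
    fix x assume "x \<in> ?L"
    then obtain i j where x: "x = (Suc j, i)" "i \<le> j" "j \<le> n"
      by (cases x; cases "fst x") auto
    then show "- ?g (case x of (j, i) \<Rightarrow> (i, j - 1)) = ?g x"
      using assms[of i "Suc j"] by (simp add: add.commute chain.scale_minus_left)
  qed auto
  finally show ?thesis by (simp add: sum_negf)
qed

lemma mult_word_Nil [simp]: "u * word [] = u" "word [] * u = u" for u :: "'x list \<Rightarrow>\<^sub>0 'k::field"
  by (simp_all flip: one_chain)

subsection \<open>Bar and Hochschild operators\<close>

definition bil :: "('b \<Rightarrow> 'b \<Rightarrow> ('b \<Rightarrow>\<^sub>0 'k::field)) \<Rightarrow> ('b \<Rightarrow>\<^sub>0 'k) \<Rightarrow> ('b \<Rightarrow>\<^sub>0 'k) \<Rightarrow> ('b \<Rightarrow>\<^sub>0 'k)" where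
  "bil m u v = linear_extension (\<lambda>b. linear_extension (m b) v) u"

lemma bil_word [simp]: "bil m (word b) (word b') = m b b'"
  by (simp add: bil_def)

lemma lin_bil_left [lin_intros]: "lin g \<Longrightarrow> lin (\<lambda>x. bil m (g x) v)"
  unfolding bil_def by (intro lin_intros)

lemma lin_bil_right [lin_intros]: "lin g \<Longrightarrow> lin (\<lambda>x. bil m u (g x))"
  unfolding bil_def linear_extension_def[of "\<lambda>b. linear_extension (m b) _"] by (intro lin_intros)

lemma bil_eqI:
  assumes "\<And>v. lin (\<lambda>u. f u v)" "\<And>u. lin (f u)"
  shows "bil (\<lambda>b b'. f (word b) (word b')) u v = f u v"
proof (rule lin_eqI[of "\<lambda>u. bil _ u v"])
  fix x
  show "bil (\<lambda>b b'. f (word b) (word b')) (word x) v = f (word x) v"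
    by (rule lin_eqI[of "bil _ _"]) (auto intro!: lin_intros assms)
qed (auto intro!: lin_intros assms)

text \<open>Splitting off the face at the first letter makes b' recursive, which suits inductions on
  words; \<open>bar_tensor\<close> recovers the sum over all faces.\<close>

fun bar_word :: "('b \<Rightarrow> 'b \<Rightarrow> ('b \<Rightarrow>\<^sub>0 'k::field)) \<Rightarrow> 'b list \<Rightarrow> ('b list \<Rightarrow>\<^sub>0 'k)" where
  "bar_word m (x # y # w) = letter (m x y) * word w - word [x] * bar_word m (y # w)"
| "bar_word m _ = 0"

definition bar :: "('b \<Rightarrow> 'b \<Rightarrow> ('b \<Rightarrow>\<^sub>0 'k::field)) \<Rightarrow> ('b list \<Rightarrow>\<^sub>0 'k) \<Rightarrow> ('b list \<Rightarrow>\<^sub>0 'k)" where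
  "bar m = linear_extension (bar_word m)"

lemma lin_bar [lin_intros]: "lin (bar m)"
  by (auto simp: bar_def intro: lin_intros)
lemmas lin_bar_comp [lin_intros] = lin_comp[OF lin_bar]

lemma bar_of_word [simp]: "bar m (word w) = bar_word m w"
  by (simp add: bar_def)

lemma bar_letters:
  "bar m (letter u * (letter v * z)) = letter (bil m u v) * z - letter u * bar m (letter v * z)"
proof (rule lin_eqI[of "\<lambda>u. bar m (letter u * (letter v * z))"])
  fix x
  show "bar m (letter (word x) * (letter v * z)) = letter (bil m (word x) v) * z - letter (word x) * bar m (letter v * z)"
  proof (rule lin_eqI[of "\<lambda>v. bar m (letter (word x) * (letter v * z))"])
    fix y
    show "bar m (letter (word x) * (letter (word y) * z)) =
      letter (bil m (word x) (word y)) * z - letter (word x) * bar m (letter (word y) * z)"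
      by (rule lin_eqI[of "\<lambda>z. bar m (letter (word x) * (letter (word y) * z))"])
        (auto intro!: lin_intros simp: word_mult)
  qed (auto intro!: lin_intros)
qed (auto intro!: lin_intros)

lemma bar_letter [simp]: "bar m (letter u) = 0"
  by (rule lin_eqI) (auto intro!: lin_intros)

lemma bar_tensor:
  "bar m (tensor vs) = (\<Sum>i<length vs - 1. (- 1) ^ i \<star> tensor (merge (bil m) i vs))"
proof (induction vs rule: induct_list012)
  case (3 u v vs)
  have "bar m (tensor (u # v # vs)) = tensor (merge (bil m) 0 (u # v # vs)) - letter u * bar m (tensor (v # vs))"
    by (simp add: bar_letters)
  also have "letter u * bar m (tensor (v # vs)) =
      (\<Sum>i<length vs. (- 1) ^ i \<star> tensor (merge (bil m) (Suc i) (u # v # vs)))"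
    using 3(2) by (simp add: sum_distrib_left)
  finally show ?case
    by (simp add: sum.lessThan_Suc_shift sum_negf chain.scale_minus_left del: sum.lessThan_Suc)
qed simp_all

definition rot :: "('b list \<Rightarrow>\<^sub>0 'k::field) \<Rightarrow> ('b list \<Rightarrow>\<^sub>0 'k)" where
  "rot = linear_extension (\<lambda>w. if w = [] then 0 else word (last w # butlast w))"

lemma lin_rot [lin_intros]: "lin rot"
  by (auto simp: rot_def intro: lin_intros)
lemmas lin_rot_comp [lin_intros] = lin_comp[OF lin_rot]

lemma rot_word [simp]: "rot (word w) = (if w = [] then 0 else word (last w # butlast w))"
  by (simp add: rot_def)

lemma rot_letter: "rot (z * letter v) = letter v * z"
proof (rule lin_eqI[of "\<lambda>z. rot (z * letter v)"])
  fix w show "rot (word w * letter v) = letter v * word w"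
    by (rule lin_eqI[of "\<lambda>v. rot (word w * letter v)"]) (auto intro!: lin_intros simp: word_mult)
qed (auto intro!: lin_intros)

definition join :: "('b \<Rightarrow> 'b \<Rightarrow> ('b \<Rightarrow>\<^sub>0 'k::field)) \<Rightarrow> ('b list \<Rightarrow>\<^sub>0 'k) \<Rightarrow> ('b list \<Rightarrow>\<^sub>0 'k)" where
  "join m = linear_extension (\<lambda>w. case w of x # y # w' \<Rightarrow> letter (m x y) * word w' | _ \<Rightarrow> 0)"

lemma lin_join [lin_intros]: "lin (join m)"
  by (auto simp: join_def intro: lin_intros)
lemmas lin_join_comp [lin_intros] = lin_comp[OF lin_join]

lemma join_word [simp]: "join m (word (x # y # w)) = letter (m x y) * word w"
  "join m (word [x]) = 0" "join m (word []) = 0"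
  by (simp_all add: join_def)

lemma join_letters: "join m (letter u * (letter v * z)) = letter (bil m u v) * z"
proof (rule lin_eqI[of "\<lambda>u. join m (letter u * (letter v * z))"])
  fix x
  show "join m (letter (word x) * (letter v * z)) = letter (bil m (word x) v) * z"
  proof (rule lin_eqI[of "\<lambda>v. join m (letter (word x) * (letter v * z))"])
    fix y
    show "join m (letter (word x) * (letter (word y) * z)) = letter (bil m (word x) (word y)) * z"
      by (rule lin_eqI[of "\<lambda>z. join m (letter (word x) * (letter (word y) * z))"])
        (auto intro!: lin_intros simp: word_mult)
  qed (auto intro!: lin_intros)
qed (auto intro!: lin_intros)

lemma join_letter [simp]: "join m (letter u) = 0"
  by (rule lin_eqI) (auto intro!: lin_intros)

text \<open>Chains may mix words of different lengths, so the sign that depends on the degree is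
  made an operator of its own.\<close>

definition len_sign :: "('b list \<Rightarrow>\<^sub>0 'k::field) \<Rightarrow> ('b list \<Rightarrow>\<^sub>0 'k)" where
  "len_sign = linear_extension (\<lambda>w. (- 1) ^ length w \<star> word w)"

lemma lin_len_sign [lin_intros]: "lin len_sign"
  by (auto simp: len_sign_def intro: lin_intros)
lemmas lin_len_sign_comp [lin_intros] = lin_comp[OF lin_len_sign]

lemma len_sign_word [simp]: "len_sign (word w) = (- 1) ^ length w \<star> word w"
  by (simp add: len_sign_def)

lemma len_sign_words_on: "u \<in> supp (words_on B m) \<Longrightarrow> len_sign u = (- 1) ^ m \<star> u"
  by (rule lin_eq_supp[where B = "words_on B m"]) (auto intro!: lin_intros simp: words_on_def)

lemma len_sign_tensor: "len_sign (tensor vs) = (- 1) ^ length vs \<star> tensor vs"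
  by (rule len_sign_words_on[where B = UNIV]) (rule tensor_supp, auto)

text \<open>On a word of length \<open>n + 1\<close> the cyclic operator is \<open>t = (- 1) ^ n rot\<close> and the last
  Hochschild face is \<open>join \<circ> rot\<close>.\<close>

definition hoch :: "('b \<Rightarrow> 'b \<Rightarrow> ('b \<Rightarrow>\<^sub>0 'k::field)) \<Rightarrow> ('b list \<Rightarrow>\<^sub>0 'k) \<Rightarrow> ('b list \<Rightarrow>\<^sub>0 'k)" where
  "hoch m u = bar m u - join m (rot (len_sign u))"

definition one_minus_t :: "('b list \<Rightarrow>\<^sub>0 'k::field) \<Rightarrow> ('b list \<Rightarrow>\<^sub>0 'k)" where
  "one_minus_t u = u + rot (len_sign u)"

lemma lin_hoch [lin_intros]: "lin (hoch m)"
  unfolding hoch_def[abs_def] by (intro lin_intros)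
lemmas lin_hoch_comp [lin_intros] = lin_comp[OF lin_hoch]

lemma lin_one_minus_t [lin_intros]: "lin one_minus_t"
  unfolding one_minus_t_def[abs_def] by (intro lin_intros)

lemma rot_tensor: "vs \<noteq> [] \<Longrightarrow> rot (tensor vs) = tensor (last vs # butlast vs)"
  by (cases vs rule: rev_cases) (simp_all add: tensor_append rot_letter)

lemma join_rot_tensor:
  assumes "length vs \<ge> 2"
  shows "join m (rot (tensor vs)) = tensor (wrap (bil m) vs)"
proof -
  obtain u v us where vs: "vs = u # us @ [v]"
  proof -
    obtain u xs where 1: "vs = u # xs" using assms by (cases vs) auto
    moreover obtain us v where "xs = us @ [v]" using 1 assms by (cases xs rule: rev_cases) auto
    ultimately show ?thesis using that by simp
  qed
  then show ?thesis by (subst rot_tensor) (auto simp: wrap_def butlast_append join_letters)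
qed

lemma hoch_tensor:
  assumes "length vs = Suc n" "n \<ge> 1"
  shows "hoch m (tensor vs) = (\<Sum>i\<le>n. (- 1) ^ i \<star> tensor (hface (bil m) n i vs))"
proof -
  have "join m (rot (len_sign (tensor vs))) = (- 1) ^ Suc n \<star> tensor (wrap (bil m) vs)"
    using assms by (simp add: len_sign_tensor chains.linear_scale[OF lin_rot] chains.linear_scale[OF lin_join]
      chains.linear_neg[OF lin_rot] chains.linear_neg[OF lin_join] join_rot_tensor chain.scale_minus_left)
  then show ?thesis
    using assms by (simp add: hoch_def bar_tensor hface_def lessThan_Suc_atMost[symmetric] chain.scale_minus_left)
qed

lemma one_minus_t_tensor:
  "vs \<noteq> [] \<Longrightarrow> one_minus_t (tensor vs) =
    tensor vs + (- 1) ^ length vs \<star> tensor (last vs # butlast vs)"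
  by (simp add: one_minus_t_def len_sign_tensor chains.linear_scale[OF lin_rot] rot_tensor)

subsection \<open>Functoriality of the tensor algebra\<close>

text \<open>The homomorphism of tensor algebras that extends the linear map given by
  \<open>f\<close> on letters.\<close>

definition thom :: "('b \<Rightarrow> ('c \<Rightarrow>\<^sub>0 'k::field)) \<Rightarrow> ('b list \<Rightarrow>\<^sub>0 'k) \<Rightarrow> ('c list \<Rightarrow>\<^sub>0 'k)" where
  "thom f = linear_extension (\<lambda>w. tensor (map f w))"

lemma lin_thom [lin_intros]: "lin (thom f)"
  by (auto simp: thom_def intro: lin_intros)
lemmas lin_thom_comp [lin_intros] = lin_comp[OF lin_thom]

lemma thom_word [simp]: "thom f (word w) = tensor (map f w)"
  by (simp add: thom_def)

lemma thom_mult: "thom f (u * v) = thom f u * thom f v"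
proof (rule lin_eqI[of "\<lambda>u. thom f (u * v)"])
  fix x show "thom f (word x * v) = thom f (word x) * thom f v"
    by (rule lin_eqI[of "\<lambda>v. thom f (word x * v)"]) (auto intro!: lin_intros simp: word_mult tensor_append)
qed (auto intro!: lin_intros)

lemma thom_letter [simp]: "thom f (letter v) = letter (linear_extension f v)"
  by (rule lin_eqI) (auto intro!: lin_intros)

lemma thom_tensor: "thom f (tensor vs) = tensor (map (linear_extension f) vs)"
  by (induction vs) (simp_all add: thom_mult)

lemma thom_len_sign: "thom f (len_sign u) = len_sign (thom f u)"
  by (rule tensor_eqI)
    (auto intro!: lin_intros simp: len_sign_tensor thom_tensor chains.linear_scale[OF lin_thom])

lemma thom_rot: "thom f (rot u) = rot (thom f u)"
  by (rule lin_eqI, intro lin_intros, intro lin_intros, rename_tac w, case_tac w rule: rev_cases)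
    (simp_all add: tensor_append rot_letter chains.linear_0[OF lin_thom])

lemma thom_one_minus_t: "thom f (one_minus_t u) = one_minus_t (thom f u)"
  by (simp add: one_minus_t_def chains.linear_add[OF lin_thom] thom_rot thom_len_sign)

context
  fixes f :: "'b \<Rightarrow> ('c \<Rightarrow>\<^sub>0 'k::field)" and m m'
  assumes hom: "\<And>u v. linear_extension f (bil m u v) = bil m' (linear_extension f u) (linear_extension f v)"
begin

lemma thom_bar: "thom f (bar m u) = bar m' (thom f u)"
proof (rule lin_eqI[of "\<lambda>u. thom f (bar m u)"], intro lin_intros, intro lin_intros)
  fix w :: "'b list"
  show "thom f (bar m (word w)) = bar m' (thom f (word w))"
    by (induction w rule: induct_list012)
      (use hom[of "word _" "word _"] in \<open>simp_all add: chains.linear_0[OF lin_thom] chains.linear_diff[OF lin_thom]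
        thom_mult bar_letters\<close>)
qed

lemma thom_join: "thom f (join m u) = join m' (thom f u)"
proof (rule lin_eqI[of "\<lambda>u. thom f (join m u)"], intro lin_intros, intro lin_intros)
  fix w :: "'b list"
  show "thom f (join m (word w)) = join m' (thom f (word w))"
    by (cases w rule: remdups_adj.cases)
      (use hom[of "word _" "word _"] in \<open>simp_all add: chains.linear_0[OF lin_thom] thom_mult join_letters\<close>)
qed

lemma thom_hoch: "thom f (hoch m u) = hoch m' (thom f u)"
  by (simp add: hoch_def chains.linear_diff[OF lin_thom] thom_bar thom_join thom_rot thom_len_sign)

end

subsection \<open>Total differentials\<close>

definition put :: "'p \<Rightarrow> ('x \<Rightarrow>\<^sub>0 'k::field) \<Rightarrow> ('p \<times> 'x \<Rightarrow>\<^sub>0 'k)" where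
  "put p = relabel (Pair p)"

definition slice :: "'p \<Rightarrow> ('p \<times> 'x \<Rightarrow>\<^sub>0 'k::field) \<Rightarrow> ('x \<Rightarrow>\<^sub>0 'k)" where
  "slice p = linear_extension (\<lambda>(p', x). if p' = p then word x else 0)"

lemma lin_put [lin_intros]: "lin (put p)" and lin_slice [lin_intros]: "lin (slice p)"
  by (auto simp: put_def slice_def intro: lin_intros)
lemmas lin_put_comp [lin_intros] = lin_comp[OF lin_put]
lemmas lin_slice_comp [lin_intros] = lin_comp[OF lin_slice]

lemma put_word [simp]: "put p (word x) = word (p, x)"
  by (simp add: put_def)

lemma put_zero [simp]: "put p 0 = 0"
  by (simp add: put_def)

lemma slice_word: "slice p (word y) = (if fst y = p then word (snd y) else 0)"
  by (simp add: slice_def split: prod.split)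

lemma slice_put: "slice p (put p' u) = (if p' = p then u else 0)"
  by (rule lin_eqI[of "\<lambda>u. slice p (put p' u)"]) (auto intro!: lin_intros simp: slice_word)

lemma put_supp: "u \<in> supp B \<Longrightarrow> (\<And>x. x \<in> B \<Longrightarrow> (p, x) \<in> B') \<Longrightarrow> put p u \<in> supp B'"
  by (rule lin_supp[of "put p"]) (auto intro: lin_intros)

lemma lookup_slice: "Poly_Mapping.lookup (slice p u) x = Poly_Mapping.lookup u (p, x)"
  unfolding slice_def linear_extension_def lookup_sum
  by (simp add: lookup_single when_def if_distrib case_prod_unfold prod_eq_iff cong: if_cong)
    (subst sum.cong[OF refl, of _ _ "\<lambda>y. if y = (p, x) then Poly_Mapping.lookup u (p, x) else 0"],
     auto simp: in_keys_iff lookup_single when_def split: if_splits)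

lemma slice_supp_iff: "u \<in> supp B \<longleftrightarrow> (\<forall>p. slice p u \<in> supp {x. (p, x) \<in> B})"
  by (auto simp: supp_def in_keys_iff lookup_slice subset_iff)

lemma slice_eqI: "(\<And>p. slice p u = slice p v) \<Longrightarrow> u = v"
  by (rule poly_mapping_eqI) (metis lookup_slice prod.exhaust)

lemma put_eqI:
  assumes "lin f" "lin g" "\<And>p u. f (put p u) = g (put p u)"
  shows "f u = g u"
  by (rule lin_eqI[OF assms(1,2)]) (metis assms(3) put_word prod.exhaust)

definition tot :: "(nat \<Rightarrow> ('x \<Rightarrow>\<^sub>0 'k::field) \<Rightarrow> ('x \<Rightarrow>\<^sub>0 'k)) \<Rightarrow> (nat \<Rightarrow> ('x \<Rightarrow>\<^sub>0 'k) \<Rightarrow> ('x \<Rightarrow>\<^sub>0 'k)) \<Rightarrow>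
    (nat \<times> 'x \<Rightarrow>\<^sub>0 'k) \<Rightarrow> (nat \<times> 'x \<Rightarrow>\<^sub>0 'k)" where
  "tot h v = linear_extension (\<lambda>(p, x). (if p = 0 then 0 else put (p - 1) (h p (word x))) + put p (v p (word x)))"

lemma lin_tot [lin_intros]: "lin (tot h v)"
  by (auto simp: tot_def intro: lin_intros)

definition slicewise :: "(('x \<Rightarrow>\<^sub>0 'k::field) \<Rightarrow> ('y \<Rightarrow>\<^sub>0 'k)) \<Rightarrow> ('p \<times> 'x \<Rightarrow>\<^sub>0 'k) \<Rightarrow> ('p \<times> 'y \<Rightarrow>\<^sub>0 'k)" where
  "slicewise F = linear_extension (\<lambda>(p, x). put p (F (word x)))"

lemma lin_slicewise [lin_intros]: "lin (slicewise F)"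
  by (auto simp: slicewise_def intro: lin_intros)
lemmas lin_slicewise_comp [lin_intros] = lin_comp[OF lin_slicewise]

lemma slicewise_put: "lin F \<Longrightarrow> slicewise F (put p u) = put p (F u)"
  by (rule lin_eqI[of "\<lambda>u. slicewise F (put p u)"])
    (auto intro!: lin_intros lin_comp[OF lin_put] simp: slicewise_def)

lemma tot_put:
  assumes "\<And>p. lin (h p)" "\<And>p. lin (v p)"
  shows "tot h v (put p u) = (if p = 0 then 0 else put (p - 1) (h p u)) + put p (v p u)"
  by (rule lin_eqI[of "\<lambda>u. tot h v (put p u)"]) (auto intro!: lin_intros lin_comp[OF lin_put] assms simp: tot_def)

lemma slice_tot:
  assumes "\<And>p. lin (h p)" "\<And>p. lin (v p)"
  shows "slice p (tot h v u) = h (Suc p) (slice (Suc p) u) + v p (slice p u)"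
proof (rule put_eqI[of "\<lambda>u. slice p (tot h v u)"])
  fix p' u
  show "slice p (tot h v (put p' u)) = h (Suc p) (slice (Suc p) (put p' u)) + v p (slice p (put p' u))"
    by (cases p') (auto simp: tot_put[OF assms] slice_put chains.linear_add[OF lin_slice]
      chains.linear_0[OF assms(1)] chains.linear_0[OF assms(2)])
qed (auto intro!: lin_intros lin_comp[OF assms(1)] lin_comp[OF assms(2)])

definition simp_tot :: "(nat \<Rightarrow> nat \<Rightarrow> ('x \<Rightarrow>\<^sub>0 'k::field) \<Rightarrow> ('x \<Rightarrow>\<^sub>0 'k)) \<Rightarrow> (nat \<Rightarrow> ('x \<Rightarrow>\<^sub>0 'k) \<Rightarrow> ('x \<Rightarrow>\<^sub>0 'k)) \<Rightarrow>
    (nat \<times> 'x \<Rightarrow>\<^sub>0 'k) \<Rightarrow> (nat \<times> 'x \<Rightarrow>\<^sub>0 'k)" where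
  "simp_tot f d = tot (\<lambda>p u. \<Sum>i\<le>p. (- 1) ^ i \<star> f p i u) (\<lambda>p u. (- 1) ^ p \<star> d p u)"

lemma lin_simp_tot [lin_intros]: "lin (simp_tot f d)"
  by (auto simp: simp_tot_def intro: lin_intros)
lemmas lin_simp_tot_comp [lin_intros] = lin_comp[OF lin_simp_tot]

lemma simp_tot_put:
  assumes "\<And>p i. lin (f p i)" "\<And>p. lin (d p)"
  shows "simp_tot f d (put p u) =
    (if p = 0 then 0 else put (p - 1) (\<Sum>i\<le>p. (- 1) ^ i \<star> f p i u)) + (- 1) ^ p \<star> put p (d p u)"
  unfolding simp_tot_def by (subst tot_put)
    (auto intro!: lin_intros assms simp: chains.linear_scale[OF lin_put])

text \<open>The mixed terms cancel because faces commute with \<open>d\<close> while the sign of the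
  internal differential changes between levels p and p - 1; the purely simplicial part is
  \<open>alternating_double_sum_zero\<close>.\<close>

lemma simp_tot_simp_tot:
  assumes f: "\<And>p i. lin (f p i)" and d: "\<And>p. lin (d p)"
    and dd: "\<And>p u. d p (d p u) = 0"
    and fd: "\<And>p i u. i \<le> Suc p \<Longrightarrow> f (Suc p) i (d (Suc p) u) = d p (f (Suc p) i u)"
    and ff: "\<And>p i j u. i < j \<Longrightarrow> j \<le> Suc (Suc p) \<Longrightarrow>
      f (Suc p) i (f (Suc (Suc p)) j u) = f (Suc p) (j - 1) (f (Suc (Suc p)) i u)"
  shows "simp_tot f d (simp_tot f d u) = 0"
proof (rule put_eqI[of "\<lambda>u. simp_tot f d (simp_tot f d u)"])
  fix p u
  note simps = simp_tot_put[OF f d] chains.linear_add[OF lin_simp_tot] chains.linear_scale[OF lin_simp_tot]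
    chains.linear_0[OF lin_simp_tot] chains.linear_sum[OF d] chains.linear_scale[OF d]
    chains.linear_sum[OF f] chains.linear_scale[OF f]
  show "simp_tot f d (simp_tot f d (put p u)) = 0"
  proof (cases p)
    case 0
    then show ?thesis by (simp add: simps dd)
  next
    case (Suc q)
    have comm: "(\<Sum>i\<le>Suc q. (- 1) ^ i \<star> d q (f (Suc q) i u)) = (\<Sum>i\<le>Suc q. (- 1) ^ i \<star> f (Suc q) i (d (Suc q) u))"
      by (intro sum.cong refl) (simp add: fd)
    have zero: "q = Suc r \<Longrightarrow> (\<Sum>j\<le>q. \<Sum>i\<le>Suc q. ((- 1) ^ j * (- 1) ^ i) \<star> f q j (f (Suc q) i u)) = 0" for r
      using alternating_double_sum_zero[of "Suc r" "\<lambda>i j. f (Suc r) i (f (Suc (Suc r)) j u)"] ff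
      by (subst sum.swap) (simp add: power_add)
    show ?thesis
    proof (cases q)
      case 0
      then show ?thesis using comm
        by (simp add: Suc simps dd chain.scale_minus_left chains.linear_diff[OF lin_simp_tot] del: sum.atMost_Suc)
    next
      case r: (Suc r)
      show ?thesis using comm zero[OF r]
        by (simp add: Suc r simps dd chain.scale_sum_right chain.scale_minus_left sum_negf del: sum.atMost_Suc)
    qed
  qed
qed (auto intro!: lin_intros)

subsection \<open>The two-column complex\<close>

definition cc2D :: "('b \<Rightarrow> 'b \<Rightarrow> ('b \<Rightarrow>\<^sub>0 'k::field)) \<Rightarrow> (nat \<times> 'b list \<Rightarrow>\<^sub>0 'k) \<Rightarrow> (nat \<times> 'b list \<Rightarrow>\<^sub>0 'k)" where
  "cc2D m = tot (\<lambda>c. if c = 1 then one_minus_t else (\<lambda>_. 0))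
     (\<lambda>c. if c = 0 then hoch m else if c = 1 then (\<lambda>u. - bar m u) else (\<lambda>_. 0))"

lemma lin_cc2D [lin_intros]: "lin (cc2D m)"
  by (auto simp: cc2D_def intro: lin_intros)
lemmas lin_cc2D_comp [lin_intros] = lin_comp[OF lin_cc2D]

lemma cc2D_put:
  "cc2D m (put c u) = (if c = 0 then put 0 (hoch m u)
     else if c = 1 then put 0 (one_minus_t u) - put 1 (bar m u) else 0)"
  unfolding cc2D_def by (subst tot_put) (auto intro!: lin_intros simp: chains.linear_neg[OF lin_put])

text \<open>A word of column 1 is a word whose leading letter is a formal unit \<open>None\<close>; then both columns
  carry the alternating sum of the same Hochschild faces.\<close>

fun opt_mult :: "('v \<Rightarrow> 'v \<Rightarrow> 'v) \<Rightarrow> 'v option \<Rightarrow> 'v option \<Rightarrow> 'v option" where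
  "opt_mult f None y = y"
| "opt_mult f (Some x) None = Some x"
| "opt_mult f (Some x) (Some y) = Some (f x y)"

definition eval_opt :: "('b \<Rightarrow>\<^sub>0 'k::field) option list \<Rightarrow> (nat \<times> 'b list \<Rightarrow>\<^sub>0 'k)" where
  "eval_opt vs = (if vs \<noteq> [] \<and> hd vs = None then put 1 (tensor (map the (tl vs)))
     else put 0 (tensor (map the vs)))"

text \<open>These are the generators in degree n of the reduced Hochschild complex of the algebra
  with a unit adjoined: the unit may only stand in front, and it does not stand alone.\<close>

definition opt_word :: "nat \<Rightarrow> 'v option list \<Rightarrow> bool" where
  "opt_word n vs \<longleftrightarrow> (\<exists>us. vs = map Some us \<and> length us = Suc n \<or> vs = None # map Some us \<and> length us = n \<and> n \<ge> 1)"

lemma eval_opt_Some: "eval_opt (map Some us) = put 0 (tensor us)"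
  by (cases us) (auto simp: eval_opt_def comp_def)

lemma eval_opt_None: "eval_opt (None # map Some us) = put 1 (tensor us)"
  by (simp add: eval_opt_def comp_def)

lemma merge_map_Some: "i + 1 < length us \<Longrightarrow> merge (opt_mult f) i (map Some us) = map Some (merge f i us)"
  by (simp add: merge_def take_map drop_map)

lemma hface_Some:
  assumes "length us = Suc n" "n \<ge> 1" "i \<le> n"
  shows "hface (opt_mult f) n i (map Some us) = map Some (hface f n i us)"
proof (cases "i < n")
  case False
  then show ?thesis using assms
    by (cases us) (auto simp: hface_def wrap_def last_map map_butlast map_tl)
qed (use assms in \<open>simp add: hface_def merge_map_Some\<close>)

lemma hface_None:
  assumes "length us = n" "n \<ge> 1"
  shows "hface (opt_mult f) n 0 (None # map Some us) = map Some us"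
    and "hface (opt_mult f) n n (None # map Some us) = map Some (last us # butlast us)"
    and "Suc i < n \<Longrightarrow> hface (opt_mult f) n (Suc i) (None # map Some us) = None # map Some (merge f i us)"
proof -
  obtain u us' where us: "us = u # us'" using assms by (cases us) auto
  show "hface (opt_mult f) n 0 (None # map Some us) = map Some us"
    using assms us by (simp add: hface_def)
  show "hface (opt_mult f) n n (None # map Some us) = map Some (last us # butlast us)"
    using assms us by (cases us' rule: rev_cases) (simp_all add: hface_def wrap_def butlast_append)
  show "Suc i < n \<Longrightarrow> hface (opt_mult f) n (Suc i) (None # map Some us) = None # map Some (merge f i us)"
    using assms by (simp add: hface_def merge_map_Some)
qed

lemma opt_word_hface:
  assumes "opt_word (Suc n) vs" "i \<le> Suc n"
  shows "opt_word n (hface (opt_mult f) (Suc n) i vs)"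
proof -
  consider us where "vs = map Some us" "length us = Suc (Suc n)"
    | us where "vs = None # map Some us" "length us = Suc n"
    using assms by (auto simp: opt_word_def)
  then show ?thesis
  proof cases
    case 1
    have "length (hface f (Suc n) i us) = Suc n"
      using 1 by (auto simp: hface_def length_merge wrap_def)
    then show ?thesis using 1 assms by (auto simp: hface_Some opt_word_def)
  next
    case 2
    consider "i = 0" | "i = Suc n" | j where "i = Suc j" "j < n" using assms(2) by (cases i) force+
    then show ?thesis
    proof cases
      case 3
      then show ?thesis using 2 by (simp add: hface_None opt_word_def)
          (rule exI[of _ "merge f j us"], auto simp: length_merge)
    next
      case 1
      show ?thesis unfolding opt_word_def
        by (rule exI[of _ us]) (use 1 2 in \<open>simp add: hface_None\<close>)
    next
      case last: 2
      show ?thesis unfolding opt_word_def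
        by (rule exI[of _ "last us # butlast us"]) (use last 2 in \<open>simp add: hface_None\<close>)
    qed
  qed
qed

text \<open>For a word headed by the formal unit the first face returns the word without it and the
  last face its rotation, together 1 - t; the inner faces, shifted by one place, give -b'.\<close>

lemma cc2D_eval_opt:
  assumes "opt_word n vs" "n \<ge> 1"
  shows "cc2D m (eval_opt vs) = (\<Sum>i\<le>n. (- 1) ^ i \<star> eval_opt (hface (opt_mult (bil m)) n i vs))"
proof -
  consider us where "vs = map Some us" "length us = Suc n"
    | us where "vs = None # map Some us" "length us = n"
    using assms by (auto simp: opt_word_def)
  then show ?thesis
  proof cases
    case 1
    have "(\<Sum>i\<le>n. (- 1) ^ i \<star> eval_opt (hface (opt_mult (bil m)) n i vs)) =
      (\<Sum>i\<le>n. (- 1) ^ i \<star> put 0 (tensor (hface (bil m) n i us)))"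
      by (intro sum.cong refl) (use 1 assms in \<open>simp add: hface_Some eval_opt_Some\<close>)
    then show ?thesis
      using 1 assms by (simp add: eval_opt_Some cc2D_put hoch_tensor chains.linear_sum[OF lin_put] chains.linear_scale[OF lin_put])
  next
    case 2
    obtain k where n: "n = Suc k" using assms by (cases n) auto
    define g where "g i = (- 1) ^ i \<star> eval_opt (hface (opt_mult (bil m)) n i vs)" for i
    have us: "us \<noteq> []" using 2 n by auto
    have g0: "g 0 = put 0 (tensor us)" and gn: "g n = (- 1) ^ n \<star> put 0 (tensor (last us # butlast us))"
      using 2 assms by (simp_all only: g_def hface_None eval_opt_Some) simp
    have gs: "g (Suc i) = - ((- 1) ^ i \<star> put 1 (tensor (merge (bil m) i us)))" if "i < k" for i
      using 2 that n by (simp add: g_def hface_None eval_opt_None chain.scale_minus_left)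
    have "(\<Sum>i\<le>n. g i) = g 0 + (\<Sum>i<k. g (Suc i)) + g n"
      by (simp only: n lessThan_Suc_atMost[symmetric] sum.lessThan_Suc[of g "Suc k"] sum.lessThan_Suc_shift[of g k])
    also have "(\<Sum>i<k. g (Suc i)) = - put 1 (bar m (tensor us))"
      using 2 n gs by (simp add: bar_tensor chains.linear_sum[OF lin_put] chains.linear_scale[OF lin_put] sum_negf)
    finally have *: "(\<Sum>i\<le>n. g i) = g 0 + - put 1 (bar m (tensor us)) + g n" .
    show ?thesis
      unfolding g_def[symmetric] * using us
      by (simp add: 2 eval_opt_None cc2D_put one_minus_t_tensor g0 gn chains.linear_add[OF lin_put]
        chains.linear_scale[OF lin_put])
  qed
qed

lemma hoch_letter [simp]: "hoch m (letter v) = 0"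
  using len_sign_tensor[of "[v]"] rot_letter[of 1 v]
  by (simp add: hoch_def chains.linear_neg[OF lin_rot] chains.linear_neg[OF lin_join])

lemma bar_bar: assumes "\<And>u v w. bil m (bil m u v) w = bil m u (bil m v w)"
  shows "bar m (bar m u) = 0"
proof (rule lin_eqI[of "\<lambda>u. bar m (bar m u)"])
  fix w :: "'a list"
  show "bar m (bar m (word w)) = 0"
  proof (induction w rule: induct_list012)
    case (3 x y w)
    show ?case
    proof (cases w)
      case Nil
      then show ?thesis by (simp add: chains.linear_diff[OF lin_bar] chains.linear_0[OF lin_bar])
    next
      case (Cons z w')
      have w: "word (x # y # w) = letter (word x) * (letter (word y) * (letter (word z) * word w'))"
        and w': "word (y # w) = letter (word y) * (letter (word z) * word w')"
        by (simp_all add: word_mult Cons)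
      let ?z = "letter (word z) * word w'" and ?x = "letter (word x)" and ?y = "letter (word y)"
      have *: "bar m (?x * (?y * bar m ?z)) = letter (bil m (word x) (word y)) * bar m ?z - ?x * bar m (?y * bar m ?z)"
        by (rule bar_letters)
      have "bar m (bar m (word (y # w))) = 0" by (rule 3)
      then show ?thesis
        unfolding w w' by (simp add: bar_letters chains.linear_diff[OF lin_bar] right_diff_distrib * assms del: letter_word bil_word)
    qed
  qed (simp_all add: chains.linear_0[OF lin_bar])
qed (auto intro!: lin_intros)

text \<open>Thanks to the formal unit the three identities b b = 0, b' b' = 0 and b (1 - t) = (1 -
  t) b' are one computation with the face identities of words. Words too short for it and columns
  other than 0 and 1 are treated apart.\<close>

lemma cc2D_cc2D:
  assumes assoc: "\<And>u v w. bil m (bil m u v) w = bil m u (bil m v w)"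
  shows "cc2D m (cc2D m u) = 0"
proof (rule lin_eqI[of "\<lambda>u. cc2D m (cc2D m u)"])
  fix x :: "nat \<times> 'a list"
  obtain c w where x: "x = (c, w)" by force
  let ?us = "map (\<lambda>b. word b :: 'a \<Rightarrow>\<^sub>0 'b) w"
  have opt: "cc2D m (cc2D m (eval_opt vs)) = 0" if vs: "opt_word (Suc n) vs" for vs :: "('a \<Rightarrow>\<^sub>0 'b) option list" and n
  proof -
    have o_assoc: "opt_mult (bil m) (opt_mult (bil m) a b) c = opt_mult (bil m) a (opt_mult (bil m) b c)" for a b c
      by (cases a; cases b; cases c) (simp_all add: assoc)
    have *: "cc2D m (cc2D m (eval_opt vs)) = (\<Sum>i\<le>Suc n. (- 1) ^ i \<star> cc2D m (eval_opt (hface (opt_mult (bil m)) (Suc n) i vs)))"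
      using vs by (simp add: cc2D_eval_opt chains.linear_sum[OF lin_cc2D] chains.linear_scale[OF lin_cc2D]
        chains.linear_diff[OF lin_cc2D] chains.linear_neg[OF lin_cc2D] chains.linear_add[OF lin_cc2D])
    show ?thesis
    proof (cases n)
      \<comment> \<open>From degree 1 all faces lead to words with one letter in column 0, whose
        boundary is 0; \<open>hface_hface\<close> does not reach down to this degree.\<close>
      case 0
      have "cc2D m (eval_opt (hface (opt_mult (bil m)) (Suc n) i vs)) = 0" if i: "i \<le> Suc n" for i
      proof -
        obtain us where "hface (opt_mult (bil m)) (Suc n) i vs = map Some us" "length us = 1"
          using opt_word_hface[OF vs i, of "bil m"] 0 by (auto simp: opt_word_def)
        moreover then obtain v where "us = [v]" by (auto simp: length_Suc_conv)
        ultimately show ?thesis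
          by (simp only: eval_opt_Some) (simp add: cc2D_put)
      qed
      then show ?thesis unfolding * by (intro sum.neutral) auto
    next
      case (Suc k)
      have "cc2D m (cc2D m (eval_opt vs)) = (\<Sum>j\<le>Suc n. \<Sum>i\<le>n. (- 1) ^ (i + j) \<star>
          eval_opt (hface (opt_mult (bil m)) n i (hface (opt_mult (bil m)) (Suc n) j vs)))"
        unfolding *
      proof (intro sum.cong refl)
        fix j assume "j \<in> {..Suc n}"
        then have "cc2D m (eval_opt (hface (opt_mult (bil m)) (Suc n) j vs)) =
            (\<Sum>i\<le>n. (- 1) ^ i \<star> eval_opt (hface (opt_mult (bil m)) n i (hface (opt_mult (bil m)) (Suc n) j vs)))"
          using opt_word_hface[OF vs] Suc by (intro cc2D_eval_opt) auto
        then show "(- 1) ^ j \<star> cc2D m (eval_opt (hface (opt_mult (bil m)) (Suc n) j vs)) = (\<Sum>i\<le>n. (- 1) ^ (i + j) \<star>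
            eval_opt (hface (opt_mult (bil m)) n i (hface (opt_mult (bil m)) (Suc n) j vs)))"
          by (simp only: chain.scale_sum_right chain.scale_scale power_add mult.commute)
      qed
      also have "\<dots> = 0"
        by (rule alternating_double_sum_zero, subst hface_hface[OF o_assoc])
          (use vs Suc in \<open>auto simp: opt_word_def\<close>)
      finally show ?thesis .
    qed
  qed
  consider "w = []" | "c = 0" "length w = 1" | n where "c = 0" "length w = Suc (Suc n)"
    | n where "c = 1" "length w = Suc n" | "c \<ge> 2"
    by (metis One_nat_def Suc_1 length_0_conv less_Suc_eq less_one linorder_not_less not0_implies_Suc)
  then show "cc2D m (cc2D m (word x)) = 0"
  proof cases
    case 1
    then show ?thesis
      by (auto simp: x cc2D_put hoch_def one_minus_t_def chains.linear_0[OF lin_join] chains.linear_0[OF lin_cc2D] simp flip: put_word)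
  next
    case 2
    then obtain b where "word x = put c (letter (word b :: 'a \<Rightarrow>\<^sub>0 'b))" by (auto simp: x length_Suc_conv)
    then show ?thesis
      using 2 by (simp add: cc2D_put chains.linear_0[OF lin_cc2D] del: letter_word)
  next
    case 3
    then have "word x = eval_opt (map Some ?us)"
      by (simp only: eval_opt_Some tensor_words) (simp add: x)
    moreover have "opt_word (Suc n) (map Some ?us)"
      unfolding opt_word_def by (rule exI[of _ ?us]) (use 3 in simp)
    ultimately show ?thesis by (metis opt)
  next
    case 4
    then have "word x = eval_opt (None # map Some ?us)"
      by (simp only: eval_opt_None tensor_words) (simp add: x)
    moreover have "opt_word (Suc n) (None # map Some ?us)"
      unfolding opt_word_def by (rule exI[of _ ?us]) (use 4 in simp)
    ultimately show ?thesis by (metis opt)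
  next
    case 5
    then show ?thesis by (simp add: x cc2D_put chains.linear_0[OF lin_cc2D] flip: put_word)
  qed
qed (auto intro!: lin_intros)

lemma thom_cc2D:
  assumes "\<And>u v. linear_extension f (bil m u v) = bil m' (linear_extension f u) (linear_extension f v)"
  shows "slicewise (thom f) (cc2D m u) = cc2D m' (slicewise (thom f) u)"
  by (rule put_eqI)
    (auto intro!: lin_intros simp: cc2D_put slicewise_put[OF lin_thom] thom_hoch[OF assms] thom_bar[OF assms]
      thom_one_minus_t chains.linear_diff[OF lin_slicewise] chains.linear_0[OF lin_slicewise])

section \<open>A criterion for relative acyclicity\<close>

text \<open>The operator \<open>N = 1 - d H - H d\<close> is a chain map that lowers the rank of the words outside
  \<open>C\<close>, hence is nilpotent modulo \<open>C\<close> on every chain.\<close>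

lemma relative_acyclic:
  fixes d H :: "('x \<Rightarrow>\<^sub>0 'k::field) \<Rightarrow> ('x \<Rightarrow>\<^sub>0 'k)" and K C :: "nat \<Rightarrow> 'x set" and rank :: "'x \<Rightarrow> 'r::wellorder"
  assumes d: "lin d" and H: "lin H" and dd: "\<And>u. d (d u) = 0"
    and CK: "C n \<subseteq> K n"
    and HK: "\<And>e. e \<in> K n \<Longrightarrow> H (word e) \<in> supp (K (Suc n))"
    and HC: "\<And>i u. u \<in> supp (C i) \<Longrightarrow> H u = 0"
    and dC: "\<And>e. e \<in> C n \<Longrightarrow> H (d (word e)) = 0"
    and N: "\<And>e. e \<in> K n - C n \<Longrightarrow>
      word e - d (H (word e)) - H (d (word e)) \<in> supp (C n \<union> {e'\<in>K n. rank e' < rank e})"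
    and u: "u \<in> supp (K n)" and du: "d u \<in> supp (C (n - 1))"
  shows "\<exists>v\<in>supp (K (Suc n)). u - d v \<in> supp (C n)"
proof -
  have main: "\<exists>v\<in>supp (K (Suc n)). u - d v \<in> supp (C n)"
    if "u \<in> supp (C n \<union> {e\<in>K n. rank e \<le> r})" "d u \<in> supp (C (n - 1))" for u r
    using that
  proof (induction r arbitrary: u rule: less_induct)
    case (less r)
    define u' where "u' = u - d (H u) - H (d u)"
    \<comment> \<open>Here the relative cycle condition is used: it kills the term H d u, so that u'
      differs from u by a boundary.\<close>
    have Hdu: "H (d u) = 0" by (rule HC) (rule less.prems)
    have Hu: "H u \<in> supp (K (Suc n))"
      by (rule lin_supp[OF H less.prems(1)]) (use CK HK in auto)
    have u': "u' \<in> supp (C n \<union> {e\<in>K n. rank e < r})"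
      unfolding u'_def
    proof (rule lin_supp[OF _ less.prems(1)])
      fix e assume e: "e \<in> C n \<union> {e\<in>K n. rank e \<le> r}"
      show "word e - d (H (word e)) - H (d (word e)) \<in> supp (C n \<union> {e\<in>K n. rank e < r})"
      proof (cases "e \<in> C n")
        case True
        then show ?thesis using HC[of "word e" n] dC[of e] by (simp add: chains.linear_0[OF d])
      next
        case False
        then show ?thesis using N[of e] e by (auto elim!: supp_mono)
      qed
    qed (intro lin_intros lin_comp[OF d] lin_comp[OF H])
    have du': "d u' = d u" by (simp add: u'_def Hdu chains.linear_diff[OF d] dd)
    have "\<exists>v\<in>supp (K (Suc n)). u' - d v \<in> supp (C n)"
    proof (cases "u' \<in> supp (C n)")
      case True
      then show ?thesis by (intro bexI[of _ 0]) (simp_all add: chains.linear_0[OF d])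
    next
      case False
      \<comment> \<open>The support is finite, so the words outside \<open>C\<close> have a largest
        rank. It lies strictly below r, which makes the well-founded induction applicable even if
        infinitely many ranks lie below r.\<close>
      define r' where "r' = Max (rank ` (Poly_Mapping.keys u' - C n))"
      have ne: "Poly_Mapping.keys u' - C n \<noteq> {}" using False by (auto simp: supp_def)
      have "r' \<in> rank ` (Poly_Mapping.keys u' - C n)" unfolding r'_def by (rule Max_in) (use ne in auto)
      then have "r' < r" using u' by (auto simp: supp_def)
      moreover have "u' \<in> supp (C n \<union> {e\<in>K n. rank e \<le> r'})"
        using u' by (auto simp: supp_def r'_def intro!: Max_ge)
      ultimately show ?thesis using less.IH[of r' u'] less.prems(2) du' by simp
    qed
    then obtain v where v: "v \<in> supp (K (Suc n))" "u' - d v \<in> supp (C n)" by blast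
    have "u - d (H u + v) = u' - d v"
      by (simp add: u'_def Hdu chains.linear_add[OF d])
    with v Hu show ?case by (intro bexI[of _ "H u + v"]) (auto intro: supp_add)
  qed
  show ?thesis
  proof (cases "u = 0")
    case True
    then show ?thesis by (intro bexI[of _ 0]) (simp_all add: chains.linear_0[OF d])
  next
    case False
    have "u \<in> supp (C n \<union> {e\<in>K n. rank e \<le> Max (rank ` Poly_Mapping.keys u)})"
      using u by (auto simp: supp_def)
    then show ?thesis using main du by blast
  qed
qed

section \<open>The homotopies on words\<close>

lemma tensor_supp_rel:
  assumes "\<And>b. b \<in> set w \<Longrightarrow> g b \<in> supp {b'. R b' b}"
  shows "tensor (map g w) \<in> supp {w'. list_all2 R w' w}"
  using assms
proof (induction w)
  case (Cons b w)
  show ?case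
    by (simp, rule mult_supp[OF letter_supp[of _ "{b'. R b' b}"], of _ _ "{w'. list_all2 R w' w}"]) (use Cons in auto)
qed simp

lemma tensor_map_word [simp]: "tensor (map (\<lambda>x. word (g x)) w) = word (map g w)"
  by (induction w) (simp_all add: word_mult)

lemma relabel_map: "relabel (map g) u = thom (\<lambda>b. word (g b)) u"
  by (rule lin_eqI) (auto intro!: lin_intros)

text \<open>\<open>A j i\<close> stands for d_j h_i and \<open>B i j\<close> for h_i d_j. The
  relations are those of a simplicial homotopy in which d_i h_i vanishes; only the terms d_(i+1) h_i
  on the diagonal next to it survive.\<close>

lemma homotopy_double_sum:
  fixes A B :: "nat \<Rightarrow> nat \<Rightarrow> ('x \<Rightarrow>\<^sub>0 'k::field)"
  assumes lt: "\<And>i j. j < i \<Longrightarrow> i \<le> Suc q \<Longrightarrow> A j i = B (i - 1) j"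
    and eq: "\<And>i. i \<le> Suc q \<Longrightarrow> A i i = 0"
    and gt: "\<And>i j. Suc i < j \<Longrightarrow> j \<le> Suc (Suc q) \<Longrightarrow> A j i = B i (j - 1)"
  shows "(\<Sum>j\<le>Suc (Suc q). \<Sum>i\<le>Suc q. (- 1) ^ (j + Suc i) \<star> A j i) +
     (\<Sum>j\<le>Suc q. \<Sum>i\<le>q. (- 1) ^ (j + Suc i) \<star> B i j) = (\<Sum>i\<le>Suc q. A (Suc i) i)"
proof -
  let ?a = "\<lambda>(j, i). (- 1) ^ (j + Suc i) \<star> A j i" and ?b = "\<lambda>(j, i). (- 1) ^ (j + Suc i) \<star> B i j"
  let ?L = "{(j, i). j < i \<and> i \<le> Suc q}" and ?E = "(\<lambda>i. (i, i)) ` {..Suc q}"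
    and ?S = "(\<lambda>i. (Suc i, i)) ` {..Suc q}" and ?G = "{(j, i). Suc i < j \<and> j \<le> Suc (Suc q)}"
    and ?L' = "{(j, i). j \<le> i \<and> i \<le> q}" and ?G' = "{(j, i). i < j \<and> j \<le> Suc q}"
  have fin: "finite ?L" "finite ?G" "finite ?L'" "finite ?G'"
    by (rule finite_subset[of _ "{..Suc (Suc q)} \<times> {..Suc (Suc q)}"]; auto)+
  have "(\<Sum>j\<le>Suc (Suc q). \<Sum>i\<le>Suc q. (- 1) ^ (j + Suc i) \<star> A j i) = sum ?a ({..Suc (Suc q)} \<times> {..Suc q})"
    by (rule sum.cartesian_product)
  also have "{..Suc (Suc q)} \<times> {..Suc q} = ((?L \<union> ?E) \<union> ?S) \<union> ?G" by (auto simp: image_iff)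
  also have "sum ?a \<dots> = sum ?a ?L + sum ?a ?E + sum ?a ?S + sum ?a ?G"
    by (subst sum.union_disjoint, use fin in simp, use fin in simp, force)+ simp
  also have "sum ?a ?E = 0" by (rule sum.neutral) (auto simp: eq)
  also have "sum ?a ?S = (\<Sum>i\<le>Suc q. A (Suc i) i)"
    by (subst sum.reindex) (auto simp: inj_on_def power_add simp flip: power_mult_distrib intro!: sum.cong)
  also have "sum ?a ?L = - sum ?b ?L'"
    unfolding sum_negf[symmetric]
  proof (rule sum.reindex_bij_witness[of _ "\<lambda>(j, i). (j, Suc i)" "\<lambda>(j, i). (j, i - 1)"])
    fix x assume "x \<in> ?L"
    then obtain i j where "x = (j, Suc i)" "j \<le> i" "i \<le> q" by (cases x; cases "snd x") auto
    then show "- ?b (case x of (j, i) \<Rightarrow> (j, i - 1)) = ?a x"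
      using lt[of j "Suc i"] by (simp add: chain.scale_minus_left)
  qed auto
  also have "sum ?a ?G = - sum ?b ?G'"
    unfolding sum_negf[symmetric]
  proof (rule sum.reindex_bij_witness[of _ "\<lambda>(j, i). (Suc j, i)" "\<lambda>(j, i). (j - 1, i)"])
    fix x assume "x \<in> ?G"
    then obtain i j where "x = (Suc j, i)" "i < j" "j \<le> Suc q" by (cases x; cases "fst x") auto
    then show "- ?b (case x of (j, i) \<Rightarrow> (j - 1, i)) = ?a x"
      using gt[of i "Suc j"] by (simp add: chain.scale_minus_left)
  qed auto
  finally have 1: "(\<Sum>j\<le>Suc (Suc q). \<Sum>i\<le>Suc q. (- 1) ^ (j + Suc i) \<star> A j i) =
    - sum ?b ?L' + (\<Sum>i\<le>Suc q. A (Suc i) i) - sum ?b ?G'" by simp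
  have "(\<Sum>j\<le>Suc q. \<Sum>i\<le>q. (- 1) ^ (j + Suc i) \<star> B i j) = sum ?b ({..Suc q} \<times> {..q})"
    by (rule sum.cartesian_product)
  also have "{..Suc q} \<times> {..q} = ?L' \<union> ?G'" by auto
  also have "sum ?b \<dots> = sum ?b ?L' + sum ?b ?G'"
    by (rule sum.union_disjoint) (use fin in auto)
  finally show ?thesis using 1 by simp
qed

text \<open>Letters of type \<open>I\<close> span a simplicially contractible ideal, those of type \<open>W\<close> a constant
  complement of it in the crossed module \<open>X\<close>, and the remaining ones a complement of \<open>X\<close>.\<close>

locale coord_letters =
  fixes \<beta> :: "nat \<Rightarrow> 'b set" and m :: "nat \<Rightarrow> 'b \<Rightarrow> 'b \<Rightarrow> ('b \<Rightarrow>\<^sub>0 'k::field)"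
    and fc :: "nat \<Rightarrow> nat \<Rightarrow> 'b \<Rightarrow> ('b \<Rightarrow>\<^sub>0 'k)" and I W :: "'b set"
    and up :: "nat \<Rightarrow> nat \<Rightarrow> 'b \<Rightarrow> ('b \<Rightarrow>\<^sub>0 'k)" and sl :: "nat \<Rightarrow> 'b \<Rightarrow> 'b"
  assumes m_supp: "m p b b' \<in> supp (\<beta> p)"
    and assoc: "bil (m p) (bil (m p) u v) w = bil (m p) u (bil (m p) v w)"
    and face_mult: "j \<le> Suc p \<Longrightarrow> linear_extension (fc (Suc p) j) (bil (m (Suc p)) u v) =
       bil (m p) (linear_extension (fc (Suc p) j) u) (linear_extension (fc (Suc p) j) v)"
    and face_face: "i < j \<Longrightarrow> j \<le> Suc (Suc p) \<Longrightarrow>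
       linear_extension (fc (Suc p) i) (fc (Suc (Suc p)) j b) =
       linear_extension (fc (Suc p) (j - 1)) (fc (Suc (Suc p)) i b)"
    and IW: "I \<inter> W = {}"
    and m_I: "b \<in> I \<or> b' \<in> I \<Longrightarrow> m p b b' \<in> supp I"
    and m_X: "b \<in> I \<union> W \<or> b' \<in> I \<union> W \<Longrightarrow> m p b b' \<in> supp (I \<union> W)"
    and m_W: "b \<in> W \<Longrightarrow> b' \<in> W \<Longrightarrow> restrict_chain W (m p b b') = restrict_chain W (m 0 b b')"
    and W_level: "b \<in> W \<Longrightarrow> b \<in> \<beta> p \<longleftrightarrow> b \<in> \<beta> 0"
    and face_I: "b \<in> \<beta> (Suc p) \<inter> I \<Longrightarrow> j \<le> Suc p \<Longrightarrow> fc (Suc p) j b \<in> supp (\<beta> p \<inter> I)"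
    and face_W: "b \<in> \<beta> (Suc p) \<inter> W \<Longrightarrow> j \<le> Suc p \<Longrightarrow> fc (Suc p) j b = word b"
    and face_Z: "b \<in> \<beta> (Suc p) - I - W \<Longrightarrow> j \<le> Suc p \<Longrightarrow> fc (Suc p) j b \<in> supp (\<beta> p - I - W)"
    and sl_letter: "b \<in> \<beta> p \<Longrightarrow> i \<le> p \<Longrightarrow> sl i b \<in> \<beta> (Suc p)"
    and sl_types: "sl i b \<in> I \<longleftrightarrow> b \<in> I" "sl i b \<in> W \<longleftrightarrow> b \<in> W"
    and face_sl_lt: "b \<in> \<beta> p \<Longrightarrow> j < i \<Longrightarrow> i \<le> p \<Longrightarrow> fc (Suc p) j (sl i b) = relabel (sl (i - 1)) (fc p j b)"
    and face_sl_eq: "b \<in> \<beta> p \<Longrightarrow> i \<le> p \<Longrightarrow> fc (Suc p) (Suc i) (sl i b) = word b"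
    and face_sl_gt: "b \<in> \<beta> p \<Longrightarrow> Suc i < j \<Longrightarrow> j \<le> Suc p \<Longrightarrow> fc (Suc p) j (sl i b) = relabel (sl i) (fc p (j - 1) b)"
    and up_supp: "b \<in> \<beta> p \<inter> I \<Longrightarrow> i \<le> p \<Longrightarrow> up p i b \<in> supp (\<beta> (Suc p) \<inter> I)"
    and face_up_lt: "b \<in> \<beta> p \<inter> I \<Longrightarrow> j < i \<Longrightarrow> i \<le> p \<Longrightarrow>
       linear_extension (fc (Suc p) j) (up p i b) = linear_extension (up (p - 1) (i - 1)) (fc p j b)"
    and face_up_eq: "b \<in> \<beta> p \<inter> I \<Longrightarrow> i \<le> p \<Longrightarrow> linear_extension (fc (Suc p) i) (up p i b) = 0"
    and face_up_gt: "b \<in> \<beta> p \<inter> I \<Longrightarrow> Suc i < j \<Longrightarrow> j \<le> Suc p \<Longrightarrow>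
       linear_extension (fc (Suc p) j) (up p i b) = linear_extension (up (p - 1) i) (fc p (j - 1) b)"
    and face_up_sum: "b \<in> \<beta> p \<inter> I \<Longrightarrow> (\<Sum>i\<le>p. linear_extension (fc (Suc p) (Suc i)) (up p i b)) = word b"
begin

section \<open>Sliding a letter of type I in the simplicial direction\<close>

definition same_type :: "nat \<Rightarrow> 'b \<Rightarrow> 'b \<Rightarrow> bool" where
  "same_type p b' b \<longleftrightarrow> b' \<in> \<beta> p \<and> (b' \<in> I \<longleftrightarrow> b \<in> I) \<and> (b' \<in> W \<longleftrightarrow> b \<in> W)"

definition face :: "nat \<Rightarrow> nat \<Rightarrow> ('b list \<Rightarrow>\<^sub>0 'k) \<Rightarrow> ('b list \<Rightarrow>\<^sub>0 'k)" where
  "face p j = thom (fc p j)"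

lemma lin_face [lin_intros]: "lin (face p j)"
  by (auto simp: face_def intro: lin_intros)
lemmas lin_face_comp [lin_intros] = lin_comp[OF lin_face]

lemma fc_same_type: "b \<in> \<beta> (Suc p) \<Longrightarrow> j \<le> Suc p \<Longrightarrow> fc (Suc p) j b \<in> supp {b'. same_type p b' b}"
  using face_I[of b p j] face_W[of b p j] face_Z[of b p j] IW W_level[of b p] W_level[of b "Suc p"]
  by (cases "b \<in> I"; cases "b \<in> W") (auto simp: same_type_def elim!: supp_mono)

lemma face_supp:
  "set w \<subseteq> \<beta> (Suc p) \<Longrightarrow> j \<le> Suc p \<Longrightarrow> face (Suc p) j (word w) \<in> supp {w'. list_all2 (same_type p) w' w}"
  unfolding face_def thom_word by (rule tensor_supp_rel) (auto intro: fc_same_type)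

text \<open>Only one letter is raised by the contraction \<open>up\<close>; \<open>sl i\<close>
  plays the role of the degeneracy s_i on all others, so that faces can be computed letter by
  letter. Choosing the first letter of type I is compatible with faces because they preserve
  types.\<close>

fun push_word :: "nat \<Rightarrow> nat \<Rightarrow> 'b list \<Rightarrow> ('b list \<Rightarrow>\<^sub>0 'k)" where
  "push_word p i [] = 0"
| "push_word p i (x # w) = (if x \<in> I then letter (up p i x) * word (map (sl i) w) else word [sl i x] * push_word p i w)"

definition push :: "nat \<Rightarrow> nat \<Rightarrow> ('b list \<Rightarrow>\<^sub>0 'k) \<Rightarrow> ('b list \<Rightarrow>\<^sub>0 'k)" where
  "push p i = linear_extension (push_word p i)"

lemma lin_push [lin_intros]: "lin (push p i)"
  by (auto simp: push_def intro: lin_intros)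
lemmas lin_push_comp [lin_intros] = lin_comp[OF lin_push]

lemma push_of_word [simp]: "push p i (word w) = push_word p i w"
  by (simp add: push_def)

lemma push_I: "v \<in> supp I \<Longrightarrow> push p i (letter v * u) = letter (linear_extension (up p i) v) * relabel (map (sl i)) u"
proof (rule lin_eq_supp[of "\<lambda>v. push p i (letter v * u)"])
  fix x assume "x \<in> I"
  then show "push p i (letter (word x) * u) = letter (linear_extension (up p i) (word x)) * relabel (map (sl i)) u"
    by (intro lin_eqI[of "\<lambda>u. push p i (letter (word x) * u)" "\<lambda>u. _ * relabel (map (sl i)) u" u])
      (auto intro!: lin_intros simp: word_mult)
qed (auto intro!: lin_intros)

lemma push_not_I: "v \<in> supp (- I) \<Longrightarrow> push p i (letter v * u) = letter (relabel (sl i) v) * push p i u"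
proof (rule lin_eq_supp[of "\<lambda>v. push p i (letter v * u)"])
  fix x assume "x \<in> - I"
  then show "push p i (letter (word x) * u) = letter (relabel (sl i) (word x)) * push p i u"
    by (intro lin_eqI[of "\<lambda>u. push p i (letter (word x) * u)" "\<lambda>u. _ * push p i u" u])
      (auto intro!: lin_intros simp: word_mult)
qed (auto intro!: lin_intros)

lemma face_sl_tensor:
  assumes "set w \<subseteq> \<beta> p"
  shows "j < i \<Longrightarrow> i \<le> p \<Longrightarrow> face (Suc p) j (word (map (sl i) w)) = relabel (map (sl (i - 1))) (face p j (word w))"
    and "i \<le> p \<Longrightarrow> face (Suc p) (Suc i) (word (map (sl i) w)) = word w"
    and "Suc i < j \<Longrightarrow> j \<le> Suc p \<Longrightarrow> face (Suc p) j (word (map (sl i) w)) = relabel (map (sl i)) (face p (j - 1) (word w))"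
  using assms by (auto simp: face_def relabel_map thom_tensor face_sl_lt face_sl_eq face_sl_gt
      subset_iff comp_def cong: map_cong simp flip: relabel_def)

lemma face_push_word_lt:
  assumes "j < i" "i \<le> p" "set w \<subseteq> \<beta> p"
  shows "face (Suc p) j (push_word p i w) = push (p - 1) (i - 1) (face p j (word w))"
  using assms(3)
proof (induction w)
  case (Cons x w)
  obtain q where q: "p = Suc q" using assms by (cases p) auto
  have f: "face p j (word (x # w)) = letter (fc p j x) * face p j (word w)" by (simp add: face_def)
  show ?case
  proof (cases "x \<in> I")
    case True
    have "fc p j x \<in> supp I" using face_I[of x q j] True Cons.prems assms q by (auto elim: supp_mono)
    then show ?thesis unfolding f
      using True Cons.prems assms face_sl_tensor(1)[of w p j i] face_up_lt[of x p j i]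
      by (simp add: push_I face_def thom_mult)
  next
    case False
    have "fc p j x \<in> supp (- I)" using fc_same_type[of x q j] False Cons.prems assms q
      by (auto elim!: supp_mono simp: same_type_def)
    then show ?thesis unfolding f
      using False Cons assms face_sl_lt[of x p j i]
      by (simp add: push_not_I face_def thom_mult)
  qed
qed (simp add: face_def chains.linear_0[OF lin_thom] chains.linear_0[OF lin_push])

lemma face_push_word_gt:
  assumes "Suc i < j" "j \<le> Suc p" "set w \<subseteq> \<beta> p"
  shows "face (Suc p) j (push_word p i w) = push (p - 1) i (face p (j - 1) (word w))"
  using assms(3)
proof (induction w)
  case (Cons x w)
  obtain q where q: "p = Suc q" using assms by (cases p) auto
  have f: "face p (j - 1) (word (x # w)) = letter (fc p (j - 1) x) * face p (j - 1) (word w)" by (simp add: face_def)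
  show ?case
  proof (cases "x \<in> I")
    case True
    have "fc (Suc q) (j - 1) x \<in> supp (\<beta> q \<inter> I)"
      by (rule face_I) (use True Cons.prems assms q in auto)
    then have "fc p (j - 1) x \<in> supp I" using q by (auto elim: supp_mono)
    then show ?thesis unfolding f
      using True Cons.prems assms face_sl_tensor(3)[of w p i j] face_up_gt[of x p i j]
      by (simp add: push_I face_def thom_mult)
  next
    case False
    have "fc (Suc q) (j - 1) x \<in> supp {b'. same_type q b' x}"
      by (rule fc_same_type) (use False Cons.prems assms q in auto)
    then have "fc p (j - 1) x \<in> supp (- I)" using False q
      by (auto elim!: supp_mono simp: same_type_def)
    then show ?thesis unfolding f
      using False Cons assms face_sl_gt[of x p i j]
      by (simp add: push_not_I face_def thom_mult)
  qed
qed (simp add: face_def chains.linear_0[OF lin_thom] chains.linear_0[OF lin_push])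

lemma face_push_word_eq:
  assumes "i \<le> p" "set w \<subseteq> \<beta> p"
  shows "face (Suc p) i (push_word p i w) = 0"
  using assms(2)
proof (induction w)
  case (Cons x w)
  then show ?case
    using assms(1) face_up_eq[of x p i] by (auto simp: face_def thom_mult chains.linear_0[OF lin_letter])
qed (simp add: face_def chains.linear_0[OF lin_thom])

text \<open>The face d_(i+1) undoes the degeneracy s_i on every letter except the raised one. Hence
  the sum is carried out inside a single letter, where it is \<open>face_up_sum\<close>.\<close>

lemma face_push_word_sum:
  assumes "set w \<subseteq> \<beta> p" "set w \<inter> I \<noteq> {}"
  shows "(\<Sum>i\<le>p. face (Suc p) (Suc i) (push_word p i w)) = word w"
  using assms
proof (induction w)
  case (Cons x w)
  show ?case
  proof (cases "x \<in> I")
    case True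
    have "(\<Sum>i\<le>p. face (Suc p) (Suc i) (push_word p i (x # w))) =
        (\<Sum>i\<le>p. letter (linear_extension (fc (Suc p) (Suc i)) (up p i x)) * word w)"
      using True Cons.prems face_sl_tensor(2)[of w p] by (intro sum.cong) (auto simp: face_def thom_mult)
    then show ?thesis
      using True Cons.prems by (simp add: face_up_sum word_mult flip: sum_distrib_right chains.linear_sum[OF lin_letter])
  next
    case False
    have "(\<Sum>i\<le>p. face (Suc p) (Suc i) (push_word p i (x # w))) =
        (\<Sum>i\<le>p. word [x] * face (Suc p) (Suc i) (push_word p i w))"
      using False Cons.prems by (intro sum.cong) (auto simp: face_def thom_mult face_sl_eq)
    then show ?thesis
      using False Cons by (simp add: word_mult flip: sum_distrib_left)
  qed
qed simp

definition hpush :: "nat \<Rightarrow> ('b list \<Rightarrow>\<^sub>0 'k) \<Rightarrow> ('b list \<Rightarrow>\<^sub>0 'k)" where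
  "hpush p u = (\<Sum>i\<le>p. (- 1) ^ Suc i \<star> push p i u)"

lemma lin_hpush [lin_intros]: "lin (hpush p)"
  unfolding hpush_def[abs_def] by (intro lin_intros)

definition bdry :: "nat \<Rightarrow> ('b list \<Rightarrow>\<^sub>0 'k) \<Rightarrow> ('b list \<Rightarrow>\<^sub>0 'k)" where
  "bdry p u = (\<Sum>j\<le>p. (- 1) ^ j \<star> face p j u)"

text \<open>This contracts the simplicial direction alone. The internal differential is not
  respected; its contributions are absorbed by the rank in \<open>rank_drop_I\<close>.\<close>

lemma bdry_hpush:
  assumes "set w \<subseteq> \<beta> p" "set w \<inter> I \<noteq> {}"
  shows "bdry (Suc p) (hpush p (word w)) + (if p = 0 then 0 else hpush (p - 1) (bdry p (word w))) = word w"
proof (cases p)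
  case 0
  have "face (Suc 0) 0 (push_word 0 0 w) = 0"
    using face_push_word_eq[of 0 p w] assms 0 by simp
  then show ?thesis using face_push_word_sum[OF assms] 0
    by (simp add: bdry_def hpush_def chains.linear_neg[OF lin_face] single_uminus)
next
  case (Suc q)
  let ?A = "\<lambda>j i. face (Suc p) j (push_word p i w)" and ?B = "\<lambda>i j. push q i (face p j (word w))"
  have "bdry (Suc p) (hpush p (word w)) = (\<Sum>j\<le>Suc (Suc q). \<Sum>i\<le>Suc q. (- 1) ^ (j + Suc i) \<star> ?A j i)"
    by (simp only: bdry_def hpush_def chains.linear_sum[OF lin_face] chains.linear_scale[OF lin_face]
      chain.scale_sum_right chain.scale_scale power_add push_of_word Suc)
  moreover have "hpush (p - 1) (bdry p (word w)) = (\<Sum>j\<le>Suc q. \<Sum>i\<le>q. (- 1) ^ (j + Suc i) \<star> ?B i j)"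
    by (subst sum.swap) (simp only: bdry_def hpush_def chains.linear_sum[OF lin_push] chains.linear_scale[OF lin_push]
      chain.scale_sum_right chain.scale_scale power_add mult.commute Suc diff_Suc_1)
  moreover have "(\<Sum>j\<le>Suc (Suc q). \<Sum>i\<le>Suc q. (- 1) ^ (j + Suc i) \<star> ?A j i) +
      (\<Sum>j\<le>Suc q. \<Sum>i\<le>q. (- 1) ^ (j + Suc i) \<star> ?B i j) = (\<Sum>i\<le>Suc q. ?A (Suc i) i)"
    by (rule homotopy_double_sum)
      (use assms Suc in \<open>auto simp: face_push_word_lt face_push_word_eq face_push_word_gt\<close>)
  ultimately show ?thesis
    using face_push_word_sum[OF assms] Suc by (simp only: nat.simps if_False)
qed

lemma push_supp:
  assumes "set w \<subseteq> \<beta> p" "i \<le> p"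
  shows "push_word p i w \<in> supp {w'. list_all2 (same_type (Suc p)) w' w \<and> set w' \<inter> I \<noteq> {}}"
  using assms(1)
proof (induction w)
  case (Cons x w)
  have sl: "list_all2 (same_type (Suc p)) (map (sl i) w) w"
    using Cons.prems assms(2) by (auto simp: list_all2_map1 list_all2_same same_type_def sl_types intro: sl_letter)
  show ?case
  proof (cases "x \<in> I")
    case True
    have "letter (up p i x) \<in> supp ((\<lambda>b. [b]) ` (\<beta> (Suc p) \<inter> I))"
      using True Cons.prems assms by (intro letter_supp up_supp) auto
    moreover have "same_type (Suc p) b x" if "b \<in> \<beta> (Suc p) \<inter> I" for b
      using that True IW by (auto simp: same_type_def)
    ultimately show ?thesis using True sl
      by (simp, elim mult_supp[where B' = "{map (sl i) w}"]) auto
  next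
    case False
    then show ?thesis using Cons assms
      by (simp, intro mult_supp[where B = "{[sl i x]}", OF _ Cons.IH]) (auto simp: same_type_def sl_types intro: sl_letter)
  qed
qed simp

end

section \<open>Boundaries of concatenated and of rotated words\<close>

lemma word_mult_left: "word xs * (word ys * z) = word (xs @ ys) * z" for z :: "'x list \<Rightarrow>\<^sub>0 'k::field"
  by (simp add: word_mult flip: mult.assoc)

lemma bar_word_append:
  assumes "x \<noteq> []" "y \<noteq> []"
  shows "bar_word m (x @ y) = bar_word m x * word y
    + (- 1) ^ (length x - 1) \<star> (word (butlast x) * (letter (m (last x) (hd y)) * word (tl y)))
    + (- 1) ^ length x \<star> (word x * bar_word m y)"
  using assms
proof (induction x rule: induct_list012)
  case (2 a)
  then obtain b y' where "y = b # y'" by (cases y) auto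
  then show ?case by simp
next
  case (3 a b x)
  have IH: "bar_word m (b # x @ y) = bar_word m (b # x) * word y
    + (- 1) ^ length x \<star> (word (butlast (b # x)) * (letter (m (last (b # x)) (hd y)) * word (tl y)))
    + (- 1) ^ Suc (length x) \<star> (word (b # x) * bar_word m y)"
    using 3 by simp
  have w: "word (butlast (a # b # x)) = word [a] * word (butlast (b # x))" "word (a # b # x) = word [a] * word (b # x)"
    by (simp_all add: word_mult)
  show ?case
    unfolding w append_Cons bar_word.simps IH
    by (simp add: algebra_simps word_mult word_mult_left chain.scale_minus_left del: butlast.simps)
qed simp

text \<open>Moving the first letter to the end turns all faces of b but one into faces of b', with
  opposite sign; only the product of the first letter with its successor is left over. Thus words of
  column 0 that start with a letter of type W are reduced to the bar complex.\<close>

lemma hoch_cons: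
  assumes "v \<noteq> []"
  shows "hoch m (word (a # v)) = join m (word (a # v)) - rot (bar m (word (v @ [a])))"
proof -
  obtain b v' where v: "v = b # v'" using assms by (cases v) auto
  have 1: "bar m (word (a # v)) = join m (word (a # v)) - word [a] * bar_word m v"
    by (simp add: v)
  have 2: "bar_word m (v @ [a]) = bar_word m v * letter (word a)
      + (- 1) ^ (length v - 1) \<star> (word (butlast v) * letter (m (last v) a))"
    using bar_word_append[OF assms, of "[a]" m] by simp
  have 3: "rot (bar m (word (v @ [a]))) = word [a] * bar_word m v
      + (- 1) ^ (length v - 1) \<star> (letter (m (last v) a) * word (butlast v))"
    by (simp only: bar_of_word 2 chains.linear_add[OF lin_rot] chains.linear_scale[OF lin_rot] rot_letter) simp
  have 4: "join m (rot (len_sign (word (a # v)))) = (- 1) ^ (length v - 1) \<star> (letter (m (last v) a) * word (butlast v))"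
  proof -
    have "rot (word (a # v)) = word (last v # a # butlast v)" using assms by simp
    then have "join m (rot (word (a # v))) = letter (m (last v) a) * word (butlast v)" using assms by simp
    moreover have "(- 1 :: 'b) ^ length (a # v) = (- 1) ^ (length v - 1)" by (simp add: v)
    ultimately show ?thesis
      by (simp only: len_sign_word chains.linear_scale[OF lin_rot] chains.linear_scale[OF lin_join])
  qed
  show ?thesis unfolding hoch_def 1 3 4 by simp
qed

section \<open>The differential of A/I on runs of type W, and the part of lower rank\<close>

context coord_letters
begin

definition Wwords :: "nat \<Rightarrow> 'b list set" where
  "Wwords n = {w. length w = n \<and> set w \<subseteq> W \<inter> \<beta> 0}"

definition nz :: "'b list \<Rightarrow> nat" where
  "nz w = length (filter (\<lambda>b. b \<notin> I \<union> W) w)"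

lemma nz_simps [simp]: "nz [] = 0" "nz (b # w) = (if b \<in> I \<union> W then nz w else Suc (nz w))"
  "nz (v @ w) = nz v + nz w"
  by (auto simp: nz_def)

text \<open>The bar differential of A/I, performed inside the runs of letters of type W. Level 0 may
  serve for all levels because the W-component of such a product is the same at each of them
  (\<open>m_W\<close>).\<close>

fun dw_word :: "'b list \<Rightarrow> ('b list \<Rightarrow>\<^sub>0 'k)" where
  "dw_word (x # y # w) = (if x \<in> W \<and> y \<in> W then letter (restrict_chain W (m 0 x y)) * word w else 0)
     - word [x] * dw_word (y # w)"
| "dw_word _ = 0"

definition dw :: "('b list \<Rightarrow>\<^sub>0 'k) \<Rightarrow> ('b list \<Rightarrow>\<^sub>0 'k)" where
  "dw = linear_extension dw_word"

lemma lin_dw [lin_intros]: "lin dw"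
  by (auto simp: dw_def intro: lin_intros)
lemmas lin_dw_comp [lin_intros] = lin_comp[OF lin_dw]

lemma dw_of_word [simp]: "dw (word w) = dw_word w"
  by (simp add: dw_def)

lemma mW_supp: "restrict_chain W (m 0 x y) \<in> supp (W \<inter> \<beta> 0)"
proof -
  have "restrict_chain W u \<in> supp (W \<inter> \<beta> 0)" if "u \<in> supp (\<beta> 0)" for u :: "'b \<Rightarrow>\<^sub>0 'k"
    by (rule lin_supp[OF lin_restrict_chain that]) (auto simp: restrict_chain_word)
  then show ?thesis using m_supp by blast
qed

definition dw_rel :: "'b list \<Rightarrow> 'b list \<Rightarrow> bool" where
  "dw_rel w' w \<longleftrightarrow> set w' \<subseteq> set w \<union> (W \<inter> \<beta> 0) \<and> filter (\<lambda>b. b \<notin> W) w' = filter (\<lambda>b. b \<notin> W) w \<and>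
     w' \<noteq> [] \<and> set w' \<inter> W \<noteq> {} \<and> (hd w \<notin> W \<longrightarrow> hd w' = hd w) \<and> (last w \<notin> W \<longrightarrow> last w' = last w) \<and>
     (last w \<in> W \<longrightarrow> last w' \<in> W) \<and> Suc (length w') = length w"

lemma dw_supp: "dw_word w \<in> supp {w'. dw_rel w' w}"
proof (induction w rule: induct_list012)
  case (3 x y w)
  have "letter (restrict_chain W (m 0 x y)) * word w \<in> supp {w'. dw_rel w' (x # y # w)}" if "x \<in> W" "y \<in> W"
    by (rule mult_supp[OF letter_supp[OF mW_supp], of _ "{w}"]) (use that in \<open>auto simp: dw_rel_def\<close>)
  moreover have "word [x] * dw_word (y # w) \<in> supp {w'. dw_rel w' (x # y # w)}"
    by (rule mult_supp[OF _ 3(2), of _ "{[x]}"]) (auto simp: dw_rel_def)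
  ultimately show ?case by (auto intro: supp_intros)
qed simp_all

lemma dw_rel_nz: "dw_rel w' w \<Longrightarrow> nz w' = nz w \<and> (set w \<inter> I = {} \<longrightarrow> set w' \<inter> I = {})"
proof
  assume rel: "dw_rel w' w"
  have "nz u = length (filter (\<lambda>b. b \<notin> I) (filter (\<lambda>b. b \<notin> W) u))" for u
    by (simp add: nz_def conj_commute)
  moreover have "filter (\<lambda>b. b \<notin> W) w' = filter (\<lambda>b. b \<notin> W) w" using rel by (simp add: dw_rel_def)
  ultimately show "nz w' = nz w" by (simp only:)
  show "set w \<inter> I = {} \<longrightarrow> set w' \<inter> I = {}" using rel IW by (auto simp: dw_rel_def)
qed

lemma dw_append:
  "x \<noteq> [] \<Longrightarrow> y \<noteq> [] \<Longrightarrow> last x \<notin> W \<or> hd y \<notin> W \<Longrightarrow>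
    dw_word (x @ y) = dw_word x * word y + (- 1) ^ length x \<star> (word x * dw_word y)"
proof (induction x rule: induct_list012)
  case (2 a)
  then obtain b y' where "y = b # y'" by (cases y) auto
  then show ?case using 2 by auto
next
  case (3 a b x)
  have IH: "dw_word (b # x @ y) = dw_word (b # x) * word y + (- 1) ^ Suc (length x) \<star> (word (b # x) * dw_word y)"
    using 3 by simp
  have w: "word (a # b # x) = word [a] * word (b # x)"
    by (simp add: word_mult)
  show ?case
    unfolding w append_Cons dw_word.simps IH
    by (simp add: algebra_simps word_mult word_mult_left chain.scale_minus_left)
qed simp

lemma dw_no_W: "set w \<inter> W = {} \<Longrightarrow> dw_word w = 0"
  by (induction w rule: induct_list012) auto

lemma dw_Wwords: "w \<in> Wwords n \<Longrightarrow> dw_word w \<in> supp (Wwords (n - 1))"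
  by (rule supp_mono[OF dw_supp]) (auto simp: Wwords_def dw_rel_def)

text \<open>No product of two letters of type W crosses the ends of \<open>u\<close>, because its
  neighbours are of other types. So \<open>dw\<close> behaves as a graded derivation here, and it
  vanishes on \<open>S\<close>.\<close>

lemma dw_block:
  assumes "P = [] \<or> last P \<notin> W" "u \<in> supp (Wwords n)" "n \<ge> 1" "set S \<inter> W = {}"
  shows "dw (word P * u * word S) = dw_word P * u * word S + (- 1) ^ length P \<star> (word P * dw u * word S)"
proof (rule lin_eq_supp[OF _ _ assms(2), of "\<lambda>u. dw (word P * u * word S)"])
  fix x assume x: "x \<in> Wwords n"
  then have ne: "x \<noteq> []" using assms(3) by (auto simp: Wwords_def)
  have 1: "dw_word (x @ S) = dw_word x * word S"
  proof (cases "S = []")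
    case False
    then have "hd S \<notin> W" using assms(4) by (cases S) auto
    then show ?thesis using dw_append[OF ne False] dw_no_W[OF assms(4)] by simp
  qed simp
  have "dw_word (P @ x @ S) = dw_word P * word (x @ S) + (- 1) ^ length P \<star> (word P * dw_word (x @ S))"
    using dw_append[of P "x @ S"] ne assms(1) by (cases "P = []") auto
  then show "dw (word P * word x * word S) = dw_word P * word x * word S + (- 1) ^ length P \<star> (word P * dw (word x) * word S)"
    by (simp add: word_mult 1 mult.assoc)
qed (auto intro!: lin_intros)

definition low :: "nat \<Rightarrow> nat \<Rightarrow> 'b list set" where
  "low p k = {w. set w \<subseteq> \<beta> p \<and> (set w \<inter> I \<noteq> {} \<or> nz w < k)}"

text \<open>What \<open>dw\<close> omits is smaller: the remaining component of a product of two
  letters of type W is of type I; a product of a letter of type W with a lifted one lies in the span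
  of I and W, which uses up the lifted letter; a product of two lifted letters uses up at least one
  of them.\<close>

lemma bar_low: "set w \<subseteq> \<beta> p \<Longrightarrow> set w \<inter> I = {} \<Longrightarrow> bar_word (m p) w - dw_word w \<in> supp (low p (nz w))"
proof (induction w rule: induct_list012)
  case (3 x y w)
  have x: "x \<notin> I" "y \<notin> I" "x \<in> \<beta> p" "y \<in> \<beta> p" and w: "set w \<subseteq> \<beta> p" "set w \<inter> I = {}"
    using 3 by auto
  have "word [x] * (bar_word (m p) (y # w) - dw_word (y # w)) \<in> supp (low p (nz (x # y # w)))"
    by (rule mult_supp[OF _ 3(2), of _ "{[x]}"]) (use 3 in \<open>auto simp: low_def\<close>)
  moreover have "letter (m p x y) * word w - (if x \<in> W \<and> y \<in> W then letter (restrict_chain W (m 0 x y)) * word w else 0)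
      \<in> supp (low p (nz (x # y # w)))"
  proof (cases "x \<in> W \<and> y \<in> W")
    case True
    have "m p x y - restrict_chain W (m p x y) \<in> supp (\<beta> p \<inter> I)"
    proof -
      have "m p x y \<in> supp (\<beta> p \<inter> (I \<union> W))"
        using m_supp[of p x y] m_X[of x y p] True by (auto simp: supp_def)
      then show ?thesis
        by (rule lin_supp[rotated]) (auto simp: restrict_chain_word intro!: lin_intros)
    qed
    from letter_supp[OF this] have "letter (m p x y - restrict_chain W (m p x y)) * word w \<in> supp (low p (nz (x # y # w)))"
      by (rule mult_supp[of _ _ _ "{w}"]) (use w in \<open>auto simp: low_def\<close>)
    then show ?thesis using True m_W[of x y p]
      by (simp add: chains.linear_diff[OF lin_letter] left_diff_distrib)
  next
    case False
    have "letter (m p x y) * word w \<in> supp (low p (nz (x # y # w)))"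
    proof (cases "x \<in> W \<or> y \<in> W")
      case X: True
      have "m p x y \<in> supp (\<beta> p \<inter> (I \<union> W))"
        using m_supp[of p x y] m_X[of x y p] X by (auto simp: supp_def)
      from letter_supp[OF this] show ?thesis
        by (rule mult_supp[of _ _ _ "{w}"]) (use w x X False in \<open>auto simp: low_def\<close>)
    next
      case Z: False
      from letter_supp[OF m_supp[of p x y]] show ?thesis
        by (rule mult_supp[of _ _ _ "{w}"]) (use w x Z in \<open>auto simp: low_def\<close>)
    qed
    then show ?thesis using False by auto
  qed
  ultimately show ?case
    using supp_diff[of "letter (m p x y) * word w - (if x \<in> W \<and> y \<in> W then letter (restrict_chain W (m 0 x y)) * word w else 0)"
        "low p (nz (x # y # w))" "word [x] * (bar_word (m p) (y # w) - dw_word (y # w))"]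
    by (simp add: algebra_simps del: nz_simps)
qed simp_all

text \<open>Multiplication can neither lose nor leave an ideal, so having some letter in
  \<open>J\<close> and having all letters in \<open>J\<close> both persist. It is applied to
  \<open>I\<close> and to \<open>I \<union> W\<close>.\<close>

lemma bar_ideal:
  assumes J: "\<And>b b'. b \<in> J \<or> b' \<in> J \<Longrightarrow> m p b b' \<in> supp J"
  shows "set w \<subseteq> \<beta> p \<Longrightarrow> bar_word (m p) w \<in>
    supp {w'. set w' \<subseteq> \<beta> p \<and> (set w \<inter> J \<noteq> {} \<longrightarrow> set w' \<inter> J \<noteq> {}) \<and> (set w \<subseteq> J \<longrightarrow> set w' \<subseteq> J) \<and> Suc (length w') = length w \<and> w' \<noteq> []}"
proof (induction w rule: induct_list012)
  case (3 x y w)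
  have "m p x y \<in> supp (\<beta> p \<inter> {b. x \<in> J \<or> y \<in> J \<longrightarrow> b \<in> J})"
    using m_supp[of p x y] J[of x y] by (auto simp: supp_def)
  from letter_supp[OF this] have "letter (m p x y) * word w \<in>
      supp {w'. set w' \<subseteq> \<beta> p \<and> (set (x # y # w) \<inter> J \<noteq> {} \<longrightarrow> set w' \<inter> J \<noteq> {}) \<and> (set (x # y # w) \<subseteq> J \<longrightarrow> set w' \<subseteq> J) \<and> Suc (length w') = length (x # y # w) \<and> w' \<noteq> []}"
    by (rule mult_supp[of _ _ _ "{w}"]) (use 3 in auto)
  moreover have "word [x] * bar_word (m p) (y # w) \<in>
      supp {w'. set w' \<subseteq> \<beta> p \<and> (set (x # y # w) \<inter> J \<noteq> {} \<longrightarrow> set w' \<inter> J \<noteq> {}) \<and> (set (x # y # w) \<subseteq> J \<longrightarrow> set w' \<subseteq> J) \<and> Suc (length w') = length (x # y # w) \<and> w' \<noteq> []}"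
    by (rule mult_supp[OF _ 3(2), of _ "{[x]}"]) (use 3 in auto)
  ultimately show ?case by (auto intro: supp_intros)
qed simp_all

lemma join_rot_ideal:
  assumes J: "\<And>b b'. b \<in> J \<or> b' \<in> J \<Longrightarrow> m p b b' \<in> supp J" and w: "set w \<subseteq> \<beta> p"
  shows "join (m p) (rot (word w)) \<in>
    supp {w'. set w' \<subseteq> \<beta> p \<and> (set w \<inter> J \<noteq> {} \<longrightarrow> set w' \<inter> J \<noteq> {}) \<and> (set w \<subseteq> J \<longrightarrow> set w' \<subseteq> J) \<and> Suc (length w') = length w \<and> w' \<noteq> []}"
proof -
  consider "w = []" | b where "w = [b]" | x y v where "w = y # v @ [x]"
    by (metis neq_Nil_conv rev_exhaust)
  then show ?thesis
  proof cases
    case 3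
    have "m p x y \<in> supp (\<beta> p \<inter> {b. x \<in> J \<or> y \<in> J \<longrightarrow> b \<in> J})"
      using m_supp[of p x y] J[of x y] by (auto simp: supp_def)
    from letter_supp[OF this] have "letter (m p x y) * word v \<in>
        supp {w'. set w' \<subseteq> \<beta> p \<and> (set w \<inter> J \<noteq> {} \<longrightarrow> set w' \<inter> J \<noteq> {}) \<and> (set w \<subseteq> J \<longrightarrow> set w' \<subseteq> J) \<and> Suc (length w') = length w \<and> w' \<noteq> []}"
      by (rule mult_supp[of _ _ _ "{v}"]) (use 3 w in auto)
    then show ?thesis using 3 by simp
  qed (auto simp: chains.linear_0[OF lin_join])
qed

lemma cc2D_ideal:
  assumes J: "\<And>b b'. b \<in> J \<or> b' \<in> J \<Longrightarrow> m p b b' \<in> supp J" and w: "set w \<subseteq> \<beta> p" "w \<noteq> []"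
  shows "cc2D (m p) (word (c, w)) \<in>
    supp {(c', w'). set w' \<subseteq> \<beta> p \<and> (set w \<inter> J \<noteq> {} \<longrightarrow> set w' \<inter> J \<noteq> {}) \<and> (set w \<subseteq> J \<longrightarrow> set w' \<subseteq> J) \<and> Suc (length w' + c') = length w + c \<and> c' \<le> 1 \<and> w' \<noteq> []}"
    (is "_ \<in> supp ?D")
proof -
  let ?B = "{w'. set w' \<subseteq> \<beta> p \<and> (set w \<inter> J \<noteq> {} \<longrightarrow> set w' \<inter> J \<noteq> {}) \<and> (set w \<subseteq> J \<longrightarrow> set w' \<subseteq> J) \<and> Suc (length w') = length w \<and> w' \<noteq> []}"
  have bar: "bar (m p) (word w) \<in> supp ?B"
    using bar_ideal[of J p w] J w by simp
  have hoch: "hoch (m p) (word w) \<in> supp ?B"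
    using bar join_rot_ideal[of J p w] J w
    by (auto simp: hoch_def len_sign_word chains.linear_scale[OF lin_rot] chains.linear_scale[OF lin_join] intro!: supp_intros
      simp del: rot_word bar_of_word scale_chain_single)
  have t: "one_minus_t (word w) \<in> supp {w'. set w' = set w \<and> length w' = length w}"
  proof -
    obtain v b where "w = v @ [b]" using w(2) by (cases w rule: rev_cases) auto
    then show ?thesis
      by (auto simp: one_minus_t_def chains.linear_scale[OF lin_rot] chains.linear_neg[OF lin_rot] intro!: supp_intros simp del: scale_chain_single)
  qed
  consider "c = 0" | "c = 1" | "c \<ge> 2" by linarith
  then show ?thesis
  proof cases
    case 1
    have "put 0 (hoch (m p) (word w)) \<in> supp ?D"
      by (rule put_supp[OF hoch]) (use 1 in auto)
    then show ?thesis using 1 by (simp add: cc2D_put flip: put_word)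
  next
    case 2
    have "put 0 (one_minus_t (word w)) \<in> supp ?D"
      by (rule put_supp[OF t]) (use 2 w in auto)
    moreover have "put 1 (bar (m p) (word w)) \<in> supp ?D"
      by (rule put_supp[OF bar]) (use 2 in auto)
    ultimately have "put 0 (one_minus_t (word w)) - put 1 (bar (m p) (word w)) \<in> supp ?D"
      by (rule supp_diff)
    then show ?thesis using 2 by (simp add: cc2D_put flip: put_word)
  qed (simp add: cc2D_put flip: put_word)
qed

end

lemma (in coord_letters) same_type_list:
  "list_all2 (same_type p) w' w \<Longrightarrow> set w' \<subseteq> \<beta> p \<and> (set w' \<inter> W = {} \<longleftrightarrow> set w \<inter> W = {}) \<and>
    (set w' \<inter> I = {} \<longleftrightarrow> set w \<inter> I = {}) \<and> (set w' \<subseteq> I \<union> W \<longleftrightarrow> set w \<subseteq> I \<union> W) \<and> nz w' = nz w \<and>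
    length w' = length w \<and> (w \<noteq> [] \<longrightarrow> (hd w' \<in> W \<longleftrightarrow> hd w \<in> W))"
  by (induction rule: list_all2_induct) (auto simp: same_type_def)

text \<open>The contraction \<open>h\<close> of the bar complex of A/I is assumed here;
  \<open>contraction_exists\<close> supplies it once the bar homology of the crossed module
  vanishes.\<close>

locale contracted_letters = coord_letters +
  fixes h :: "('a list \<Rightarrow>\<^sub>0 'b::field) \<Rightarrow> ('a list \<Rightarrow>\<^sub>0 'b)"
  assumes lin_h [lin_intros]: "lin h"
    and h_supp: "w \<in> Wwords n \<Longrightarrow> n \<ge> 1 \<Longrightarrow> h (word w) \<in> supp (Wwords (Suc n))"
    and dw_h: "w \<in> Wwords n \<Longrightarrow> n \<ge> 1 \<Longrightarrow> dw (h (word w)) + h (dw (word w)) = word w"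
begin

text \<open>The contraction \<open>h\<close> is applied to the last run of letters of type \<open>W\<close>.\<close>

definition hw_word :: "'a list \<Rightarrow> ('a list \<Rightarrow>\<^sub>0 'b)" where
  "hw_word w = (let r = dropWhile (\<lambda>b. b \<notin> W) (rev w);
      S = rev (takeWhile (\<lambda>b. b \<notin> W) (rev w));
      x = rev (takeWhile (\<lambda>b. b \<in> W) r); P = rev (dropWhile (\<lambda>b. b \<in> W) r)
    in (- 1) ^ length P \<star> (word P * h (word x) * word S))"

definition hw :: "('a list \<Rightarrow>\<^sub>0 'b) \<Rightarrow> ('a list \<Rightarrow>\<^sub>0 'b)" where
  "hw = linear_extension hw_word"

lemma lin_hw [lin_intros]: "lin hw"
  by (auto simp: hw_def intro: lin_intros)
lemmas lin_hw_comp [lin_intros] = lin_comp[OF lin_hw]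

lemma hw_of_word [simp]: "hw (word w) = hw_word w"
  by (simp add: hw_def)

text \<open>Every decomposition of this shape is the one that \<open>hw_word\<close> computes, so
  proofs are free to name the prefix, the last run and the suffix.\<close>

lemma hw_word_block:
  assumes "P = [] \<or> last P \<notin> W" "x \<noteq> []" "set x \<subseteq> W" "set S \<inter> W = {}"
  shows "hw_word (P @ x @ S) = (- 1) ^ length P \<star> (word P * h (word x) * word S)"
proof -
  have S: "takeWhile (\<lambda>b. b \<notin> W) (rev S @ rev x @ rev P) = rev S"
    "dropWhile (\<lambda>b. b \<notin> W) (rev S @ rev x @ rev P) = rev x @ rev P"
  proof -
    obtain y x' where "rev x = y # x'" "y \<in> W" using assms(2,3) by (cases x rule: rev_cases) auto
    moreover have "\<And>b. b \<in> set (rev S) \<Longrightarrow> b \<notin> W" using assms(4) by auto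
    ultimately show "takeWhile (\<lambda>b. b \<notin> W) (rev S @ rev x @ rev P) = rev S"
      "dropWhile (\<lambda>b. b \<notin> W) (rev S @ rev x @ rev P) = rev x @ rev P"
      by (simp_all add: takeWhile_append dropWhile_append)
  qed
  have x: "takeWhile (\<lambda>b. b \<in> W) (rev x @ rev P) = rev x" "dropWhile (\<lambda>b. b \<in> W) (rev x @ rev P) = rev P"
  proof -
    have "\<And>b. b \<in> set (rev x) \<Longrightarrow> b \<in> W" using assms(3) by auto
    moreover have "takeWhile (\<lambda>b. b \<in> W) (rev P) = []" "dropWhile (\<lambda>b. b \<in> W) (rev P) = rev P"
      using assms(1) by (cases P rule: rev_cases; simp)+
    ultimately show "takeWhile (\<lambda>b. b \<in> W) (rev x @ rev P) = rev x" "dropWhile (\<lambda>b. b \<in> W) (rev x @ rev P) = rev P"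
      by (simp_all add: takeWhile_append dropWhile_append)
  qed
  show ?thesis by (simp add: hw_word_def Let_def S x)
qed

lemma hw_block:
  assumes "u1 \<in> supp {P. length P = l \<and> (P = [] \<or> last P \<notin> W)}" "u \<in> supp (Wwords n)" "n \<ge> 1"
    "u2 \<in> supp {S. set S \<inter> W = {}}"
  shows "hw (u1 * u * u2) = (- 1) ^ l \<star> (u1 * h u * u2)"
proof (rule lin_eq_supp[OF _ _ assms(1), of "\<lambda>u1. hw (u1 * u * u2)"])
  fix P assume P: "P \<in> {P. length P = l \<and> (P = [] \<or> last P \<notin> W)}"
  show "hw (word P * u * u2) = (- 1) ^ l \<star> (word P * h u * u2)"
  proof (rule lin_eq_supp[OF _ _ assms(2), of "\<lambda>u. hw (word P * u * u2)"])
    fix x assume x: "x \<in> Wwords n"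
    show "hw (word P * word x * u2) = (- 1) ^ l \<star> (word P * h (word x) * u2)"
    proof (rule lin_eq_supp[OF _ _ assms(4), of "\<lambda>u2. hw (word P * word x * u2)"])
      fix S assume "S \<in> {S. set S \<inter> W = {}}"
      moreover have "x \<noteq> []" using x assms(3) by (auto simp: Wwords_def)
      ultimately have "hw_word (P @ x @ S) = (- 1) ^ l \<star> (word P * h (word x) * word S)"
        using hw_word_block[of P x S] P x assms(3) by (auto simp: Wwords_def)
      then show "hw (word P * word x * word S) = (- 1) ^ l \<star> (word P * h (word x) * word S)"
        by (simp add: word_mult)
    qed (auto intro!: lin_intros)
  qed (auto intro!: lin_intros)
qed (auto intro!: lin_intros)

lemma block_decomp:
  assumes "set w \<inter> W \<noteq> {}"
  obtains P x S where "w = P @ x @ S" "P = [] \<or> last P \<notin> W" "x \<noteq> []" "set x \<subseteq> W" "set S \<inter> W = {}"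
proof -
  define r where "r = rev (dropWhile (\<lambda>b. b \<notin> W) (rev w))"
  define S where "S = rev (takeWhile (\<lambda>b. b \<notin> W) (rev w))"
  define x where "x = rev (takeWhile (\<lambda>b. b \<in> W) (rev r))"
  define P where "P = rev (dropWhile (\<lambda>b. b \<in> W) (rev r))"
  have "w = r @ S" by (simp add: r_def S_def flip: rev_append)
  moreover have r: "r = P @ x" by (simp add: x_def P_def flip: rev_append)
  moreover have "set S \<inter> W = {}" "set x \<subseteq> W" by (auto simp: S_def x_def dest: set_takeWhileD)
  moreover have "P = [] \<or> last P \<notin> W"
    using hd_dropWhile[of "\<lambda>b. b \<in> W" "rev r"] by (auto simp: P_def last_rev)
  moreover have "x \<noteq> []"
  proof -
    obtain b where b: "b \<in> set (rev w)" "b \<in> W" using assms by auto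
    then have "dropWhile (\<lambda>b. b \<notin> W) (rev w) \<noteq> []" by auto
    then have "hd (rev r) \<in> W" "rev r \<noteq> []"
      using hd_dropWhile[of "\<lambda>b. b \<notin> W" "rev w"] by (auto simp: r_def)
    then show ?thesis by (cases "rev r") (auto simp: x_def)
  qed
  ultimately show ?thesis using that by simp
qed

text \<open>\<open>dw\<close> acts on the prefix and on the last run. The prefix terms of the two
  summands cancel, because \<open>dw\<close> shortens the prefix by one and the sign of
  \<open>hw\<close> is the parity of the prefix; the terms on the run are
  \<open>dw_h\<close>.\<close>

lemma dw_hw:
  assumes "set w \<inter> W \<noteq> {}" "set w \<inter> W \<subseteq> \<beta> 0"
  shows "dw (hw (word w)) + hw (dw (word w)) = word w"
proof -
  obtain P x S where w: "w = P @ x @ S" "P = [] \<or> last P \<notin> W" "x \<noteq> []" "set x \<subseteq> W" "set S \<inter> W = {}"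
    using block_decomp[OF assms(1)] by metis
  let ?n = "length x"
  have x: "x \<in> Wwords ?n" "?n \<ge> 1" using w assms by (auto simp: Wwords_def Suc_le_eq)
  have hx: "h (word x) \<in> supp (Wwords (Suc ?n))" using h_supp x by blast
  have ww: "(word w :: 'a list \<Rightarrow>\<^sub>0 'b) = word P * word x * word S" using w by (simp add: word_mult)
  have hw: "hw (word w) = (- 1) ^ length P \<star> (word P * h (word x) * word S)"
    using hw_word_block[OF w(2-5)] w(1) by simp
  have "dw (hw (word w)) = (- 1) ^ length P \<star> (dw_word P * h (word x) * word S + (- 1) ^ length P \<star> (word P * dw (h (word x)) * word S))"
    unfolding hw chains.linear_scale[OF lin_dw] using dw_block[OF w(2) hx _ w(5)] by simp
  then have 1: "dw (hw (word w)) = (- 1) ^ length P \<star> (dw_word P * h (word x) * word S) + word P * dw (h (word x)) * word S"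
    by (simp add: chain.scale_right_distrib flip: power_mult_distrib)
  have dww: "dw (word w) = dw_word P * word x * word S + (- 1) ^ length P \<star> (word P * dw (word x) * word S)"
    unfolding ww using dw_block[OF w(2) _ x(2) w(5), of "word x"] x(1) by simp
  \<comment> \<open>The words of \<open>dw_word P\<close> keep the last letter of P, which is not in
    W; so x is still the whole last run, only the parity of the prefix has changed.\<close>
  have 2: "hw (dw_word P * word x * word S) = - ((- 1) ^ length P \<star> (dw_word P * h (word x) * word S))"
  proof (cases "P = []")
    case False
    then have "dw_word P \<in> supp {P'. length P' = length P - 1 \<and> (P' = [] \<or> last P' \<notin> W)}"
      by (intro supp_mono[OF dw_supp]) (use w(2) in \<open>auto simp: dw_rel_def\<close>)
    then have "hw (dw_word P * word x * word S) = (- 1) ^ (length P - 1) \<star> (dw_word P * h (word x) * word S)"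
      by (rule hw_block[where n = ?n]) (use x w(5) in auto)
    then show ?thesis using False by (cases "length P") (simp_all add: chain.scale_minus_left)
  qed (simp add: chains.linear_0[OF lin_hw])
  have 3: "hw (word P * dw (word x) * word S) = (- 1) ^ length P \<star> (word P * h (dw (word x)) * word S)"
  proof (cases "?n = 1")
    case True
    then have "dw (word x) = 0" by (auto simp: length_Suc_conv)
    then show ?thesis by (simp add: chains.linear_0[OF lin_hw] chains.linear_0[OF lin_h])
  next
    case False
    have "dw (word x) \<in> supp (Wwords (?n - 1))" using dw_Wwords[OF x(1)] by simp
    then show ?thesis by (intro hw_block[where n = "?n - 1"]) (use x False w(2,5) in auto)
  qed
  have "hw (dw (word w)) = - ((- 1) ^ length P \<star> (dw_word P * h (word x) * word S)) + word P * h (dw (word x)) * word S"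
    unfolding dww chains.linear_add[OF lin_hw] chains.linear_scale[OF lin_hw] 2 3
    by (simp flip: power_mult_distrib)
  then have "dw (hw (word w)) + hw (dw (word w)) = word P * (dw (h (word x)) + h (dw (word x))) * word S"
    unfolding 1 by (simp add: distrib_left distrib_right)
  also have "\<dots> = word w" using dw_h[OF x] ww by simp
  finally show ?thesis .
qed

definition hw_rel :: "'a list \<Rightarrow> 'a list \<Rightarrow> bool" where
  "hw_rel w' w \<longleftrightarrow> set w' \<subseteq> set w \<union> (W \<inter> \<beta> 0) \<and> filter (\<lambda>b. b \<notin> W) w' = filter (\<lambda>b. b \<notin> W) w \<and>
     set w' \<inter> W \<noteq> {} \<and> (hd w \<notin> W \<longrightarrow> hd w' = hd w) \<and> length w' = Suc (length w)"

lemma hw_word_supp: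
  assumes "set w \<inter> W \<noteq> {}" "set w \<inter> W \<subseteq> \<beta> 0"
  shows "hw_word w \<in> supp {w'. hw_rel w' w}"
proof -
  obtain P x S where w: "w = P @ x @ S" "P = [] \<or> last P \<notin> W" "x \<noteq> []" "set x \<subseteq> W" "set S \<inter> W = {}"
    using block_decomp[OF assms(1)] by metis
  let ?n = "length x"
  have x: "x \<in> Wwords ?n" "?n \<ge> 1" using w assms by (auto simp: Wwords_def Suc_le_eq)
  have "word P * h (word x) * word S \<in> supp {w'. hw_rel w' w}"
  proof (rule mult_supp[of _ "(@) P ` Wwords (Suc ?n)" _ "{S}"])
    show "word P * h (word x) \<in> supp ((@) P ` Wwords (Suc ?n))"
      by (rule mult_supp[OF _ h_supp[OF x], of _ "{P}"]) auto
    fix u v assume "u \<in> (@) P ` Wwords (Suc ?n)" "v \<in> {S}"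
    then obtain y where y: "y \<in> Wwords (Suc ?n)" "u @ v = P @ y @ S" by auto
    have f: "filter (\<lambda>b. b \<notin> W) z = []" if "set z \<subseteq> W" for z using that by (auto simp: filter_empty_conv)
    have "y \<noteq> []" using y by (auto simp: Wwords_def)
    moreover have "hd (P @ x @ S) \<notin> W \<Longrightarrow> P \<noteq> []" using w(3,4) by (cases x) auto
    moreover have "set y \<inter> W \<noteq> {}" using y(1) \<open>y \<noteq> []\<close> by (cases y) (auto simp: Wwords_def)
    ultimately show "u @ v \<in> {w'. hw_rel w' w}"
      using y(1) w f[of x] f[of y] unfolding y(2) by (auto simp: hw_rel_def Wwords_def)
  qed simp
  then show ?thesis
    using hw_word_block[OF w(2-5)] w(1) by (simp add: supp_scale)
qed

lemma hw_rel_nz: "hw_rel w' w \<Longrightarrow> nz w' = nz w \<and> (set w \<inter> I = {} \<longrightarrow> set w' \<inter> I = {})"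
proof
  assume rel: "hw_rel w' w"
  have "nz u = length (filter (\<lambda>b. b \<notin> I) (filter (\<lambda>b. b \<notin> W) u))" for u
    by (simp add: nz_def conj_commute)
  moreover have "filter (\<lambda>b. b \<notin> W) w' = filter (\<lambda>b. b \<notin> W) w" using rel by (simp add: hw_rel_def)
  ultimately show "nz w' = nz w" by (simp only:)
  show "set w \<inter> I = {} \<longrightarrow> set w' \<inter> I = {}" using rel IW by (auto simp: hw_rel_def)
qed

lemma face_Wwords: "u \<in> supp (Wwords n) \<Longrightarrow> j \<le> Suc p \<Longrightarrow> face (Suc p) j u = u"
proof (rule lin_eq_supp[where B = "Wwords n"])
  fix w assume "w \<in> Wwords n" "j \<le> Suc p"
  then have "map (fc (Suc p) j) w = map (\<lambda>b. word b) w"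
    using W_level[of _ "Suc p"] by (auto simp: Wwords_def subset_iff intro!: face_W)
  then show "face (Suc p) j (word w) = word w" by (simp only: face_def thom_word tensor_words)
qed (auto intro!: lin_intros)

text \<open>Faces fix the letters of type W and preserve the types of all others. Hence they change
  neither the last run nor the value of \<open>h\<close> on it.\<close>

lemma face_hw:
  assumes "set w \<inter> W \<noteq> {}" "set w \<subseteq> \<beta> (Suc p)" "j \<le> Suc p"
  shows "face (Suc p) j (hw (word w)) = hw (face (Suc p) j (word w))"
proof -
  obtain P x S where w: "w = P @ x @ S" "P = [] \<or> last P \<notin> W" "x \<noteq> []" "set x \<subseteq> W" "set S \<inter> W = {}"
    using block_decomp[OF assms(1)] by metis
  let ?n = "length x" and ?f = "face (Suc p) j"
  have "set x \<subseteq> W \<inter> \<beta> 0"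
  proof
    fix b assume "b \<in> set x"
    then have "b \<in> W" "b \<in> \<beta> (Suc p)" using w(1,4) assms(2) by auto
    then show "b \<in> W \<inter> \<beta> 0" using W_level by blast
  qed
  then have x: "x \<in> Wwords ?n" "?n \<ge> 1" using w(3) by (auto simp: Wwords_def Suc_le_eq)
  have ww: "(word w :: 'a list \<Rightarrow>\<^sub>0 'b) = word P * word x * word S" using w by (simp add: word_mult)
  have mult: "?f (u * v) = ?f u * ?f v" for u v by (simp add: face_def thom_mult)
  have P: "?f (word P) \<in> supp {P'. length P' = length P \<and> (P' = [] \<or> last P' \<notin> W)}"
  proof (rule supp_mono[OF face_supp])
    show "{w'. list_all2 (same_type p) w' P} \<subseteq> {P'. length P' = length P \<and> (P' = [] \<or> last P' \<notin> W)}"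
    proof
      fix P' assume "P' \<in> {w'. list_all2 (same_type p) w' P}"
      then have r: "list_all2 (same_type p) P' P" by simp
      have "P' = [] \<or> last P' \<notin> W" using w(2) r
        by (cases P rule: rev_cases) (auto simp: list_all2_append2 list_all2_Cons2 same_type_def)
      then show "P' \<in> {P'. length P' = length P \<and> (P' = [] \<or> last P' \<notin> W)}"
        using list_all2_lengthD[OF r] by simp
    qed
  qed (use assms w in auto)
  have S: "?f (word S) \<in> supp {S. set S \<inter> W = {}}"
  proof (rule supp_mono[OF face_supp])
    show "{w'. list_all2 (same_type p) w' S} \<subseteq> {S. set S \<inter> W = {}}"
      using same_type_list[of p _ S] w(5) by blast
  qed (use assms w in auto)
  have "?f (hw (word w)) = (- 1) ^ length P \<star> (?f (word P) * ?f (h (word x)) * ?f (word S))"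
    using hw_word_block[OF w(2-5)] w(1) by (simp add: mult chains.linear_scale[OF lin_face])
  also have "?f (h (word x)) = h (word x)"
    using face_Wwords[OF h_supp[OF x]] assms(3) by blast
  also have "(- 1) ^ length P \<star> (?f (word P) * h (word x) * ?f (word S)) = hw (?f (word P) * word x * ?f (word S))"
    by (rule hw_block[OF P _ x(2) S, symmetric]) (use x in simp)
  also have "word x = ?f (word x)"
    using face_Wwords[of "word x" ?n j p] x assms(3) by simp
  finally show ?thesis unfolding ww mult .
qed

end

section \<open>The total differential and the rank of a word\<close>

context coord_letters
begin

text \<open>A generator \<open>(p, c, w)\<close> is the word \<open>w\<close> in column
  \<open>c\<close> of the two-column complex at simplicial level \<open>p\<close>.\<close>

definition dtot :: "(nat \<times> nat \<times> 'b list \<Rightarrow>\<^sub>0 'k) \<Rightarrow> (nat \<times> nat \<times> 'b list \<Rightarrow>\<^sub>0 'k)" where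
  "dtot = simp_tot (\<lambda>p j. slicewise (face p j)) (\<lambda>p. cc2D (m p))"

lemma lin_dtot [lin_intros]: "lin dtot"
  by (auto simp: dtot_def intro: lin_intros)

lemma dtot_put: "dtot (put p (put c u)) =
    (if p = 0 then 0 else put (p - 1) (put c (bdry p u))) + (- 1) ^ p \<star> put p (cc2D (m p) (put c u))"
  unfolding dtot_def
  by (subst simp_tot_put)
    (auto intro!: lin_intros simp: bdry_def slicewise_put lin_face chains.linear_sum[OF lin_put] chains.linear_scale[OF lin_put])

lemma face_cc2D: "i \<le> Suc p \<Longrightarrow> slicewise (face (Suc p) i) (cc2D (m (Suc p)) u) = cc2D (m p) (slicewise (face (Suc p) i) u)"
  unfolding face_def by (rule thom_cc2D) (rule face_mult)

lemma face_bar: "i \<le> Suc p \<Longrightarrow> face (Suc p) i (bar (m (Suc p)) u) = bar (m p) (face (Suc p) i u)"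
  unfolding face_def by (rule thom_bar) (rule face_mult)

lemma face_face_chain:
  assumes "i < j" "j \<le> Suc (Suc p)"
  shows "face (Suc p) i (face (Suc (Suc p)) j u) = face (Suc p) (j - 1) (face (Suc (Suc p)) i u)"
proof (rule lin_eqI[of "\<lambda>u. face (Suc p) i (face (Suc (Suc p)) j u)"])
  fix w :: "'b list"
  show "face (Suc p) i (face (Suc (Suc p)) j (word w)) = face (Suc p) (j - 1) (face (Suc (Suc p)) i (word w))"
    using face_face[OF assms] by (simp add: face_def thom_tensor comp_def cong: map_cong)
qed (auto intro!: lin_intros)

lemma dtot_dtot: "dtot (dtot u) = 0"
  unfolding dtot_def
proof (rule simp_tot_simp_tot)
  show "cc2D (m p) (cc2D (m p) u) = 0" for p u
    by (rule cc2D_cc2D) (rule assoc)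
  fix p i j and u :: "nat \<times> 'b list \<Rightarrow>\<^sub>0 'k" assume ij: "i < j" "j \<le> Suc (Suc p)"
  show "slicewise (face (Suc p) i) (slicewise (face (Suc (Suc p)) j) u) =
      slicewise (face (Suc p) (j - 1)) (slicewise (face (Suc (Suc p)) i) u)"
    by (rule put_eqI[of "\<lambda>u. slicewise (face (Suc p) i) (slicewise (face (Suc (Suc p)) j) u)"])
      (auto intro!: lin_intros simp: slicewise_put lin_face face_face_chain[OF ij])
qed (auto intro!: lin_intros face_cc2D)

lemma bdry_supp:
  assumes "set w \<subseteq> \<beta> p" "p > 0"
  shows "bdry p (word w) \<in> supp {w'. list_all2 (same_type (p - 1)) w' w}"
proof -
  obtain q where "p = Suc q" using assms by (cases p) auto
  then show ?thesis unfolding bdry_def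
    using face_supp[of w q] assms by (auto intro!: supp_intros)
qed

lemma hpush_supp:
  assumes "set w \<subseteq> \<beta> p"
  shows "hpush p (word w) \<in> supp {w'. list_all2 (same_type (Suc p)) w' w \<and> set w' \<inter> I \<noteq> {}}"
  unfolding hpush_def push_of_word by (intro supp_sum supp_scale push_supp) (use assms in auto)

lemma dtot_ideal:
  assumes J: "J = I \<or> J = I \<union> W" and w: "set w \<subseteq> \<beta> p" "w \<noteq> []" "c \<le> 1"
  shows "dtot (word (p, c, w)) \<in> supp {(p', c', w'). set w' \<subseteq> \<beta> p' \<and> c' \<le> 1 \<and> w' \<noteq> [] \<and>
    Suc (p' + c' + length w') = p + c + length w \<and> (set w \<inter> J \<noteq> {} \<longrightarrow> set w' \<inter> J \<noteq> {}) \<and> (set w \<subseteq> J \<longrightarrow> set w' \<subseteq> J)}"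
    (is "_ \<in> supp ?D")
proof -
  have mJ: "b \<in> J \<or> b' \<in> J \<Longrightarrow> m p b b' \<in> supp J" for b b'
    using J m_I m_X by auto
  have 1: "put (p - 1) (put c (bdry p (word w))) \<in> supp ?D" if "p > 0"
  proof (intro put_supp[where B = "{c} \<times> {w'. list_all2 (same_type (p - 1)) w' w}"]
      put_supp[where B = "{w'. list_all2 (same_type (p - 1)) w' w}"])
    show "bdry p (word w) \<in> supp {w'. list_all2 (same_type (p - 1)) w' w}"
      by (rule bdry_supp) (use w that in auto)
    fix x assume "x \<in> {c} \<times> {w'. list_all2 (same_type (p - 1)) w' w}"
    then obtain w' where x: "x = (c, w')" "list_all2 (same_type (p - 1)) w' w" by auto
    moreover have "w' \<noteq> []" using x(2) w(2) by auto
    moreover have "set w \<subseteq> I \<Longrightarrow> set w' \<subseteq> I" using x(2)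
      by (induction rule: list_all2_induct) (auto simp: same_type_def)
    ultimately show "(p - 1, x) \<in> ?D"
      using same_type_list[OF x(2)] w that J by auto
  qed auto
  have 2: "put p (cc2D (m p) (put c (word w))) \<in> supp ?D"
    unfolding put_word by (rule put_supp[OF cc2D_ideal[OF mJ w(1,2)]]) (use w in auto)
  have "dtot (word (p, c, w)) = (if p = 0 then 0 else put (p - 1) (put c (bdry p (word w)))) + (- 1) ^ p \<star> put p (cc2D (m p) (put c (word w)))"
    using dtot_put[of p c "word w"] by simp
  then show ?thesis using 1 2 by (auto intro!: supp_intros)
qed

lemma W_sub: "W \<inter> \<beta> 0 \<subseteq> \<beta> p"
  using W_level[of _ p] by blast

text \<open>The order is lexicographic. Words with a letter of type I come lowest and are measured
  by length plus column, which the internal differential lowers while a letter of type I persists.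
  For the other words the second component counts lifted letters plus the column: the part of b'
  outside \<open>dw\<close> lowers the former, 1 - t the latter. The length of the leading run
  decides the remaining case, the first face of a rotated word in column 0.\<close>

definition irank :: "nat \<times> 'b list \<Rightarrow> nat \<times> nat \<times> nat" where
  "irank = (\<lambda>(c, w). if set w \<inter> I \<noteq> {} then (0, length w + c, 0)
     else (1, nz w + c, if c = 0 then length (takeWhile (\<lambda>b. b \<in> W) w) else 0))"

definition mixed :: "'b list \<Rightarrow> bool" where
  "mixed w \<longleftrightarrow> set w \<inter> I = {} \<and> set w \<inter> W \<noteq> {} \<and> \<not> set w \<subseteq> I \<union> W"

end

section \<open>The homotopy on mixed words\<close>

context contracted_letters
begin

text \<open>If a word of column 0 starts with a letter of type W, the last Hochschild face may join
  two such letters, which does not lower the rank. In that case the first letter is moved to the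
  end, where b becomes -b' up to one face by \<open>hoch_cons\<close>; this is the origin of the
  minus sign. In column 1 the sign comes from the differential -b'.\<close>

definition hmix :: "nat \<Rightarrow> ('a list \<Rightarrow>\<^sub>0 'b) \<Rightarrow> ('a list \<Rightarrow>\<^sub>0 'b)" where
  "hmix c = linear_extension (\<lambda>w. if c = 0 \<and> w \<noteq> [] \<and> hd w \<in> W then - rot (hw (word (tl w @ [hd w])))
     else if c = 0 then hw (word w) else - hw (word w))"

lemma lin_hmix [lin_intros]: "lin (hmix c)"
  by (auto simp: hmix_def intro: lin_intros)
lemmas lin_hmix_comp [lin_intros] = lin_comp[OF lin_hmix]

lemma hmix_cons: "a \<in> W \<Longrightarrow> hmix 0 (word [a] * u) = - rot (hw (u * word [a]))"
  by (rule lin_eqI[of "\<lambda>u. hmix 0 (word [a] * u)"]) (auto intro!: lin_intros simp: hmix_def word_mult)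

lemma hmix_hd: "u \<in> supp {w. w \<noteq> [] \<and> hd w \<notin> W} \<Longrightarrow> hmix 0 u = hw u"
  by (rule lin_eq_supp[of "hmix 0"]) (auto intro!: lin_intros simp: hmix_def)

lemma hmix_1: "c \<noteq> 0 \<Longrightarrow> hmix c u = - hw u"
  by (rule lin_eqI[of "hmix c"]) (auto intro!: lin_intros simp: hmix_def)

text \<open>Once the letter of type W stands at the end, it belongs to the last run and no suffix
  remains. The prefix is nonempty because a mixed word has a lifted letter.\<close>

lemma mixed_cons_decomp:
  assumes "mixed (a # v)" "a \<in> W"
  obtains P x where "v @ [a] = P @ x" "P \<noteq> []" "last P \<notin> W" "x \<noteq> []" "set x \<subseteq> W"
    "a # v = last x # P @ butlast x"
proof -
  have "set (v @ [a]) \<inter> W \<noteq> {}" using assms by auto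
  then obtain P x S where w: "v @ [a] = P @ x @ S" "P = [] \<or> last P \<notin> W" "x \<noteq> []" "set x \<subseteq> W" "set S \<inter> W = {}"
    by (rule block_decomp)
  have S: "S = []" using w(1,5) assms(2) by (cases S rule: rev_cases) auto
  have P: "P \<noteq> []"
  proof
    assume "P = []"
    then have "set (v @ [a]) \<subseteq> W" using w(1,4) S by simp
    then show False using assms by (auto simp: mixed_def)
  qed
  have "a = last x" "v = P @ butlast x"
    using w(1,3) S by (metis append.right_neutral last_appendR last_snoc, metis append.right_neutral butlast_append butlast_snoc)
  then show ?thesis using that[of P x] w S P by simp
qed

text \<open>The leading run consists of the letter taken from the end and the leading run of
  \<open>P\<close>; it stops inside \<open>P\<close>, whose last letter is not in W. So the rank
  does not depend on \<open>x\<close>, and replacing \<open>x\<close> by a word of \<open>h\<close>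
  leaves it unchanged.\<close>

lemma irank_rotated:
  assumes "P \<noteq> []" "last P \<notin> W" "x \<noteq> []" "set x \<subseteq> W" "set P \<inter> I = {}"
  shows "irank (0, last x # P @ butlast x) = (1, nz P, Suc (length (takeWhile (\<lambda>b. b \<in> W) P)))"
proof -
  have "nz z = 0" if "set z \<subseteq> W" for z using that by (auto simp: nz_def filter_empty_conv)
  moreover have "set (butlast x) \<subseteq> W" "last x \<in> W" using assms by (auto dest: in_set_butlastD)
  moreover have "takeWhile (\<lambda>b. b \<in> W) (P @ butlast x) = takeWhile (\<lambda>b. b \<in> W) P"
    by (rule takeWhile_append1[of "last P"]) (use assms in auto)
  ultimately show ?thesis using assms(5) IW by (auto simp: irank_def)
qed

lemma hw_P_x:
  assumes "P \<noteq> []" "last P \<notin> W" "x \<noteq> []" "set x \<subseteq> W"  "set x \<subseteq> \<beta> 0"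
  shows "hw_word (P @ x) \<in> supp {P @ y | y. y \<in> Wwords (Suc (length x))}"
proof -
  have x: "x \<in> Wwords (length x)" "length x \<ge> 1" using assms by (auto simp: Wwords_def Suc_le_eq)
  have "word P * h (word x) \<in> supp {P @ y | y. y \<in> Wwords (Suc (length x))}"
    by (rule mult_supp[OF _ h_supp[OF x], of _ "{P}"]) auto
  then show ?thesis
    using hw_word_block[of P x "[]"] assms by (simp add: supp_scale)
qed

lemma hmix_supp:
  assumes "mixed w" "set w \<subseteq> \<beta> p"
  shows "hmix c (word w) \<in> supp {w'. set w' \<subseteq> \<beta> p \<and> length w' = Suc (length w) \<and> mixed w' \<and> irank (c, w') = irank (c, w)}"
    (is "_ \<in> supp ?D")
proof -
  have wW: "set w \<inter> W \<subseteq> \<beta> 0" using assms(2) W_level[of _ p] by auto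
  have rel: "w' \<in> ?D" if "hw_rel w' w" "c = 0 \<longrightarrow> hd w \<notin> W" for w'
  proof -
    have ne: "w' \<noteq> []" "w \<noteq> []" using that assms by (auto simp: hw_rel_def mixed_def)
    have "set w' \<subseteq> \<beta> p" using that assms W_level[of _ p] by (auto simp: hw_rel_def)
    moreover have "\<not> set w' \<subseteq> I \<union> W"
    proof -
      obtain b where b: "b \<in> set w" "b \<notin> I \<union> W" using assms by (auto simp: mixed_def)
      then have "b \<in> set (filter (\<lambda>b. b \<notin> W) w)" by simp
      then have "b \<in> set w'" using that(1) by (metis (no_types, lifting) filter_is_subset hw_rel_def subsetD)
      then show ?thesis using b by auto
    qed
    moreover have "c = 0 \<Longrightarrow> hd w' \<notin> W" using that by (auto simp: hw_rel_def)
    then have "c = 0 \<Longrightarrow> takeWhile (\<lambda>b. b \<in> W) w' = []" "c = 0 \<Longrightarrow> takeWhile (\<lambda>b. b \<in> W) w = []"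
      using ne that by (cases w', simp_all, cases w, simp_all)
    ultimately show ?thesis
      using hw_rel_nz[OF that(1)] that assms by (auto simp: hw_rel_def mixed_def irank_def)
  qed
  have hw: "hw (word w) \<in> supp ?D" if "c = 0 \<longrightarrow> hd w \<notin> W"
  proof -
    have "hw_word w \<in> supp {w'. hw_rel w' w}"
      by (rule hw_word_supp) (use assms wW in \<open>auto simp: mixed_def\<close>)
    then show ?thesis using rel that by (auto simp: subset_iff intro: supp_mono simp del: mem_Collect_eq)
  qed
  show ?thesis
  proof (cases "c = 0 \<and> hd w \<in> W")
    case False
    then show ?thesis using hw by (auto simp: hmix_def intro: supp_neg)
  next
    case True
    obtain a v where w: "w = a # v" using assms by (cases w) (auto simp: mixed_def)
    then have a: "a \<in> W" using True by simp
    obtain P x where P: "v @ [a] = P @ x" "P \<noteq> []" "last P \<notin> W" "x \<noteq> []" "set x \<subseteq> W" "a # v = last x # P @ butlast x"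
      using mixed_cons_decomp[of a v] assms a w by auto
    have sets: "set w = set P \<union> set x" using P(1) w by (metis set_append set_rotate1 rotate1.simps(2))
    have len: "length w = length P + length x" using P(1) w by (metis length_append_singleton length_append length_Cons)
    have "hw_word (P @ x) \<in> supp {P @ y | y. y \<in> Wwords (Suc (length x))}"
      by (rule hw_P_x) (use P sets wW in auto)
    then have "rot (hw_word (P @ x)) \<in> supp ?D"
    proof (rule lin_supp[OF lin_rot])
      fix z assume "z \<in> {P @ y | y. y \<in> Wwords (Suc (length x))}"
      then obtain y where y: "z = P @ y" "y \<in> Wwords (Suc (length x))" by auto
      have "y \<noteq> []" using y by (auto simp: Wwords_def)
      have Y: "set (last y # P @ butlast y) = set P \<union> set y"
        using \<open>y \<noteq> []\<close> by (cases y rule: rev_cases) auto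
      have PI: "set P \<inter> I = {}" using assms(1) sets by (auto simp: mixed_def)
      have PZ: "\<not> set P \<subseteq> I \<union> W" using assms(1) sets P by (auto simp: mixed_def)
      have "last y # P @ butlast y \<in> ?D"
      proof (intro CollectI conjI)
        show "set (last y # P @ butlast y) \<subseteq> \<beta> p" unfolding Y
          using sets assms(2) y(2) W_sub[of p] by (auto simp: Wwords_def)
        show "length (last y # P @ butlast y) = Suc (length w)" using y len by (simp add: Wwords_def)
        show "mixed (last y # P @ butlast y)" unfolding mixed_def Y
          using PI PZ y(2) \<open>y \<noteq> []\<close> IW by (cases y) (auto simp: Wwords_def)
        have "irank (0, last y # P @ butlast y) = irank (0, last x # P @ butlast x)"
          by (subst (1 2) irank_rotated) (use P PI y \<open>y \<noteq> []\<close> in \<open>auto simp: Wwords_def\<close>)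
        then show "irank (c, last y # P @ butlast y) = irank (c, w)" using True P(6) w by simp
      qed
      then show "rot (word z) \<in> supp ?D" using y \<open>y \<noteq> []\<close> by (simp add: butlast_append)
    qed
    then show ?thesis using True w P(1) a by (simp add: hmix_def supp_neg)
  qed
qed

end

context contracted_letters
begin

lemma face_hmix:
  assumes "mixed w" "set w \<subseteq> \<beta> (Suc p)" "j \<le> Suc p"
  shows "face (Suc p) j (hmix c (word w)) = hmix c (face (Suc p) j (word w))"
proof (cases "c = 0 \<and> hd w \<in> W")
  case True
  obtain a v where w: "w = a # v" using assms by (cases w) (auto simp: mixed_def)
  then have a: "a \<in> W" using True by simp
  let ?f = "face (Suc p) j"
  have mult: "?f (u * v) = ?f u * ?f v" for u v by (simp add: face_def thom_mult)
  have fa: "?f (word [a]) = word [a]"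
    using face_W[of a p j] a assms w by (simp add: face_def)
  have "hmix c (?f (word w)) = hmix 0 (word [a] * ?f (word v))"
    using True fa mult[of "word [a]" "word v"] w by (simp add: word_mult)
  also have "\<dots> = - rot (hw (?f (word (v @ [a]))))"
    using a fa mult[of "word v" "word [a]"] by (simp add: hmix_cons word_mult)
  also have "?f (word (v @ [a])) = ?f (word (tl w @ [hd w]))" using w by simp
  also have "hw \<dots> = ?f (hw (word (tl w @ [hd w])))"
    by (rule face_hw[symmetric]) (use assms w a in auto)
  also have "- rot (?f (hw (word (tl w @ [hd w])))) = ?f (hmix c (word w))"
    using True w by (simp add: hmix_def face_def thom_rot chains.linear_neg[OF lin_thom])
  finally show ?thesis by simp
next
  case False
  have hw: "face (Suc p) j (hw (word w)) = hw (face (Suc p) j (word w))"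
    by (rule face_hw) (use assms in \<open>auto simp: mixed_def\<close>)
  show ?thesis
  proof (cases "c = 0")
    case True
    then have "hd w \<notin> W" using False by simp
    have "face (Suc p) j (word w) \<in> supp {w. w \<noteq> [] \<and> hd w \<notin> W}"
    proof (rule supp_mono[OF face_supp[OF assms(2,3)]])
      have "w \<noteq> []" using assms by (auto simp: mixed_def)
      then show "{w'. list_all2 (same_type p) w' w} \<subseteq> {w. w \<noteq> [] \<and> hd w \<notin> W}"
        using same_type_list[of p _ w] \<open>hd w \<notin> W\<close> by fastforce
    qed
    then show ?thesis using True \<open>hd w \<notin> W\<close> hw by (simp add: hmix_hd) (simp add: hmix_def)
  next
    case c: False
    then show ?thesis using hw by (simp add: hmix_1 chains.linear_neg[OF lin_face])
  qed
qed

lemma bdry_hmix: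
  assumes "mixed w" "set w \<subseteq> \<beta> p" "p > 0"
  shows "bdry p (hmix c (word w)) = hmix c (bdry p (word w))"
proof -
  obtain q where "p = Suc q" using assms by (cases p) auto
  then show ?thesis using face_hmix[of w q] assms
    by (simp add: bdry_def chains.linear_sum[OF lin_hmix] chains.linear_scale[OF lin_hmix] del: sum.atMost_Suc)
qed

definition lower :: "nat \<Rightarrow> nat \<times> nat \<times> nat \<Rightarrow> (nat \<times> 'a list) set" where
  "lower p r = {(c, w). set w \<subseteq> \<beta> p \<and> w \<noteq> [] \<and> c \<le> 1 \<and> irank (c, w) < r}"

lemma low_lower:
  assumes "u \<in> supp {w. w \<in> low p k \<and> w \<noteq> []}" "c \<le> 1" "(1, k + c, 0) \<le> r"
  shows "put c u \<in> supp (lower p r)"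
proof (rule put_supp[OF assms(1)])
  fix w assume "w \<in> {w. w \<in> low p k \<and> w \<noteq> []}"
  moreover have "(0, n, 0) < r" for n using assms(3) by (rule less_le_trans[rotated]) simp
  moreover have "(1, n + c, l) < r" if "n < k" for n l using assms(3) by (rule less_le_trans[rotated]) (use that in simp)
  ultimately show "(c, w) \<in> lower p r"
    using assms(2) by (auto simp: lower_def low_def irank_def)
qed

lemma bar_dw_low:
  assumes "u \<in> supp {w. set w \<subseteq> \<beta> p \<and> set w \<inter> I = {} \<and> nz w = k}"
  shows "bar (m p) u - dw u \<in> supp {w. w \<in> low p k \<and> w \<noteq> []}"
proof (rule lin_supp[OF _ assms])
  fix w assume w: "w \<in> {w. set w \<subseteq> \<beta> p \<and> set w \<inter> I = {} \<and> nz w = k}"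
  then have "bar_word (m p) w - dw_word w \<in> supp (low p k)" using bar_low[of w p] by auto
  moreover have "bar_word (m p) w - dw_word w \<in> supp {w. w \<noteq> []}"
    by (intro supp_diff supp_mono[OF dw_supp] supp_mono[OF bar_ideal[OF m_I]]) (use w in \<open>auto simp: dw_rel_def\<close>)
  ultimately show "bar (m p) (word w) - dw (word w) \<in> supp {w. w \<in> low p k \<and> w \<noteq> []}"
    by (auto simp: supp_def)
qed (auto intro!: lin_intros)

text \<open>The first face of a rotated word whose tail starts with a letter of type \<open>W\<close> shortens the
  leading run; this is what the last component of the rank accounts for.\<close>

lemma join_rotated_lower:
  assumes "P \<noteq> []" "last P \<notin> W" "x \<noteq> []" "set x \<subseteq> W" "set P \<inter> I = {}" "set P \<subseteq> \<beta> p" "set x \<subseteq> \<beta> p"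
  shows "put 0 (join (m p) (word (last x # P @ butlast x))) \<in>
    supp (lower p (1, nz P, Suc (length (takeWhile (\<lambda>b. b \<in> W) P))))"
proof -
  obtain b P' where P: "P = b # P'" using assms by (cases P) auto
  have x: "last x \<in> W" "last x \<in> \<beta> p" "set (butlast x) \<subseteq> W" "set (butlast x) \<subseteq> \<beta> p"
    using assms by (auto dest: in_set_butlastD)
  have nz0: "nz (butlast x) = 0" using x by (auto simp: nz_def filter_empty_conv)
  have "m p (last x) b \<in> supp (\<beta> p \<inter> (I \<union> W))"
    using m_supp[of p] m_X[of "last x" b p] x by (auto simp: supp_def)
  from letter_supp[OF this] have "letter (m p (last x) b) * word (P' @ butlast x) \<in>
      supp {z # P' @ butlast x | z. z \<in> \<beta> p \<inter> (I \<union> W)}"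
    by (rule mult_supp[of _ _ _ "{P' @ butlast x}"]) auto
  then have "put 0 (letter (m p (last x) b) * word (P' @ butlast x)) \<in>
    supp (lower p (1, nz P, Suc (length (takeWhile (\<lambda>b. b \<in> W) P))))"
  proof (rule put_supp)
    fix y assume "y \<in> {z # P' @ butlast x | z. z \<in> \<beta> p \<inter> (I \<union> W)}"
    then obtain z where y: "y = z # P' @ butlast x" "z \<in> \<beta> p" "z \<in> I \<union> W" by auto
    have set: "set y \<subseteq> \<beta> p" using y assms P x by auto
    show "(0, y) \<in> lower p (1, nz P, Suc (length (takeWhile (\<lambda>b. b \<in> W) P)))"
    proof (cases "set y \<inter> I = {}")
      case False
      then show ?thesis using set y(1) by (auto simp: lower_def irank_def)
    next
      case I: True
      show ?thesis
      proof (cases "b \<in> W")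
        case False
        then show ?thesis using set I y nz0 P assms(5) by (auto simp: lower_def irank_def)
      next
        case True
        then have "P' \<noteq> []" "last P' \<notin> W" using assms(2) P by (auto split: if_splits)
        then have "takeWhile (\<lambda>b. b \<in> W) (P' @ butlast x) = takeWhile (\<lambda>b. b \<in> W) P'"
          by (intro takeWhile_append1[of "last P'"]) auto
        then show ?thesis using True set I y nz0 P by (auto simp: lower_def irank_def)
      qed
    qed
  qed
  then show ?thesis using P by simp
qed

lemma rot_low:
  "u \<in> supp {w. w \<in> low p k \<and> w \<noteq> []} \<Longrightarrow> rot u \<in> supp {w. w \<in> low p k \<and> w \<noteq> []}"
proof (rule lin_supp[OF lin_rot])
  fix w assume w: "w \<in> {w. w \<in> low p k \<and> w \<noteq> []}"
  then obtain v b where "w = v @ [b]" by (cases w rule: rev_cases) auto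
  with w show "rot (word w) \<in> supp {w. w \<in> low p k \<and> w \<noteq> []}" by (auto simp: low_def)
qed

text \<open>Up to words of lower rank, the differential of a mixed word is a chain \<open>u\<close> of mixed words, and
  \<open>hmix\<close> is a contracting homotopy.\<close>

lemma hmix_homotopy:
  assumes w: "mixed w" "set w \<subseteq> \<beta> p" and c: "c \<le> 1"
  shows "\<exists>u\<in>supp {w'. mixed w' \<and> set w' \<subseteq> \<beta> p}.
    cc2D (m p) (put c (word w)) - put c u \<in> supp (lower p (irank (c, w))) \<and>
    put c (word w) - cc2D (m p) (put c (hmix c (word w))) - put c (hmix c u) \<in> supp (lower p (irank (c, w)))"
proof -
  let ?L = "lower p (irank (c, w))" and ?k = "nz w"
  have wW: "set w \<inter> W \<subseteq> \<beta> 0" using w(2) W_level[of _ p] by auto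
  have wI: "set w \<inter> I = {}" "set w \<inter> W \<noteq> {}" "w \<noteq> []" using w(1) by (auto simp: mixed_def)
  have dw_mixed: "v' \<in> {w'. mixed w' \<and> set w' \<subseteq> \<beta> p}" if d: "dw_rel v' v" "mixed v" "set v \<subseteq> \<beta> p" for v v'
  proof -
    obtain b where b: "b \<in> set v" "b \<notin> I \<union> W" using d(2) by (auto simp: mixed_def)
    then have "b \<in> set (filter (\<lambda>b. b \<notin> W) v)" by simp
    then have "b \<in> set v'" using d(1) by (metis (no_types, lifting) filter_is_subset dw_rel_def subsetD)
    then show ?thesis
      using b d dw_rel_nz[OF d(1)] W_sub[of p] by (auto simp: mixed_def dw_rel_def)
  qed
  have barw: "bar (m p) (word w) - dw (word w) \<in> supp {w. w \<in> low p ?k \<and> w \<noteq> []}"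
    by (rule bar_dw_low) (use w wI in auto)
  have hw_words: "hw (word w) \<in> supp {w'. hw_rel w' w}"
    using hw_word_supp[of w] wI wW by simp
  have hw_set: "{w'. hw_rel w' w} \<subseteq> {w'. set w' \<subseteq> \<beta> p \<and> set w' \<inter> I = {} \<and> nz w' = ?k}"
    using hw_rel_nz w wI W_sub[of p] by (auto simp: hw_rel_def)
  have barhw: "bar (m p) (hw (word w)) - dw (hw (word w)) \<in> supp {w. w \<in> low p ?k \<and> w \<noteq> []}"
    by (rule bar_dw_low[OF supp_mono[OF hw_words hw_set]])
  have id: "dw (hw (word w)) + hw (dw (word w)) = word w" by (rule dw_hw) (use wI wW in auto)
  consider "c = 1" | "c = 0" "hd w \<notin> W" | "c = 0" "hd w \<in> W" using c by linarith
  then show ?thesis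
  proof cases
    case 1
    have r: "irank (c, w) = (1, ?k + 1, 0)" using 1 wI by (simp add: irank_def)
    \<comment> \<open>The operator 1 - t only permutes letters but passes from column 1 to column 0,
      which lowers the second component of the rank.\<close>
    have t: "put 0 (one_minus_t u) \<in> supp ?L" if u: "u \<in> supp {w'. set w' \<subseteq> \<beta> p \<and> set w' \<inter> I = {} \<and> nz w' = ?k \<and> w' \<noteq> []}" for u
    proof (rule lin_supp[OF _ u, of "\<lambda>u. put 0 (one_minus_t u)"])
      fix w' assume w': "w' \<in> {w'. set w' \<subseteq> \<beta> p \<and> set w' \<inter> I = {} \<and> nz w' = ?k \<and> w' \<noteq> []}"
      then obtain v b where v: "w' = v @ [b]" by (cases w' rule: rev_cases) auto
      have "(0, w') \<in> ?L" "(0, b # v) \<in> ?L"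
        using w' v unfolding r by (auto simp: lower_def irank_def)
      moreover have "put 0 (one_minus_t (word w')) = word (0, w') + (- 1) ^ length w' \<star> word (0, b # v)"
        by (simp add: one_minus_t_def v chains.linear_add[OF lin_put] chains.linear_diff[OF lin_put] chains.linear_scale[OF lin_put]
          chains.linear_scale[OF lin_rot] chains.linear_neg[OF lin_rot] chains.linear_neg[OF lin_put] del: scale_chain_single)
      ultimately show "put 0 (one_minus_t (word w')) \<in> supp ?L" by (metis supp_add supp_scale supp_word)
    qed (auto intro!: lin_intros)
    have hw': "hw (word w) \<in> supp {w'. set w' \<subseteq> \<beta> p \<and> set w' \<inter> I = {} \<and> nz w' = ?k \<and> w' \<noteq> []}"
      by (rule supp_mono[OF hw_words]) (use hw_set in \<open>auto simp: hw_rel_def\<close>)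
    have "cc2D (m p) (put c (word w)) - put c (- dw (word w)) =
        put 0 (one_minus_t (word w)) - put 1 (bar (m p) (word w) - dw (word w))"
      using 1 by (simp add: cc2D_put chains.linear_diff[OF lin_put] chains.linear_neg[OF lin_put] del: put_word bar_of_word dw_of_word)
    also have "\<dots> \<in> supp ?L"
      by (intro supp_diff t low_lower[OF barw]) (use w wI r in auto)
    finally have A: "cc2D (m p) (put c (word w)) - put c (- dw (word w)) \<in> supp ?L" .
    have "put c (word w) - cc2D (m p) (put c (hmix c (word w))) - put c (hmix c (- dw (word w))) =
        put 1 (dw (hw (word w)) + hw (dw (word w))) + put 0 (one_minus_t (hw (word w)))
          - put 1 (bar (m p) (hw (word w))) - put 1 (hw (dw (word w)))"
      using 1 by (simp add: id hmix_1 cc2D_put chains.linear_neg[OF lin_hw] chains.linear_neg[OF lin_bar] chains.linear_neg[OF lin_one_minus_t] chains.linear_neg[OF lin_cc2D]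
          chains.linear_neg[OF lin_put] del: put_word bar_of_word dw_of_word hw_of_word)
    also have "\<dots> = put 0 (one_minus_t (hw (word w))) - put 1 (bar (m p) (hw (word w)) - dw (hw (word w)))"
      by (simp add: chains.linear_add[OF lin_put] chains.linear_diff[OF lin_put] algebra_simps del: put_word bar_of_word dw_of_word hw_of_word)
    also have "\<dots> \<in> supp ?L"
      by (intro supp_diff t hw' low_lower[OF barhw]) (use r in auto)
    finally have B: "put c (word w) - cc2D (m p) (put c (hmix c (word w))) - put c (hmix c (- dw (word w))) \<in> supp ?L" .
    have "- dw (word w) \<in> supp {w'. mixed w' \<and> set w' \<subseteq> \<beta> p}"
      using supp_neg[OF supp_mono[OF dw_supp]] dw_mixed w by (metis (no_types, lifting) dw_of_word mem_Collect_eq subsetI)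
    then show ?thesis using A B by blast
  next
    case 2
    have r: "irank (c, w) = (1, ?k, 0)" using 2 wI by (cases w) (auto simp: irank_def)
    \<comment> \<open>The word starts with a lifted letter, so the last face multiplies this letter
      by the last one. If the last letter is of type W, the product lies in the span of I and W; if
      it is lifted too, two lifted letters become at most one.\<close>
    have j: "join (m p) (rot (len_sign u)) \<in> supp {w. w \<in> low p ?k \<and> w \<noteq> []}"
      if u: "u \<in> supp {w'. set w' \<subseteq> \<beta> p \<and> set w' \<inter> I = {} \<and> nz w' = ?k \<and> w' \<noteq> [] \<and> hd w' \<notin> W}" for u
    proof (rule lin_supp[OF _ u, of "\<lambda>u. join (m p) (rot (len_sign u))"])
      fix w' assume w': "w' \<in> {w'. set w' \<subseteq> \<beta> p \<and> set w' \<inter> I = {} \<and> nz w' = ?k \<and> w' \<noteq> [] \<and> hd w' \<notin> W}"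
      have "join (m p) (rot (word w')) \<in> supp {w. w \<in> low p ?k \<and> w \<noteq> []}"
      proof -
        have "w' \<noteq> []" using w' by simp
        then consider b where "w' = [b]" | x y v where "w' = y # v @ [x]"
          by (metis neq_Nil_conv rev_exhaust)
        then show ?thesis
        proof cases
          case (2 x y v)
          have y: "y \<notin> I \<union> W" using w' 2 by auto
          have "m p x y \<in> supp (\<beta> p \<inter> {b. x \<in> W \<longrightarrow> b \<in> I \<union> W})"
            using m_supp[of p x y] m_X[of x y p] by (auto simp: supp_def)
          from letter_supp[OF this] have "letter (m p x y) * word v \<in> supp {w. w \<in> low p ?k \<and> w \<noteq> []}"
            by (rule mult_supp[of _ _ _ "{v}"]) (use w' 2 y in \<open>auto simp: low_def split: if_splits\<close>)
          then show ?thesis using 2 by simp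
        qed simp
      qed
      then show "join (m p) (rot (len_sign (word w'))) \<in> supp {w. w \<in> low p ?k \<and> w \<noteq> []}"
        by (simp add: chains.linear_scale[OF lin_rot] chains.linear_scale[OF lin_join] supp_scale del: rot_word scale_chain_single)
    qed (auto intro!: lin_intros)
    have hw': "hw (word w) \<in> supp {w'. set w' \<subseteq> \<beta> p \<and> set w' \<inter> I = {} \<and> nz w' = ?k \<and> w' \<noteq> [] \<and> hd w' \<notin> W}"
      by (rule supp_mono[OF hw_words]) (use hw_set 2 in \<open>auto simp: hw_rel_def\<close>)
    have hm: "hmix 0 (word w) = hw (word w)"
      by (rule hmix_hd) (use 2 wI in auto)
    have dwx: "dw (word w) \<in> supp {w'. dw_rel w' w}" using dw_supp by simp
    have hd: "hmix 0 (dw (word w)) = hw (dw (word w))"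
      by (rule hmix_hd, rule supp_mono[OF dwx]) (use 2 in \<open>auto simp: dw_rel_def\<close>)
    have "cc2D (m p) (put c (word w)) - put c (dw (word w)) =
        put 0 ((bar (m p) (word w) - dw (word w)) - join (m p) (rot (len_sign (word w))))"
      using 2 by (simp add: cc2D_put hoch_def chains.linear_diff[OF lin_put] chains.linear_add[OF lin_put] algebra_simps
        del: put_word bar_of_word dw_of_word rot_word len_sign_word)
    also have "\<dots> \<in> supp ?L"
      by (rule low_lower[of _ p ?k]) (use 2 r w wI in \<open>auto intro!: supp_diff[OF barw] j simp del: bar_of_word dw_of_word rot_word len_sign_word\<close>)
    finally have A: "cc2D (m p) (put c (word w)) - put c (dw (word w)) \<in> supp ?L" .
    have "put c (word w) - cc2D (m p) (put c (hmix c (word w))) - put c (hmix c (dw (word w))) =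
        put 0 (dw (hw (word w)) + hw (dw (word w))) - put 0 (bar (m p) (hw (word w)) - join (m p) (rot (len_sign (hw (word w)))))
          - put 0 (hw (dw (word w)))"
      using 2 by (simp add: id hm hd cc2D_put hoch_def del: put_word bar_of_word dw_of_word hw_of_word)
    also have "\<dots> = put 0 (join (m p) (rot (len_sign (hw (word w)))) - (bar (m p) (hw (word w)) - dw (hw (word w))))"
      by (simp add: chains.linear_add[OF lin_put] chains.linear_diff[OF lin_put] algebra_simps del: put_word bar_of_word dw_of_word hw_of_word)
    also have "\<dots> \<in> supp ?L"
      by (rule low_lower[of _ p ?k], intro supp_diff barhw j hw') (use r in auto)
    finally have B: "put c (word w) - cc2D (m p) (put c (hmix c (word w))) - put c (hmix c (dw (word w))) \<in> supp ?L" .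
    have "dw (word w) \<in> supp {w'. mixed w' \<and> set w' \<subseteq> \<beta> p}"
      using supp_mono[OF dwx] dw_mixed w by (metis (no_types, lifting) mem_Collect_eq subsetI)
    then show ?thesis using A B by blast
  next
    case 3
    obtain a v where wv: "w = a # v" using wI by (cases w) auto
    then have a: "a \<in> W" using 3 by simp
    obtain P x where P: "v @ [a] = P @ x" "P \<noteq> []" "last P \<notin> W" "x \<noteq> []" "set x \<subseteq> W" "a # v = last x # P @ butlast x"
      using mixed_cons_decomp[of a v] w a wv by auto
    have sets: "set w = set P \<union> set x" using P(1) wv by (metis set_append set_rotate1 rotate1.simps(2))
    have x0: "nz x = 0" using P(5) by (auto simp: nz_def filter_empty_conv)
    have "nz w = nz (v @ [a])" by (simp add: wv)
    then have k: "nz P = ?k" by (simp only: P(1)) (simp add: x0)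
    let ?q = "word (P @ x) :: 'a list \<Rightarrow>\<^sub>0 'b"
    have r: "irank (c, w) = (1, ?k, Suc (length (takeWhile (\<lambda>b. b \<in> W) P)))"
      using irank_rotated[OF P(2-5)] sets wI(1) 3 wv P(6) k by auto
    have Pm: "mixed (P @ x)" "set (P @ x) \<subseteq> \<beta> p" using w sets by (auto simp: mixed_def)
    have vne: "v \<noteq> []" using P by (cases v; cases P) auto
    have PI: "set P \<inter> I = {}" using sets wI(1) by auto
    \<comment> \<open>This is the single face of b that \<open>hoch_cons\<close> leaves over,
      written in terms of the word before rotation.\<close>
    define E where "E u = join (m p) (rot u)" for u
    have E: "put 0 (E u) \<in> supp ?L" if u: "u \<in> supp {P @ y | y n. y \<in> Wwords (Suc n)}" for u
    proof (rule lin_supp[OF _ u, of "\<lambda>u. put 0 (E u)"])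
      fix z assume "z \<in> {P @ y | y n. y \<in> Wwords (Suc n)}"
      then obtain y n where y: "z = P @ y" "y \<in> Wwords (Suc n)" by auto
      then have "y \<noteq> []" "set y \<subseteq> W" "set y \<subseteq> \<beta> p" using W_sub[of p] by (auto simp: Wwords_def)
      then show "put 0 (E (word z)) \<in> supp ?L"
        using join_rotated_lower[OF P(2,3), of y p] PI sets w(2) k unfolding r E_def
        by (simp add: y(1) butlast_append)
    qed (auto intro!: lin_intros simp: E_def)
    have hoch: "hoch (m p) (rot u) = E u - rot (bar (m p) u)" if u: "u \<in> supp {P @ y | y n. y \<in> Wwords (Suc n)}" for u
    proof (rule lin_eq_supp[OF _ _ u, of "\<lambda>u. hoch (m p) (rot u)"])
      fix z assume "z \<in> {P @ y | y n. y \<in> Wwords (Suc n)}"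
      then obtain y b where y: "z = (P @ y) @ [b]"
        by (clarsimp simp: Wwords_def) (metis append_assoc length_0_conv nat.distinct(1) rev_exhaust)
      show "hoch (m p) (rot (word z)) = E (word z) - rot (bar (m p) (word z))"
        using hoch_cons[of "P @ y" "m p" b] P(2) by (simp add: y E_def butlast_append)
    qed (auto intro!: lin_intros simp: E_def)
    have q: "?q \<in> supp {P @ y | y n. y \<in> Wwords (Suc n)}"
      using P(4,5) sets wW by (auto simp: Wwords_def intro!: exI[of _ x] exI[of _ "length x - 1"])
    have hq: "hw ?q \<in> supp {P @ y | y n. y \<in> Wwords (Suc n)}"
    proof -
      have "set x \<subseteq> \<beta> 0" using sets wW P(5) by auto
      then have "hw_word (P @ x) \<in> supp {P @ y | y. y \<in> Wwords (Suc (length x))}"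
        by (rule hw_P_x[OF P(2-5)])
      then show ?thesis unfolding hw_of_word by (rule supp_mono) auto
    qed
    have rq: "rot ?q = word w"
      using P(4,6) wv by (simp add: butlast_append)
    have hmw: "hmix c (word w) = - rot (hw ?q)"
      using hmix_cons[OF a, of "word v"] 3 wv P(1) by (simp add: word_mult)
    have dq: "dw ?q \<in> supp {w'. dw_rel w' (P @ x)}" using dw_supp by simp
    \<comment> \<open>\<open>dw\<close> keeps the last letter in W, so every rotated word starts
      with a letter of type W and \<open>hmix\<close> takes its rotated branch.\<close>
    have hmd: "hmix c (- rot (dw ?q)) = rot (hw (dw ?q))"
    proof -
      have "hmix 0 (rot u) = - rot (hw u)" if u: "u \<in> supp {w'. w' \<noteq> [] \<and> last w' \<in> W}" for u
      proof (rule lin_eq_supp[OF _ _ u, of "\<lambda>u. hmix 0 (rot u)"])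
        fix z assume "z \<in> {w'. w' \<noteq> [] \<and> last w' \<in> W}"
        then obtain y b where "z = y @ [b]" "b \<in> W" by (cases z rule: rev_cases) auto
        then show "hmix 0 (rot (word z)) = - rot (hw (word z))"
          using hmix_cons[of b "word y"] by (simp add: word_mult)
      qed (auto intro!: lin_intros)
      moreover have "dw ?q \<in> supp {w'. w' \<noteq> [] \<and> last w' \<in> W}"
        by (rule supp_mono[OF dq]) (use P(4,5) in \<open>auto simp: dw_rel_def\<close>)
      ultimately show ?thesis using 3 by (simp add: chains.linear_neg[OF lin_hmix])
    qed
    have idq: "dw (hw ?q) + hw (dw ?q) = ?q"
      by (rule dw_hw) (use Pm W_level[of _ p] in \<open>auto simp: mixed_def\<close>)
    have lowr: "(1, ?k + 0, 0) \<le> irank (c, w)" unfolding r by simp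
    have bq: "bar (m p) ?q - dw ?q \<in> supp {w. w \<in> low p ?k \<and> w \<noteq> []}"
      by (rule bar_dw_low) (use Pm k x0 in \<open>auto simp: mixed_def\<close>)
    have bhq: "bar (m p) (hw ?q) - dw (hw ?q) \<in> supp {w. w \<in> low p ?k \<and> w \<noteq> []}"
    proof (rule bar_dw_low, rule supp_mono[OF hq], safe)
      fix y n assume y: "y \<in> Wwords (Suc n)"
      have "nz y = 0" using y by (auto simp: Wwords_def nz_def filter_empty_conv)
      then show "nz (P @ y) = nz w" using k by simp
      show "\<And>b. b \<in> set (P @ y) \<Longrightarrow> b \<in> \<beta> p" using y Pm W_sub[of p] by (auto simp: Wwords_def)
      show "\<And>b. b \<in> set (P @ y) \<Longrightarrow> b \<in> I \<Longrightarrow> b \<in> {}" using y Pm IW by (auto simp: Wwords_def mixed_def)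
    qed
    have "cc2D (m p) (put c (word w)) - put c (- rot (dw ?q)) = put 0 (E ?q) - put 0 (rot (bar (m p) ?q - dw ?q))"
      unfolding rq[symmetric] using 3 hoch[OF q]
      by (simp add: cc2D_put chains.linear_diff[OF lin_put] chains.linear_diff[OF lin_rot] chains.linear_neg[OF lin_put]
        del: put_word bar_of_word dw_of_word rot_word)
    also have "\<dots> \<in> supp ?L"
      by (intro supp_diff E q low_lower[OF rot_low[OF bq]] lowr) simp
    finally have A: "cc2D (m p) (put c (word w)) - put c (- rot (dw ?q)) \<in> supp ?L" .
    have "put c (word w) - cc2D (m p) (put c (hmix c (word w))) - put c (hmix c (- rot (dw ?q))) =
        put 0 (rot (dw (hw ?q) + hw (dw ?q))) + put 0 (E (hw ?q) - rot (bar (m p) (hw ?q))) - put 0 (rot (hw (dw ?q)))"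
      unfolding hmd hmw idq rq using 3 hoch[OF hq]
      by (simp add: cc2D_put chains.linear_neg[OF lin_cc2D] chains.linear_neg[OF lin_hoch] chains.linear_neg[OF lin_put]
        del: put_word bar_of_word dw_of_word rot_word hw_of_word)
    also have "\<dots> = put 0 (E (hw ?q)) - put 0 (rot (bar (m p) (hw ?q) - dw (hw ?q)))"
      by (simp add: chains.linear_add[OF lin_put] chains.linear_diff[OF lin_put] chains.linear_add[OF lin_rot]
        chains.linear_diff[OF lin_rot] algebra_simps del: put_word bar_of_word dw_of_word rot_word hw_of_word)
    also have "\<dots> \<in> supp ?L"
      by (intro supp_diff E hq low_lower[OF rot_low[OF bhq]] lowr) simp
    finally have B: "put c (word w) - cc2D (m p) (put c (hmix c (word w))) - put c (hmix c (- rot (dw ?q))) \<in> supp ?L" .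
    have "rot (dw ?q) \<in> supp {w'. mixed w' \<and> set w' \<subseteq> \<beta> p}"
    proof (rule lin_supp[OF lin_rot dq])
      fix z assume "z \<in> {w'. dw_rel w' (P @ x)}"
      then have "mixed z" "set z \<subseteq> \<beta> p" "z \<noteq> []" using dw_mixed[of z "P @ x"] Pm by (auto simp: dw_rel_def)
      then show "rot (word z) \<in> supp {w'. mixed w' \<and> set w' \<subseteq> \<beta> p}"
        by (cases z rule: rev_cases) (auto simp: mixed_def)
    qed
    then show ?thesis using A B by (intro bexI[of _ "- rot (dw ?q)"]) (auto intro: supp_neg)
  qed
qed

end

section \<open>The homotopy on all words and the drop of rank\<close>

context coord_letters
begin

text \<open>A word of length q + 1 has degree q, hence the \<open>Suc n\<close>.\<close>

definition cells :: "nat \<Rightarrow> (nat \<times> nat \<times> 'b list) set" where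
  "cells n = {(p, c, w). c \<le> 1 \<and> w \<noteq> [] \<and> p + c + length w = Suc n \<and> set w \<subseteq> \<beta> p}"

definition K_cells :: "nat \<Rightarrow> (nat \<times> nat \<times> 'b list) set" where
  "K_cells n = {(p, c, w) \<in> cells n. set w \<inter> (I \<union> W) \<noteq> {}}"

definition X_cells :: "nat \<Rightarrow> (nat \<times> nat \<times> 'b list) set" where
  "X_cells n = {(p, c, w) \<in> cells n. set w \<subseteq> I \<union> W}"

end

context contracted_letters
begin

text \<open>The factor (-1)^p on mixed words compensates the sign of the internal differential at
  level p. Sliding raises the level instead and carries its signs inside \<open>hpush\<close>. Words
  with lifted letters only lie outside the kernel, and 0 is a default value for them.\<close>

definition homot :: "(nat \<times> nat \<times> 'a list \<Rightarrow>\<^sub>0 'b) \<Rightarrow> (nat \<times> nat \<times> 'a list \<Rightarrow>\<^sub>0 'b)" where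
  "homot = linear_extension (\<lambda>(p, c, w). if set w \<subseteq> I \<union> W then 0
     else if set w \<inter> I \<noteq> {} then put (Suc p) (put c (hpush p (word w)))
     else if set w \<inter> W \<noteq> {} then (- 1) ^ p \<star> put p (put c (hmix c (word w))) else 0)"

lemma lin_homot [lin_intros]: "lin homot"
  by (auto simp: homot_def intro: lin_intros)
lemmas lin_homot_comp [lin_intros] = lin_comp[OF lin_homot]

lemma homot_I: "u \<in> supp {w. set w \<inter> I \<noteq> {} \<and> \<not> set w \<subseteq> I \<union> W} \<Longrightarrow>
    homot (put p (put c u)) = put (Suc p) (put c (hpush p u))"
  by (rule lin_eq_supp[of "\<lambda>u. homot (put p (put c u))"]) (auto intro!: lin_intros simp: homot_def)

lemma homot_mixed: "u \<in> supp {w. mixed w} \<Longrightarrow> homot (put p (put c u)) = (- 1) ^ p \<star> put p (put c (hmix c u))"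
  by (rule lin_eq_supp[of "\<lambda>u. homot (put p (put c u))"]) (auto intro!: lin_intros simp: homot_def mixed_def)

text \<open>The homotopy keeps the rank and the column. Therefore terms of lower rank that the
  differential produces remain lower after \<open>homot\<close> has been applied to them.\<close>

lemma homot_rank:
  assumes "set w \<subseteq> \<beta> p" "w \<noteq> []"
  shows "homot (word (p, c, w)) \<in> supp {(p', c', w'). c' = c \<and> w' \<noteq> [] \<and> set w' \<subseteq> \<beta> p' \<and>
    p' + length w' = Suc (p + length w) \<and> set w' \<inter> (I \<union> W) \<noteq> {} \<and> irank (c, w') = irank (c, w)}"
    (is "_ \<in> supp ?D")
proof -
  consider "set w \<subseteq> I \<union> W" | "\<not> set w \<subseteq> I \<union> W" "set w \<inter> I \<noteq> {}" | "mixed w"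
    | "\<not> set w \<subseteq> I \<union> W" "set w \<inter> I = {}" "set w \<inter> W = {}"
    unfolding mixed_def by blast
  then show ?thesis
  proof cases
    case 2
    have "put (Suc p) (put c (hpush p (word w))) \<in> supp ?D"
    proof (intro put_supp[where B = "{c} \<times> {w'. list_all2 (same_type (Suc p)) w' w \<and> set w' \<inter> I \<noteq> {}}"]
        put_supp[where B = "{w'. list_all2 (same_type (Suc p)) w' w \<and> set w' \<inter> I \<noteq> {}}"] hpush_supp assms)
      fix x assume "x \<in> {c} \<times> {w'. list_all2 (same_type (Suc p)) w' w \<and> set w' \<inter> I \<noteq> {}}"
      then obtain w' where x: "x = (c, w')" "list_all2 (same_type (Suc p)) w' w" "set w' \<inter> I \<noteq> {}" by auto
      then show "(Suc p, x) \<in> ?D"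
        using same_type_list[OF x(2)] 2 assms(2) by (auto simp: irank_def)
    qed auto
    then show ?thesis using 2 by (simp add: homot_def)
  next
    case 3
    have "put c (hmix c (word w)) \<in> supp {(c', w'). c' = c \<and> set w' \<subseteq> \<beta> p \<and>
        length w' = Suc (length w) \<and> mixed w' \<and> irank (c, w') = irank (c, w)}"
      by (rule put_supp[OF hmix_supp[OF 3 assms(1)]]) auto
    then have "put p (put c (hmix c (word w))) \<in> supp ?D"
      by (rule put_supp) (auto simp: mixed_def)
    then show ?thesis using 3 by (auto simp: homot_def mixed_def supp_scale)
  qed (auto simp: homot_def)
qed

lemma irank_I: "set w \<inter> I \<noteq> {} \<Longrightarrow> irank (c, w) = (0, length w + c, 0)"
  by (simp add: irank_def)

lemma irank_I_less: "x \<in> set w \<Longrightarrow> x \<in> I \<Longrightarrow> length w + c < n \<Longrightarrow> irank (c, w) < (0, n, 0)"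
  by (subst irank_I) auto

lemma homot_lower:
  assumes "v \<in> supp (lower p r)"
  shows "homot (put p v) \<in> supp {(p', x). irank x < r}"
proof (rule lin_supp[OF _ assms, of "\<lambda>v. homot (put p v)"])
  fix x assume x: "x \<in> lower p r"
  obtain c w where cw: "x = (c, w)" by (cases x)
  show "homot (put p (word x)) \<in> supp {(p', x). irank x < r}"
    unfolding cw put_word by (rule supp_mono[OF homot_rank]) (use x cw in \<open>auto simp: lower_def\<close>)
qed (auto intro!: lin_intros)

lemma dtot_cells:
  assumes "e \<in> cells n"
  shows "dtot (word e) \<in> supp {e'. \<exists>k. n = Suc k \<and> e' \<in> cells k \<and> (e \<in> K_cells n \<longrightarrow> e' \<in> K_cells k) \<and> (e \<in> X_cells n \<longrightarrow> e' \<in> X_cells k)}"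
proof -
  obtain p c w where e: "e = (p, c, w)" by (cases e)
  have w: "set w \<subseteq> \<beta> p" "w \<noteq> []" "c \<le> 1" "p + c + length w = Suc n" using assms by (auto simp: e cells_def)
  show ?thesis unfolding e
  proof (rule supp_mono[OF dtot_ideal[of "I \<union> W", OF _ w(1-3)]])
    let ?D = "{(p', c', w'). set w' \<subseteq> \<beta> p' \<and> c' \<le> 1 \<and> w' \<noteq> [] \<and> Suc (p' + c' + length w') = p + c + length w \<and>
      (set w \<inter> (I \<union> W) \<noteq> {} \<longrightarrow> set w' \<inter> (I \<union> W) \<noteq> {}) \<and> (set w \<subseteq> I \<union> W \<longrightarrow> set w' \<subseteq> I \<union> W)}"
    show "?D \<subseteq> {e'. \<exists>k. n = Suc k \<and> e' \<in> cells k \<and> ((p, c, w) \<in> K_cells n \<longrightarrow> e' \<in> K_cells k) \<and>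
        ((p, c, w) \<in> X_cells n \<longrightarrow> e' \<in> X_cells k)}"
    proof
      fix e' assume e': "e' \<in> ?D"
      obtain p' c' w' where pcw': "e' = (p', c', w')" by (cases e')
      obtain k where k: "n = Suc k" "p' + c' + length w' = Suc k"
        using e' w(4) by (cases w') (auto simp: pcw')
      show "e' \<in> {e'. \<exists>k. n = Suc k \<and> e' \<in> cells k \<and> ((p, c, w) \<in> K_cells n \<longrightarrow> e' \<in> K_cells k) \<and>
        ((p, c, w) \<in> X_cells n \<longrightarrow> e' \<in> X_cells k)}"
        by (intro CollectI exI[of _ k]) (use e' w k in \<open>auto simp: pcw' cells_def K_cells_def X_cells_def\<close>)
    qed
  qed simp
qed

lemma homot_K_cells:
  assumes "e \<in> cells n"
  shows "homot (word e) \<in> supp (K_cells (Suc n))"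
proof -
  obtain p c w where e: "e = (p, c, w)" by (cases e)
  show ?thesis unfolding e
    by (rule supp_mono[OF homot_rank]) (use assms in \<open>auto simp: cells_def K_cells_def e\<close>)
qed

lemma homot_X_cells: "u \<in> supp (X_cells n) \<Longrightarrow> homot u = 0"
  by (rule lin_eq_supp[of homot]) (auto intro!: lin_intros simp: homot_def X_cells_def cells_def)

text \<open>The simplicial terms give back the word itself by \<open>bdry_hpush\<close>. What
  remains is the internal differential, applied after sliding or before it; it lowers length plus
  column and keeps a letter of type I.\<close>

lemma rank_drop_I:
  assumes w: "set w \<subseteq> \<beta> p" "w \<noteq> []" "c \<le> 1" and I: "set w \<inter> I \<noteq> {}" "\<not> set w \<subseteq> I \<union> W"
  shows "word (p, c, w) - dtot (homot (word (p, c, w))) - homot (dtot (word (p, c, w))) \<in> supp {(p', x). irank x < irank (c, w)}"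
    (is "?N \<in> supp ?D")
proof -
  let ?w = "word w :: 'a list \<Rightarrow>\<^sub>0 'b"
  have e: "word (p, c, w) = put p (put c ?w)" by simp
  have r: "irank (c, w) = (0, length w + c, 0)" using I by (simp add: irank_def)
  have Iu: "u \<in> supp {w'. set w' \<inter> I \<noteq> {} \<and> \<not> set w' \<subseteq> I \<union> W}"
    if "u \<in> supp {w'. list_all2 (same_type q) w' w}" for u q
    by (rule supp_mono[OF that]) (use same_type_list[of q _ w] I in blast)
  have h: "homot (put p (put c ?w)) = put (Suc p) (put c (hpush p ?w))"
    by (rule homot_I) (use I in simp)
  have hb: "homot (if p = 0 then 0 else put (p - 1) (put c (bdry p ?w))) = (if p = 0 then 0 else put p (put c (hpush (p - 1) (bdry p ?w))))"
  proof (cases "p = 0")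
    case False
    then show ?thesis using homot_I[OF Iu[OF bdry_supp[OF w(1)]], of "p - 1" c] by simp
  qed (simp add: chains.linear_0[OF lin_homot])
  have split: "put p (put c ?w) = put p (put c (bdry (Suc p) (hpush p ?w))) + (if p = 0 then 0 else put p (put c (hpush (p - 1) (bdry p ?w))))"
    using arg_cong[OF bdry_hpush[OF w(1) I(1)], of "\<lambda>u. put p (put c u)"]
    by (auto simp: chains.linear_add[OF lin_put] split: if_splits)
  have "?N = - ((- 1) ^ Suc p \<star> put (Suc p) (cc2D (m (Suc p)) (put c (hpush p ?w)))) - (- 1) ^ p \<star> homot (put p (cc2D (m p) (put c ?w)))"
    unfolding e h dtot_put chains.linear_add[OF lin_homot] chains.linear_scale[OF lin_homot] hb
    by (subst split) (simp add: algebra_simps)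
  moreover have "put (Suc p) (cc2D (m (Suc p)) (put c (hpush p ?w))) \<in> supp ?D"
  proof (rule lin_supp[OF _ hpush_supp[OF w(1)], of "\<lambda>u. put (Suc p) (cc2D (m (Suc p)) (put c u))"])
    fix w' assume "w' \<in> {w'. list_all2 (same_type (Suc p)) w' w \<and> set w' \<inter> I \<noteq> {}}"
    then have w': "set w' \<subseteq> \<beta> (Suc p)" "length w' = length w" "set w' \<inter> I \<noteq> {}" using same_type_list[of "Suc p" w' w] by auto
    then have "w' \<noteq> []" by auto
    show "put (Suc p) (cc2D (m (Suc p)) (put c (word w'))) \<in> supp ?D" unfolding put_word
      by (rule put_supp[OF cc2D_ideal[OF m_I w'(1) \<open>w' \<noteq> []\<close>, of c]]) (use w' in \<open>auto simp: r intro: irank_I_less\<close>)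
  qed (auto intro!: lin_intros)
  moreover have "homot (put p (cc2D (m p) (put c ?w))) \<in> supp ?D"
    unfolding put_word
    by (rule homot_lower, rule supp_mono[OF cc2D_ideal[OF m_I w(1,2)]]) (use I in \<open>auto simp: lower_def r intro: irank_I_less\<close>)
  ultimately show ?thesis by (auto intro!: supp_intros)
qed

lemma rank_drop_mixed:
  assumes w: "set w \<subseteq> \<beta> p" "w \<noteq> []" "c \<le> 1" and mixed: "mixed w"
  shows "word (p, c, w) - dtot (homot (word (p, c, w))) - homot (dtot (word (p, c, w))) \<in> supp {(p', x). irank x < irank (c, w)}"
    (is "?N \<in> supp ?D")
proof -
  let ?w = "word w :: 'a list \<Rightarrow>\<^sub>0 'b"
  have e: "word (p, c, w) = put p (put c ?w)" by simp
  obtain u where u: "u \<in> supp {w'. mixed w' \<and> set w' \<subseteq> \<beta> p}"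
    "cc2D (m p) (put c ?w) - put c u \<in> supp (lower p (irank (c, w)))"
    "put c ?w - cc2D (m p) (put c (hmix c ?w)) - put c (hmix c u) \<in> supp (lower p (irank (c, w)))"
    using hmix_homotopy[OF mixed w(1,3)] by blast
  define l where "l = cc2D (m p) (put c ?w) - put c u"
  have l: "cc2D (m p) (put c ?w) = put c u + l" by (simp add: l_def)
  have h: "homot (put p (put c ?w)) = (- 1) ^ p \<star> put p (put c (hmix c ?w))"
    by (rule homot_mixed) (use mixed in simp)
  have hu: "homot (put p (put c u)) = (- 1) ^ p \<star> put p (put c (hmix c u))"
    by (rule homot_mixed, rule supp_mono[OF u(1)]) auto
  \<comment> \<open>\<open>bdry\<close> commutes with \<open>hmix\<close>, whereas the sign in
    \<open>homot\<close> changes from (-1)^p to (-1)^(p - 1); so the simplicial terms of d H and of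
    H d cancel.\<close>
  have hb: "homot (if p = 0 then 0 else put (p - 1) (put c (bdry p ?w))) =
      - ((- 1) ^ p \<star> (if p = 0 then 0 else put (p - 1) (put c (bdry p (hmix c ?w)))))"
  proof (cases p)
    case (Suc q)
    have "bdry p ?w \<in> supp {w. mixed w}"
      by (rule supp_mono[OF bdry_supp[OF w(1)]])
        (use Suc same_type_list[of "p - 1" _ w] mixed in \<open>auto simp: mixed_def simp del: diff_Suc_1\<close>)
    then show ?thesis using Suc bdry_hmix[OF mixed w(1), of c] by (simp add: homot_mixed chain.scale_minus_left)
  qed (simp add: chains.linear_0[OF lin_homot])
  have sq: "(- 1) ^ p \<star> (- 1) ^ p \<star> v = v" for v :: "nat \<times> nat \<times> 'a list \<Rightarrow>\<^sub>0 'b"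
    by (simp flip: power_mult_distrib)
  have "?N = put p (put c ?w - cc2D (m p) (put c (hmix c ?w)) - put c (hmix c u)) - (- 1) ^ p \<star> homot (put p l)"
    unfolding e h dtot_put chains.linear_add[OF lin_homot] chains.linear_scale[OF lin_homot] hb chains.linear_scale[OF lin_dtot]
      l chains.linear_add[OF lin_put] hu chains.linear_diff[OF lin_put] chain.scale_right_distrib sq
    by simp
  moreover have "put p (put c ?w - cc2D (m p) (put c (hmix c ?w)) - put c (hmix c u)) \<in> supp ?D"
    by (rule put_supp[OF u(3)]) (auto simp: lower_def)
  moreover have "homot (put p l) \<in> supp ?D"
    unfolding l_def by (rule homot_lower[OF u(2)])
  ultimately show ?thesis by (auto intro!: supp_intros)
qed

theorem K_acyclic:
  assumes u: "u \<in> supp (K_cells n)" and du: "dtot u \<in> supp (X_cells (n - 1))"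
  shows "\<exists>v\<in>supp (K_cells (Suc n)). u - dtot v \<in> supp (X_cells n)"
proof (rule relative_acyclic[of dtot homot X_cells n K_cells "\<lambda>(p, x). irank x"])
  show "X_cells n \<subseteq> K_cells n"
  proof
    fix e assume e: "e \<in> X_cells n"
    obtain p c b w where "e = (p, c, b # w)"
      using e by (cases e; cases "snd (snd e)") (auto simp: X_cells_def cells_def)
    then show "e \<in> K_cells n" using e by (auto simp: X_cells_def K_cells_def)
  qed
  show "homot (word e) \<in> supp (K_cells (Suc n))" if "e \<in> K_cells n" for e
    by (rule homot_K_cells) (use that in \<open>auto simp: K_cells_def\<close>)
  show "homot u = 0" if "u \<in> supp (X_cells i)" for i u by (rule homot_X_cells[OF that])
  show "homot (dtot (word e)) = 0" if "e \<in> X_cells n" for e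
    by (rule homot_X_cells[of _ "n - 1"], rule supp_mono[OF dtot_cells[of e n]]) (use that in \<open>auto simp: X_cells_def\<close>)
  fix e assume e: "e \<in> K_cells n - X_cells n"
  obtain p c w where pcw: "e = (p, c, w)" by (cases e)
  have w: "set w \<subseteq> \<beta> p" "w \<noteq> []" "c \<le> 1" "set w \<inter> (I \<union> W) \<noteq> {}" "\<not> set w \<subseteq> I \<union> W"
    using e by (auto simp: pcw K_cells_def X_cells_def cells_def)
  let ?N = "word e - dtot (homot (word e)) - homot (dtot (word e))"
  have "?N \<in> supp {(p', x). irank x < irank (c, w)}"
  proof (cases "set w \<inter> I = {}")
    case True
    then show ?thesis unfolding pcw by (intro rank_drop_mixed) (use w in \<open>auto simp: mixed_def\<close>)
  next
    case False
    then show ?thesis unfolding pcw by (intro rank_drop_I) (use w in auto)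
  qed
  moreover have "?N \<in> supp (K_cells n)"
  proof (intro supp_diff)
    show "word e \<in> supp (K_cells n)" using e by simp
    have "homot (word e) \<in> supp (K_cells (Suc n))" by (rule homot_K_cells) (use e in \<open>auto simp: K_cells_def\<close>)
    then show "dtot (homot (word e)) \<in> supp (K_cells n)"
      by (rule lin_supp[OF lin_dtot])
        (rule supp_mono[OF dtot_cells], auto simp: K_cells_def)
    have "dtot (word e) \<in> supp {e'. \<exists>k. n = Suc k \<and> e' \<in> cells k}"
      by (rule supp_mono[OF dtot_cells]) (use e in \<open>auto simp: K_cells_def\<close>)
    then show "homot (dtot (word e)) \<in> supp (K_cells n)"
      by (rule lin_supp[OF lin_homot]) (auto intro: homot_K_cells)
  qed
  ultimately show "?N \<in> supp (X_cells n \<union> {e' \<in> K_cells n. (case e' of (p, x) \<Rightarrow> irank x) < (case e of (p, x) \<Rightarrow> irank x)})"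
    by (auto simp: supp_def pcw)
qed (use u du in \<open>auto intro: lin_intros simp: dtot_dtot\<close>)

end

subsection \<open>The bar complex and its contraction\<close>

context coord_letters
begin

definition dbar :: "(nat \<times> 'b list \<Rightarrow>\<^sub>0 'k) \<Rightarrow> (nat \<times> 'b list \<Rightarrow>\<^sub>0 'k)" where
  "dbar = simp_tot face (\<lambda>p. bar (m p))"

lemma lin_dbar [lin_intros]: "lin dbar"
  by (auto simp: dbar_def intro: lin_intros)

lemma dbar_put: "dbar (put p u) = (if p = 0 then 0 else put (p - 1) (bdry p u)) + (- 1) ^ p \<star> put p (bar (m p) u)"
  unfolding dbar_def bdry_def by (rule simp_tot_put) (auto intro: lin_intros)

lemma dbar_dbar: "dbar (dbar u) = 0"
  unfolding dbar_def
proof (rule simp_tot_simp_tot)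
  show "face (Suc p) i (face (Suc (Suc p)) j u) = face (Suc p) (j - 1) (face (Suc (Suc p)) i u)"
    if "i < j" "j \<le> Suc (Suc p)" for p i j u
    by (rule face_face_chain[OF that])
qed (auto intro: lin_intros bar_bar assoc face_bar)

definition bar_cells :: "nat \<Rightarrow> (nat \<times> 'b list) set" where
  "bar_cells n = {(p, w). w \<noteq> [] \<and> p + length w = Suc n \<and> set w \<subseteq> \<beta> p \<inter> (I \<union> W)}"

definition bar_I_cells :: "nat \<Rightarrow> (nat \<times> 'b list) set" where
  "bar_I_cells n = {(p, w) \<in> bar_cells n. set w \<inter> I \<noteq> {}}"

lemma dbar_cells:
  assumes "e \<in> bar_cells n"
  shows "dbar (word e) \<in> supp {e'. \<exists>k. n = Suc k \<and> e' \<in> bar_cells k \<and> (e \<in> bar_I_cells n \<longrightarrow> e' \<in> bar_I_cells k)}"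
    (is "_ \<in> supp ?D")
proof -
  obtain p w where e: "e = (p, w)" by (cases e)
  have w: "w \<noteq> []" "p + length w = Suc n" "set w \<subseteq> \<beta> p" "set w \<subseteq> I \<union> W"
    using assms by (auto simp: e bar_cells_def)
  have 1: "put (p - 1) (bdry p (word w)) \<in> supp ?D" if p: "p > 0"
  proof (rule put_supp[OF bdry_supp[OF w(3) p]])
    fix w' assume "w' \<in> {w'. list_all2 (same_type (p - 1)) w' w}"
    then have w': "list_all2 (same_type (p - 1)) w' w" by simp
    then have "w' \<noteq> []" "n = Suc (n - 1)" using w p by (auto dest: list_all2_lengthD) (cases w; cases n; auto)
    then show "(p - 1, w') \<in> ?D"
      using same_type_list[OF w'] w p by (intro CollectI exI[of _ "n - 1"]) (auto simp: e bar_cells_def bar_I_cells_def)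
  qed
  have barI: "bar_word (m p) w \<in> supp {w'. set w' \<subseteq> \<beta> p \<and> (set w \<inter> I \<noteq> {} \<longrightarrow> set w' \<inter> I \<noteq> {}) \<and> Suc (length w') = length w \<and> w' \<noteq> []}"
    by (rule supp_mono[OF bar_ideal[OF m_I w(3)]]) auto
  have barX: "bar_word (m p) w \<in> supp {w'. set w' \<subseteq> I \<union> W}"
    by (rule supp_mono[OF bar_ideal[OF m_X w(3)]]) (use w in auto)
  have "put p (bar_word (m p) w) \<in> supp ?D"
  proof (rule put_supp)
    show "bar_word (m p) w \<in> supp {w'. set w' \<subseteq> I \<union> W \<and> set w' \<subseteq> \<beta> p \<and> (set w \<inter> I \<noteq> {} \<longrightarrow> set w' \<inter> I \<noteq> {}) \<and> Suc (length w') = length w \<and> w' \<noteq> []}"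
      using barI barX by (auto simp: supp_def)
    fix w' assume w': "w' \<in> {w'. set w' \<subseteq> I \<union> W \<and> set w' \<subseteq> \<beta> p \<and> (set w \<inter> I \<noteq> {} \<longrightarrow> set w' \<inter> I \<noteq> {}) \<and> Suc (length w') = length w \<and> w' \<noteq> []}"
    then have "n = Suc (n - 1)" using w by (cases w'; cases n) auto
    then show "(p, w') \<in> ?D"
      using w w' by (intro CollectI exI[of _ "n - 1"]) (auto simp: e bar_cells_def bar_I_cells_def)
  qed
  then show ?thesis
    using 1 dbar_put[of p "word w"] by (auto simp: e intro!: supp_intros)
qed

lemma dbar_supp: "u \<in> supp (bar_cells (Suc n)) \<Longrightarrow> dbar u \<in> supp (bar_cells n)"
  by (rule lin_supp[OF lin_dbar], assumption, rule supp_mono[OF dbar_cells]) auto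

text \<open>Sliding contracts the simplicial direction and b' lowers the length, so the criterion
  applies with empty \<open>C\<close> and the length as rank.\<close>

lemma bar_I_acyclic:
  assumes u: "u \<in> supp (bar_I_cells n)" and du: "dbar u = 0"
  shows "\<exists>v\<in>supp (bar_I_cells (Suc n)). u = dbar v"
proof -
  define H where "H = linear_extension (\<lambda>(p, w). put (Suc p) (hpush p (word w)))"
  have H: "lin H" by (auto simp: H_def intro: lin_intros)
  have H_put: "H (put p u) = put (Suc p) (hpush p u)" for p u
    by (rule lin_eqI[of "\<lambda>u. H (put p u)"]) (auto intro!: lin_intros lin_comp[OF H] simp: H_def)
  have H_word: "H (word (p, w)) = put (Suc p) (hpush p (word w))" for p w
    by (simp add: H_def)
  have H_supp: "H (word (p, w)) \<in> supp {(p', w'). set w' \<subseteq> \<beta> p' \<and> set w' \<inter> I \<noteq> {} \<and> (set w' \<subseteq> I \<union> W \<longleftrightarrow> set w \<subseteq> I \<union> W) \<and>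
      p' = Suc p \<and> length w' = length w}" if "set w \<subseteq> \<beta> p" for p w
    unfolding H_word by (rule put_supp[OF hpush_supp[OF that]]) (use same_type_list[of "Suc p" _ w] in auto)
  have HK: "H (word e) \<in> supp (bar_I_cells (Suc i))" if "e \<in> bar_I_cells i" for e i
    using that by (cases e, simp, intro supp_mono[OF H_supp]) (auto simp: bar_I_cells_def bar_cells_def)
  have "\<exists>v\<in>supp (bar_I_cells (Suc n)). u - dbar v \<in> supp {}"
  proof (rule relative_acyclic[of dbar H "\<lambda>_. {}" n bar_I_cells "\<lambda>(p, w). length w"])
    fix e assume e: "e \<in> bar_I_cells n - {}"
    obtain p w where pw: "e = (p, w)" by (cases e)
    have w: "w \<noteq> []" "set w \<subseteq> \<beta> p" "set w \<inter> I \<noteq> {}" using e by (auto simp: pw bar_I_cells_def bar_cells_def)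
    let ?w = "word w :: 'b list \<Rightarrow>\<^sub>0 'k"
    let ?N = "word e - dbar (H (word e)) - H (dbar (word e))" and ?D = "{(p', w'). length w' < length w}"
    have ew: "word e = put p ?w" by (simp add: pw)
    have hb: "H (if p = 0 then 0 else put (p - 1) (bdry p ?w)) = (if p = 0 then 0 else put p (hpush (p - 1) (bdry p ?w)))"
      by (simp add: H_put chains.linear_0[OF H])
    have split: "put p ?w = put p (bdry (Suc p) (hpush p ?w)) + (if p = 0 then 0 else put p (hpush (p - 1) (bdry p ?w)))"
      using arg_cong[OF bdry_hpush[OF w(2,3)], of "put p"] by (auto simp: chains.linear_add[OF lin_put] split: if_splits)
    have "?N = - ((- 1) ^ Suc p \<star> put (Suc p) (bar (m (Suc p)) (hpush p ?w))) - (- 1) ^ p \<star> H (put p (bar (m p) ?w))"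
      unfolding ew dbar_put H_put[of p ?w] chains.linear_add[OF H] chains.linear_scale[OF H] hb
      by (subst split) (simp add: algebra_simps)
    moreover have "put (Suc p) (bar (m (Suc p)) (hpush p ?w)) \<in> supp ?D"
    proof (rule lin_supp[OF _ hpush_supp[OF w(2)], of "\<lambda>u. put (Suc p) (bar (m (Suc p)) u)"])
      fix w' assume "w' \<in> {w'. list_all2 (same_type (Suc p)) w' w \<and> set w' \<inter> I \<noteq> {}}"
      then have w': "set w' \<subseteq> \<beta> (Suc p)" "length w' = length w" using same_type_list[of "Suc p" w' w] by auto
      show "put (Suc p) (bar (m (Suc p)) (word w')) \<in> supp ?D"
        unfolding bar_of_word by (rule put_supp[OF bar_ideal[OF m_I w'(1)]]) (use w' in auto)
    qed (auto intro!: lin_intros)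
    moreover have "H (put p (bar (m p) ?w)) \<in> supp ?D"
      unfolding bar_of_word
    proof (rule lin_supp[OF _ bar_ideal[OF m_I w(2)], of "\<lambda>u. H (put p u)"])
      fix w' assume "w' \<in> {w'. set w' \<subseteq> \<beta> p \<and> (set w \<inter> I \<noteq> {} \<longrightarrow> set w' \<inter> I \<noteq> {}) \<and> (set w \<subseteq> I \<longrightarrow> set w' \<subseteq> I) \<and> Suc (length w') = length w \<and> w' \<noteq> []}"
      then show "H (put p (word w')) \<in> supp ?D"
        unfolding put_word by (intro supp_mono[OF H_supp]) auto
    qed (auto intro!: lin_intros lin_comp[OF H])
    ultimately have "?N \<in> supp ?D" by (auto intro!: supp_intros)
    moreover have "?N \<in> supp (bar_I_cells n)"
    proof (intro supp_diff)
      show "word e \<in> supp (bar_I_cells n)" using e by simp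
      show "dbar (H (word e)) \<in> supp (bar_I_cells n)"
        by (rule lin_supp[OF lin_dbar HK]) (use e in \<open>auto intro!: supp_mono[OF dbar_cells] simp: bar_I_cells_def\<close>)
      have "dbar (word e) \<in> supp {e'. \<exists>k. n = Suc k \<and> e' \<in> bar_I_cells k}"
        by (rule supp_mono[OF dbar_cells]) (use e in \<open>auto simp: bar_I_cells_def\<close>)
      then show "H (dbar (word e)) \<in> supp (bar_I_cells n)"
        by (rule lin_supp[OF H]) (auto intro: HK)
    qed
    ultimately show "?N \<in> supp ({} \<union> {e' \<in> bar_I_cells n. (case e' of (p, w) \<Rightarrow> length w) < (case e of (p, w) \<Rightarrow> length w)})"
      by (auto simp: supp_def pw)
  qed (use u du HK in \<open>auto intro: lin_intros H dbar_dbar simp: chains.linear_0[OF H]\<close>)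
  then show ?thesis by auto
qed

text \<open>The projection to the bar complex of A/I: words with a letter of type I are divided out,
  and what is left is constant in the simplicial direction, so that only level 0 is
  retained.\<close>

definition W_part :: "(nat \<times> 'b list \<Rightarrow>\<^sub>0 'k) \<Rightarrow> ('b list \<Rightarrow>\<^sub>0 'k)" where
  "W_part u = restrict_chain {w. set w \<subseteq> W} (slice 0 u)"

lemma lin_W_part [lin_intros]: "lin W_part"
  unfolding W_part_def[abs_def] by (intro lin_intros lin_comp[OF lin_restrict_chain])
lemmas lin_W_part_comp [lin_intros] = lin_comp[OF lin_W_part]

lemma W_part_word: "W_part (word (p, w)) = (if p = 0 \<and> set w \<subseteq> W then word w else 0)"
  by (simp add: W_part_def slice_word restrict_chain_word chains.linear_0[OF lin_restrict_chain])

lemma W_part_put: "W_part (put p u) = (if p = 0 then restrict_chain {w. set w \<subseteq> W} u else 0)"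
  by (simp add: W_part_def slice_put chains.linear_0[OF lin_restrict_chain])

lemma W_part_bar_cells: "u \<in> supp (bar_cells n) \<Longrightarrow> W_part u \<in> supp (Wwords (Suc n))"
  by (rule lin_supp[OF lin_W_part]) (auto simp: bar_cells_def W_part_word Wwords_def)

lemma W_part_I: "u \<in> supp (bar_I_cells n) \<Longrightarrow> W_part u = 0"
proof (erule lin_eq_supp[OF lin_W_part lin_zero])
  fix e assume e: "e \<in> bar_I_cells n"
  obtain p w where pw: "e = (p, w)" by (cases e)
  then have "\<not> set w \<subseteq> W" using e IW by (auto simp: bar_I_cells_def)
  then show "W_part (word e) = 0" by (simp add: pw W_part_word)
qed

lemma bar_Wwords:
  assumes "set w \<subseteq> W \<inter> \<beta> 0"
  shows "bar_word (m 0) w - dw_word w \<in> supp {w'. set w' \<subseteq> \<beta> 0 \<inter> (I \<union> W) \<and> set w' \<inter> I \<noteq> {} \<and> Suc (length w') = length w \<and> w' \<noteq> []}"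
proof -
  have w: "set w \<subseteq> \<beta> 0" "set w \<inter> I = {}" "nz w = 0"
    using assms IW by (auto simp: nz_def filter_empty_conv)
  have "bar_word (m 0) w - dw_word w \<in> supp {w'. set w' \<subseteq> I \<union> W \<and> Suc (length w') = length w \<and> w' \<noteq> []}"
    by (intro supp_diff supp_mono[OF dw_supp] supp_mono[OF bar_ideal[OF m_X]]) (use assms w in \<open>auto simp: dw_rel_def\<close>)
  then show ?thesis using bar_low[OF w(1,2)] w(3) by (auto simp: supp_def low_def)
qed

lemma W_part_dbar:
  assumes "u \<in> supp (bar_cells n)"
  shows "W_part (dbar u) = dw (W_part u)"
proof (rule lin_eq_supp[OF _ _ assms, of "\<lambda>u. W_part (dbar u)"])
  fix e assume e: "e \<in> bar_cells n"
  show "W_part (dbar (word e)) = dw (W_part (word e))"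
  proof (cases "e \<in> bar_I_cells n")
    case True
    have "dbar (word e) \<in> supp (bar_I_cells (n - 1))"
      by (rule supp_mono[OF dbar_cells[OF e]]) (use True in auto)
    then show ?thesis using True W_part_I[of "word e" n] by (simp add: W_part_I chains.linear_0[OF lin_dw])
  next
    case False
    obtain p w where pw: "e = (p, w)" by (cases e)
    have w: "set w \<subseteq> W" "set w \<subseteq> \<beta> p" "set w \<subseteq> W \<inter> \<beta> 0"
      using e False W_level[of _ p] by (auto simp: pw bar_cells_def bar_I_cells_def)
    consider "p = 0" | "p = 1" | "p \<ge> 2" by linarith
    then show ?thesis
    proof cases
      case 1
      have "restrict_chain {w. set w \<subseteq> W} (bar_word (m 0) w - dw_word w) = 0"
        by (rule restrict_chain_zero[OF bar_Wwords[OF w(3)]]) (use IW in auto)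
      moreover have "restrict_chain {w. set w \<subseteq> W} (dw_word w) = dw_word w"
        by (rule restrict_chain_id[OF supp_mono[OF dw_supp]]) (use w(1) in \<open>auto simp: dw_rel_def\<close>)
      ultimately show ?thesis
        using dbar_put[of p "word w"] 1 w(1) by (simp add: pw W_part_put W_part_word chains.linear_diff[OF lin_restrict_chain])
    next
      \<comment> \<open>Both faces of a word in W are the word itself, so they cancel in the
        alternating sum.\<close>
      case 2
      have "map (fc 1 j) w = map (\<lambda>b. word b) w" if "j \<le> 1" for j
        using w that by (auto intro!: face_W simp: 2)
      then have "face 1 j (word w) = word w" if "j \<le> 1" for j
        using that by (simp only: face_def thom_word tensor_words)
      then have "bdry 1 (word w) = 0" by (simp add: bdry_def single_uminus)
      then show ?thesis
        using dbar_put[of p "word w"] 2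
        by (simp add: pw W_part_put W_part_word chains.linear_neg[OF lin_W_part] chains.linear_0[OF lin_dw])
    next
      case 3
      then show ?thesis
        using dbar_put[of p "word w"] by (simp add: pw W_part_put W_part_word chains.linear_0[OF lin_dw]
          chains.linear_add[OF lin_W_part] chains.linear_scale[OF lin_W_part])
    qed
  qed
qed (auto intro!: lin_intros)

lemma put_Wwords: "u \<in> supp (Wwords (Suc n)) \<Longrightarrow> put 0 u \<in> supp (bar_cells n)"
  by (rule put_supp) (auto simp: Wwords_def bar_cells_def)

lemma W_part_put_Wwords: "u \<in> supp (Wwords n) \<Longrightarrow> W_part (put 0 u) = u"
  unfolding W_part_put by (simp, rule restrict_chain_id, erule supp_mono) (auto simp: Wwords_def)

lemma dw_supp_Wwords: "u \<in> supp (Wwords (Suc n)) \<Longrightarrow> dw u \<in> supp (Wwords n)"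
  by (rule lin_supp[OF lin_dw], assumption) (use dw_Wwords[of _ "Suc n"] in auto)

lemma dw_Wwords_1: "u \<in> supp (Wwords 1) \<Longrightarrow> dw u = 0"
  by (rule lin_eq_supp[OF lin_dw lin_zero]) (auto simp: Wwords_def length_Suc_conv)

text \<open>\<open>W_part\<close> is a chain map from \<open>dbar\<close> to \<open>dw\<close> and
  hits every word in W, so the square of \<open>dw\<close> vanishes because that of
  \<open>dbar\<close> does.\<close>

lemma dw_dw:
  assumes "u \<in> supp (Wwords (Suc n))"
  shows "dw (dw u) = 0"
proof (cases n)
  case 0
  then show ?thesis using dw_Wwords_1 assms by (simp add: chains.linear_0[OF lin_dw])
next
  case (Suc k)
  have u: "put 0 u \<in> supp (bar_cells n)" by (rule put_Wwords[OF assms])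
  have "dw (dw u) = dw (W_part (dbar (put 0 u)))"
    using W_part_dbar[OF u] W_part_put_Wwords[OF assms] by simp
  also have "\<dots> = W_part (dbar (dbar (put 0 u)))"
    using W_part_dbar[OF dbar_supp, of "put 0 u" k] u Suc by simp
  finally show ?thesis by (simp add: dbar_dbar chains.linear_0[OF lin_W_part])
qed

context
  assumes bar_acyclic: "\<And>n u. u \<in> supp (bar_cells n) \<Longrightarrow> dbar u = 0 \<Longrightarrow> \<exists>v\<in>supp (bar_cells (Suc n)). u = dbar v"
begin

text \<open>A diagram chase modulo the acyclic subcomplex of words with a letter of type I: the
  boundary of a \<open>dw\<close>-cycle \<open>c\<close> at level 0 lies in this subcomplex, so
  \<open>c\<close> can be corrected there by some \<open>f\<close> to a cycle; this cycle bounds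
  some \<open>g\<close> by hypothesis, and the projection of \<open>g\<close> bounds
  \<open>c\<close>.\<close>

lemma Wwords_acyclic:
  assumes c: "c \<in> supp (Wwords (Suc n))" and dc: "dw c = 0"
  shows "\<exists>e\<in>supp (Wwords (Suc (Suc n))). c = dw e"
proof -
  have e0: "put 0 c \<in> supp (bar_cells n)" by (rule put_Wwords[OF c])
  have db: "dbar (put 0 c) \<in> supp {e'. \<exists>k. n = Suc k \<and> e' \<in> bar_I_cells k}"
  proof -
    have "dbar (put 0 c) = put 0 (bar (m 0) c - dw c)" using dc by (simp add: dbar_put)
    also have "\<dots> \<in> supp {e'. \<exists>k. n = Suc k \<and> e' \<in> bar_I_cells k}"
    proof (rule lin_supp[OF _ c, of "\<lambda>c. put 0 (bar (m 0) c - dw c)"])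
      fix w assume w: "w \<in> Wwords (Suc n)"
      show "put 0 (bar (m 0) (word w) - dw (word w)) \<in> supp {e'. \<exists>k. n = Suc k \<and> e' \<in> bar_I_cells k}"
        unfolding bar_of_word dw_of_word
      proof (rule put_supp[OF bar_Wwords])
        fix w' assume w': "w' \<in> {w'. set w' \<subseteq> \<beta> 0 \<inter> (I \<union> W) \<and> set w' \<inter> I \<noteq> {} \<and> Suc (length w') = length w \<and> w' \<noteq> []}"
        then obtain k where k: "n = Suc k" "length w' = Suc k" using w by (cases w') (auto simp: Wwords_def)
        show "(0, w') \<in> {e'. \<exists>k. n = Suc k \<and> e' \<in> bar_I_cells k}"
          by (intro CollectI exI[of _ k]) (use w' k in \<open>auto simp: bar_I_cells_def bar_cells_def\<close>)
      qed (use w in \<open>auto simp: Wwords_def\<close>)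
    qed (auto intro!: lin_intros)
    finally show ?thesis .
  qed
  obtain f where f: "f \<in> supp (bar_I_cells n)" "dbar f = dbar (put 0 c)"
  proof (cases n)
    case 0
    then have "dbar (put 0 c) = 0" using db by (simp add: supp_def)
    then show ?thesis using that[of 0] by (simp add: chains.linear_0[OF lin_dbar])
  next
    case (Suc k)
    then have "dbar (put 0 c) \<in> supp (bar_I_cells k)" using db by (auto elim!: supp_mono)
    then show ?thesis using bar_I_acyclic[of _ k] dbar_dbar that Suc by metis
  qed
  have fc: "f \<in> supp (bar_cells n)" using f(1) by (auto simp: bar_I_cells_def elim!: supp_mono)
  then obtain g where g: "g \<in> supp (bar_cells (Suc n))" "put 0 c - f = dbar g"
    using bar_acyclic[of "put 0 c - f" n] supp_diff[OF e0 fc] f(2) by (auto simp: chains.linear_diff[OF lin_dbar])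
  have "c = W_part (put 0 c - f)"
    by (simp add: chains.linear_diff[OF lin_W_part] W_part_put_Wwords[OF c] W_part_I[OF f(1)])
  also have "\<dots> = dw (W_part g)" unfolding g(2) by (rule W_part_dbar[OF g(1)])
  finally show ?thesis using W_part_bar_cells[OF g(1)] by blast
qed

text \<open>Over a field \<open>dw\<close> has a linear right inverse g on its image, and an acyclic
  complex with such inverses is contracted by g (1 - g dw).\<close>

lemma contraction_exists: "\<exists>h. contracted_letters \<beta> m fc I W up sl h"
proof -
  have sub: "chain.subspace (supp B :: ('b list \<Rightarrow>\<^sub>0 'k) set)" for B
    by (auto simp: chain.subspace_def intro: supp_intros)
  have "\<exists>g. lin g \<and> range g \<subseteq> supp (Wwords (Suc n)) \<and> (\<forall>v\<in>dw ` supp (Wwords (Suc n)). dw (g v) = v)" for n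
    using chains.linear_exists_right_inverse_on[OF lin_dw sub[of "Wwords (Suc n)"]] by blast
  then obtain g where g: "\<And>n. lin (g n)" "\<And>n v. g n v \<in> supp (Wwords (Suc n))"
    "\<And>n v. v \<in> dw ` supp (Wwords (Suc n)) \<Longrightarrow> dw (g n v) = v"
    by (metis rangeI subsetD)
  define h where "h = linear_extension (\<lambda>w. let n = length w in
    g n (word w - (if n \<le> 1 then 0 else g (n - 1) (dw (word w)))))"
  have h: "lin h" by (simp add: h_def lin_intros)
  have g0: "g n 0 = 0" for n using chains.linear_0[OF g(1)] .
  have h_eq: "h u = g n (u - (if n \<le> 1 then 0 else g (n - 1) (dw u)))" if "u \<in> supp (Wwords n)" for u n
    by (rule lin_eq_supp[OF h _ that])
      (auto intro!: lin_intros lin_comp[OF g(1)] simp: h_def Wwords_def)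
  have dwg: "dw (g n u) = u" if "u \<in> supp (Wwords n)" "dw u = 0" "n \<ge> 1" for u n
  proof -
    obtain k where "n = Suc k" using \<open>n \<ge> 1\<close> by (cases n) auto
    then show ?thesis using Wwords_acyclic[of u k] that by (intro g(3)) auto
  qed
  show ?thesis
  proof (intro exI[of _ h] contracted_letters.intro contracted_letters_axioms.intro)
    show "coord_letters \<beta> m fc I W up sl" by unfold_locales
    show "lin h" by (rule h)
    fix w n assume w: "w \<in> Wwords n" "n \<ge> 1"
    show "h (word w) \<in> supp (Wwords (Suc n))" using h_eq[of "word w" n] w g(2) by simp
    let ?w = "word w :: 'b list \<Rightarrow>\<^sub>0 'k"
    show "dw (h ?w) + h (dw ?w) = ?w"
    proof (cases "n = 1")
      case True
      then have "dw ?w = 0" using dw_Wwords_1[of ?w] w by simp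
      then show ?thesis using h_eq[of ?w n] dwg[of ?w n] w True by (simp add: chains.linear_0[OF h] del: dw_of_word)
    next
      case False
      then obtain k where n: "n = Suc (Suc k)" using w by (cases n; cases "n - 1") auto
      have dww: "dw ?w \<in> supp (Wwords (Suc k))" by (rule dw_supp_Wwords) (use w n in simp)
      have ddw: "dw (dw ?w) = 0" by (rule dw_dw[of _ "Suc k"]) (use w n in simp)
      have 1: "dw (g (Suc k) (dw ?w)) = dw ?w" by (rule dwg) (use dww ddw in auto)
      have "dw (h ?w) = ?w - g (Suc k) (dw ?w)"
        using h_eq[of ?w n] w n dwg[of "?w - g (Suc k) (dw ?w)" n] 1 g(2)[of "Suc k" "dw ?w"]
        by (simp add: chains.linear_diff[OF lin_dw] supp_diff del: dw_of_word)
      moreover have "h (dw ?w) = g (Suc k) (dw ?w)"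
        using h_eq[OF dww] ddw g0 by (simp del: dw_of_word)
      ultimately show ?thesis by simp
    qed
  qed
qed

end

end

section \<open>Coordinates on tensor powers\<close>

text \<open>A linear isomorphism onto the chains on \<open>B\<close>. It replaces a vector space on
  a carrier set by finitely supported functions on a basis.\<close>

definition coord :: "('k::field, 'v) module \<Rightarrow> 'b set \<Rightarrow> ('v \<Rightarrow> ('b \<Rightarrow>\<^sub>0 'k)) \<Rightarrow> bool" where
  "coord V B \<kappa> \<longleftrightarrow> Module.module ground_field V \<and> bij_betw \<kappa> (carrier V) (supp B) \<and>
     (\<forall>x\<in>carrier V. \<forall>y\<in>carrier V. \<kappa> (x \<oplus>\<^bsub>V\<^esub> y) = \<kappa> x + \<kappa> y) \<and>
     (\<forall>c. \<forall>x\<in>carrier V. \<kappa> (c \<odot>\<^bsub>V\<^esub> x) = c \<star> \<kappa> x)"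

lemma coordD:
  assumes "coord V B \<kappa>"
  shows coord_module: "Module.module ground_field V"
    and coord_bij: "bij_betw \<kappa> (carrier V) (supp B)"
    and coord_add: "x \<in> carrier V \<Longrightarrow> y \<in> carrier V \<Longrightarrow> \<kappa> (x \<oplus>\<^bsub>V\<^esub> y) = \<kappa> x + \<kappa> y"
    and coord_smult: "x \<in> carrier V \<Longrightarrow> \<kappa> (c \<odot>\<^bsub>V\<^esub> x) = c \<star> \<kappa> x"
    and coord_supp: "x \<in> carrier V \<Longrightarrow> \<kappa> x \<in> supp B"
  using assms by (auto simp: coord_def bij_betw_def)

lemma ground_module_closed:
  assumes "Module.module ground_field (V :: ('k::field, 'v) module)"
  shows "x \<in> carrier V \<Longrightarrow> y \<in> carrier V \<Longrightarrow> x \<oplus>\<^bsub>V\<^esub> y \<in> carrier V"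
    and "x \<in> carrier V \<Longrightarrow> c \<odot>\<^bsub>V\<^esub> x \<in> carrier V"
    and "\<zero>\<^bsub>V\<^esub> \<in> carrier V"
proof -
  interpret Module.module ground_field V by fact
  show "x \<in> carrier V \<Longrightarrow> y \<in> carrier V \<Longrightarrow> x \<oplus>\<^bsub>V\<^esub> y \<in> carrier V" by simp
  show "x \<in> carrier V \<Longrightarrow> c \<odot>\<^bsub>V\<^esub> x \<in> carrier V"
    using smult_closed[of c x] by (simp add: ground_field_def)
  show "\<zero>\<^bsub>V\<^esub> \<in> carrier V" by simp
qed

lemma coord_zero:
  assumes "coord V B \<kappa>" shows "\<kappa> \<zero>\<^bsub>V\<^esub> = 0"
proof -
  interpret Module.module ground_field V using assms by (rule coord_module)
  have "\<kappa> (\<zero>\<^bsub>V\<^esub> \<oplus>\<^bsub>V\<^esub> \<zero>\<^bsub>V\<^esub>) = \<kappa> \<zero>\<^bsub>V\<^esub> + \<kappa> \<zero>\<^bsub>V\<^esub>"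
    by (rule coord_add[OF assms]) auto
  then show ?thesis by simp
qed

definition vec :: "('k::field, 'v) module \<Rightarrow> ('v \<Rightarrow> ('b \<Rightarrow>\<^sub>0 'k)) \<Rightarrow> ('b \<Rightarrow>\<^sub>0 'k) \<Rightarrow> 'v" where
  "vec V \<kappa> = inv_into (carrier V) \<kappa>"

lemma vec:
  assumes "coord V B \<kappa>"
  shows vec_closed: "v \<in> supp B \<Longrightarrow> vec V \<kappa> v \<in> carrier V"
    and coord_vec: "v \<in> supp B \<Longrightarrow> \<kappa> (vec V \<kappa> v) = v"
    and vec_coord: "x \<in> carrier V \<Longrightarrow> vec V \<kappa> (\<kappa> x) = x"
  using coord_bij[OF assms] unfolding vec_def bij_betw_def
  by (auto simp: inv_into_into f_inv_into_f)

lemma coord_inj: "coord V B \<kappa> \<Longrightarrow> x \<in> carrier V \<Longrightarrow> y \<in> carrier V \<Longrightarrow> \<kappa> x = \<kappa> y \<Longrightarrow> x = y"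
  by (metis vec_coord)

section \<open>The tensor relations as the kernel of the coordinate map\<close>

lemma lin_span:
  assumes "lin f" "u \<in> chain.span S" "\<And>x. x \<in> S \<Longrightarrow> f x \<in> chain.span S'"
  shows "f u \<in> chain.span S'"
proof -
  have "chain.subspace {u. f u \<in> chain.span S'}"
    by (auto simp: chain.subspace_def chains.linear_add[OF assms(1)] chains.linear_0[OF assms(1)]
      chains.linear_scale[OF assms(1)] chain.span_zero chain.span_add chain.span_scale)
  then show ?thesis using chain.span_induct[OF assms(2), of "\<lambda>u. f u \<in> chain.span S'"] assms(3) by simp
qed

lemma subspace_supp: "chain.subspace (supp B)"
  by (auto simp: chain.subspace_def intro: supp_intros)

lemma lin_in_subspace:
  assumes "lin f" "u \<in> supp B" "chain.subspace R" "\<And>x. x \<in> B \<Longrightarrow> f (word x) \<in> R"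
  shows "f u \<in> R"
  unfolding lin_apply[OF assms(1), of u]
  using assms by (intro chain.subspace_sum chain.subspace_scale) (auto simp: supp_def)

lemma words_iff: "w \<in> words V m \<longleftrightarrow> length w = m \<and> set w \<subseteq> carrier V"
  by (simp add: words_def)

lemma relations_mult_right:
  assumes w: "w \<in> words V n" and u: "u \<in> tensor_relations V m"
  shows "u * word w \<in> tensor_relations V (m + n)"
  using u unfolding tensor_relations_def
proof (rule lin_span[of "\<lambda>u. u * word w", rotated])
  fix r assume "r \<in> multilinear_relations V m"
  then consider xs x y ys where "r = word (xs @ [x \<oplus>\<^bsub>V\<^esub> y] @ ys) - word (xs @ [x] @ ys) - word (xs @ [y] @ ys)"
      "xs @ [x] @ ys \<in> words V m" "y \<in> carrier V"
    | xs c x ys where "r = word (xs @ [c \<odot>\<^bsub>V\<^esub> x] @ ys) - c \<star> word (xs @ [x] @ ys)" "xs @ [x] @ ys \<in> words V m"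
    unfolding multilinear_relations_def by blast
  then have "r * word w \<in> multilinear_relations V (m + n)"
  proof cases
    case 1
    then show ?thesis unfolding multilinear_relations_def using w
      by (intro UnI1 CollectI exI[of _ xs] exI[of _ x] exI[of _ y] exI[of _ "ys @ w"])
        (auto simp: left_diff_distrib word_mult words_iff)
  next
    case 2
    then show ?thesis unfolding multilinear_relations_def using w
      by (intro UnI2 CollectI exI[of _ xs] exI[of _ c] exI[of _ x] exI[of _ "ys @ w"])
        (auto simp: left_diff_distrib word_mult words_iff mult_single plus_list_def)
  qed
  then show "r * word w \<in> chain.span (multilinear_relations V (m + n))" by (rule chain.span_base)
qed (auto intro!: lin_intros)

lemma relations_mult_left:
  assumes a: "a \<in> carrier V" and u: "u \<in> tensor_relations V m"
  shows "word [a] * u \<in> tensor_relations V (Suc m)"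
  using u unfolding tensor_relations_def
proof (rule lin_span[of "\<lambda>u. word [a] * u", rotated])
  fix r assume "r \<in> multilinear_relations V m"
  then consider xs x y ys where "r = word (xs @ [x \<oplus>\<^bsub>V\<^esub> y] @ ys) - word (xs @ [x] @ ys) - word (xs @ [y] @ ys)"
      "xs @ [x] @ ys \<in> words V m" "y \<in> carrier V"
    | xs c x ys where "r = word (xs @ [c \<odot>\<^bsub>V\<^esub> x] @ ys) - c \<star> word (xs @ [x] @ ys)" "xs @ [x] @ ys \<in> words V m"
    unfolding multilinear_relations_def by blast
  then have "word [a] * r \<in> multilinear_relations V (Suc m)"
  proof cases
    case 1
    then show ?thesis unfolding multilinear_relations_def using a
      by (intro UnI1 CollectI exI[of _ "a # xs"] exI[of _ x] exI[of _ y] exI[of _ ys])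
        (auto simp: right_diff_distrib word_mult words_iff)
  next
    case 2
    then show ?thesis unfolding multilinear_relations_def using a
      by (intro UnI2 CollectI exI[of _ "a # xs"] exI[of _ c] exI[of _ x] exI[of _ ys])
        (auto simp: right_diff_distrib word_mult words_iff mult_single plus_list_def)
  qed
  then show "word [a] * r \<in> chain.span (multilinear_relations V (Suc m))" by (rule chain.span_base)
qed (auto intro!: lin_intros)

lemma subspace_relations: "chain.subspace (tensor_relations V m)"
  by (simp add: tensor_relations_def chain.subspace_span)

text \<open>Modulo the relations a vector is the sum of its basis components. The induction runs
  over a finite set of basis elements that contains the support and removes one component at a
  time.\<close>

lemma relations_1:
  assumes V: "coord V B \<kappa>"
  shows "v \<in> supp B \<Longrightarrow> word [vec V \<kappa> v] - letter (relabel (\<lambda>b. vec V \<kappa> (word b)) v) \<in> tensor_relations V 1"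
proof -
  let ?R = "tensor_relations V 1" and ?D = "\<lambda>v. letter (relabel (\<lambda>b. vec V \<kappa> (word b)) v)"
  note closed = ground_module_closed[OF coord_module[OF V]]
  have add: "word [x \<oplus>\<^bsub>V\<^esub> y] - word [x] - word [y] \<in> ?R" if "x \<in> carrier V" "y \<in> carrier V" for x y
    unfolding tensor_relations_def multilinear_relations_def
    by (rule chain.span_base, rule UnI1, rule CollectI, rule exI[of _ "[]"], rule exI[of _ x], rule exI[of _ y], rule exI[of _ "[]"])
      (use that in \<open>auto simp: words_iff\<close>)
  have smult: "word [c \<odot>\<^bsub>V\<^esub> x] - c \<star> word [x] \<in> ?R" if "x \<in> carrier V" for c x
    unfolding tensor_relations_def multilinear_relations_def
    by (rule chain.span_base, rule UnI2, rule CollectI, rule exI[of _ "[]"], rule exI[of _ c], rule exI[of _ x], rule exI[of _ "[]"])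
      (use that in \<open>auto simp: words_iff\<close>)
  have main: "finite A \<Longrightarrow> A \<subseteq> B \<Longrightarrow> v \<in> supp A \<Longrightarrow> word [vec V \<kappa> v] - ?D v \<in> ?R" for A v
  proof (induction A arbitrary: v rule: finite_induct)
    \<comment> \<open>The word of the zero vector is itself a relation, namely the one for scaling
      the zero vector by 0.\<close>
    case empty
    have z: "vec V \<kappa> 0 = \<zero>\<^bsub>V\<^esub>" using vec_coord[OF V closed(3)] coord_zero[OF V] by simp
    have "0 \<odot>\<^bsub>V\<^esub> \<zero>\<^bsub>V\<^esub> = \<zero>\<^bsub>V\<^esub>"
      by (rule coord_inj[OF V]) (use closed in \<open>auto simp: coord_smult[OF V] coord_zero[OF V]\<close>)
    then show ?case using empty smult[OF closed(3), of 0] by (simp add: z chains.linear_0[OF lin_letter])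
  next
    case (insert b A)
    define c where "c = Poly_Mapping.lookup v b"
    define v' where "v' = v - c \<star> word b"
    have v': "v' \<in> supp A" using insert.prems insert.hyps
      by (auto simp: supp_def v'_def c_def in_keys_iff lookup_minus lookup_single when_def subset_iff split: if_splits)
    then have v'B: "v' \<in> supp B" and vB: "v \<in> supp B" using insert.prems by (auto elim: supp_mono)
    have bB: "word b \<in> supp B" using insert.prems by simp
    let ?x = "vec V \<kappa> v'" and ?y = "vec V \<kappa> (word b)"
    have xy: "?x \<in> carrier V" "?y \<in> carrier V" using vec_closed[OF V] v'B bB by auto
    have "vec V \<kappa> v = ?x \<oplus>\<^bsub>V\<^esub> c \<odot>\<^bsub>V\<^esub> ?y"
    proof (rule coord_inj[OF V])
      show "\<kappa> (vec V \<kappa> v) = \<kappa> (?x \<oplus>\<^bsub>V\<^esub> c \<odot>\<^bsub>V\<^esub> ?y)"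
        using xy closed v'B bB vB by (simp add: coord_add[OF V] coord_smult[OF V] coord_vec[OF V] v'_def)
    qed (use xy closed vB vec_closed[OF V] in auto)
    moreover have "?D v = ?D v' + c \<star> word [?y]"
    proof -
      have "v = v' + c \<star> word b" by (simp add: v'_def)
      then have "relabel (\<lambda>b. vec V \<kappa> (word b)) v = relabel (\<lambda>b. vec V \<kappa> (word b)) v' + c \<star> word ?y"
        by (simp only: chains.linear_add[OF lin_relabel] chains.linear_scale[OF lin_relabel] relabel_single)
      then show ?thesis by (simp only: chains.linear_add[OF lin_letter] chains.linear_scale[OF lin_letter] letter_word)
    qed
    ultimately have "word [vec V \<kappa> v] - ?D v = (word [?x \<oplus>\<^bsub>V\<^esub> c \<odot>\<^bsub>V\<^esub> ?y] - word [?x] - word [c \<odot>\<^bsub>V\<^esub> ?y])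
        + (word [?x] - ?D v') + (word [c \<odot>\<^bsub>V\<^esub> ?y] - c \<star> word [?y])"
      by simp
    also have "\<dots> \<in> ?R"
      by (intro chain.subspace_add subspace_relations add smult insert.IH) (use xy closed insert.prems v' in auto)
    finally show ?case .
  qed
  show "v \<in> supp B \<Longrightarrow> word [vec V \<kappa> v] - ?D v \<in> ?R"
    by (rule main[of "Poly_Mapping.keys v"]) (auto simp: supp_def)
qed

lemma thom_supp_words:
  assumes "coord V B \<kappa>" "u \<in> supp (words V m)"
  shows "thom \<kappa> u \<in> supp (words_on B m)"
proof (rule lin_supp[OF lin_thom assms(2)])
  fix w assume "w \<in> words V m"
  then show "thom \<kappa> (word w) \<in> supp (words_on B m)"
    using tensor_supp[of "map \<kappa> w" B] coord_supp[OF assms(1)] by (auto simp: words_iff)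
qed

context
  fixes V :: "('k::field, 'v) module" and B :: "'b set" and \<kappa>
  assumes V: "coord V B \<kappa>"
begin

text \<open>A section of the coordinate map on tensor powers: basis letters are read as vectors of
  \<open>V\<close>.\<close>

private definition "dec = thom (\<lambda>b. word (vec V \<kappa> (word b)))"

lemma dec_supp: "u \<in> supp (words_on B m) \<Longrightarrow> dec u \<in> supp (words V m)"
  unfolding dec_def
  by (rule lin_supp[OF lin_thom]) (auto simp: words_on_def words_iff intro!: vec_closed[OF V])

lemma thom_dec: "u \<in> supp (words_on B m) \<Longrightarrow> thom \<kappa> (dec u) = u"
proof (rule lin_eq_supp[of "\<lambda>u. thom \<kappa> (dec u)"])
  fix w assume "w \<in> words_on B m"
  then have "map (\<lambda>b. \<kappa> (vec V \<kappa> (word b))) w = map (\<lambda>b. word b) w"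
    by (auto simp: words_on_def intro!: coord_vec[OF V])
  then show "thom \<kappa> (dec (word w)) = word w"
    by (simp only: dec_def thom_word tensor_map_word) (simp only: thom_word map_map comp_def tensor_words)
qed (auto intro!: lin_intros simp: dec_def)

lemma dec_thom: "w \<in> words V m \<Longrightarrow> word w - dec (thom \<kappa> (word w)) \<in> tensor_relations V m"
proof (induction w arbitrary: m)
  case Nil
  then show ?case by (simp add: dec_def chain.subspace_0[OF subspace_relations])
next
  case (Cons a w)
  then obtain n where m: "m = Suc n" and w: "w \<in> words V n" "a \<in> carrier V" by (auto simp: words_iff)
  let ?l = "letter (relabel (\<lambda>b. vec V \<kappa> (word b)) (\<kappa> a))" and ?t = "tensor (map \<kappa> w)"
  have "dec (thom \<kappa> (word (a # w))) = ?l * dec ?t"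
    by (simp add: dec_def thom_mult relabel_def)
  then have "word (a # w) - dec (thom \<kappa> (word (a # w))) = (word [a] - ?l) * word w + ?l * (word w - dec ?t)"
    by (simp add: left_diff_distrib right_diff_distrib word_mult)
  moreover have "(word [a] - ?l) * word w \<in> tensor_relations V m"
    using relations_mult_right[OF w(1) relations_1[OF V coord_supp[OF V w(2)]]] vec_coord[OF V w(2)] m by simp
  moreover have "?l * (word w - dec ?t) \<in> tensor_relations V m"
  proof (rule lin_in_subspace[of "\<lambda>v. letter (relabel (\<lambda>b. vec V \<kappa> (word b)) v) * (word w - dec ?t)", OF _ coord_supp[OF V w(2)] subspace_relations])
    fix b assume "b \<in> B"
    then have "word [vec V \<kappa> (word b)] * (word w - dec ?t) \<in> tensor_relations V (Suc n)"
      by (intro relations_mult_left vec_closed[OF V]) (use Cons.IH[OF w(1)] in auto)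
    then show "letter (relabel (\<lambda>b. vec V \<kappa> (word b)) (word b)) * (word w - dec ?t) \<in> tensor_relations V m"
      by (simp add: m)
  qed (auto intro!: lin_intros)
  ultimately show ?case using chain.subspace_add[OF subspace_relations] by metis
qed

text \<open>Membership in a span of relations becomes a computation. The relations lie in the kernel
  because the tensor is multilinear; conversely every \<open>u\<close> agrees with
  \<open>dec (thom \<kappa> u)\<close> modulo relations, by \<open>dec_thom\<close> on
  words.\<close>

lemma relations_eq_kernel: "tensor_relations V m = {u \<in> supp (words V m). thom \<kappa> u = 0}"
proof
  note closed = ground_module_closed[OF coord_module[OF V]]
  have sub: "chain.subspace {u \<in> supp (words V m). thom \<kappa> u = 0}"
    by (auto simp: chain.subspace_def chains.linear_add[OF lin_thom] chains.linear_0[OF lin_thom]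
      chains.linear_scale[OF lin_thom] intro: supp_intros)
  show "tensor_relations V m \<subseteq> {u \<in> supp (words V m). thom \<kappa> u = 0}"
    unfolding tensor_relations_def
  proof (rule chain.span_minimal[OF _ sub], unfold multilinear_relations_def, safe)
    fix xs x y ys assume w: "xs @ [x] @ ys \<in> words V m" "y \<in> carrier V"
    show "word (xs @ [x \<oplus>\<^bsub>V\<^esub> y] @ ys) - word (xs @ [x] @ ys) - word (xs @ [y] @ ys) \<in> supp (words V m)"
      by (intro supp_diff) (use w closed in \<open>auto simp: words_iff\<close>)
    show "thom \<kappa> (word (xs @ [x \<oplus>\<^bsub>V\<^esub> y] @ ys) - word (xs @ [x] @ ys) - word (xs @ [y] @ ys)) = 0"
      using w by (simp add: chains.linear_diff[OF lin_thom] tensor_append words_iff coord_add[OF V]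
        chains.linear_add[OF lin_letter] distrib_left distrib_right)
  next
    fix xs c x ys assume w: "xs @ [x] @ ys \<in> words V m"
    show "word (xs @ [c \<odot>\<^bsub>V\<^esub> x] @ ys) - c \<star> word (xs @ [x] @ ys) \<in> supp (words V m)"
      by (intro supp_diff supp_scale) (use w closed in \<open>auto simp: words_iff\<close>)
    show "thom \<kappa> (word (xs @ [c \<odot>\<^bsub>V\<^esub> x] @ ys) - c \<star> word (xs @ [x] @ ys)) = 0"
      using w by (simp add: chains.linear_diff[OF lin_thom] chains.linear_scale[OF lin_thom] tensor_append words_iff
        coord_smult[OF V] chains.linear_scale[OF lin_letter] del: scale_chain_single)
  qed
  show "{u \<in> supp (words V m). thom \<kappa> u = 0} \<subseteq> tensor_relations V m"
  proof safe
    fix u assume u: "u \<in> supp (words V m)" "thom \<kappa> u = 0"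
    have "u - dec (thom \<kappa> u) \<in> tensor_relations V m"
    proof (rule lin_in_subspace[of "\<lambda>u. u - dec (thom \<kappa> u)", OF _ u(1) subspace_relations])
      show "word w - dec (thom \<kappa> (word w)) \<in> tensor_relations V m" if "w \<in> words V m" for w
        by (rule dec_thom[OF that])
    qed (auto intro!: lin_intros simp: dec_def)
    then show "u \<in> tensor_relations V m" using u by (simp add: dec_def chains.linear_0[OF lin_thom])
  qed
qed

lemma thom_words_surj: "u \<in> supp (words_on B m) \<Longrightarrow> \<exists>x\<in>supp (words V m). thom \<kappa> x = u"
  using dec_supp thom_dec by blast

end

text \<open>An element of a tensor power is a fibre of the coordinate map.\<close>

definition fibre :: "('k::field, 'v) module \<Rightarrow> ('v \<Rightarrow> ('b \<Rightarrow>\<^sub>0 'k)) \<Rightarrow> nat \<Rightarrow> ('b list \<Rightarrow>\<^sub>0 'k) \<Rightarrow> ('v list \<Rightarrow>\<^sub>0 'k) set" where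
  "fibre V \<kappa> m c = {x \<in> supp (words V m). thom \<kappa> x = c}"

text \<open>The chain groups are written multiplicatively and have cosets or families of cosets as
  elements. An additive bijection from chains on \<open>B\<close> allows all computations to be made
  with chains.\<close>

definition pres :: "'c monoid \<Rightarrow> 'x set \<Rightarrow> (('x \<Rightarrow>\<^sub>0 'k::field) \<Rightarrow> 'c) \<Rightarrow> bool" where
  "pres G B \<phi> \<longleftrightarrow> bij_betw \<phi> (supp B) (carrier G) \<and> \<phi> 0 = \<one>\<^bsub>G\<^esub> \<and>
     (\<forall>x\<in>supp B. \<forall>y\<in>supp B. \<phi> (x + y) = \<phi> x \<otimes>\<^bsub>G\<^esub> \<phi> y)"

lemma presD:
  assumes "pres G B \<phi>"
  shows pres_closed: "x \<in> supp B \<Longrightarrow> \<phi> x \<in> carrier G"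
    and pres_zero: "\<phi> 0 = \<one>\<^bsub>G\<^esub>"
    and pres_add: "x \<in> supp B \<Longrightarrow> y \<in> supp B \<Longrightarrow> \<phi> (x + y) = \<phi> x \<otimes>\<^bsub>G\<^esub> \<phi> y"
    and pres_inj: "x \<in> supp B \<Longrightarrow> y \<in> supp B \<Longrightarrow> \<phi> x = \<phi> y \<longleftrightarrow> x = y"
    and pres_surj: "g \<in> carrier G \<Longrightarrow> \<exists>x\<in>supp B. g = \<phi> x"
  using assms by (auto simp: pres_def bij_betw_def inj_on_def)

lemma pres_comm_group:
  assumes "pres G B \<phi>" shows "comm_group G"
proof (rule comm_groupI)
  fix x y z assume "x \<in> carrier G" "y \<in> carrier G" "z \<in> carrier G"
  then obtain a b c where abc: "x = \<phi> a" "y = \<phi> b" "z = \<phi> c" "a \<in> supp B" "b \<in> supp B" "c \<in> supp B"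
    using pres_surj[OF assms] by metis
  note add = pres_add[OF assms, symmetric]
  show "x \<otimes>\<^bsub>G\<^esub> y \<in> carrier G" using abc by (simp add: add pres_closed[OF assms] supp_add)
  show "x \<otimes>\<^bsub>G\<^esub> y \<otimes>\<^bsub>G\<^esub> z = x \<otimes>\<^bsub>G\<^esub> (y \<otimes>\<^bsub>G\<^esub> z)" using abc by (simp add: add supp_add add.assoc)
  show "x \<otimes>\<^bsub>G\<^esub> y = y \<otimes>\<^bsub>G\<^esub> x" using abc by (simp add: add add.commute)
next
  fix x assume "x \<in> carrier G"
  then obtain a where a: "x = \<phi> a" "a \<in> supp B" using pres_surj[OF assms] by metis
  show "\<one>\<^bsub>G\<^esub> \<otimes>\<^bsub>G\<^esub> x = x" using a pres_add[OF assms, of 0 a] by (simp add: pres_zero[OF assms])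
  show "\<exists>y\<in>carrier G. y \<otimes>\<^bsub>G\<^esub> x = \<one>\<^bsub>G\<^esub>"
    using a pres_add[OF assms, of "- a" a] pres_closed[OF assms supp_neg[OF a(2)]]
    by (auto simp: pres_zero[OF assms] supp_neg)
qed (use pres_closed[OF assms, of 0] pres_zero[OF assms] in simp)

lemma pres_inv:
  assumes "pres G B \<phi>" "x \<in> supp B" shows "inv\<^bsub>G\<^esub> \<phi> x = \<phi> (- x)"
proof -
  interpret comm_group G by (rule pres_comm_group[OF assms(1)])
  show ?thesis
    by (rule inv_equality)
      (use pres_add[OF assms(1), of "- x" x] assms pres_closed[OF assms(1)] in \<open>auto simp: pres_zero[OF assms(1)] supp_neg\<close>)
qed

lemma pres_sign:
  assumes "pres G B \<phi>" "x \<in> supp B"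
  shows "\<phi> x [^]\<^bsub>G\<^esub> ((- 1) ^ i :: int) = \<phi> ((- 1) ^ i \<star> x)"
proof -
  interpret comm_group G by (rule pres_comm_group[OF assms(1)])
  have x: "\<phi> x \<in> carrier G" by (rule pres_closed[OF assms])
  show ?thesis
    by (cases "even i") (use x in \<open>simp_all add: int_pow_neg int_pow_1 pres_inv[OF assms]\<close>)
qed

lemma pres_finprod:
  assumes "pres G B \<phi>" "finite J" "\<And>j. j \<in> J \<Longrightarrow> f j \<in> supp B"
  shows "finprod G (\<lambda>j. \<phi> (f j)) J = \<phi> (\<Sum>j\<in>J. f j)"
proof -
  interpret comm_group G by (rule pres_comm_group[OF assms(1)])
  show ?thesis using assms(2,3)
  proof (induction J rule: finite_induct)
    case (insert j J)
    then have "finprod G (\<lambda>j. \<phi> (f j)) (insert j J) = \<phi> (f j) \<otimes>\<^bsub>G\<^esub> \<phi> (\<Sum>j\<in>J. f j)"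
      by (subst finprod_insert) (auto intro: pres_closed[OF assms(1)])
    then show ?case using insert pres_add[OF assms(1), of "f j" "\<Sum>j\<in>J. f j"] by (simp add: supp_sum)
  qed (simp add: pres_zero[OF assms(1)])
qed

lemma pres_tensor_power:
  assumes V: "coord V B \<kappa>"
  shows "pres (tensor_power V m) (words_on B m) (fibre V \<kappa> m)"
proof -
  let ?F = "free_space (words V m) :: ('a list \<Rightarrow>\<^sub>0 'b) monoid" and ?R = "tensor_relations V m"
  have carF: "carrier ?F = supp (words V m)" by (auto simp: free_space_def supp_def)
  have coset: "?R #>\<^bsub>?F\<^esub> x = fibre V \<kappa> m (thom \<kappa> x)" if x: "x \<in> supp (words V m)" for x
  proof
    show "?R #>\<^bsub>?F\<^esub> x \<subseteq> fibre V \<kappa> m (thom \<kappa> x)"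
      using x by (auto simp: r_coset_def free_space_def fibre_def relations_eq_kernel[OF V] chains.linear_add[OF lin_thom] supp_add)
    show "fibre V \<kappa> m (thom \<kappa> x) \<subseteq> ?R #>\<^bsub>?F\<^esub> x"
    proof
      fix y assume "y \<in> fibre V \<kappa> m (thom \<kappa> x)"
      then have "y - x \<in> ?R" using x by (auto simp: relations_eq_kernel[OF V] fibre_def chains.linear_diff[OF lin_thom] supp_diff)
      then show "y \<in> ?R #>\<^bsub>?F\<^esub> x"
        by (auto simp: r_coset_def free_space_def intro!: bexI[of _ "y - x"])
    qed
  qed
  have inj: "inj_on (fibre V \<kappa> m) (supp (words_on B m))"
  proof (rule inj_onI)
    fix c d assume "c \<in> supp (words_on B m)" "fibre V \<kappa> m c = fibre V \<kappa> m d"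
    then show "c = d" using thom_words_surj[OF V, of c m] by (auto simp: fibre_def)
  qed
  have "carrier (tensor_power V m) = (\<lambda>x. ?R #>\<^bsub>?F\<^esub> x) ` supp (words V m)"
    by (auto simp: tensor_power_def FactGroup_def RCOSETS_def carF)
  also have "\<dots> = fibre V \<kappa> m ` thom \<kappa> ` supp (words V m)"
    by (simp add: image_image coset)
  also have "thom \<kappa> ` supp (words V m) = supp (words_on B m)"
    using thom_words_surj[OF V, of _ m] thom_supp_words[OF V, of _ m] by (auto simp: image_iff)
  finally have bij: "bij_betw (fibre V \<kappa> m) (supp (words_on B m)) (carrier (tensor_power V m))"
    using inj by (simp add: bij_betw_def)
  have "fibre V \<kappa> m 0 = \<one>\<^bsub>tensor_power V m\<^esub>"
    by (simp add: tensor_power_def FactGroup_def relations_eq_kernel[OF V] fibre_def)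
  moreover have "fibre V \<kappa> m (c + d) = fibre V \<kappa> m c \<otimes>\<^bsub>tensor_power V m\<^esub> fibre V \<kappa> m d"
    if c: "c \<in> supp (words_on B m)" for c d
  proof
    show "fibre V \<kappa> m c \<otimes>\<^bsub>tensor_power V m\<^esub> fibre V \<kappa> m d \<subseteq> fibre V \<kappa> m (c + d)"
      by (auto simp: tensor_power_def FactGroup_def set_mult_def free_space_def fibre_def chains.linear_add[OF lin_thom] supp_add)
    show "fibre V \<kappa> m (c + d) \<subseteq> fibre V \<kappa> m c \<otimes>\<^bsub>tensor_power V m\<^esub> fibre V \<kappa> m d"
    proof
      fix z assume z: "z \<in> fibre V \<kappa> m (c + d)"
      obtain x where x: "x \<in> supp (words V m)" "thom \<kappa> x = c" using thom_words_surj[OF V c] by blast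
      have "z = x + (z - x)" "z - x \<in> fibre V \<kappa> m d"
        using x z by (auto simp: fibre_def chains.linear_diff[OF lin_thom] supp_diff)
      then show "z \<in> fibre V \<kappa> m c \<otimes>\<^bsub>tensor_power V m\<^esub> fibre V \<kappa> m d"
        using x(1) x(2)[symmetric] unfolding tensor_power_def FactGroup_def set_mult_def free_space_def
        by (simp, intro bexI[of _ x] bexI[of _ "z - x"]) (auto simp: fibre_def)
    qed
  qed
  ultimately show ?thesis using bij by (simp add: pres_def)
qed

text \<open>In coordinates the map on cosets is \<open>F\<close>, so it is well defined: the fibre
  of \<open>c\<close> goes into the fibre of \<open>F c\<close>, and the whole fibre is reached
  because two of its elements differ by a relation.\<close>

lemma tensor_hom_fibre:
  assumes V: "coord V B \<kappa>" and V': "coord V' B' \<kappa>'" and F: "lin F"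
    and f: "\<And>w. w \<in> words V m \<Longrightarrow> f w \<in> supp (words V' m')"
      "\<And>w. w \<in> words V m \<Longrightarrow> thom \<kappa>' (f w) = F (tensor (map \<kappa> w))"
    and c: "c \<in> supp (words_on B m)"
  shows "tensor_hom V' m' f (fibre V \<kappa> m c) = fibre V' \<kappa>' m' (F c)"
proof -
  have closed: "linear_extension f x \<in> supp (words V' m')" if "x \<in> supp (words V m)" for x
    by (rule lin_supp[OF lin_linear_extension that]) (simp add: f)
  have eq: "thom \<kappa>' (linear_extension f x) = F (thom \<kappa> x)" if "x \<in> supp (words V m)" for x
    by (rule lin_eq_supp[of "\<lambda>x. thom \<kappa>' (linear_extension f x)", OF _ _ that])
      (auto intro!: lin_intros lin_comp[OF F] simp: f)
  obtain x where x: "x \<in> supp (words V m)" "thom \<kappa> x = c" using thom_words_surj[OF V c] by blast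
  show ?thesis
  proof
    show "tensor_hom V' m' f (fibre V \<kappa> m c) \<subseteq> fibre V' \<kappa>' m' (F c)"
      by (auto simp: tensor_hom_def quotient_hom_def set_mult_def free_space_def fibre_def
        relations_eq_kernel[OF V'] chains.linear_add[OF lin_thom] eq closed supp_add)
    show "fibre V' \<kappa>' m' (F c) \<subseteq> tensor_hom V' m' f (fibre V \<kappa> m c)"
    proof
      fix y assume "y \<in> fibre V' \<kappa>' m' (F c)"
      then have "y - linear_extension f x \<in> tensor_relations V' m'"
        using x by (auto simp: relations_eq_kernel[OF V'] fibre_def chains.linear_diff[OF lin_thom] eq closed supp_diff)
      then show "y \<in> tensor_hom V' m' f (fibre V \<kappa> m c)"
        using x unfolding tensor_hom_def quotient_hom_def set_mult_def free_space_def fibre_def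
        by (simp, intro bexI[of _ "y - linear_extension f x"] exI[of _ x]) auto
    qed
  qed
qed

section \<open>Coordinates on complexes\<close>

definition tcells :: "(nat \<Rightarrow> nat \<Rightarrow> 'x set) \<Rightarrow> nat \<Rightarrow> (nat \<times> 'x) set" where
  "tcells Bs n = {(p, i). p \<le> n \<and> i \<in> Bs p (n - p)}"

definition tphi :: "(nat \<Rightarrow> nat \<Rightarrow> ('x \<Rightarrow>\<^sub>0 'k::field) \<Rightarrow> 'c) \<Rightarrow> nat \<Rightarrow> (nat \<times> 'x \<Rightarrow>\<^sub>0 'k) \<Rightarrow> nat \<Rightarrow> 'c" where
  "tphi \<phi> n c = (\<lambda>p\<in>{..n}. \<phi> p (n - p) (slice p c))"

lemma slice_tcells:
  assumes "c \<in> supp (tcells Bs n)" "p \<le> n"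
  shows "slice p c \<in> supp (Bs p (n - p))"
proof -
  have "slice p c \<in> supp {x. (p, x) \<in> tcells Bs n}" using iffD1[OF slice_supp_iff assms(1)] by (rule spec)
  then show ?thesis by (rule supp_mono) (auto simp: tcells_def)
qed

lemma slice_tcells_gt:
  assumes "c \<in> supp (tcells Bs n)" "n < p"
  shows "slice p c = 0"
proof -
  have "slice p c \<in> supp {x. (p, x) \<in> tcells Bs n}" using iffD1[OF slice_supp_iff assms(1)] by (rule spec)
  then have "slice p c \<in> supp {}" by (rule supp_mono) (use assms(2) in \<open>auto simp: tcells_def\<close>)
  then show ?thesis by simp
qed

lemma tcellsI: "(\<And>p. p \<le> n \<Longrightarrow> slice p c \<in> supp (Bs p (n - p))) \<Longrightarrow> (\<And>p. n < p \<Longrightarrow> slice p c = 0) \<Longrightarrow> c \<in> supp (tcells Bs n)"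
  unfolding slice_supp_iff[of c] tcells_def
  by (intro allI) (metis (no_types, lifting) Collect_cong case_prodI case_prodD mem_Collect_eq not_le_imp_less subsetI supp_mono supp_zero)

lemma pres_total:
  assumes P: "\<And>p q. pres (bi_grp B p q) (Bs p q) (\<phi> p q)"
  shows "pres (chain_grp (total_complex B) n) (tcells Bs n) (tphi \<phi> n)"
  unfolding pres_def
proof (intro conjI ballI)
  have G: "chain_grp (total_complex B) n = product_group {..n} (\<lambda>p. bi_grp B p (n - p))"
    by (simp add: total_complex_def)
  show "tphi \<phi> n 0 = \<one>\<^bsub>chain_grp (total_complex B) n\<^esub>"
    by (simp add: G tphi_def chains.linear_0[OF lin_slice] pres_zero[OF P])
  show "tphi \<phi> n (x + y) = tphi \<phi> n x \<otimes>\<^bsub>chain_grp (total_complex B) n\<^esub> tphi \<phi> n y"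
    if "x \<in> supp (tcells Bs n)" "y \<in> supp (tcells Bs n)" for x y
    using that by (auto simp: G tphi_def chains.linear_add[OF lin_slice] pres_add[OF P] slice_tcells intro!: restrict_ext)
  show "bij_betw (tphi \<phi> n) (supp (tcells Bs n)) (carrier (chain_grp (total_complex B) n))"
    unfolding bij_betw_def
  proof
    show "inj_on (tphi \<phi> n) (supp (tcells Bs n))"
    proof (rule inj_onI)
      fix x y assume xy: "x \<in> supp (tcells Bs n)" "y \<in> supp (tcells Bs n)" "tphi \<phi> n x = tphi \<phi> n y"
      show "x = y"
      proof (rule slice_eqI)
        fix p show "slice p x = slice p y"
        proof (cases "p \<le> n")
          case True
          then have "\<phi> p (n - p) (slice p x) = \<phi> p (n - p) (slice p y)"
            using fun_cong[OF xy(3), of p] by (simp add: tphi_def)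
          then show ?thesis using pres_inj[OF P] slice_tcells xy True by metis
        qed (use xy in \<open>simp add: slice_tcells_gt\<close>)
      qed
    qed
    show "tphi \<phi> n ` supp (tcells Bs n) = carrier (chain_grp (total_complex B) n)"
    proof
      show "tphi \<phi> n ` supp (tcells Bs n) \<subseteq> carrier (chain_grp (total_complex B) n)"
        by (auto simp: G tphi_def PiE_iff extensional_def intro!: pres_closed[OF P] slice_tcells split: if_splits)
      show "carrier (chain_grp (total_complex B) n) \<subseteq> tphi \<phi> n ` supp (tcells Bs n)"
      proof
        fix z assume z: "z \<in> carrier (chain_grp (total_complex B) n)"
        then have "\<forall>p\<in>{..n}. \<exists>x\<in>supp (Bs p (n - p)). z p = \<phi> p (n - p) x"
          using pres_surj[OF P] by (auto simp: G PiE_iff)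
        then obtain x where x: "\<And>p. p \<le> n \<Longrightarrow> x p \<in> supp (Bs p (n - p)) \<and> z p = \<phi> p (n - p) (x p)"
          by (metis atMost_iff)
        define c where "c = (\<Sum>p\<le>n. put p (x p))"
        have s: "slice p c = (if p \<le> n then x p else 0)" for p
          by (simp add: c_def chains.linear_sum[OF lin_slice] slice_put)
        have "c \<in> supp (tcells Bs n)" by (rule tcellsI) (use x in \<open>auto simp: s\<close>)
        moreover have "z = tphi \<phi> n c"
          using z x by (auto simp: G tphi_def s PiE_iff extensional_def)
        ultimately show "z \<in> tphi \<phi> n ` supp (tcells Bs n)" by blast
      qed
    qed
  qed
qed

text \<open>The condition \<open>V0\<close> is a boundary case: \<open>tot\<close> applies the
  vertical differential in row 0 as well, where the total complex has no target.\<close>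

lemma total_bd:
  assumes P: "\<And>p q. pres (bi_grp B p q) (Bs p q) (\<phi> p q)"
    and h: "\<And>p. lin (h p)" and v: "\<And>p. lin (v p)"
    and H: "\<And>p q c. c \<in> supp (Bs (Suc p) q) \<Longrightarrow> h (Suc p) c \<in> supp (Bs p q) \<and> bi_h B (Suc p) q (\<phi> (Suc p) q c) = \<phi> p q (h (Suc p) c)"
    and V: "\<And>p q c. c \<in> supp (Bs p (Suc q)) \<Longrightarrow> v p c \<in> supp (Bs p q) \<and> bi_v B p (Suc q) (\<phi> p (Suc q) c) = \<phi> p q (v p c)"
    and V0: "\<And>p c. c \<in> supp (Bs p 0) \<Longrightarrow> v p c = 0"
    and c: "c \<in> supp (tcells Bs (Suc n))"
  shows "tot h v c \<in> supp (tcells Bs n)"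
    and "chain_bd (total_complex B) (Suc n) (tphi \<phi> (Suc n) c) = tphi \<phi> n (tot h v c)"
proof -
  have s: "h (Suc p) (slice (Suc p) c) \<in> supp (Bs p (n - p))" "v p (slice p c) \<in> supp (Bs p (n - p))"
    "bi_h B (Suc p) (n - p) (\<phi> (Suc p) (n - p) (slice (Suc p) c)) = \<phi> p (n - p) (h (Suc p) (slice (Suc p) c))"
    "bi_v B p (Suc n - p) (\<phi> p (Suc n - p) (slice p c)) = \<phi> p (n - p) (v p (slice p c))" if p: "p \<le> n" for p
    using H[of "slice (Suc p) c" p "n - p"] V[of "slice p c" p "n - p"] slice_tcells[OF c, of "Suc p"] slice_tcells[OF c, of p] p
    by (auto simp: Suc_diff_le)
  show "tot h v c \<in> supp (tcells Bs n)"
  proof (rule tcellsI)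
    fix p assume p: "n < p"
    have "v p (slice p c) = 0"
    proof (cases "p = Suc n")
      case True
      then show ?thesis using V0 slice_tcells[OF c, of p] by simp
    next
      case False
      then show ?thesis using slice_tcells_gt[OF c, of p] p chains.linear_0[OF v] by simp
    qed
    then show "slice p (tot h v c) = 0"
      using slice_tcells_gt[OF c, of "Suc p"] p chains.linear_0[OF h] by (simp add: slice_tot[OF h v])
  qed (auto simp: slice_tot[OF h v] intro!: supp_add s)
  have "bi_h B (p + 1) (n - p) (tphi \<phi> (Suc n) c (p + 1)) \<otimes>\<^bsub>bi_grp B p (n - p)\<^esub> bi_v B p (Suc n - p) (tphi \<phi> (Suc n) c p)
      = \<phi> p (n - p) (slice p (tot h v c))" if p: "p \<le> n" for p
    using p s[OF p] by (simp add: tphi_def slice_tot[OF h v] pres_add[OF P])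
  then show "chain_bd (total_complex B) (Suc n) (tphi \<phi> (Suc n) c) = tphi \<phi> n (tot h v c)"
    unfolding tphi_def[of \<phi> n] total_complex_def lessThan_Suc_atMost
    by (auto intro!: restrict_ext)
qed

lemma total_map_tphi:
  assumes "\<And>p q c. c \<in> supp (Bs p q) \<Longrightarrow> f p q (\<phi> p q c) = \<phi>' p q (F c)"
    and "\<And>p. slice p (G c) = F (slice p c)" and "c \<in> supp (tcells Bs n)"
  shows "total_map f n (tphi \<phi> n c) = tphi \<phi>' n (G c)"
  unfolding total_map_def tphi_def
  by (auto simp: assms(1)[OF slice_tcells[OF assms(3)]] assms(2) intro!: restrict_ext)

lemma slice_slicewise: "lin F \<Longrightarrow> slice p (slicewise F c) = F (slice p c)"
  by (rule put_eqI[of "\<lambda>c. slice p (slicewise F c)"])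
    (auto intro!: lin_intros lin_comp[of F] simp: slicewise_put slice_put chains.linear_0)

context
  fixes C :: "nat \<Rightarrow> 'c chain_complex" and f and Bs :: "nat \<Rightarrow> nat \<Rightarrow> 'x set"
    and \<phi> :: "nat \<Rightarrow> nat \<Rightarrow> ('x \<Rightarrow>\<^sub>0 'k::field) \<Rightarrow> 'c" and fT d
  assumes P: "\<And>p q. pres (chain_grp (C p) q) (Bs p q) (\<phi> p q)"
    and lin_f: "\<And>p i. lin (fT p i)" and lin_d: "\<And>p. lin (d p)"
    and f: "\<And>p q i c. c \<in> supp (Bs (Suc p) q) \<Longrightarrow> i \<le> Suc p \<Longrightarrow>
      fT (Suc p) i c \<in> supp (Bs p q) \<and> f (Suc p) i q (\<phi> (Suc p) q c) = \<phi> p q (fT (Suc p) i c)"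
    and d: "\<And>p q c. c \<in> supp (Bs p (Suc q)) \<Longrightarrow>
      d p c \<in> supp (Bs p q) \<and> chain_bd (C p) (Suc q) (\<phi> p (Suc q) c) = \<phi> p q (d p c)"
    and d0: "\<And>p c. c \<in> supp (Bs p 0) \<Longrightarrow> d p c = 0"
begin

lemma pres_simplicial: "pres (chain_grp (total_complex (simplicial_bicomplex C f)) n) (tcells Bs n) (tphi \<phi> n)"
  by (rule pres_total) (simp add: simplicial_bicomplex_def P)

lemma simplicial_bd:
  assumes "c \<in> supp (tcells Bs (Suc n))"
  shows "simp_tot fT d c \<in> supp (tcells Bs n)"
    and "chain_bd (total_complex (simplicial_bicomplex C f)) (Suc n) (tphi \<phi> (Suc n) c) = tphi \<phi> n (simp_tot fT d c)"
proof -
  let ?B = "simplicial_bicomplex C f"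
  have P': "pres (bi_grp ?B p q) (Bs p q) (\<phi> p q)" for p q
    by (simp add: simplicial_bicomplex_def P)
  have H: "(\<Sum>i\<le>Suc p. (- 1) ^ i \<star> fT (Suc p) i c) \<in> supp (Bs p q) \<and>
      bi_h ?B (Suc p) q (\<phi> (Suc p) q c) = \<phi> p q (\<Sum>i\<le>Suc p. (- 1) ^ i \<star> fT (Suc p) i c)"
    if c: "c \<in> supp (Bs (Suc p) q)" for p q c
  proof
    have mem: "(- 1) ^ i \<star> fT (Suc p) i c \<in> supp (Bs p q)" if "i \<le> Suc p" for i
      using f[OF c that] by (simp add: supp_scale)
    then show "(\<Sum>i\<le>Suc p. (- 1) ^ i \<star> fT (Suc p) i c) \<in> supp (Bs p q)" by (intro supp_sum) auto
    interpret G: comm_group "chain_grp (C p) q" by (rule pres_comm_group[OF P])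
    have "bi_h ?B (Suc p) q (\<phi> (Suc p) q c) =
        finprod (chain_grp (C p) q) (\<lambda>i. f (Suc p) i q (\<phi> (Suc p) q c) [^]\<^bsub>chain_grp (C p) q\<^esub> ((- 1) ^ i :: int)) {..Suc p}"
      by (simp add: simplicial_bicomplex_def)
    also have "\<dots> = finprod (chain_grp (C p) q) (\<lambda>i. \<phi> p q ((- 1) ^ i \<star> fT (Suc p) i c)) {..Suc p}"
      by (rule G.finprod_cong') (use f[OF c] mem in \<open>auto simp: pres_sign[OF P] intro!: pres_closed[OF P]\<close>)
    also have "\<dots> = \<phi> p q (\<Sum>i\<le>Suc p. (- 1) ^ i \<star> fT (Suc p) i c)"
      by (rule pres_finprod[OF P]) (use mem in auto)
    finally show "bi_h ?B (Suc p) q (\<phi> (Suc p) q c) = \<phi> p q (\<Sum>i\<le>Suc p. (- 1) ^ i \<star> fT (Suc p) i c)" .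
  qed
  have V: "(- 1) ^ p \<star> d p c \<in> supp (Bs p q) \<and> bi_v ?B p (Suc q) (\<phi> p (Suc q) c) = \<phi> p q ((- 1) ^ p \<star> d p c)"
    if "c \<in> supp (Bs p (Suc q))" for p q c
    using d[OF that] by (simp add: simplicial_bicomplex_def pres_sign[OF P] supp_scale)
  have linh: "\<And>p. lin (\<lambda>u. \<Sum>i\<le>p. (- 1) ^ i \<star> fT p i u)" and linv: "\<And>p. lin (\<lambda>u. (- 1) ^ p \<star> d p u)"
    by (intro lin_intros lin_f lin_d)+
  show "simp_tot fT d c \<in> supp (tcells Bs n)"
    "chain_bd (total_complex (simplicial_bicomplex C f)) (Suc n) (tphi \<phi> (Suc n) c) = tphi \<phi> n (simp_tot fT d c)"
    unfolding simp_tot_def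
    by (rule total_bd[OF P' linh linv H V _ assms]; simp add: d0)+
qed

end

subsection \<open>Quasi-isomorphisms\<close>

text \<open>In coordinates, homology is that of \<open>d\<close> on spans of cells, and a chain map given by an
  inclusion of cells is a quasi-isomorphism if the quotient is acyclic.\<close>

definition pres_complex :: "'c chain_complex \<Rightarrow> (nat \<Rightarrow> 'x set) \<Rightarrow> (nat \<Rightarrow> ('x \<Rightarrow>\<^sub>0 'k::field) \<Rightarrow> 'c) \<Rightarrow> (('x \<Rightarrow>\<^sub>0 'k) \<Rightarrow> ('x \<Rightarrow>\<^sub>0 'k)) \<Rightarrow> bool"
  where "pres_complex C X \<phi> d \<longleftrightarrow> lin d \<and> (\<forall>u. d (d u) = 0) \<and> (\<forall>n. pres (chain_grp C n) (X n) (\<phi> n)) \<and>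
    (\<forall>u\<in>supp (X 0). d u = 0) \<and>
    (\<forall>n. \<forall>u\<in>supp (X (Suc n)). d u \<in> supp (X n) \<and> chain_bd C (Suc n) (\<phi> (Suc n) u) = \<phi> n (d u))"

lemma pres_complexD:
  assumes "pres_complex C X \<phi> d"
  shows "lin d" "d (d u) = 0" "pres (chain_grp C n) (X n) (\<phi> n)" "u \<in> supp (X 0) \<Longrightarrow> d u = 0"
    "u \<in> supp (X (Suc n)) \<Longrightarrow> d u \<in> supp (X n)"
    "u \<in> supp (X (Suc n)) \<Longrightarrow> chain_bd C (Suc n) (\<phi> (Suc n) u) = \<phi> n (d u)"
  using assms by (auto simp: pres_complex_def)

lemma pres_cycles:
  assumes C: "pres_complex C X \<phi> d"
  shows "cycles C n = \<phi> n ` {z \<in> supp (X n). d z = 0}"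
proof -
  note P = pres_complexD(3)[OF C]
  have img: "carrier (chain_grp C n) = \<phi> n ` supp (X n)" for n
    using P[of n] by (auto simp: pres_def bij_betw_def)
  show ?thesis
  proof (cases n)
    case 0
    then show ?thesis using pres_complexD(4)[OF C] by (auto simp: cycles_def img)
  next
    case (Suc k)
    have "\<phi> k (d z) = \<one>\<^bsub>chain_grp C k\<^esub> \<longleftrightarrow> d z = 0" if "z \<in> supp (X (Suc k))" for z
      using pres_inj[OF P, of "d z" k 0] pres_zero[OF P] pres_complexD(5)[OF C that] by auto
    then show ?thesis using Suc pres_complexD(6)[OF C] pres_zero[OF P, of k] by (auto simp: cycles_def kernel_def img)
  qed
qed

lemma pres_boundaries:
  assumes C: "pres_complex C X \<phi> d"
  shows "boundaries C n = \<phi> n ` d ` supp (X (Suc n))"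
proof -
  have "carrier (chain_grp C (Suc n)) = \<phi> (Suc n) ` supp (X (Suc n))"
    using pres_complexD(3)[OF C, of "Suc n"] by (auto simp: pres_def bij_betw_def)
  then show ?thesis using pres_complexD(6)[OF C] by (auto simp: boundaries_def image_iff)
qed

text \<open>The homology class of a cycle \<open>z\<close> if \<open>Bd\<close> is the set of
  boundaries, transported to group elements.\<close>

definition hclass :: "(('x \<Rightarrow>\<^sub>0 'k::field) \<Rightarrow> 'c) \<Rightarrow> ('x \<Rightarrow>\<^sub>0 'k) set \<Rightarrow> ('x \<Rightarrow>\<^sub>0 'k) \<Rightarrow> 'c set" where
  "hclass \<phi> Bd z = \<phi> ` {b + z | b. b \<in> Bd}"

lemma coset_absorb:
  assumes "0 \<in> B1" "\<And>b b'. b \<in> B1 \<Longrightarrow> b' \<in> B2 \<Longrightarrow> b' + b \<in> B2"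
  shows "{\<psi> ((b' + b) + z) | b b'. b \<in> B1 \<and> b' \<in> B2} = hclass \<psi> B2 z"
proof (intro equalityI subsetI)
  fix x assume "x \<in> {\<psi> ((b' + b) + z) | b b'. b \<in> B1 \<and> b' \<in> B2}"
  then obtain b b' where "x = \<psi> ((b' + b) + z)" "b \<in> B1" "b' \<in> B2" by blast
  then show "x \<in> hclass \<psi> B2 z" using assms(2) unfolding hclass_def by blast
next
  fix x assume "x \<in> hclass \<psi> B2 z"
  then obtain b where b: "x = \<psi> (b + z)" "b \<in> B2" unfolding hclass_def by blast
  then have "x = \<psi> ((b + 0) + z)" by simp
  then show "x \<in> {\<psi> ((b' + b) + z) | b b'. b \<in> B1 \<and> b' \<in> B2}" using assms(1) b(2) by blast
qed

lemma hclass_shift: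
  assumes "\<And>b. b \<in> B \<Longrightarrow> b + e \<in> B" "\<And>b. b \<in> B \<Longrightarrow> b - e \<in> B"
  shows "hclass \<psi> B (z + e) = hclass \<psi> B z"
proof -
  have "{b + (z + e) | b. b \<in> B} = {b + z | b. b \<in> B}"
  proof (intro equalityI subsetI)
    fix x assume "x \<in> {b + (z + e) | b. b \<in> B}"
    then obtain b where "b \<in> B" "x = (b + e) + z" by (auto simp: algebra_simps)
    then show "x \<in> {b + z | b. b \<in> B}" using assms(1) by blast
  next
    fix x assume "x \<in> {b + z | b. b \<in> B}"
    then obtain b where "b \<in> B" "x = (b - e) + (z + e)" by (auto simp: algebra_simps)
    then show "x \<in> {b + (z + e) | b. b \<in> B}" using assms(2) by blast
  qed
  then show ?thesis by (simp add: hclass_def)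
qed

context
  fixes C :: "'c chain_complex" and X :: "nat \<Rightarrow> 'x set" and \<phi> :: "nat \<Rightarrow> ('x \<Rightarrow>\<^sub>0 'k::field) \<Rightarrow> 'c" and d
  assumes C: "pres_complex C X \<phi> d"
begin

lemma bd_add: "b \<in> d ` supp (X m) \<Longrightarrow> b' \<in> d ` supp (X m) \<Longrightarrow> b + b' \<in> d ` supp (X m)"
  by (metis (no_types, lifting) image_iff chains.linear_add[OF pres_complexD(1)[OF C]] supp_add)

lemma bd_zero: "0 \<in> d ` supp (X m)"
  by (metis image_eqI chains.linear_0[OF pres_complexD(1)[OF C]] supp_zero)

lemma bd_neg: "b \<in> d ` supp (X m) \<Longrightarrow> - b \<in> d ` supp (X m)"
  by (metis (no_types, lifting) image_iff chains.linear_neg[OF pres_complexD(1)[OF C]] supp_neg)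

lemma bd_supp: "b \<in> d ` supp (X (Suc n)) \<Longrightarrow> b \<in> supp (X n)"
  using pres_complexD(5)[OF C] by auto

lemma carrier_homology: "carrier (homology C n) = hclass (\<phi> n) (d ` supp (X (Suc n))) ` {z \<in> supp (X n). d z = 0}"
proof -
  have "boundaries C n #>\<^bsub>chain_grp C n\<lparr>carrier := cycles C n\<rparr>\<^esub> \<phi> n z = hclass (\<phi> n) (d ` supp (X (Suc n))) z"
    if "z \<in> supp (X n)" for z
    using bd_supp that
    by (auto simp: r_coset_def hclass_def pres_boundaries[OF C] pres_add[OF pres_complexD(3)[OF C], symmetric] image_iff)
  then have "(\<lambda>z. boundaries C n #>\<^bsub>chain_grp C n\<lparr>carrier := cycles C n\<rparr>\<^esub> \<phi> n z) ` {z \<in> supp (X n). d z = 0} =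
      hclass (\<phi> n) (d ` supp (X (Suc n))) ` {z \<in> supp (X n). d z = 0}"
    by (intro image_cong) auto
  moreover have "carrier (homology C n) =
      (\<lambda>z. boundaries C n #>\<^bsub>chain_grp C n\<lparr>carrier := cycles C n\<rparr>\<^esub> \<phi> n z) ` {z \<in> supp (X n). d z = 0}"
    by (auto simp: homology_def FactGroup_def RCOSETS_def pres_cycles[OF C])
  ultimately show ?thesis by simp
qed

lemma mult_homology:
  assumes "z \<in> supp (X n)" "z' \<in> supp (X n)"
  shows "hclass (\<phi> n) (d ` supp (X (Suc n))) z \<otimes>\<^bsub>homology C n\<^esub> hclass (\<phi> n) (d ` supp (X (Suc n))) z' =
    hclass (\<phi> n) (d ` supp (X (Suc n))) (z + z')"
proof -
  let ?Bd = "d ` supp (X (Suc n))"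
  note add = pres_add[OF pres_complexD(3)[OF C], symmetric]
  have "hclass (\<phi> n) ?Bd z \<otimes>\<^bsub>homology C n\<^esub> hclass (\<phi> n) ?Bd z' =
      {\<phi> n (b + z) \<otimes>\<^bsub>chain_grp C n\<^esub> \<phi> n (b' + z') | b b'. b \<in> ?Bd \<and> b' \<in> ?Bd}"
    by (auto simp: homology_def FactGroup_def set_mult_def hclass_def)
  also have "\<dots> = {\<phi> n ((b' + b) + (z + z')) | b b'. b \<in> ?Bd \<and> b' \<in> ?Bd}"
  proof -
    have "\<phi> n (b + z) \<otimes>\<^bsub>chain_grp C n\<^esub> \<phi> n (b' + z') = \<phi> n ((b' + b) + (z + z'))" if "b \<in> ?Bd" "b' \<in> ?Bd" for b b'
      by (subst add) (use assms bd_supp that in \<open>auto intro: supp_add simp: algebra_simps\<close>)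
    then show ?thesis by (metis (no_types, lifting))
  qed
  also have "\<dots> = hclass (\<phi> n) ?Bd (z + z')"
    by (rule coset_absorb[OF bd_zero]) (rule bd_add)
  finally show ?thesis .
qed

end

lemma quasi_iso_inclusion:
  assumes C: "pres_complex C X \<phi> d" and D: "pres_complex D Y \<psi> d"
    and XY: "\<And>n. X n \<subseteq> Y n"
    and f: "\<And>n u. u \<in> supp (X n) \<Longrightarrow> f n (\<phi> n u) = \<psi> n u"
    and acyclic: "\<And>n u. u \<in> supp (Y n) \<Longrightarrow> d u \<in> supp (X (n - 1)) \<Longrightarrow> \<exists>v\<in>supp (Y (Suc n)). u - d v \<in> supp (X n)"
  shows "quasi_isomorphism C D f"
  unfolding quasi_isomorphism_def
proof (intro conjI allI)
  note PC = pres_complexD(3)[OF C] and PD = pres_complexD(3)[OF D]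
  have sub: "u \<in> supp (X n) \<Longrightarrow> u \<in> supp (Y n)" for u n by (erule supp_mono) (rule XY)
  have imgC: "x \<in> carrier (chain_grp C n) \<Longrightarrow> \<exists>u\<in>supp (X n). x = \<phi> n u" for x n
    using pres_surj[OF PC] by blast
  show "is_chain_map C D f"
    unfolding is_chain_map_def
  proof (intro conjI allI ballI)
    fix n
    show "f n \<in> hom (chain_grp C n) (chain_grp D n)"
    proof (rule homI)
      fix x y assume "x \<in> carrier (chain_grp C n)" "y \<in> carrier (chain_grp C n)"
      then obtain u v where "x = \<phi> n u" "y = \<phi> n v" "u \<in> supp (X n)" "v \<in> supp (X n)" using imgC by meson
      then show "f n x \<in> carrier (chain_grp D n)" "f n (x \<otimes>\<^bsub>chain_grp C n\<^esub> y) = f n x \<otimes>\<^bsub>chain_grp D n\<^esub> f n y"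
        by (auto simp: f pres_add[OF PC, symmetric] supp_add pres_add[OF PD, symmetric] sub intro: pres_closed[OF PD])
    qed
    fix x assume "x \<in> carrier (chain_grp C (Suc n))"
    then obtain u where "x = \<phi> (Suc n) u" "u \<in> supp (X (Suc n))" using imgC by meson
    then show "f n (chain_bd C (Suc n) x) = chain_bd D (Suc n) (f (Suc n) x)"
      by (simp add: f pres_complexD(5,6)[OF C] pres_complexD(6)[OF D] sub)
  qed
  fix n
  let ?BC = "d ` supp (X (Suc n))" and ?BD = "d ` supp (Y (Suc n))"
  let ?ZC = "{z \<in> supp (X n). d z = 0}" and ?ZD = "{z \<in> supp (Y n). d z = 0}"
  note lin = pres_complexD(1)[OF C] and dd = pres_complexD(2)[OF C]
  have BCD: "?BC \<subseteq> ?BD" using sub by auto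
  have hm: "homology_map D f n (hclass (\<phi> n) ?BC z) = hclass (\<psi> n) ?BD z" if z: "z \<in> supp (X n)" for z
  proof -
    have "homology_map D f n (hclass (\<phi> n) ?BC z) = {\<psi> n b' \<otimes>\<^bsub>chain_grp D n\<^esub> \<psi> n (b + z) | b b'. b \<in> ?BC \<and> b' \<in> ?BD}"
    proof -
      have "f n (\<phi> n (b + z)) = \<psi> n (b + z)" if "b \<in> ?BC" for b
        by (rule f) (use bd_supp[OF C that] z in \<open>auto intro: supp_add\<close>)
      then show ?thesis
        unfolding homology_map_def quotient_hom_def set_mult_def hclass_def pres_boundaries[OF D]
        by (auto simp: image_iff) (metis (no_types, lifting) imageI)+
    qed
    also have "\<dots> = {\<psi> n ((b' + b) + z) | b b'. b \<in> ?BC \<and> b' \<in> ?BD}"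
    proof -
      have "\<psi> n b' \<otimes>\<^bsub>chain_grp D n\<^esub> \<psi> n (b + z) = \<psi> n ((b' + b) + z)" if "b \<in> ?BC" "b' \<in> ?BD" for b b'
        by (subst pres_add[OF PD, symmetric])
          (use bd_supp[OF C that(1)] bd_supp[OF D that(2)] z sub in \<open>auto intro: supp_add simp: algebra_simps\<close>)
      then show ?thesis by (metis (no_types, lifting))
    qed
    also have "\<dots> = hclass (\<psi> n) ?BD z"
      by (rule coset_absorb[OF bd_zero[OF C]]) (use bd_add[OF D] BCD in blast)
    finally show ?thesis .
  qed
  show "homology_map D f n \<in> iso (homology C n) (homology D n)"
    unfolding iso_def
  proof (intro CollectI conjI)
    show "homology_map D f n \<in> hom (homology C n) (homology D n)"
    proof (rule homI)
      fix x y assume "x \<in> carrier (homology C n)" "y \<in> carrier (homology C n)"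
      then obtain u v where uv: "x = hclass (\<phi> n) ?BC u" "y = hclass (\<phi> n) ?BC v" "u \<in> ?ZC" "v \<in> ?ZC"
        by (auto simp: carrier_homology[OF C])
      then show "homology_map D f n x \<in> carrier (homology D n)"
        using sub by (auto simp: hm carrier_homology[OF D])
      show "homology_map D f n (x \<otimes>\<^bsub>homology C n\<^esub> y) = homology_map D f n x \<otimes>\<^bsub>homology D n\<^esub> homology_map D f n y"
        using uv(3,4) by (simp add: uv(1,2) hm mult_homology[OF C] mult_homology[OF D] supp_add sub)
    qed
    show "bij_betw (homology_map D f n) (carrier (homology C n)) (carrier (homology D n))"
      unfolding bij_betw_def
    proof
      show "inj_on (homology_map D f n) (carrier (homology C n))"
      proof (rule inj_onI)
        fix x y assume "x \<in> carrier (homology C n)" "y \<in> carrier (homology C n)"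
          and eq: "homology_map D f n x = homology_map D f n y"
        then obtain u v where uv: "x = hclass (\<phi> n) ?BC u" "y = hclass (\<phi> n) ?BC v" "u \<in> ?ZC" "v \<in> ?ZC"
          by (auto simp: carrier_homology[OF C])
        then have "hclass (\<psi> n) ?BD u = hclass (\<psi> n) ?BD v" using eq by (simp add: hm)
        moreover have "\<psi> n (0 + u) \<in> hclass (\<psi> n) ?BD u" using bd_zero[OF D] unfolding hclass_def by blast
        ultimately obtain b where b: "b \<in> ?BD" "\<psi> n u = \<psi> n (b + v)" by (auto simp: hclass_def)
        then have "u = b + v"
          using uv bd_supp[OF D b(1)] sub pres_inj[OF PD, of u n "b + v"] by (auto intro: supp_add)
        \<comment> \<open>The chain k is a relative cycle one degree higher. Acyclicity of the
          quotient changes it by a boundary into a chain of the smaller complex, with the same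
          boundary u - v.\<close>
        then obtain k where k: "k \<in> supp (Y (Suc n))" "d k = u - v" using b(1) by auto
        moreover have "d k \<in> supp (X (Suc n - 1))" using k uv by (simp add: supp_diff)
        ultimately obtain w where w: "w \<in> supp (Y (Suc (Suc n)))" "k - d w \<in> supp (X (Suc n))"
          using acyclic[of k "Suc n"] by blast
        have "u - v = d (k - d w)" by (simp add: chains.linear_diff[OF lin] dd k)
        then have uv': "u - v \<in> ?BC" using w(2) by blast
        have "hclass (\<phi> n) ?BC (v + (u - v)) = hclass (\<phi> n) ?BC v"
          by (rule hclass_shift) (use bd_add[OF C] bd_neg[OF C] uv' in \<open>auto simp only: diff_conv_add_uminus\<close>)
        then show "x = y" by (simp add: uv)
      qed
      show "homology_map D f n ` carrier (homology C n) = carrier (homology D n)"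
      proof
        show "homology_map D f n ` carrier (homology C n) \<subseteq> carrier (homology D n)"
          using sub by (auto simp: hm carrier_homology[OF C] carrier_homology[OF D] intro!: imageI)
        show "carrier (homology D n) \<subseteq> homology_map D f n ` carrier (homology C n)"
        proof
          fix x assume "x \<in> carrier (homology D n)"
          then obtain u where u: "x = hclass (\<psi> n) ?BD u" "u \<in> supp (Y n)" "d u = 0" by (auto simp: carrier_homology[OF D])
          \<comment> \<open>A cycle of the larger complex is in particular a relative cycle, hence
            homologous to a chain of the smaller one.\<close>
          then obtain v where v: "v \<in> supp (Y (Suc n))" "u - d v \<in> supp (X n)" using acyclic[of u n] by auto
          have "hclass (\<psi> n) ?BD ((u - d v) + d v) = hclass (\<psi> n) ?BD (u - d v)"
            by (rule hclass_shift) (use bd_add[OF D] bd_neg[OF D] v(1) in \<open>auto simp only: diff_conv_add_uminus imageI\<close>)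
          then have "x = hclass (\<psi> n) ?BD (u - d v)" by (simp add: u)
          moreover have "d (u - d v) = 0" by (simp add: chains.linear_diff[OF lin] dd u)
          ultimately show "x \<in> homology_map D f n ` carrier (homology C n)"
            using v(2) hm[OF v(2)] by (auto simp: carrier_homology[OF C] intro!: image_eqI)
        qed
      qed
    qed
  qed
qed

text \<open>In coordinates adapted to the map \<open>G\<close> deletes some cells and keeps the
  others; so its kernel is spanned by cells, and the complex of the kernel inherits
  \<open>\<psi>\<close> and \<open>d\<close>.\<close>

lemma pres_complex_kernel:
  assumes D: "pres_complex D Y \<psi> d" and E: "\<And>n. pres (chain_grp E n) (Z n) (\<chi> n)"
    and g: "\<And>n u. u \<in> supp (Y n) \<Longrightarrow> G u \<in> supp (Z n) \<and> g n (\<psi> n u) = \<chi> n (G u)"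
    and K: "\<And>n u. u \<in> supp (Y n) \<Longrightarrow> G u = 0 \<longleftrightarrow> u \<in> supp (K n)" and KY: "\<And>n. K n \<subseteq> Y n"
    and dK: "\<And>n u. u \<in> supp (K (Suc n)) \<Longrightarrow> d u \<in> supp (K n)"
  shows "pres_complex (kernel_complex D E g) K \<psi> d"
  unfolding pres_complex_def
proof (intro conjI allI ballI)
  note PD = pres_complexD(3)[OF D]
  have sub: "u \<in> supp (K n) \<Longrightarrow> u \<in> supp (Y n)" for u n by (erule supp_mono) (rule KY)
  show "lin d" "\<And>u. d (d u) = 0" using pres_complexD[OF D] by auto
  show "d u = 0" if "u \<in> supp (K 0)" for u using pres_complexD(4)[OF D] sub[OF that] by blast
  fix n
  show "d u \<in> supp (K n)" if "u \<in> supp (K (Suc n))" for u by (rule dK[OF that])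
  show "chain_bd (kernel_complex D E g) (Suc n) (\<psi> (Suc n) u) = \<psi> n (d u)" if "u \<in> supp (K (Suc n))" for u
    using pres_complexD(6)[OF D sub[OF that]] by (simp add: kernel_complex_def)
  have iff: "g n (\<psi> n u) = \<one>\<^bsub>chain_grp E n\<^esub> \<longleftrightarrow> u \<in> supp (K n)" if "u \<in> supp (Y n)" for u
    using g[OF that] K[OF that] pres_inj[OF E, of "G u" n 0] pres_zero[OF E] by auto
  have "kernel (chain_grp D n) (chain_grp E n) (g n) = \<psi> n ` supp (K n)"
    using pres_surj[OF PD] pres_closed[OF PD] iff sub by (auto simp: kernel_def) blast+
  moreover have "inj_on (\<psi> n) (supp (K n))"
    using PD[of n] sub unfolding pres_def bij_betw_def inj_on_def by blast
  moreover have "\<psi> n (x + y) = \<psi> n x \<otimes>\<^bsub>chain_grp D n\<^esub> \<psi> n y" if "x \<in> supp (K n)" "y \<in> supp (K n)" for x y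
    by (rule pres_add[OF PD sub[OF that(1)] sub[OF that(2)]])
  ultimately show "pres (chain_grp (kernel_complex D E g) n) (K n) (\<psi> n)"
    using pres_zero[OF PD, of n] by (simp add: pres_def kernel_complex_def bij_betw_def)
qed

lemma acyclic_of_trivial_homology:
  assumes C: "pres_complex C X \<phi> d" and triv: "trivial_group (homology C n)"
    and u: "u \<in> supp (X n)" "d u = 0"
  shows "\<exists>v\<in>supp (X (Suc n)). u = d v"
proof -
  let ?B = "d ` supp (X (Suc n))"
  have "hclass (\<phi> n) ?B u \<in> carrier (homology C n)" "hclass (\<phi> n) ?B 0 \<in> carrier (homology C n)"
    using u chains.linear_0[OF pres_complexD(1)[OF C]] by (auto simp: carrier_homology[OF C])
  then have "hclass (\<phi> n) ?B u = hclass (\<phi> n) ?B 0" using triv by (auto simp: trivial_group_def)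
  moreover have "\<phi> n (0 + u) \<in> hclass (\<phi> n) ?B u" using bd_zero[OF C] unfolding hclass_def by blast
  ultimately obtain b where b: "b \<in> ?B" "\<phi> n u = \<phi> n b" by (auto simp: hclass_def)
  then have "u = b" using u bd_supp[OF C b(1)] pres_inj[OF pres_complexD(3)[OF C], of u n b] by auto
  then show ?thesis using b(1) by auto
qed

section \<open>Coordinates on the bar and Hochschild complexes\<close>

definition coord_alg :: "('k::field, 'v) module \<Rightarrow> 'b set \<Rightarrow> ('v \<Rightarrow> ('b \<Rightarrow>\<^sub>0 'k)) \<Rightarrow> ('b \<Rightarrow> 'b \<Rightarrow> ('b \<Rightarrow>\<^sub>0 'k)) \<Rightarrow> bool" where
  "coord_alg A B \<kappa> m \<longleftrightarrow> nonunital_algebra A \<and> coord A B \<kappa> \<and>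
     (\<forall>x\<in>carrier A. \<forall>y\<in>carrier A. \<kappa> (x \<otimes>\<^bsub>A\<^esub> y) = bil m (\<kappa> x) (\<kappa> y))"

lemma map_merge:
  assumes "i + 1 < length w" "set w \<subseteq> S" "\<And>x y. x \<in> S \<Longrightarrow> y \<in> S \<Longrightarrow> g (f x y) = f' (g x) (g y)"
  shows "map g (merge f i w) = merge f' i (map g w)"
proof -
  have "w ! i \<in> S" "w ! (i + 1) \<in> S" using assms(1,2) by (auto simp: subset_iff)
  then show ?thesis using assms(1,3) by (simp add: merge_def take_map drop_map)
qed

lemma set_merge: "i + 1 < length w \<Longrightarrow> set w \<subseteq> S \<Longrightarrow> (\<And>x y. x \<in> S \<Longrightarrow> y \<in> S \<Longrightarrow> f x y \<in> S) \<Longrightarrow> set (merge f i w) \<subseteq> S"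
  by (auto simp: merge_def subset_iff dest: in_set_takeD in_set_dropD)

lemma last_butlast_cases:
  assumes "length w = Suc (Suc n)"
  obtains x v y where "w = x # v @ [y]" "length v = n"
proof -
  obtain x u where "w = x # u" using assms by (cases w) auto
  moreover obtain v y where "u = v @ [y]" using assms \<open>w = x # u\<close> by (cases u rule: rev_cases) auto
  ultimately show ?thesis using that assms by simp
qed

context
  fixes A :: "('k::field, 'v) module" and B :: "'b set" and \<kappa> m
  assumes A: "coord_alg A B \<kappa> m"
begin

lemma coord_algD: "nonunital_algebra A" "coord A B \<kappa>"
  "x \<in> carrier A \<Longrightarrow> y \<in> carrier A \<Longrightarrow> \<kappa> (x \<otimes>\<^bsub>A\<^esub> y) = bil m (\<kappa> x) (\<kappa> y)"
  using A by (auto simp: coord_alg_def)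

lemma alg_mult_closed: "x \<in> carrier A \<Longrightarrow> y \<in> carrier A \<Longrightarrow> x \<otimes>\<^bsub>A\<^esub> y \<in> carrier A"
  using coord_algD(1) by (rule nonunital_algebra.mult_closed)

lemma word_b'_coord:
  assumes w: "w \<in> words A (Suc n)"
  shows "word_b' A n w \<in> supp (words A n)" "thom \<kappa> (word_b' A n w) = bar m (tensor (map \<kappa> w))"
proof -
  have b': "word_b' A n w = (\<Sum>i<n. (- 1) ^ i \<star> word (merge (\<otimes>\<^bsub>A\<^esub>) i w))"
    by (simp add: word_b'_def merge_def del: scale_chain_single)
  show "word_b' A n w \<in> supp (words A n)"
    unfolding b'
  proof (intro supp_sum supp_scale)
    fix i assume "i \<in> {..<n}"
    then have "merge (\<otimes>\<^bsub>A\<^esub>) i w \<in> words A n"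
      using w set_merge[of i w "carrier A" "(\<otimes>\<^bsub>A\<^esub>)"] alg_mult_closed by (auto simp: words_iff length_merge)
    then show "word (merge (\<otimes>\<^bsub>A\<^esub>) i w) \<in> supp (words A n)" by simp
  qed
  have "map \<kappa> (merge (\<otimes>\<^bsub>A\<^esub>) i w) = merge (bil m) i (map \<kappa> w)" if "i < n" for i
    by (rule map_merge[where S = "carrier A"]) (use that w coord_algD(3) in \<open>auto simp: words_iff\<close>)
  then show "thom \<kappa> (word_b' A n w) = bar m (tensor (map \<kappa> w))"
    using w by (simp add: b' bar_tensor chains.linear_sum[OF lin_thom] chains.linear_scale[OF lin_thom] words_iff
      del: scale_chain_single)
qed

lemma word_b_coord:
  assumes w: "w \<in> words A (Suc n)" and n: "n \<ge> 1"
  shows "word_b A n w \<in> supp (words A n)" "thom \<kappa> (word_b A n w) = hoch m (tensor (map \<kappa> w))"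
proof -
  obtain k where k: "n = Suc k" using n by (cases n) auto
  obtain x v y where v: "w = x # v @ [y]" "length v = k"
    using last_butlast_cases[of w k] w k by (auto simp: words_iff)
  have xy: "x \<in> carrier A" "y \<in> carrier A" "set v \<subseteq> carrier A" using w v by (auto simp: words_iff)
  have b: "word_b A n w = word_b' A n w + (- 1) ^ n \<star> word ((y \<otimes>\<^bsub>A\<^esub> x) # v)"
    using v by (simp add: word_b_def butlast_append del: scale_chain_single)
  have "word ((y \<otimes>\<^bsub>A\<^esub> x) # v) \<in> supp (words A n)" using xy v k alg_mult_closed by (simp add: words_iff)
  then show "word_b A n w \<in> supp (words A n)"
    unfolding b using word_b'_coord(1)[OF w] by (intro supp_add supp_scale)
  have "tensor (map \<kappa> w) = tensor (\<kappa> x # map \<kappa> v @ [\<kappa> y])" using v by simp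
  moreover have "join m (rot (tensor (\<kappa> x # map \<kappa> v @ [\<kappa> y]))) = letter (bil m (\<kappa> y) (\<kappa> x)) * tensor (map \<kappa> v)"
    by (subst rot_tensor) (auto simp: join_letters butlast_append)
  ultimately have "join m (rot (len_sign (tensor (map \<kappa> w)))) = - ((- 1) ^ n \<star> (letter (bil m (\<kappa> y) (\<kappa> x)) * tensor (map \<kappa> v)))"
    using len_sign_tensor[of "map \<kappa> w"] w
    by (simp add: words_iff chains.linear_scale[OF lin_rot] chains.linear_scale[OF lin_join] chain.scale_minus_left
      chains.linear_neg[OF lin_rot] chains.linear_neg[OF lin_join])
  then show "thom \<kappa> (word_b A n w) = hoch m (tensor (map \<kappa> w))"
    unfolding b hoch_def using word_b'_coord(2)[OF w] xy
    by (simp add: chains.linear_add[OF lin_thom] chains.linear_scale[OF lin_thom] coord_algD(3) del: scale_chain_single)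
qed

lemma word_t_coord:
  assumes w: "w \<in> words A (Suc n)"
  shows "word w - word_t n w \<in> supp (words A (Suc n))" "thom \<kappa> (word w - word_t n w) = one_minus_t (tensor (map \<kappa> w))"
proof -
  obtain v y where v: "w = v @ [y]" using w by (cases w rule: rev_cases) (auto simp: words_iff)
  show "word w - word_t n w \<in> supp (words A (Suc n))"
    unfolding word_t_def by (intro supp_diff supp_scale) (use w v in \<open>auto simp: words_iff\<close>)
  show "thom \<kappa> (word w - word_t n w) = one_minus_t (tensor (map \<kappa> w))"
    using w v one_minus_t_tensor[of "map \<kappa> w"]
    by (simp add: word_t_def words_iff chains.linear_diff[OF lin_thom] chains.linear_scale[OF lin_thom] chain.scale_minus_left
      del: scale_chain_single)
qed

lemma bar_supp_words: "u \<in> supp (words_on B (Suc (Suc q))) \<Longrightarrow> bar m u \<in> supp (words_on B (Suc q))"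
  and hoch_supp_words: "u \<in> supp (words_on B (Suc (Suc q))) \<Longrightarrow> hoch m u \<in> supp (words_on B (Suc q))"
  and one_minus_t_supp_words: "u \<in> supp (words_on B (Suc q)) \<Longrightarrow> one_minus_t u \<in> supp (words_on B (Suc q))"
proof -
  note surj = thom_words_surj[OF coord_algD(2)]
  \<comment> \<open>Every chain on words in \<open>B\<close> is the coordinate image of a chain on
    words in \<open>A\<close>, so an operator has the right target as soon as the word operator it
    describes has.\<close>
  have key: "F u \<in> supp (words_on B n')" if F: "lin F"
    and f: "\<And>w. w \<in> words A n \<Longrightarrow> f w \<in> supp (words A n') \<and> thom \<kappa> (f w) = F (tensor (map \<kappa> w))"
    and u: "u \<in> supp (words_on B n)" for F f n n' u
  proof -
    obtain x where x: "x \<in> supp (words A n)" "thom \<kappa> x = u" using surj[OF u] by blast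
    have "F (thom \<kappa> x) \<in> supp (words_on B n')"
    proof (rule lin_supp[OF lin_comp[OF F lin_thom] x(1)])
      fix w assume "w \<in> words A n"
      then show "F (thom \<kappa> (word w)) \<in> supp (words_on B n')"
        using f[of w] thom_supp_words[OF coord_algD(2), of "f w" n'] by simp
    qed
    then show ?thesis using x by simp
  qed
  show "u \<in> supp (words_on B (Suc (Suc q))) \<Longrightarrow> bar m u \<in> supp (words_on B (Suc q))"
    by (rule key[OF lin_bar, of _ "word_b' A (Suc q)"]) (auto simp: word_b'_coord)
  show "u \<in> supp (words_on B (Suc (Suc q))) \<Longrightarrow> hoch m u \<in> supp (words_on B (Suc q))"
    by (rule key[OF lin_hoch, of _ "word_b A (Suc q)"]) (auto simp: word_b_coord)
  show "u \<in> supp (words_on B (Suc q)) \<Longrightarrow> one_minus_t u \<in> supp (words_on B (Suc q))"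
    by (rule key[OF lin_one_minus_t, of _ "\<lambda>w. word w - word_t q w"]) (auto simp: word_t_coord)
qed

lemma bar_hoch_1: "u \<in> supp (words_on B 1) \<Longrightarrow> bar m u = 0 \<and> hoch m u = 0"
proof -
  assume u: "u \<in> supp (words_on B 1)"
  have 1: "bar m (word w) = 0 \<and> hoch m (word w) = 0" if "w \<in> words_on B 1" for w
  proof -
    obtain b where "(word w :: 'b list \<Rightarrow>\<^sub>0 'k) = letter (word b)" using \<open>w \<in> words_on B 1\<close> by (auto simp: words_on_def length_Suc_conv)
    then show ?thesis by (simp only: bar_letter hoch_letter)
  qed
  show ?thesis
    using lin_eq_supp[OF lin_bar lin_zero u] lin_eq_supp[OF lin_hoch lin_zero u] 1 by blast
qed

lemma pres_bar: "pres (chain_grp (bar_complex A) q) (words_on B (Suc q)) (fibre A \<kappa> (Suc q))"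
  using pres_tensor_power[OF coord_algD(2), of "Suc q"] by (simp add: bar_complex_def)

lemma bar_complex_bd:
  assumes "c \<in> supp (words_on B (Suc (Suc q)))"
  shows "chain_bd (bar_complex A) (Suc q) (fibre A \<kappa> (Suc (Suc q)) c) = fibre A \<kappa> (Suc q) (bar m c)"
  unfolding bar_complex_def chain_complex.simps
  by (rule tensor_hom_fibre[OF coord_algD(2) coord_algD(2) lin_bar _ _ assms]) (auto simp: word_b'_coord)

end

definition cc2_cells :: "'b set \<Rightarrow> nat \<Rightarrow> nat \<Rightarrow> 'b list set" where
  "cc2_cells B c q = (if c \<le> 1 then words_on B (Suc q) else {})"

definition cc2_fibre :: "('k::field, 'v) module \<Rightarrow> ('v \<Rightarrow> ('b \<Rightarrow>\<^sub>0 'k)) \<Rightarrow> nat \<Rightarrow> nat \<Rightarrow> ('b list \<Rightarrow>\<^sub>0 'k) \<Rightarrow> ('v list \<Rightarrow>\<^sub>0 'k) set" where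
  "cc2_fibre A \<kappa> c q = (if c \<le> 1 then fibre A \<kappa> (Suc q) else (\<lambda>_. \<one>\<^bsub>tensor_power A (Suc q)\<^esub>))"

lemma pres_cc2_bi:
  assumes A: "coord A B \<kappa>"
  shows "pres (bi_grp (cc2_bicomplex A) c q) (cc2_cells B c q) (cc2_fibre A \<kappa> c q)"
proof (cases "c \<le> 1")
  case True
  then show ?thesis using pres_tensor_power[OF A, of "Suc q"] by (simp add: cc2_bicomplex_def cc2_cells_def cc2_fibre_def)
next
  case False
  then show ?thesis
    by (auto simp: cc2_bicomplex_def cc2_cells_def cc2_fibre_def pres_def bij_betw_def singleton_group_def inj_on_def)
qed

lemma pres_cc2:
  assumes A: "coord A B \<kappa>"
  shows "pres (chain_grp (cc2_complex A) q) (tcells (cc2_cells B) q) (tphi (cc2_fibre A \<kappa>) q)"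
  unfolding cc2_complex_def by (rule pres_total[OF pres_cc2_bi[OF A]])

lemma cc2_complex_bd:
  fixes A :: "('k::field, 'v) module" and B :: "'b set"
  assumes A: "coord_alg A B \<kappa> m" and c: "c \<in> supp (tcells (cc2_cells B) (Suc q))"
  shows "cc2D m c \<in> supp (tcells (cc2_cells B) q)"
    and "chain_bd (cc2_complex A) (Suc q) (tphi (cc2_fibre A \<kappa>) (Suc q) c) = tphi (cc2_fibre A \<kappa>) q (cc2D m c)"
proof -
  note AV = coord_algD(2)[OF A]
  let ?h = "\<lambda>c. if c = 1 then one_minus_t else (\<lambda>_. 0 :: 'b list \<Rightarrow>\<^sub>0 'k)"
    and ?v = "\<lambda>c. if c = 0 then hoch m else if c = 1 then (\<lambda>u. - bar m u) else (\<lambda>_. 0)"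
  have lh: "\<And>c. lin (?h c)" and lv: "\<And>c. lin (?v c)" by (auto intro!: lin_intros)
  have H: "?h (Suc p) u \<in> supp (cc2_cells B p q) \<and>
      bi_h (cc2_bicomplex A) (Suc p) q (cc2_fibre A \<kappa> (Suc p) q u) = cc2_fibre A \<kappa> p q (?h (Suc p) u)"
    if u: "u \<in> supp (cc2_cells B (Suc p) q)" for p q u
  proof (cases "p = 0")
    case True
    then have u: "u \<in> supp (words_on B (Suc q))" using u by (simp add: cc2_cells_def)
    have "tensor_hom A (Suc q) (\<lambda>xs. word xs - word_t q xs) (fibre A \<kappa> (Suc q) u) = fibre A \<kappa> (Suc q) (one_minus_t u)"
      by (rule tensor_hom_fibre[OF AV AV lin_one_minus_t _ _ u]) (auto simp: word_t_coord[OF A])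
    then show ?thesis using True one_minus_t_supp_words[OF A u]
      by (simp add: cc2_bicomplex_def cc2_cells_def cc2_fibre_def)
  next
    case False
    then show ?thesis using pres_zero[OF pres_tensor_power[OF AV, of "Suc q"]]
      by (simp add: cc2_bicomplex_def cc2_fibre_def)
  qed
  have V: "?v p u \<in> supp (cc2_cells B p q) \<and>
      bi_v (cc2_bicomplex A) p (Suc q) (cc2_fibre A \<kappa> p (Suc q) u) = cc2_fibre A \<kappa> p q (?v p u)"
    if u: "u \<in> supp (cc2_cells B p (Suc q))" for p q u
  proof -
    consider "p = 0" | "p = 1" | "p \<ge> 2" by linarith
    then show ?thesis
    proof cases
      case 1
      then have u: "u \<in> supp (words_on B (Suc (Suc q)))" using u by (simp add: cc2_cells_def)
      have "tensor_hom A (Suc q) (word_b A (Suc q)) (fibre A \<kappa> (Suc (Suc q)) u) = fibre A \<kappa> (Suc q) (hoch m u)"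
        by (rule tensor_hom_fibre[OF AV AV lin_hoch _ _ u]) (auto simp: word_b_coord[OF A])
      then show ?thesis using 1 hoch_supp_words[OF A u] by (simp add: cc2_bicomplex_def cc2_cells_def cc2_fibre_def)
    next
      case 2
      then have u: "u \<in> supp (words_on B (Suc (Suc q)))" using u by (simp add: cc2_cells_def)
      have "tensor_hom A (Suc q) (\<lambda>xs. - word_b' A (Suc q) xs) (fibre A \<kappa> (Suc (Suc q)) u) = fibre A \<kappa> (Suc q) (- bar m u)"
        by (rule tensor_hom_fibre[OF AV AV lin_neg[OF lin_bar] _ _ u])
          (auto simp: word_b'_coord[OF A] supp_neg chains.linear_neg[OF lin_thom])
      then show ?thesis using 2 supp_neg[OF bar_supp_words[OF A u]] by (simp add: cc2_bicomplex_def cc2_cells_def cc2_fibre_def)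
    next
      case 3
      then show ?thesis by (simp add: cc2_bicomplex_def cc2_fibre_def)
    qed
  qed
  have V0: "?v p u = 0" if u: "u \<in> supp (cc2_cells B p 0)" for p u
    using u bar_hoch_1[OF A, of u] by (auto simp: cc2_cells_def)
  note bd = total_bd[where h = ?h and v = ?v, OF pres_cc2_bi[OF AV] lh lv H V V0 c]
  show "cc2D m c \<in> supp (tcells (cc2_cells B) q)" unfolding cc2D_def by (rule bd(1))
  show "chain_bd (cc2_complex A) (Suc q) (tphi (cc2_fibre A \<kappa>) (Suc q) c) = tphi (cc2_fibre A \<kappa>) q (cc2D m c)"
    unfolding cc2D_def cc2_complex_def by (rule bd(2))
qed

lemma tensor_map_fibre:
  assumes V: "coord V B \<kappa>" and V': "coord V' B' \<kappa>'"
    and g: "\<And>x. x \<in> carrier V \<Longrightarrow> g x \<in> carrier V' \<and> \<kappa>' (g x) = linear_extension f (\<kappa> x)"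
    and c: "c \<in> supp (words_on B n)"
  shows "tensor_map V' n g (fibre V \<kappa> n c) = fibre V' \<kappa>' n (thom f c)"
  unfolding tensor_map_def
proof (rule tensor_hom_fibre[OF V V' lin_thom _ _ c])
  fix w assume w: "w \<in> words V n"
  show "word (map g w) \<in> supp (words V' n)" using w g by (auto simp: words_iff)
  have "map (\<lambda>x. \<kappa>' (g x)) w = map (\<lambda>x. linear_extension f (\<kappa> x)) w"
    using w g by (auto simp: words_iff)
  then show "thom \<kappa>' (word (map g w)) = thom f (tensor (map \<kappa> w))"
    by (simp add: thom_tensor comp_def del: map_eq_conv)
qed

lemma cc2_map_tphi:
  fixes V :: "('k::field, 'v) module" and B :: "'b set"
  assumes V: "coord V B \<kappa>" and V': "coord V' B' \<kappa>'"
    and g: "\<And>x. x \<in> carrier V \<Longrightarrow> g x \<in> carrier V' \<and> \<kappa>' (g x) = linear_extension f (\<kappa> x)"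
    and c: "c \<in> supp (tcells (cc2_cells B) n)"
  shows "cc2_map V' g n (tphi (cc2_fibre V \<kappa>) n c) = tphi (cc2_fibre V' \<kappa>') n (slicewise (thom f) c)"
  unfolding cc2_map_def
proof (rule total_map_tphi[where F = "thom f" and Bs = "cc2_cells B"])
  fix p q and u :: "'b list \<Rightarrow>\<^sub>0 'k" assume u: "u \<in> supp (cc2_cells B p q)"
  show "(if p \<le> 1 then tensor_map V' (q + 1) g else (\<lambda>_. \<one>\<^bsub>tensor_power V' (q + 1)\<^esub>)) (cc2_fibre V \<kappa> p q u) =
      cc2_fibre V' \<kappa>' p q (thom f u)"
    using u tensor_map_fibre[OF V V' g, where c = u and n = "Suc q"] by (auto simp: cc2_cells_def cc2_fibre_def)
qed (use c in \<open>auto intro: slice_slicewise lin_thom\<close>)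

lemma thom_words_on:
  assumes "\<And>b. b \<in> B \<Longrightarrow> f b \<in> supp B'" "u \<in> supp (words_on B n)"
  shows "thom f u \<in> supp (words_on B' n)"
proof (rule lin_supp[OF lin_thom assms(2)])
  fix w assume "w \<in> words_on B n"
  then show "thom f (word w) \<in> supp (words_on B' n)"
    using tensor_supp[of "map f w" B'] assms(1) by (auto simp: words_on_def)
qed

lemma slicewise_thom_supp:
  assumes "\<And>b. b \<in> B \<Longrightarrow> f b \<in> supp B'" "u \<in> supp (tcells (cc2_cells B) n)"
  shows "slicewise (thom f) u \<in> supp (tcells (cc2_cells B') n)"
proof (rule tcellsI)
  show "slice p (slicewise (thom f) u) \<in> supp (cc2_cells B' p (n - p))" if "p \<le> n" for p
    using slice_tcells[OF assms(2) that] thom_words_on[OF assms(1), of B]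
    by (auto simp: slice_slicewise[OF lin_thom] cc2_cells_def chains.linear_0[OF lin_thom] split: if_splits)
  show "slice p (slicewise (thom f) u) = 0" if "n < p" for p
    using slice_tcells_gt[OF assms(2) that] by (simp add: slice_slicewise[OF lin_thom] chains.linear_0[OF lin_thom])
qed

section \<open>The nerve\<close>

lemma tuple_simps [simp]:
  "tuple_hd (tuple_cons r x) = r" "tuple_tl (tuple_cons r x) = x"
  "tuple_cons r x = tuple_cons r' x' \<longleftrightarrow> r = r' \<and> x = x'"
  by (auto simp: tuple_hd_def tuple_tl_def tuple_cons_def prod_eq_iff)

lemma nerve_total_cons [simp]: "nerve_total X (tuple_cons r x) = cm_map X r \<oplus>\<^bsub>cm_base X\<^esub> nerve_total X x"
  by (simp add: nerve_total_def tuple_cons_def)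

lemma nerve_total_Nil [simp]: "nerve_total X ([], a) = a"
  by (simp add: nerve_total_def)

lemma nerve_0_simps [simp]:
  "carrier (nerve X 0) = {[]} \<times> carrier (cm_base X)"
  "\<zero>\<^bsub>nerve X 0\<^esub> = ([], \<zero>\<^bsub>cm_base X\<^esub>)"
  "u \<otimes>\<^bsub>nerve X 0\<^esub> v = ([], snd u \<otimes>\<^bsub>cm_base X\<^esub> snd v)"
  "u \<oplus>\<^bsub>nerve X 0\<^esub> v = ([], snd u \<oplus>\<^bsub>cm_base X\<^esub> snd v)"
  "c \<odot>\<^bsub>nerve X 0\<^esub> u = ([], c \<odot>\<^bsub>cm_base X\<^esub> snd u)"
  by (simp_all add: Let_def)

lemma nerve_Suc_simps [simp]:
  "tuple_cons r x \<in> carrier (nerve X (Suc n)) \<longleftrightarrow> r \<in> carrier (cm_top X) \<and> x \<in> carrier (nerve X n)"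
  "\<zero>\<^bsub>nerve X (Suc n)\<^esub> = tuple_cons \<zero>\<^bsub>cm_top X\<^esub> \<zero>\<^bsub>nerve X n\<^esub>"
  "u \<otimes>\<^bsub>nerve X (Suc n)\<^esub> v = tuple_cons
      (tuple_hd u \<otimes>\<^bsub>cm_top X\<^esub> tuple_hd v \<oplus>\<^bsub>cm_top X\<^esub> cm_lact X (nerve_total X (tuple_tl u)) (tuple_hd v)
        \<oplus>\<^bsub>cm_top X\<^esub> cm_ract X (tuple_hd u) (nerve_total X (tuple_tl v)))
      (tuple_tl u \<otimes>\<^bsub>nerve X n\<^esub> tuple_tl v)"
  "u \<oplus>\<^bsub>nerve X (Suc n)\<^esub> v = tuple_cons (tuple_hd u \<oplus>\<^bsub>cm_top X\<^esub> tuple_hd v) (tuple_tl u \<oplus>\<^bsub>nerve X n\<^esub> tuple_tl v)"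
  "c \<odot>\<^bsub>nerve X (Suc n)\<^esub> u = tuple_cons (c \<odot>\<^bsub>cm_top X\<^esub> tuple_hd u) (c \<odot>\<^bsub>nerve X n\<^esub> tuple_tl u)"
  by (cases x, auto simp: nerve_semidirect_def)

lemma nerve_cases [elim!]:
  assumes "x \<in> carrier (nerve X (Suc n))"
  obtains r y where "x = tuple_cons r y" "r \<in> carrier (cm_top X)" "y \<in> carrier (nerve X n)"
  using assms by (auto simp: nerve_semidirect_def)

declare nerve.simps [simp del]

section \<open>The nerve as a simplicial algebra\<close>

lemma nonunital_algebraI:
  fixes A :: "('k::field, 'v) module"
  assumes "abelian_group A"
    and "\<And>c x. x \<in> carrier A \<Longrightarrow> c \<odot>\<^bsub>A\<^esub> x \<in> carrier A"
    and "\<And>c d x. x \<in> carrier A \<Longrightarrow> (c + d) \<odot>\<^bsub>A\<^esub> x = c \<odot>\<^bsub>A\<^esub> x \<oplus>\<^bsub>A\<^esub> d \<odot>\<^bsub>A\<^esub> x"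
    and "\<And>c x y. x \<in> carrier A \<Longrightarrow> y \<in> carrier A \<Longrightarrow> c \<odot>\<^bsub>A\<^esub> (x \<oplus>\<^bsub>A\<^esub> y) = c \<odot>\<^bsub>A\<^esub> x \<oplus>\<^bsub>A\<^esub> c \<odot>\<^bsub>A\<^esub> y"
    and "\<And>c d x. x \<in> carrier A \<Longrightarrow> (c * d) \<odot>\<^bsub>A\<^esub> x = c \<odot>\<^bsub>A\<^esub> (d \<odot>\<^bsub>A\<^esub> x)"
    and "\<And>x. x \<in> carrier A \<Longrightarrow> 1 \<odot>\<^bsub>A\<^esub> x = x"
    and "nonunital_algebra_axioms A"
  shows "nonunital_algebra A"
proof -
  have cring: "cring (ground_field :: 'k ring)"
  proof (rule cringI)
    show "abelian_group (ground_field :: 'k ring)"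
      by (rule abelian_groupI) (auto simp: ground_field_def add.assoc add.commute intro: exI[of _ "- _"] add.left_inverse)
    show "Group.comm_monoid (ground_field :: 'k ring)"
      by (rule comm_monoidI) (auto simp: ground_field_def)
  qed (auto simp: ground_field_def distrib_right)
  have "Module.module (ground_field :: 'k ring) A"
    by (rule moduleI[OF cring assms(1)]) (use assms in \<open>auto simp: ground_field_def\<close>)
  then show ?thesis using assms(7) by (simp add: nonunital_algebra_def)
qed

lemma ground_smult:
  fixes V :: "('k::field, 'v) module"
  assumes "Module.module ground_field V"
  shows "x \<in> carrier V \<Longrightarrow> (c + d) \<odot>\<^bsub>V\<^esub> x = c \<odot>\<^bsub>V\<^esub> x \<oplus>\<^bsub>V\<^esub> d \<odot>\<^bsub>V\<^esub> x"
    and "x \<in> carrier V \<Longrightarrow> y \<in> carrier V \<Longrightarrow> c \<odot>\<^bsub>V\<^esub> (x \<oplus>\<^bsub>V\<^esub> y) = c \<odot>\<^bsub>V\<^esub> x \<oplus>\<^bsub>V\<^esub> c \<odot>\<^bsub>V\<^esub> y"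
    and "x \<in> carrier V \<Longrightarrow> (c * d) \<odot>\<^bsub>V\<^esub> x = c \<odot>\<^bsub>V\<^esub> (d \<odot>\<^bsub>V\<^esub> x)"
    and "x \<in> carrier V \<Longrightarrow> 1 \<odot>\<^bsub>V\<^esub> x = x"
  using Module.module.smult_l_distr[OF assms, of c d x] Module.module.smult_r_distr[OF assms, of c x y]
    Module.module.smult_assoc1[OF assms, of c d x] Module.module.smult_one[OF assms, of x]
  by (auto simp: ground_field_def)

context
  fixes X :: "('k::field, 'r, 'a) crossed_mod"
  assumes X: "crossed_module X"
begin

interpretation act: algebra_action "cm_base X" "cm_top X" "cm_lact X" "cm_ract X"
  using X by (simp add: crossed_module_def Let_def)

lemma map_hom:
  shows "r \<in> carrier (cm_top X) \<Longrightarrow> cm_map X r \<in> carrier (cm_base X)"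
    and "r \<in> carrier (cm_top X) \<Longrightarrow> s \<in> carrier (cm_top X) \<Longrightarrow> cm_map X (r \<oplus>\<^bsub>cm_top X\<^esub> s) = cm_map X r \<oplus>\<^bsub>cm_base X\<^esub> cm_map X s"
    and "r \<in> carrier (cm_top X) \<Longrightarrow> cm_map X (c \<odot>\<^bsub>cm_top X\<^esub> r) = c \<odot>\<^bsub>cm_base X\<^esub> cm_map X r"
    and "r \<in> carrier (cm_top X) \<Longrightarrow> s \<in> carrier (cm_top X) \<Longrightarrow> cm_map X (r \<otimes>\<^bsub>cm_top X\<^esub> s) = cm_map X r \<otimes>\<^bsub>cm_base X\<^esub> cm_map X s"
    and "r \<in> carrier (cm_top X) \<Longrightarrow> a \<in> carrier (cm_base X) \<Longrightarrow> cm_map X (cm_lact X a r) = a \<otimes>\<^bsub>cm_base X\<^esub> cm_map X r"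
    and "r \<in> carrier (cm_top X) \<Longrightarrow> a \<in> carrier (cm_base X) \<Longrightarrow> cm_map X (cm_ract X r a) = cm_map X r \<otimes>\<^bsub>cm_base X\<^esub> a"
    and "r \<in> carrier (cm_top X) \<Longrightarrow> s \<in> carrier (cm_top X) \<Longrightarrow> cm_lact X (cm_map X r) s = r \<otimes>\<^bsub>cm_top X\<^esub> s"
    and "r \<in> carrier (cm_top X) \<Longrightarrow> s \<in> carrier (cm_top X) \<Longrightarrow> cm_ract X r (cm_map X s) = r \<otimes>\<^bsub>cm_top X\<^esub> s"
  using X by (auto simp: crossed_module_def Let_def algebra_hom_def linear_map_def hom_def)

private lemmas base_simps = act.A.mult_closed act.A.mult_assoc act.A.mult_l_distr act.A.mult_r_distr act.A.smult_mult_l act.A.smult_mult_r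
  and top_simps = act.R.mult_closed act.R.mult_assoc act.R.mult_l_distr act.R.mult_r_distr act.R.smult_mult_l act.R.smult_mult_r
  and act_simps = act.lact_closed act.ract_closed act.lact_add_l act.lact_add_r act.ract_add_l act.ract_add_r act.lact_smult_l
    act.lact_smult_r act.ract_smult_l act.ract_smult_r act.lact_assoc act.ract_assoc act.act_assoc act.lact_mult act.act_mult act.ract_mult
  and smult_simps = ground_module_closed[OF act.R.module_axioms] ground_smult[OF act.R.module_axioms]
    ground_module_closed[OF act.A.module_axioms] ground_smult[OF act.A.module_axioms]

text \<open>One induction for both facts: a tuple acts on the top algebra through its total, so the
  algebra axioms at level n + 1 rest on the total being a homomorphism at level n.\<close>

lemma nerve_algebra_total:
  "nonunital_algebra (nerve X n) \<and>
   (\<forall>x\<in>carrier (nerve X n). nerve_total X x \<in> carrier (cm_base X)) \<and>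
   (\<forall>x\<in>carrier (nerve X n). \<forall>y\<in>carrier (nerve X n).
      nerve_total X (x \<oplus>\<^bsub>nerve X n\<^esub> y) = nerve_total X x \<oplus>\<^bsub>cm_base X\<^esub> nerve_total X y \<and>
      nerve_total X (x \<otimes>\<^bsub>nerve X n\<^esub> y) = nerve_total X x \<otimes>\<^bsub>cm_base X\<^esub> nerve_total X y) \<and>
   (\<forall>c. \<forall>x\<in>carrier (nerve X n). nerve_total X (c \<odot>\<^bsub>nerve X n\<^esub> x) = c \<odot>\<^bsub>cm_base X\<^esub> nerve_total X x)"
proof (induction n)
  case 0
  have "abelian_group (nerve X 0)"
    by (rule abelian_groupI) (auto simp: act.A.M.a_ac intro: act.A.M.l_neg)
  moreover have "nonunital_algebra_axioms (nerve X 0)"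
    by unfold_locales (auto simp: base_simps)
  ultimately have "nonunital_algebra (nerve X 0)"
    by (intro nonunital_algebraI) (auto simp: smult_simps)
  then show ?case by auto
next
  case (Suc n)
  then interpret N: nonunital_algebra "nerve X n" by blast
  have tot: "x \<in> carrier (nerve X n) \<Longrightarrow> nerve_total X x \<in> carrier (cm_base X)"
    "x \<in> carrier (nerve X n) \<Longrightarrow> y \<in> carrier (nerve X n) \<Longrightarrow> nerve_total X (x \<oplus>\<^bsub>nerve X n\<^esub> y) = nerve_total X x \<oplus>\<^bsub>cm_base X\<^esub> nerve_total X y"
    "x \<in> carrier (nerve X n) \<Longrightarrow> y \<in> carrier (nerve X n) \<Longrightarrow> nerve_total X (x \<otimes>\<^bsub>nerve X n\<^esub> y) = nerve_total X x \<otimes>\<^bsub>cm_base X\<^esub> nerve_total X y"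
    "x \<in> carrier (nerve X n) \<Longrightarrow> nerve_total X (c \<odot>\<^bsub>nerve X n\<^esub> x) = c \<odot>\<^bsub>cm_base X\<^esub> nerve_total X x" for x y c
    using Suc by auto
  note N_simps = N.mult_closed N.mult_assoc N.mult_l_distr N.mult_r_distr N.smult_mult_l N.smult_mult_r
    ground_module_closed[OF N.module_axioms] ground_smult[OF N.module_axioms]
  have "abelian_group (nerve X (Suc n))"
  proof (rule abelian_groupI)
    fix x assume "x \<in> carrier (nerve X (Suc n))"
    then obtain r y where "x = tuple_cons r y" "r \<in> carrier (cm_top X)" "y \<in> carrier (nerve X n)" by auto
    then show "\<exists>y\<in>carrier (nerve X (Suc n)). y \<oplus>\<^bsub>nerve X (Suc n)\<^esub> x = \<zero>\<^bsub>nerve X (Suc n)\<^esub>"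
      by (intro bexI[of _ "tuple_cons (\<ominus>\<^bsub>cm_top X\<^esub> r) (\<ominus>\<^bsub>nerve X n\<^esub> y)"]) (auto simp: act.R.M.l_neg N.M.l_neg)
  qed (auto simp: act.R.M.a_ac N.M.a_ac)
  moreover have "nonunital_algebra_axioms (nerve X (Suc n))"
    by unfold_locales (auto simp: N_simps top_simps act_simps tot act.R.M.a_ac smult_simps)
  ultimately have "nonunital_algebra (nerve X (Suc n))"
    by (intro nonunital_algebraI) (auto simp: smult_simps N_simps)
  moreover have "nerve_total X x \<in> carrier (cm_base X)" if "x \<in> carrier (nerve X (Suc n))" for x
    using that by (auto simp: tot map_hom)
  moreover have "nerve_total X (x \<oplus>\<^bsub>nerve X (Suc n)\<^esub> y) = nerve_total X x \<oplus>\<^bsub>cm_base X\<^esub> nerve_total X y"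
    "nerve_total X (x \<otimes>\<^bsub>nerve X (Suc n)\<^esub> y) = nerve_total X x \<otimes>\<^bsub>cm_base X\<^esub> nerve_total X y"
    if "x \<in> carrier (nerve X (Suc n))" "y \<in> carrier (nerve X (Suc n))" for x y
    using that by (auto simp: tot map_hom base_simps top_simps act_simps act.A.M.a_ac)
  moreover have "nerve_total X (c \<odot>\<^bsub>nerve X (Suc n)\<^esub> x) = c \<odot>\<^bsub>cm_base X\<^esub> nerve_total X x"
    if "x \<in> carrier (nerve X (Suc n))" for x c
    using that by (auto simp: tot map_hom smult_simps)
  ultimately show ?case by (blast del: nerve_cases)
qed

lemma nerve_algebra: "nonunital_algebra (nerve X n)"
  and nerve_total_closed: "x \<in> carrier (nerve X n) \<Longrightarrow> nerve_total X x \<in> carrier (cm_base X)"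
  using nerve_algebra_total[of n] by auto

lemma nerve_module: "Module.module ground_field (nerve X n)"
  using nerve_algebra by (simp add: nonunital_algebra_def)

lemma nerve_mult_closed: "x \<in> carrier (nerve X n) \<Longrightarrow> y \<in> carrier (nerve X n) \<Longrightarrow> x \<otimes>\<^bsub>nerve X n\<^esub> y \<in> carrier (nerve X n)"
  using nerve_algebra by (rule nonunital_algebra.mult_closed)

lemma length_nerve: "x \<in> carrier (nerve X n) \<Longrightarrow> length (fst x) = n"
  by (induction n arbitrary: x) (auto simp: tuple_cons_def)

lemma nerve_face_0: "nerve_face X (Suc n) 0 (tuple_cons r x) = x"
  by (simp add: nerve_face_def tuple_cons_def)

lemma nerve_face_last: "nerve_face X (Suc 0) (Suc 0) (tuple_cons r ([], a)) = ([], cm_map X r \<oplus>\<^bsub>cm_base X\<^esub> a)"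
  by (simp add: nerve_face_def tuple_cons_def)

lemma nerve_face_1: "nerve_face X (Suc (Suc n)) (Suc 0) (tuple_cons r (tuple_cons s x)) = tuple_cons (r \<oplus>\<^bsub>cm_top X\<^esub> s) x"
  by (simp add: nerve_face_def tuple_cons_def)

lemma nerve_face_Suc:
  "x \<in> carrier (nerve X (Suc n)) \<Longrightarrow> nerve_face X (Suc (Suc n)) (Suc (Suc i)) (tuple_cons r x) = tuple_cons r (nerve_face X (Suc n) (Suc i) x)"
  using length_nerve[of x "Suc n"] by (auto simp: nerve_face_def tuple_cons_def Let_def)

text \<open>The faces of positive index only regroup the summands of the total, or apply the
  structure map to one of them earlier. The face d_0 drops a summand and is left out.\<close>

lemma nerve_face_total:
  "x \<in> carrier (nerve X (Suc n)) \<Longrightarrow> i \<le> n \<Longrightarrow>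
    nerve_face X (Suc n) (Suc i) x \<in> carrier (nerve X n) \<and> nerve_total X (nerve_face X (Suc n) (Suc i) x) = nerve_total X x"
proof (induction n arbitrary: x i)
  case 0
  then show ?case by (auto simp: nerve_face_last map_hom)
next
  case (Suc n)
  obtain r y where x: "x = tuple_cons r y" "r \<in> carrier (cm_top X)" "y \<in> carrier (nerve X (Suc n))"
    using nerve_cases[OF Suc.prems(1)] .
  show ?case
  proof (cases i)
    case 0
    obtain s z where y: "y = tuple_cons s z" "s \<in> carrier (cm_top X)" "z \<in> carrier (nerve X n)"
      using nerve_cases[OF x(3)] .
    then show ?thesis using x 0 by (simp add: nerve_face_1 map_hom nerve_total_closed act.A.M.a_assoc)
  next
    case (Suc j)
    then show ?thesis using x Suc.IH[OF x(3), of j] Suc.prems(2) nerve_face_Suc[OF x(3)] by auto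
  qed
qed

lemma nerve_face_closed: "x \<in> carrier (nerve X (Suc n)) \<Longrightarrow> i \<le> Suc n \<Longrightarrow> nerve_face X (Suc n) i x \<in> carrier (nerve X n)"
  using nerve_face_total[of x n "i - 1"] by (cases i) (auto simp: nerve_face_0)

lemma nerve_face_mult:
  "x \<in> carrier (nerve X (Suc n)) \<Longrightarrow> x' \<in> carrier (nerve X (Suc n)) \<Longrightarrow> i \<le> Suc n \<Longrightarrow>
    nerve_face X (Suc n) i (x \<otimes>\<^bsub>nerve X (Suc n)\<^esub> x') = nerve_face X (Suc n) i x \<otimes>\<^bsub>nerve X n\<^esub> nerve_face X (Suc n) i x'"
proof (induction n arbitrary: x x' i)
  case 0
  show ?case
  proof (cases i)
    case 0
    then show ?thesis using "0.prems" by (auto simp: nerve_face_0)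
  next
    case (Suc j)
    then show ?thesis using "0.prems"
      by (auto simp: nerve_face_last map_hom base_simps top_simps act_simps act.A.M.a_ac)
  qed
next
  case (Suc n)
  obtain r y where x: "x = tuple_cons r y" "r \<in> carrier (cm_top X)" "y \<in> carrier (nerve X (Suc n))"
    using nerve_cases[OF Suc.prems(1)] .
  obtain r' y' where x': "x' = tuple_cons r' y'" "r' \<in> carrier (cm_top X)" "y' \<in> carrier (nerve X (Suc n))"
    using nerve_cases[OF Suc.prems(2)] .
  have yy: "y \<otimes>\<^bsub>nerve X (Suc n)\<^esub> y' \<in> carrier (nerve X (Suc n))" by (rule nerve_mult_closed[OF x(3) x'(3)])
  have mult: "x \<otimes>\<^bsub>nerve X (Suc (Suc n))\<^esub> x' = tuple_cons (r \<otimes>\<^bsub>cm_top X\<^esub> r' \<oplus>\<^bsub>cm_top X\<^esub> cm_lact X (nerve_total X y) r'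
      \<oplus>\<^bsub>cm_top X\<^esub> cm_ract X r (nerve_total X y')) (y \<otimes>\<^bsub>nerve X (Suc n)\<^esub> y')"
    by (subst nerve_Suc_simps(3)) (simp add: x(1) x'(1))
  consider "i = 0" | "i = Suc 0" | j where "i = Suc (Suc j)" "j \<le> n" using Suc.prems(3)
    by (metis Suc_le_mono not0_implies_Suc)
  then show ?case
  proof cases
    case 1
    then show ?thesis unfolding mult by (simp only: nerve_face_0 x(1) x'(1))
  next
    case 2
    obtain s z where y: "y = tuple_cons s z" "s \<in> carrier (cm_top X)" "z \<in> carrier (nerve X n)"
      using nerve_cases[OF x(3)] .
    obtain s' z' where y': "y' = tuple_cons s' z'" "s' \<in> carrier (cm_top X)" "z' \<in> carrier (nerve X n)"
      using nerve_cases[OF x'(3)] .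
    show ?thesis using x(2) x'(2) y y' 2
      by (simp add: x(1) x'(1) nerve_face_1 map_hom nerve_total_closed top_simps act_simps act.R.M.a_ac)
  next
    \<comment> \<open>Faces of index 2 or more leave the first entry alone and preserve the total of
      the remaining tuple, through which that tuple acts on the first entry.\<close>
    case 3
    have "nerve_face X (Suc (Suc n)) i (x \<otimes>\<^bsub>nerve X (Suc (Suc n))\<^esub> x') = tuple_cons (r \<otimes>\<^bsub>cm_top X\<^esub> r' \<oplus>\<^bsub>cm_top X\<^esub> cm_lact X (nerve_total X y) r'
      \<oplus>\<^bsub>cm_top X\<^esub> cm_ract X r (nerve_total X y')) (nerve_face X (Suc n) (Suc j) y \<otimes>\<^bsub>nerve X n\<^esub> nerve_face X (Suc n) (Suc j) y')"
      unfolding mult 3(1) nerve_face_Suc[OF yy] using Suc.IH[OF x(3) x'(3), of "Suc j"] 3(2) by simp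
    then show ?thesis
      unfolding 3(1) x(1) x'(1) nerve_face_Suc[OF x(3)] nerve_face_Suc[OF x'(3)]
      using nerve_face_total[OF x(3) 3(2)] nerve_face_total[OF x'(3) 3(2)] by simp
  qed
qed

end

lemma nerve_map_cons [simp]: "nerve_map \<mu> \<nu> (tuple_cons r x) = tuple_cons (\<mu> r) (nerve_map \<mu> \<nu> x)"
  and nerve_map_Nil [simp]: "nerve_map \<mu> \<nu> ([], a) = ([], \<nu> a)"
  by (simp_all add: nerve_map_def tuple_cons_def)

context
  fixes X :: "('k::field, 'r, 'a) crossed_mod" and Y :: "('k, 's, 'b) crossed_mod" and \<mu> \<nu>
  assumes X: "crossed_module X" and Y: "crossed_module Y" and mor: "crossed_module_morphism X Y \<mu> \<nu>"
begin

lemma morphism_simps: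
  "r \<in> carrier (cm_top X) \<Longrightarrow> \<mu> r \<in> carrier (cm_top Y)"
  "r \<in> carrier (cm_top X) \<Longrightarrow> r' \<in> carrier (cm_top X) \<Longrightarrow> \<mu> (r \<oplus>\<^bsub>cm_top X\<^esub> r') = \<mu> r \<oplus>\<^bsub>cm_top Y\<^esub> \<mu> r'"
  "r \<in> carrier (cm_top X) \<Longrightarrow> \<mu> (c \<odot>\<^bsub>cm_top X\<^esub> r) = c \<odot>\<^bsub>cm_top Y\<^esub> \<mu> r"
  "r \<in> carrier (cm_top X) \<Longrightarrow> r' \<in> carrier (cm_top X) \<Longrightarrow> \<mu> (r \<otimes>\<^bsub>cm_top X\<^esub> r') = \<mu> r \<otimes>\<^bsub>cm_top Y\<^esub> \<mu> r'"
  "a \<in> carrier (cm_base X) \<Longrightarrow> \<nu> a \<in> carrier (cm_base Y)"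
  "a \<in> carrier (cm_base X) \<Longrightarrow> a' \<in> carrier (cm_base X) \<Longrightarrow> \<nu> (a \<oplus>\<^bsub>cm_base X\<^esub> a') = \<nu> a \<oplus>\<^bsub>cm_base Y\<^esub> \<nu> a'"
  "a \<in> carrier (cm_base X) \<Longrightarrow> \<nu> (c \<odot>\<^bsub>cm_base X\<^esub> a) = c \<odot>\<^bsub>cm_base Y\<^esub> \<nu> a"
  "a \<in> carrier (cm_base X) \<Longrightarrow> a' \<in> carrier (cm_base X) \<Longrightarrow> \<nu> (a \<otimes>\<^bsub>cm_base X\<^esub> a') = \<nu> a \<otimes>\<^bsub>cm_base Y\<^esub> \<nu> a'"
  "r \<in> carrier (cm_top X) \<Longrightarrow> cm_map Y (\<mu> r) = \<nu> (cm_map X r)"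
  "a \<in> carrier (cm_base X) \<Longrightarrow> r \<in> carrier (cm_top X) \<Longrightarrow> \<mu> (cm_lact X a r) = cm_lact Y (\<nu> a) (\<mu> r)"
  "a \<in> carrier (cm_base X) \<Longrightarrow> r \<in> carrier (cm_top X) \<Longrightarrow> \<mu> (cm_ract X r a) = cm_ract Y (\<mu> r) (\<nu> a)"
  using mor by (auto simp: crossed_module_morphism_def algebra_hom_def linear_map_def hom_def)

lemma nerve_map_hom:
  "(\<forall>x\<in>carrier (nerve X n). nerve_map \<mu> \<nu> x \<in> carrier (nerve Y n) \<and> nerve_total Y (nerve_map \<mu> \<nu> x) = \<nu> (nerve_total X x)) \<and>
   (\<forall>x\<in>carrier (nerve X n). \<forall>y\<in>carrier (nerve X n).
      nerve_map \<mu> \<nu> (x \<otimes>\<^bsub>nerve X n\<^esub> y) = nerve_map \<mu> \<nu> x \<otimes>\<^bsub>nerve Y n\<^esub> nerve_map \<mu> \<nu> y)"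
proof (induction n)
  case 0
  then show ?case by (auto simp: morphism_simps)
next
  case (Suc n)
  interpret act: algebra_action "cm_base X" "cm_top X" "cm_lact X" "cm_ract X"
    using X by (simp add: crossed_module_def Let_def)
  have "nerve_map \<mu> \<nu> x \<in> carrier (nerve Y (Suc n)) \<and> nerve_total Y (nerve_map \<mu> \<nu> x) = \<nu> (nerve_total X x)"
    if "x \<in> carrier (nerve X (Suc n))" for x
    using that Suc by (auto simp: morphism_simps nerve_total_closed[OF X] map_hom[OF X])
  moreover have "nerve_map \<mu> \<nu> (x \<otimes>\<^bsub>nerve X (Suc n)\<^esub> y) = nerve_map \<mu> \<nu> x \<otimes>\<^bsub>nerve Y (Suc n)\<^esub> nerve_map \<mu> \<nu> y"
    if "x \<in> carrier (nerve X (Suc n))" "y \<in> carrier (nerve X (Suc n))" for x y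
    using that Suc by (auto simp: morphism_simps nerve_total_closed[OF X] act.lact_closed act.ract_closed act.R.mult_closed)
  ultimately show ?case by (blast del: nerve_cases)
qed

lemma nerve_map_closed: "x \<in> carrier (nerve X n) \<Longrightarrow> nerve_map \<mu> \<nu> x \<in> carrier (nerve Y n)"
  and nerve_map_mult: "x \<in> carrier (nerve X n) \<Longrightarrow> y \<in> carrier (nerve X n) \<Longrightarrow>
    nerve_map \<mu> \<nu> (x \<otimes>\<^bsub>nerve X n\<^esub> y) = nerve_map \<mu> \<nu> x \<otimes>\<^bsub>nerve Y n\<^esub> nerve_map \<mu> \<nu> y"
  using nerve_map_hom[of n] by auto

lemma nerve_map_face:
  "x \<in> carrier (nerve X (Suc n)) \<Longrightarrow> i \<le> Suc n \<Longrightarrow>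
    nerve_map \<mu> \<nu> (nerve_face X (Suc n) i x) = nerve_face Y (Suc n) i (nerve_map \<mu> \<nu> x)"
proof (induction n arbitrary: x i)
  case 0
  then obtain r a where x: "x = tuple_cons r ([], a)" "r \<in> carrier (cm_top X)" "a \<in> carrier (cm_base X)" by auto
  show ?case
  proof (cases i)
    case (Suc j)
    then show ?thesis using "0.prems"(2) x map_hom(1)[OF X x(2)]
      by (simp add: nerve_face_last[OF X] nerve_face_last[OF Y] morphism_simps)
  qed (simp add: x nerve_face_0[OF X] nerve_face_0[OF Y])
next
  case (Suc n)
  obtain r y where x: "x = tuple_cons r y" "r \<in> carrier (cm_top X)" "y \<in> carrier (nerve X (Suc n))"
    using nerve_cases[OF Suc.prems(1)] .
  consider "i = 0" | "i = Suc 0" | j where "i = Suc (Suc j)" "j \<le> n" using Suc.prems(2)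
    by (metis Suc_le_mono not0_implies_Suc)
  then show ?case
  proof cases
    case 1
    then show ?thesis by (simp add: x(1) nerve_face_0[OF X] nerve_face_0[OF Y])
  next
    case 2
    obtain s z where y: "y = tuple_cons s z" "s \<in> carrier (cm_top X)" "z \<in> carrier (nerve X n)"
      using nerve_cases[OF x(3)] .
    then show ?thesis using x(2) 2 by (simp add: x(1) nerve_face_1[OF X] nerve_face_1[OF Y] morphism_simps)
  next
    case 3
    have y: "nerve_map \<mu> \<nu> y \<in> carrier (nerve Y (Suc n))" using x(3) by (rule nerve_map_closed)
    show ?thesis
      using Suc.IH[OF x(3), of "Suc j"] 3(2) by (simp add: x(1) 3(1) nerve_face_Suc[OF X x(3)] nerve_face_Suc[OF Y y])
  qed
qed

end

section \<open>Coordinates on the nerve\<close>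

lemma linear_extension_relabel: "linear_extension f (relabel g u) = linear_extension (\<lambda>x. f (g x)) u"
  by (rule lin_eqI) (auto intro!: lin_intros)

lemma linear_extension_lin: "lin F \<Longrightarrow> linear_extension (\<lambda>x. F (f x)) u = F (linear_extension f u)"
  by (rule lin_eqI) (auto intro!: lin_intros lin_comp[of F])

lemma linear_extension_zero: "linear_extension (\<lambda>x. 0) u = 0"
  by (rule lin_eqI) (auto intro!: lin_intros)

lemma linear_extension_id: "linear_extension word u = u"
  by (rule lin_eqI) (auto intro!: lin_intros)

lemma relabel_onto:
  assumes "inj f" "v \<in> supp (f ` B)"
  obtains u where "u \<in> supp B" "v = relabel f u"
proof
  show "unlabel f v \<in> supp B"
    by (rule lin_supp[OF lin_unlabel assms(2)]) (use assms(1) in \<open>auto simp: unlabel_word inj_eq\<close>)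
  show "v = relabel f (unlabel f v)"
    by (rule relabel_unlabel[OF assms(1), symmetric]) (rule supp_mono[OF assms(2)], auto)
qed

lemma relabel_inj: "inj f \<Longrightarrow> relabel f u = relabel f v \<Longrightarrow> u = v"
  by (metis unlabel_relabel)

lemma restrict_chain_add: "restrict_chain B (u + v) = restrict_chain B u + restrict_chain B v"
  by (rule chains.linear_add[OF lin_restrict_chain])

lemma coord_cong:
  assumes V: "coord V B \<kappa>" and eq: "\<And>x. x \<in> carrier V \<Longrightarrow> \<kappa>' x = \<kappa> x"
  shows "coord V B \<kappa>'"
  using V ground_module_closed[OF coord_module[OF V]] bij_betw_cong[of "carrier V" \<kappa>' \<kappa>]
  by (auto simp: coord_def eq)

lemma coord_transport:
  fixes M :: "('k::field, 'm) module" and U :: "('k, 'u) module" and f :: "'x \<Rightarrow> 'y"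
  assumes U: "coord U B \<kappa>" and M: "Module.module ground_field M" and f: "inj f"
    and p: "bij_betw p (carrier M) (carrier U)"
    and add: "\<And>x y. x \<in> carrier M \<Longrightarrow> y \<in> carrier M \<Longrightarrow> p (x \<oplus>\<^bsub>M\<^esub> y) = p x \<oplus>\<^bsub>U\<^esub> p y"
    and smult: "\<And>c x. x \<in> carrier M \<Longrightarrow> p (c \<odot>\<^bsub>M\<^esub> x) = c \<odot>\<^bsub>U\<^esub> p x"
  shows "coord M (f ` B) (\<lambda>x. relabel f (\<kappa> (p x)))"
  unfolding coord_def
proof (intro conjI ballI allI)
  have closed: "x \<in> carrier M \<Longrightarrow> p x \<in> carrier U" for x using p by (auto simp: bij_betw_def)
  have "bij_betw (relabel f) (supp B :: ('x \<Rightarrow>\<^sub>0 'k) set) (supp (f ` B))"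
    unfolding bij_betw_def
  proof
    show "inj_on (relabel f :: ('x \<Rightarrow>\<^sub>0 'k) \<Rightarrow> _) (supp B)" by (rule inj_onI) (rule relabel_inj[OF f])
    show "relabel f ` (supp B :: ('x \<Rightarrow>\<^sub>0 'k) set) = supp (f ` B)" using relabel_onto[OF f] by (auto intro: relabel_supp) blast
  qed
  from bij_betw_trans[OF bij_betw_trans[OF p coord_bij[OF U]] this]
  show "bij_betw (\<lambda>x. relabel f (\<kappa> (p x))) (carrier M) (supp (f ` B))" by (simp add: comp_def)
  show "relabel f (\<kappa> (p (x \<oplus>\<^bsub>M\<^esub> y))) = relabel f (\<kappa> (p x)) + relabel f (\<kappa> (p y))"
    if "x \<in> carrier M" "y \<in> carrier M" for x y
    using that closed by (simp add: add coord_add[OF U] chains.linear_add[OF lin_relabel])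
  show "relabel f (\<kappa> (p (c \<odot>\<^bsub>M\<^esub> x))) = c \<star> relabel f (\<kappa> (p x))" if "x \<in> carrier M" for c x
    using that closed by (simp add: smult coord_smult[OF U] chains.linear_scale[OF lin_relabel])
qed (rule M)

lemma coord_sum:
  fixes M :: "('k::field, 'm) module" and U :: "('k, 'u) module" and N :: "('k, 'n) module"
    and f :: "'x \<Rightarrow> 'z" and g :: "'y \<Rightarrow> 'z"
  assumes U: "coord U B \<kappa>" and N: "coord N B' \<kappa>'" and M: "Module.module ground_field M"
    and f: "inj f" and g: "inj g" and disj: "f ` B \<inter> g ` B' = {}"
    and closed: "\<And>x. x \<in> carrier M \<Longrightarrow> p x \<in> carrier U \<and> q x \<in> carrier N"
    and add: "\<And>x y. x \<in> carrier M \<Longrightarrow> y \<in> carrier M \<Longrightarrow> p (x \<oplus>\<^bsub>M\<^esub> y) = p x \<oplus>\<^bsub>U\<^esub> p y \<and> q (x \<oplus>\<^bsub>M\<^esub> y) = q x \<oplus>\<^bsub>N\<^esub> q y"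
    and smult: "\<And>c x. x \<in> carrier M \<Longrightarrow> p (c \<odot>\<^bsub>M\<^esub> x) = c \<odot>\<^bsub>U\<^esub> p x \<and> q (c \<odot>\<^bsub>M\<^esub> x) = c \<odot>\<^bsub>N\<^esub> q x"
    and inj: "\<And>x y. x \<in> carrier M \<Longrightarrow> y \<in> carrier M \<Longrightarrow> p x = p y \<Longrightarrow> q x = q y \<Longrightarrow> x = y"
    and surj: "\<And>u n. u \<in> carrier U \<Longrightarrow> n \<in> carrier N \<Longrightarrow> \<exists>x\<in>carrier M. p x = u \<and> q x = n"
  shows "coord M (f ` B \<union> g ` B') (\<lambda>x. relabel f (\<kappa> (p x)) + relabel g (\<kappa>' (q x)))"
  unfolding coord_def
proof (intro conjI ballI allI)
  let ?k = "\<lambda>x. relabel f (\<kappa> (p x)) + relabel g (\<kappa>' (q x))"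
  have r: "restrict_chain (f ` B) (?k x) = relabel f (\<kappa> (p x))" "restrict_chain (g ` B') (?k x) = relabel g (\<kappa>' (q x))"
    if "x \<in> carrier M" for x
  proof -
    have 1: "relabel f (\<kappa> (p x)) \<in> supp (f ` B)" and 2: "relabel g (\<kappa>' (q x)) \<in> supp (g ` B')"
      using closed[OF that] by (auto intro!: relabel_supp coord_supp[OF U] coord_supp[OF N])
    show "restrict_chain (f ` B) (?k x) = relabel f (\<kappa> (p x))"
      using restrict_chain_zero[OF 2 disj] by (simp add: restrict_chain_add restrict_chain_id[OF 1])
    show "restrict_chain (g ` B') (?k x) = relabel g (\<kappa>' (q x))"
      using restrict_chain_zero[OF 1, of "g ` B'"] disj by (simp add: restrict_chain_add restrict_chain_id[OF 2] Int_commute)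
  qed
  show "bij_betw ?k (carrier M) (supp (f ` B \<union> g ` B'))"
    unfolding bij_betw_def
  proof
    show "inj_on ?k (carrier M)"
    proof (rule inj_onI)
      fix x y assume xy: "x \<in> carrier M" "y \<in> carrier M" "?k x = ?k y"
      then have "relabel f (\<kappa> (p x)) = relabel f (\<kappa> (p y))" "relabel g (\<kappa>' (q x)) = relabel g (\<kappa>' (q y))"
        using r[of x] r[of y] by auto
      then have "\<kappa> (p x) = \<kappa> (p y)" "\<kappa>' (q x) = \<kappa>' (q y)" using relabel_inj[OF f] relabel_inj[OF g] by auto
      then have "p x = p y" "q x = q y"
        using closed[OF xy(1)] closed[OF xy(2)] coord_inj[OF U] coord_inj[OF N] by auto
      then show "x = y" using inj xy by blast
    qed
    show "?k ` carrier M = supp (f ` B \<union> g ` B')"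
    proof
      show "?k ` carrier M \<subseteq> supp (f ` B \<union> g ` B')"
      proof
        fix z assume "z \<in> ?k ` carrier M"
        then obtain x where x: "x \<in> carrier M" "z = ?k x" by blast
        have "relabel f (\<kappa> (p x)) \<in> supp (f ` B \<union> g ` B')"
          by (rule supp_mono[OF relabel_supp[OF coord_supp[OF U]]]) (use closed[OF x(1)] in auto)
        moreover have "relabel g (\<kappa>' (q x)) \<in> supp (f ` B \<union> g ` B')"
          by (rule supp_mono[OF relabel_supp[OF coord_supp[OF N]]]) (use closed[OF x(1)] in auto)
        ultimately show "z \<in> supp (f ` B \<union> g ` B')" unfolding x(2) by (rule supp_add)
      qed
      show "supp (f ` B \<union> g ` B') \<subseteq> ?k ` carrier M"
      proof
        fix z :: "'z \<Rightarrow>\<^sub>0 'k" assume "z \<in> supp (f ` B \<union> g ` B')"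
        then obtain v w where vw: "z = v + w" "v \<in> supp (f ` B)" "w \<in> supp (g ` B')" using supp_split by blast
        obtain v' where v': "v' \<in> supp B" "v = relabel f v'" using relabel_onto[OF f vw(2)] .
        obtain w' where w': "w' \<in> supp B'" "w = relabel g w'" using relabel_onto[OF g vw(3)] .
        obtain x where "x \<in> carrier M" "p x = vec U \<kappa> v'" "q x = vec N \<kappa>' w'"
          using surj[OF vec_closed[OF U v'(1)] vec_closed[OF N w'(1)]] by blast
        then show "z \<in> ?k ` carrier M"
          using coord_vec[OF U v'(1)] coord_vec[OF N w'(1)] v' w' vw by (intro image_eqI[of _ _ x]) auto
      qed
    qed
  qed
  show "?k (x \<oplus>\<^bsub>M\<^esub> y) = ?k x + ?k y" if "x \<in> carrier M" "y \<in> carrier M" for x y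
    using that closed by (simp add: add coord_add[OF U] coord_add[OF N] chains.linear_add[OF lin_relabel])
  show "?k (c \<odot>\<^bsub>M\<^esub> x) = c \<star> ?k x" if "x \<in> carrier M" for c x
    using that closed by (simp add: smult coord_smult[OF U] coord_smult[OF N] chains.linear_scale[OF lin_relabel] chain.scale_right_distrib)
qed (rule M)

text \<open>The letter \<open>Inl (i, x)\<close> stands for the basis vector \<open>x\<close> in the \<open>i\<close>-th entry (counted from 1) of
  a tuple \<open>(r\<^sub>1, \<dots>, r\<^sub>n, a)\<close>, the letter \<open>Inr y\<close> for the basis vector \<open>y\<close> in the entry \<open>a\<close>.\<close>

definition nerve_letters :: "'x set \<Rightarrow> 'y set \<Rightarrow> nat \<Rightarrow> ((nat \<times> 'x) + 'y) set" where
  "nerve_letters R A p = {Inl (i, x) | i x. 1 \<le> i \<and> i \<le> p \<and> x \<in> R} \<union> Inr ` A"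

fun shift_letter :: "(nat \<times> 'x) + 'y \<Rightarrow> (nat \<times> 'x) + 'y" where
  "shift_letter (Inl (i, x)) = Inl (Suc i, x)"
| "shift_letter (Inr y) = Inr y"

abbreviation first_letter :: "'x \<Rightarrow> (nat \<times> 'x) + 'y" where
  "first_letter x \<equiv> Inl (Suc 0, x)"

lemma inj_shift_letter: "inj shift_letter"
  by (rule injI, elim shift_letter.elims) auto

lemma nerve_letters_Suc: "nerve_letters R A (Suc p) = first_letter ` R \<union> shift_letter ` nerve_letters R A p"
  (is "?L = ?R")
proof
  show "?L \<subseteq> ?R"
  proof
    fix b assume b: "b \<in> ?L"
    show "b \<in> ?R"
    proof (cases b)
      case (Inl ix)
      then obtain i x where ix: "b = Inl (i, x)" "1 \<le> i" "i \<le> Suc p" "x \<in> R" using b by (auto simp: nerve_letters_def)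
      show ?thesis
      proof (cases "i = Suc 0")
        case False
        then have "b = shift_letter (Inl (i - 1, x))" "Inl (i - 1, x) \<in> nerve_letters R A p" using ix by (auto simp: nerve_letters_def)
        then show ?thesis by blast
      qed (use ix in auto)
    next
      case (Inr y)
      then have "b = shift_letter (Inr y)" "Inr y \<in> nerve_letters R A p" using b by (auto simp: nerve_letters_def)
      then show ?thesis by blast
    qed
  qed
  show "?R \<subseteq> ?L" by (auto simp: nerve_letters_def)
qed

definition nerve_coord :: "('r \<Rightarrow> ('x \<Rightarrow>\<^sub>0 'k::field)) \<Rightarrow> ('a \<Rightarrow> ('y \<Rightarrow>\<^sub>0 'k)) \<Rightarrow> 'r list \<times> 'a \<Rightarrow> ((nat \<times> 'x) + 'y \<Rightarrow>\<^sub>0 'k)" where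
  "nerve_coord \<kappa>R \<kappa>A x = foldr (\<lambda>r v. relabel first_letter (\<kappa>R r) + relabel shift_letter v) (fst x) (relabel Inr (\<kappa>A (snd x)))"

lemma nerve_coord_simps [simp]:
  "nerve_coord \<kappa>R \<kappa>A (tuple_cons r x) = relabel first_letter (\<kappa>R r) + relabel shift_letter (nerve_coord \<kappa>R \<kappa>A x)"
  "nerve_coord \<kappa>R \<kappa>A ([], a) = relabel Inr (\<kappa>A a)"
  by (simp_all add: nerve_coord_def tuple_cons_def)

text \<open>With \<open>j \<le> p\<close>, the conditions \<open>i \<le> j\<close> and
  \<open>i = p\<close> single out the last face, the only one that uses the structure map. The first
  entry behind d_0 is the one that is deleted.\<close>

fun face_letter :: "('x \<Rightarrow> ('y \<Rightarrow>\<^sub>0 'k::field)) \<Rightarrow> nat \<Rightarrow> nat \<Rightarrow> (nat \<times> 'x) + 'y \<Rightarrow> ((nat \<times> 'x) + 'y \<Rightarrow>\<^sub>0 'k)" where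
  "face_letter rm p j (Inl (i, x)) =
     (if j < i then if i = Suc 0 then 0 else word (Inl (i - 1, x))
      else if i = p then relabel Inr (rm x) else word (Inl (i, x)))"
| "face_letter rm p j (Inr y) = word (Inr y)"

lemma face_letter_Inr [simp]: "linear_extension (face_letter rm p j) (relabel Inr v) = relabel Inr v"
  by (simp add: linear_extension_relabel) (simp add: relabel_def)

lemma face_letter_shift:
  assumes "1 \<le> p" "1 \<le> j"
  shows "linear_extension (face_letter rm (Suc p) (Suc j)) (relabel shift_letter u) =
    relabel shift_letter (linear_extension (face_letter rm p j) u)"
proof (rule lin_eqI[of "\<lambda>u. linear_extension (face_letter rm (Suc p) (Suc j)) (relabel shift_letter u)"])
  fix b :: "nat \<times> 'a + 'b"
  show "linear_extension (face_letter rm (Suc p) (Suc j)) (relabel shift_letter (word b)) =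
      relabel shift_letter (linear_extension (face_letter rm p j) (word b))"
    using assms by (cases b rule: shift_letter.cases) (auto simp: relabel_comp)
qed (auto intro!: lin_intros)

lemma face_face_letter:
  assumes b: "b \<in> nerve_letters R A (Suc (Suc p))" and ij: "i < j" "j \<le> Suc (Suc p)"
  shows "linear_extension (face_letter rm (Suc p) i) (face_letter rm (Suc (Suc p)) j b) =
    linear_extension (face_letter rm (Suc p) (j - 1)) (face_letter rm (Suc (Suc p)) i b)"
proof (cases b rule: shift_letter.cases)
  case (1 k x)
  have k: "1 \<le> k" "k \<le> Suc (Suc p)" using b 1 by (auto simp: nerve_letters_def)
  consider "j < k" | "k \<le> i" | "i < k" "k \<le> j" by linarith
  then show ?thesis
  proof cases
    case 1
    have "linear_extension (face_letter rm (Suc p) i) (word (Inl (k - 1, x))) =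
      linear_extension (face_letter rm (Suc p) (j - 1)) (word (Inl (k - 1, x)))"
      using 1 ij by auto
    then show ?thesis using 1 ij \<open>b = Inl (k, x)\<close> by auto
  next
    case 2
    then show ?thesis using ij k \<open>b = Inl (k, x)\<close> by auto
  next
    case 3
    then show ?thesis using ij k \<open>b = Inl (k, x)\<close>
      by (auto simp: chains.linear_0[OF lin_linear_extension])
  qed
qed simp

lemma face_letter_supp:
  assumes "b \<in> nerve_letters R A (Suc p)" "j \<le> Suc p" "\<And>x. x \<in> R \<Longrightarrow> rm x \<in> supp A"
  shows "face_letter rm (Suc p) j b \<in> supp (nerve_letters R A p)"
proof (cases b rule: shift_letter.cases)
  case (1 i x)
  have "relabel Inr (rm x) \<in> supp (nerve_letters R A p)"
    by (rule supp_mono[OF relabel_supp[OF assms(3)]]) (use assms(1) 1 in \<open>auto simp: nerve_letters_def\<close>)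
  then show ?thesis using assms(1,2) 1 by (auto simp: nerve_letters_def)
qed (use assms in \<open>auto simp: nerve_letters_def\<close>)

context
  fixes X :: "('k::field, 'r, 'a) crossed_mod" and R :: "'x set" and A :: "'y set" and \<kappa>R \<kappa>A rm
  assumes X: "crossed_module X" and R: "coord (cm_top X) R \<kappa>R" and A: "coord (cm_base X) A \<kappa>A"
    and rm: "\<And>r. r \<in> carrier (cm_top X) \<Longrightarrow> \<kappa>A (cm_map X r) = linear_extension rm (\<kappa>R r)"
begin

lemma coord_nerve: "coord (nerve X p) (nerve_letters R A p) (nerve_coord \<kappa>R \<kappa>A)"
proof (induction p)
  case 0
  have "coord (nerve X 0) (Inr ` A) (\<lambda>x. relabel Inr (\<kappa>A (snd x)))"
    by (rule coord_transport[OF A nerve_module[OF X]]) (auto simp: bij_betw_def inj_on_def image_iff)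
  then have "coord (nerve X 0) (nerve_letters R A 0) (\<lambda>x. relabel Inr (\<kappa>A (snd x)))"
    by (simp add: nerve_letters_def)
  then show ?case by (rule coord_cong) auto
next
  case (Suc p)
  have "coord (nerve X (Suc p)) (first_letter ` R \<union> shift_letter ` nerve_letters R A p)
      (\<lambda>x. relabel first_letter (\<kappa>R (tuple_hd x)) + relabel shift_letter (nerve_coord \<kappa>R \<kappa>A (tuple_tl x)))"
  proof (rule coord_sum[OF R Suc nerve_module[OF X]])
    show "first_letter ` R \<inter> shift_letter ` nerve_letters R A p = {}" by (auto simp: nerve_letters_def)
    show "\<exists>x\<in>carrier (nerve X (Suc p)). tuple_hd x = u \<and> tuple_tl x = n"
      if "u \<in> carrier (cm_top X)" "n \<in> carrier (nerve X p)" for u n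
      using that by (intro bexI[of _ "tuple_cons u n"]) auto
    show "x = y" if "x \<in> carrier (nerve X (Suc p))" "y \<in> carrier (nerve X (Suc p))"
      "tuple_hd x = tuple_hd y" "tuple_tl x = tuple_tl y" for x y
      using that by (elim nerve_cases) simp
    show "inj shift_letter" by (rule inj_shift_letter)
  qed (auto simp: inj_on_def)
  then show ?case unfolding nerve_letters_Suc by (rule coord_cong) auto
qed

lemma nerve_coord_face:
  "x \<in> carrier (nerve X (Suc p)) \<Longrightarrow> j \<le> Suc p \<Longrightarrow>
    nerve_coord \<kappa>R \<kappa>A (nerve_face X (Suc p) j x) = linear_extension (face_letter rm (Suc p) j) (nerve_coord \<kappa>R \<kappa>A x)"
proof (induction p arbitrary: x j)
  have add: "linear_extension (face_letter rm q j) (u + v) = linear_extension (face_letter rm q j) u + linear_extension (face_letter rm q j) v" for q j u v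
    by (rule chains.linear_add[OF lin_linear_extension])
  have zero: "nerve_coord \<kappa>R \<kappa>A (nerve_face X (Suc q) 0 x) = linear_extension (face_letter rm (Suc q) 0) (nerve_coord \<kappa>R \<kappa>A x)"
    if mem: "x \<in> carrier (nerve X (Suc q))" for q x
  proof -
    obtain r y where x: "x = tuple_cons r y" "y \<in> carrier (nerve X q)" using nerve_cases[OF mem] by blast
    have "linear_extension (face_letter rm (Suc q) 0) (relabel shift_letter (nerve_coord \<kappa>R \<kappa>A y)) = nerve_coord \<kappa>R \<kappa>A y"
      by (rule lin_eq_supp[OF _ _ coord_supp[OF coord_nerve x(2)], of "\<lambda>u. linear_extension _ (relabel _ u)"])
        (auto intro!: lin_intros simp: nerve_letters_def)
    moreover have "linear_extension (face_letter rm (Suc q) 0) (relabel first_letter (\<kappa>R r)) = 0"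
      by (simp add: linear_extension_relabel linear_extension_zero)
    ultimately show ?thesis by (simp add: x nerve_face_0[OF X] add)
  qed
  {
    case 0
    show ?case
    proof (cases j)
      case (Suc i)
      then obtain r a where x: "x = tuple_cons r ([], a)" "r \<in> carrier (cm_top X)" "a \<in> carrier (cm_base X)" "j = Suc 0"
        using 0 by auto
      have "linear_extension (face_letter rm (Suc 0) (Suc 0)) (relabel first_letter (\<kappa>R r)) = relabel Inr (\<kappa>A (cm_map X r))"
        by (simp add: linear_extension_relabel linear_extension_lin[OF lin_relabel] rm x)
      then show ?thesis
        using x map_hom(1)[OF X, of r] by (simp add: nerve_face_last[OF X] add relabel_comp coord_add[OF A] chains.linear_add[OF lin_relabel])
    qed (use zero[OF 0(1)] in simp)
  next
    case (Suc p)
    obtain r y where x: "x = tuple_cons r y" "r \<in> carrier (cm_top X)" "y \<in> carrier (nerve X (Suc p))"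
      using nerve_cases[OF Suc.prems(1)] by blast
    consider "j = 0" | "j = Suc 0" | i where "j = Suc (Suc i)" "i \<le> p" using Suc.prems(2)
      by (metis Suc_le_mono not0_implies_Suc)
    then show ?case
    proof cases
      case 1
      then show ?thesis using zero[OF Suc.prems(1)] by simp
    next
      case 2
      obtain s z where y: "y = tuple_cons s z" "s \<in> carrier (cm_top X)" "z \<in> carrier (nerve X p)"
        using nerve_cases[OF x(3)] by blast
      have *: "linear_extension (face_letter rm (Suc (Suc p)) (Suc 0)) (relabel shift_letter (relabel shift_letter u)) = relabel shift_letter u" for u
      proof (rule lin_eqI[of "\<lambda>u. linear_extension _ (relabel _ (relabel _ u))"])
        fix b :: "nat \<times> 'x + 'y"
        show "linear_extension (face_letter rm (Suc (Suc p)) (Suc 0)) (relabel shift_letter (relabel shift_letter (word b))) = relabel shift_letter (word b)"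
          by (cases b rule: shift_letter.cases) auto
      qed (auto intro!: lin_intros)
      have "linear_extension (face_letter rm (Suc (Suc p)) (Suc 0)) (relabel first_letter u) = relabel first_letter u" for u
        by (simp add: linear_extension_relabel) (simp add: relabel_def)
      moreover have "linear_extension (face_letter rm (Suc (Suc p)) (Suc 0)) (relabel shift_letter (relabel first_letter u)) = relabel first_letter u" for u
        by (simp add: linear_extension_relabel) (simp add: relabel_def)
      ultimately show ?thesis
        using x(2) y by (simp add: x(1) 2 nerve_face_1[OF X] * add coord_add[OF R] chains.linear_add[OF lin_relabel])
    next
      case 3
      have "linear_extension (face_letter rm (Suc (Suc p)) (Suc (Suc i))) (relabel first_letter u) = relabel first_letter u" for u
        by (simp add: linear_extension_relabel) (simp add: relabel_def)
      then show ?thesis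
        using Suc.IH[OF x(3), of "Suc i"] 3(2) by (simp add: x(1) 3(1) nerve_face_Suc[OF X x(3)] add face_letter_shift)
    qed
  }
qed

end

subsection \<open>Structure constants\<close>

text \<open>Restricting to \<open>B\<close> first gives a linear map on all chains, so that the laws
  of the structure constants hold for arbitrary arguments, as \<open>coord_letters\<close>
  demands.\<close>

definition basis_vec :: "('k::field, 'v) module \<Rightarrow> 'b set \<Rightarrow> ('v \<Rightarrow> ('b \<Rightarrow>\<^sub>0 'k)) \<Rightarrow> ('b \<Rightarrow>\<^sub>0 'k) \<Rightarrow> 'v" where
  "basis_vec V B \<kappa> u = vec V \<kappa> (restrict_chain B u)"

lemma basis_vec:
  assumes V: "coord V B \<kappa>"
  shows basis_vec_closed: "basis_vec V B \<kappa> u \<in> carrier V"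
    and coord_basis_vec: "\<kappa> (basis_vec V B \<kappa> u) = restrict_chain B u"
    and basis_vec_coord: "x \<in> carrier V \<Longrightarrow> basis_vec V B \<kappa> (\<kappa> x) = x"
  using vec_closed[OF V restrict_chain_supp] coord_vec[OF V restrict_chain_supp]
    vec_coord[OF V] restrict_chain_id[OF coord_supp[OF V]]
  by (auto simp: basis_vec_def)

lemma basis_vec_linear:
  assumes V: "coord V B \<kappa>"
  shows basis_vec_add: "basis_vec V B \<kappa> (u + v) = basis_vec V B \<kappa> u \<oplus>\<^bsub>V\<^esub> basis_vec V B \<kappa> v"
    and basis_vec_scale: "basis_vec V B \<kappa> (c \<star> u) = c \<odot>\<^bsub>V\<^esub> basis_vec V B \<kappa> u"
  using ground_module_closed[OF coord_module[OF V]]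
  by (auto intro!: coord_inj[OF V] simp: basis_vec_closed[OF V] coord_basis_vec[OF V] coord_add[OF V] coord_smult[OF V]
    chains.linear_add[OF lin_restrict_chain] chains.linear_scale[OF lin_restrict_chain])

definition struct_const :: "('k::field, 'v) module \<Rightarrow> 'b set \<Rightarrow> ('v \<Rightarrow> ('b \<Rightarrow>\<^sub>0 'k)) \<Rightarrow> 'b \<Rightarrow> 'b \<Rightarrow> ('b \<Rightarrow>\<^sub>0 'k)" where
  "struct_const A B \<kappa> b b' = \<kappa> (basis_vec A B \<kappa> (word b) \<otimes>\<^bsub>A\<^esub> basis_vec A B \<kappa> (word b'))"

context
  fixes A :: "('k::field, 'v) module" and B :: "'b set" and \<kappa>
  assumes A: "nonunital_algebra A" and \<kappa>: "coord A B \<kappa>"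
begin

interpretation nonunital_algebra A by (rule A)

lemma bil_struct_const: "bil (struct_const A B \<kappa>) u v = \<kappa> (basis_vec A B \<kappa> u \<otimes>\<^bsub>A\<^esub> basis_vec A B \<kappa> v)"
  unfolding struct_const_def
  by (rule bil_eqI[of "\<lambda>u v. \<kappa> (basis_vec A B \<kappa> u \<otimes>\<^bsub>A\<^esub> basis_vec A B \<kappa> v)"]; rule linI)
    (simp_all add: basis_vec_closed[OF \<kappa>] basis_vec_linear[OF \<kappa>] mult_l_distr mult_r_distr smult_mult_l smult_mult_r
      mult_closed coord_add[OF \<kappa>] coord_smult[OF \<kappa>])

lemma coord_alg_struct_const: "coord_alg A B \<kappa> (struct_const A B \<kappa>)"
  unfolding coord_alg_def by (simp add: A \<kappa> bil_struct_const basis_vec_coord[OF \<kappa>])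

lemma struct_const_supp: "struct_const A B \<kappa> b b' \<in> supp B"
  unfolding struct_const_def by (intro coord_supp[OF \<kappa>] mult_closed basis_vec_closed[OF \<kappa>])

lemma struct_const_assoc:
  "bil (struct_const A B \<kappa>) (bil (struct_const A B \<kappa>) u v) w = bil (struct_const A B \<kappa>) u (bil (struct_const A B \<kappa>) v w)"
  by (simp add: bil_struct_const basis_vec_coord[OF \<kappa>] mult_closed basis_vec_closed[OF \<kappa>] mult_assoc)

end

text \<open>Cut off outside the letters of level p, since \<open>face_mult\<close> and
  \<open>face_face\<close> are required for all chains and not only for those of the right
  level.\<close>

definition nerve_fc :: "'x set \<Rightarrow> 'y set \<Rightarrow> ('x \<Rightarrow> ('y \<Rightarrow>\<^sub>0 'k::field)) \<Rightarrow> nat \<Rightarrow> nat \<Rightarrow> (nat \<times> 'x) + 'y \<Rightarrow> ((nat \<times> 'x) + 'y \<Rightarrow>\<^sub>0 'k)" where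
  "nerve_fc R A rm p j b = (if b \<in> nerve_letters R A p then face_letter rm p j b else 0)"

lemma linear_extension_nerve_fc:
  "linear_extension (nerve_fc R A rm p j) u = linear_extension (face_letter rm p j) (restrict_chain (nerve_letters R A p) u)"
  by (rule lin_eqI)
    (auto intro!: lin_intros simp: nerve_fc_def restrict_chain_word chains.linear_0[OF lin_linear_extension])

context
  fixes X :: "('k::field, 'r, 'a) crossed_mod" and R :: "'x set" and A :: "'y set" and \<kappa>R \<kappa>A rm
  assumes X: "crossed_module X" and R: "coord (cm_top X) R \<kappa>R" and A: "coord (cm_base X) A \<kappa>A"
    and rm: "\<And>r. r \<in> carrier (cm_top X) \<Longrightarrow> \<kappa>A (cm_map X r) = linear_extension rm (\<kappa>R r)"
    and rm_supp: "\<And>x. x \<in> R \<Longrightarrow> rm x \<in> supp A"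
begin

lemma nerve_coord_fc:
  assumes "x \<in> carrier (nerve X (Suc p))" "j \<le> Suc p"
  shows "nerve_coord \<kappa>R \<kappa>A (nerve_face X (Suc p) j x) = linear_extension (nerve_fc R A rm (Suc p) j) (nerve_coord \<kappa>R \<kappa>A x)"
  using restrict_chain_id[OF coord_supp[OF coord_nerve[OF X R A rm] assms(1)]]
  by (simp add: linear_extension_nerve_fc nerve_coord_face[OF X R A rm assms])

lemma nerve_fc_mult:
  assumes j: "j \<le> Suc p"
  defines "m \<equiv> \<lambda>p. struct_const (nerve X p) (nerve_letters R A p) (nerve_coord \<kappa>R \<kappa>A)"
  shows "linear_extension (nerve_fc R A rm (Suc p) j) (bil (m (Suc p)) u v) =
    bil (m p) (linear_extension (nerve_fc R A rm (Suc p) j) u) (linear_extension (nerve_fc R A rm (Suc p) j) v)"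
proof -
  note C = coord_nerve[OF X R A rm]
  let ?e = "\<lambda>p. basis_vec (nerve X p) (nerve_letters R A p) (nerve_coord \<kappa>R \<kappa>A)"
  have e: "linear_extension (nerve_fc R A rm (Suc p) j) u = nerve_coord \<kappa>R \<kappa>A (nerve_face X (Suc p) j (?e (Suc p) u))" for u
    by (simp add: nerve_coord_face[OF X R A rm basis_vec_closed[OF C] j] coord_basis_vec[OF C] linear_extension_nerve_fc)
  have closed: "nerve_face X (Suc p) j (?e (Suc p) u) \<in> carrier (nerve X p)" for u
    by (rule nerve_face_closed[OF X basis_vec_closed[OF C] j])
  note prod = nerve_mult_closed[OF X basis_vec_closed[OF C] basis_vec_closed[OF C]]
  show ?thesis
    unfolding m_def e
    by (simp only: bil_struct_const[OF nerve_algebra[OF X] C] basis_vec_coord[OF C prod] basis_vec_coord[OF C closed] nerve_face_mult[OF X basis_vec_closed[OF C] basis_vec_closed[OF C] j])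
qed

lemma nerve_fc_supp: "b \<in> nerve_letters R A (Suc p) \<Longrightarrow> j \<le> Suc p \<Longrightarrow> nerve_fc R A rm (Suc p) j b \<in> supp (nerve_letters R A p)"
  using face_letter_supp[of b R A p j rm] rm_supp by (simp add: nerve_fc_def)

lemma nerve_fc_fc:
  assumes ij: "i < j" "j \<le> Suc (Suc p)"
  shows "linear_extension (nerve_fc R A rm (Suc p) i) (nerve_fc R A rm (Suc (Suc p)) j b) =
    linear_extension (nerve_fc R A rm (Suc p) (j - 1)) (nerve_fc R A rm (Suc (Suc p)) i b)"
proof (cases "b \<in> nerve_letters R A (Suc (Suc p))")
  case True
  have "restrict_chain (nerve_letters R A (Suc p)) (nerve_fc R A rm (Suc (Suc p)) k b) = face_letter rm (Suc (Suc p)) k b"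
    if "k \<le> Suc (Suc p)" for k
    using restrict_chain_id[OF nerve_fc_supp[OF True that]] True by (simp add: nerve_fc_def)
  then show ?thesis
    using ij face_face_letter[OF True ij, of rm] by (simp add: linear_extension_nerve_fc)
qed (simp add: nerve_fc_def chains.linear_0[OF lin_linear_extension])

end

subsection \<open>Coordinates on the complexes of a crossed module\<close>

lemma tot_degree_0:
  assumes h: "\<And>p. lin (h p)" and v: "\<And>p. lin (v p)"
    and V0: "\<And>p c. c \<in> supp (Bs p 0) \<Longrightarrow> v p c = 0" and c: "c \<in> supp (tcells Bs 0)"
  shows "tot h v c = 0"
proof -
  have "slice p (tot h v c) = 0" for p
    using slice_tcells_gt[OF c, of "Suc p"] slice_tcells_gt[OF c, of p] slice_tcells[OF c, of p] V0[of "slice p c" p]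
    by (cases p) (simp_all add: slice_tot[OF h v] chains.linear_0[OF h] chains.linear_0[OF v])
  then have "tot h v c \<in> supp {}" unfolding slice_supp_iff by simp
  then show ?thesis by simp
qed

lemma simp_tot_degree_0:
  assumes "\<And>p i. lin (f p i)" "\<And>p. lin (d p)" "\<And>p c. c \<in> supp (Bs p 0) \<Longrightarrow> d p c = 0" "c \<in> supp (tcells Bs 0)"
  shows "simp_tot f d c = 0"
  unfolding simp_tot_def
  by (rule tot_degree_0[OF _ _ _ assms(4)]) (intro lin_intros assms | simp add: assms(3))+

lemma cc2D_degree_0: "c \<in> supp (tcells (cc2_cells B) 0) \<Longrightarrow> coord_alg A B \<kappa> m \<Longrightarrow> cc2D m c = 0"
  unfolding cc2D_def
proof (rule tot_degree_0[of _ _ "cc2_cells B"])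
  assume A: "coord_alg A B \<kappa> m"
  show "(if p = 0 then hoch m else if p = 1 then \<lambda>u. - bar m u else (\<lambda>_. 0)) c = 0" if "c \<in> supp (cc2_cells B p 0)" for p c
    using that bar_hoch_1[OF A, of c] by (auto simp: cc2_cells_def)
qed (auto intro!: lin_intros)

context
  fixes X :: "('k::field, 'r, 'a) crossed_mod" and B :: "nat \<Rightarrow> 'b set" and \<kappa> m fc
  assumes X: "crossed_module X" and alg: "\<And>p. coord_alg (nerve X p) (B p) \<kappa> (m p)"
    and face: "\<And>p j x. x \<in> carrier (nerve X (Suc p)) \<Longrightarrow> j \<le> Suc p \<Longrightarrow>
      \<kappa> (nerve_face X (Suc p) j x) = linear_extension (fc (Suc p) j) (\<kappa> x)"
begin

private lemma C: "coord (nerve X p) (B p) \<kappa>"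
  by (rule coord_algD(2)[OF alg])

private lemma fc_supp: "b \<in> B (Suc p) \<Longrightarrow> j \<le> Suc p \<Longrightarrow> fc (Suc p) j b \<in> supp (B p)"
  using face[OF vec_closed[OF C], of "word b" p j] coord_vec[OF C, of "word b" "Suc p"]
    coord_supp[OF C nerve_face_closed[OF X vec_closed[OF C]], of "word b" p j] by simp

private lemma face': "j \<le> Suc p \<Longrightarrow> x \<in> carrier (nerve X (Suc p)) \<Longrightarrow>
    nerve_face X (Suc p) j x \<in> carrier (nerve X p) \<and> \<kappa> (nerve_face X (Suc p) j x) = linear_extension (fc (Suc p) j) (\<kappa> x)"
  using face[of x p j] nerve_face_closed[OF X, of x p j] by simp

lemma pres_bar_complex_cm:
  assumes dd: "\<And>u. simp_tot (\<lambda>p j. thom (fc p j)) (\<lambda>p. bar (m p)) (simp_tot (\<lambda>p j. thom (fc p j)) (\<lambda>p. bar (m p)) u) = 0"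
  shows "pres_complex (bar_complex_cm X) (tcells (\<lambda>p q. words_on (B p) (Suc q)))
    (tphi (\<lambda>p q. fibre (nerve X p) \<kappa> (Suc q))) (simp_tot (\<lambda>p j. thom (fc p j)) (\<lambda>p. bar (m p)))"
proof -
  let ?Bs = "\<lambda>p q. words_on (B p) (Suc q)" and ?\<phi> = "\<lambda>p q. fibre (nerve X p) \<kappa> (Suc q)"
    and ?f = "\<lambda>p i. bar_map (nerve X (p - 1)) (nerve_face X p i)"
  have P: "pres (chain_grp (bar_complex (nerve X p)) q) (?Bs p q) (?\<phi> p q)" for p q by (rule pres_bar[OF alg])
  have F: "thom (fc (Suc p) i) c \<in> supp (?Bs p q) \<and> ?f (Suc p) i q (?\<phi> (Suc p) q c) = ?\<phi> p q (thom (fc (Suc p) i) c)"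
    if "c \<in> supp (?Bs (Suc p) q)" "i \<le> Suc p" for p q i c
    using thom_words_on[OF fc_supp[OF _ that(2)] that(1)] tensor_map_fibre[OF C C face'[OF that(2)] that(1)]
    by (simp add: bar_map_def)
  have D: "bar (m p) c \<in> supp (?Bs p q) \<and> chain_bd (bar_complex (nerve X p)) (Suc q) (?\<phi> p (Suc q) c) = ?\<phi> p q (bar (m p) c)"
    if "c \<in> supp (?Bs p (Suc q))" for p q c
    using bar_supp_words[OF alg that] bar_complex_bd[OF alg that] by simp
  have D0: "bar (m p) c = 0" if "c \<in> supp (?Bs p 0)" for p c using bar_hoch_1[OF alg, of c p] that by simp
  note bd = simplicial_bd[where f = ?f, OF P lin_thom lin_bar F D D0]
  show ?thesis
    unfolding pres_complex_def bar_complex_cm_def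
    using bd pres_simplicial[where f = ?f, OF P lin_thom lin_bar F D D0] dd
      simp_tot_degree_0[of "\<lambda>p j. thom (fc p j)" "\<lambda>p. bar (m p)" ?Bs, OF lin_thom lin_bar D0]
    by (auto intro!: lin_simp_tot lin_intros)
qed

lemma pres_cc2_complex_cm:
  assumes dd: "\<And>u. simp_tot (\<lambda>p j. slicewise (thom (fc p j))) (\<lambda>p. cc2D (m p))
      (simp_tot (\<lambda>p j. slicewise (thom (fc p j))) (\<lambda>p. cc2D (m p)) u) = 0"
  shows "pres_complex (cc2_complex_cm X) (tcells (\<lambda>p. tcells (cc2_cells (B p))))
    (tphi (\<lambda>p. tphi (cc2_fibre (nerve X p) \<kappa>))) (simp_tot (\<lambda>p j. slicewise (thom (fc p j))) (\<lambda>p. cc2D (m p)))"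
proof -
  let ?Bs = "\<lambda>p. tcells (cc2_cells (B p))" and ?\<phi> = "\<lambda>p. tphi (cc2_fibre (nerve X p) \<kappa>)"
    and ?f = "\<lambda>p i. cc2_map (nerve X (p - 1)) (nerve_face X p i)"
  have P: "pres (chain_grp (cc2_complex (nerve X p)) q) (?Bs p q) (?\<phi> p q)" for p q by (rule pres_cc2[OF C])
  have lf: "lin (slicewise (thom (fc p j)))" and ld: "lin (cc2D (m p))" for p j by (intro lin_intros)+
  have F: "slicewise (thom (fc (Suc p) i)) c \<in> supp (?Bs p q) \<and>
      ?f (Suc p) i q (?\<phi> (Suc p) q c) = ?\<phi> p q (slicewise (thom (fc (Suc p) i)) c)"
    if "c \<in> supp (?Bs (Suc p) q)" "i \<le> Suc p" for p q i c
    using slicewise_thom_supp[OF fc_supp[OF _ that(2)] that(1)] cc2_map_tphi[OF C C face'[OF that(2)] that(1)] by simp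
  have D: "cc2D (m p) c \<in> supp (?Bs p q) \<and> chain_bd (cc2_complex (nerve X p)) (Suc q) (?\<phi> p (Suc q) c) = ?\<phi> p q (cc2D (m p) c)"
    if "c \<in> supp (?Bs p (Suc q))" for p q c
    using cc2_complex_bd[OF alg that] by simp
  have D0: "cc2D (m p) c = 0" if "c \<in> supp (?Bs p 0)" for p c by (rule cc2D_degree_0[OF that alg])
  note bd = simplicial_bd[where f = ?f, OF P lf ld F D D0]
  show ?thesis
    unfolding pres_complex_def cc2_complex_cm_def
    using bd pres_simplicial[where f = ?f, OF P lf ld F D D0] dd
      simp_tot_degree_0[of "\<lambda>p j. slicewise (thom (fc p j))" "\<lambda>p. cc2D (m p)" ?Bs, OF lf ld D0]
    by (auto intro!: lin_simp_tot lin_intros)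
qed

end

lemma pres_cc2_complex_cm_grp:
  assumes "\<And>p. coord (nerve X p) (B p) \<kappa>"
  shows "pres (chain_grp (cc2_complex_cm X) n) (tcells (\<lambda>p. tcells (cc2_cells (B p))) n) (tphi (\<lambda>p. tphi (cc2_fibre (nerve X p) \<kappa>)) n)"
  unfolding cc2_complex_cm_def by (rule pres_total) (simp add: simplicial_bicomplex_def pres_cc2[OF assms])

lemma cc2_map_cm_tphi:
  assumes X: "\<And>p. coord (nerve X p) (B p) \<kappa>" and Y: "\<And>p. coord (nerve Y p) (B' p) \<kappa>'"
    and g: "\<And>p x. x \<in> carrier (nerve X p) \<Longrightarrow> nerve_map \<mu> \<nu> x \<in> carrier (nerve Y p) \<and> \<kappa>' (nerve_map \<mu> \<nu> x) = linear_extension f (\<kappa> x)"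
    and c: "c \<in> supp (tcells (\<lambda>p. tcells (cc2_cells (B p))) n)"
  shows "cc2_map_cm Y \<mu> \<nu> n (tphi (\<lambda>p. tphi (cc2_fibre (nerve X p) \<kappa>)) n c) =
    tphi (\<lambda>p. tphi (cc2_fibre (nerve Y p) \<kappa>')) n (slicewise (slicewise (thom f)) c)"
  unfolding cc2_map_cm_def
  by (rule total_map_tphi[where F = "slicewise (thom f)" and Bs = "\<lambda>p. tcells (cc2_cells (B p))"])
    (auto intro!: cc2_map_tphi[OF X Y g] slice_slicewise lin_intros c)

section \<open>Bases\<close>

text \<open>Bases of N, U and F are chosen so that each extends the one before. Sending the first
  basis to 0 gives coordinates on F/N in which U/N is spanned by basis vectors; the basis vectors
  themselves serve as labels.\<close>

lemma adapted_basis: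
  fixes N U F :: "('x \<Rightarrow>\<^sub>0 'k::field) set"
  assumes N: "chain.subspace N" and U: "chain.subspace U" and F: "chain.subspace F" and sub: "N \<subseteq> U" "U \<subseteq> F"
  obtains g :: "('x \<Rightarrow>\<^sub>0 'k) \<Rightarrow> (('x \<Rightarrow>\<^sub>0 'k) \<Rightarrow>\<^sub>0 'k)" and B C where "lin g" "C \<subseteq> B" "g ` F = supp B"
    "\<And>u. u \<in> F \<Longrightarrow> g u = 0 \<longleftrightarrow> u \<in> N" "\<And>u. u \<in> F \<Longrightarrow> g u \<in> supp C \<longleftrightarrow> u \<in> U"
proof -
  obtain B0 where B0: "B0 \<subseteq> N" "chain.independent B0" "N \<subseteq> chain.span B0"
    using chain.maximal_independent_subset[of N] by blast
  obtain B1 where B1: "B0 \<subseteq> B1" "B1 \<subseteq> U" "chain.independent B1" "U \<subseteq> chain.span B1"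
  proof (rule chain.maximal_independent_subset_extend[of B0 U])
    show "B0 \<subseteq> U" using B0(1) sub(1) by (rule subset_trans)
  qed (rule B0(2), rule that)
  obtain B2 where B2: "B1 \<subseteq> B2" "B2 \<subseteq> F" "chain.independent B2" "F \<subseteq> chain.span B2"
  proof (rule chain.maximal_independent_subset_extend[of B1 F])
    show "B1 \<subseteq> F" using B1(2) sub(2) by (rule subset_trans)
  qed (rule B1(3), rule that)
  have span: "chain.span B0 = N" "chain.span B1 = U" "chain.span B2 = F"
    by (rule subset_antisym[OF chain.span_minimal[OF B0(1) N] B0(3)]
        subset_antisym[OF chain.span_minimal[OF B1(2) U] B1(4)]
        subset_antisym[OF chain.span_minimal[OF B2(2) F] B2(4)])+
  obtain g :: "('x \<Rightarrow>\<^sub>0 'k) \<Rightarrow> (('x \<Rightarrow>\<^sub>0 'k) \<Rightarrow>\<^sub>0 'k)" where g: "lin g" "\<And>b. b \<in> B2 \<Longrightarrow> g b = (if b \<in> B0 then 0 else word b)"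
    using chains.linear_independent_extend[OF B2(3), of "\<lambda>b. if b \<in> B0 then 0 else word b"] by blast
  \<comment> \<open>Reading labels as vectors inverts g modulo N.\<close>
  define e :: "(('x \<Rightarrow>\<^sub>0 'k) \<Rightarrow>\<^sub>0 'k) \<Rightarrow> ('x \<Rightarrow>\<^sub>0 'k)" where "e = linear_extension (\<lambda>b. b)"
  have lin_e: "lin e" unfolding e_def by (rule lin_linear_extension)
  have ge: "u - e (g u) \<in> N" if u: "u \<in> F" for u
    unfolding span(1)[symmetric]
  proof (rule lin_span[of "\<lambda>u. u - e (g u)" u B2])
    show "lin (\<lambda>u. u - e (g u))" by (intro lin_intros lin_comp[OF lin_e g(1)])
    show "x - e (g x) \<in> chain.span B0" if "x \<in> B2" for x
      using that g(2)[OF that] by (auto simp: e_def chain.span_base chain.span_zero chains.linear_0[OF lin_linear_extension])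
  qed (use u span in simp)
  have g_span: "g u \<in> supp (S - B0)" if "u \<in> chain.span S" "S \<subseteq> B2" for u S
  proof -
    have "chain.subspace {u. g u \<in> supp (S - B0)}"
      by (auto simp: chain.subspace_def chains.linear_add[OF g(1)] chains.linear_0[OF g(1)] chains.linear_scale[OF g(1)] intro: supp_intros)
    then show ?thesis using chain.span_induct[OF that(1), of "\<lambda>u. g u \<in> supp (S - B0)"] that(2) g(2) by (auto simp: subset_iff)
  qed
  have e_span: "e v \<in> chain.span S" if "v \<in> supp (S - B0)" for v S
    by (rule lin_in_subspace[OF lin_e that chain.subspace_span]) (auto simp: e_def intro: chain.span_base)
  have eg: "g (e v) = v" if "v \<in> supp (B2 - B0)" for v
    by (rule lin_eq_supp[OF lin_comp[OF g(1) lin_e] lin_id that]) (use g(2) in \<open>auto simp: e_def\<close>)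
  have iff: "g u \<in> supp (S - B0) \<longleftrightarrow> u \<in> chain.span S" if u: "u \<in> F" and S: "B0 \<subseteq> S" "S \<subseteq> B2" for u S
  proof
    assume "g u \<in> supp (S - B0)"
    then have "e (g u) \<in> chain.span S" by (rule e_span)
    moreover have "u - e (g u) \<in> chain.span S" using ge[OF u] chain.span_mono[OF S(1)] span(1) by blast
    ultimately show "u \<in> chain.span S" using chain.span_add by fastforce
  qed (rule g_span[OF _ S(2)])
  show ?thesis
  proof (rule that[of g "B1 - B0" "B2 - B0"])
    show "g ` F = supp (B2 - B0)"
      using g_span[of _ B2] e_span[of _ B2] eg span(3) by (auto simp: image_iff) metis
    show "g u = 0 \<longleftrightarrow> u \<in> N" if "u \<in> F" for u using iff[OF that, of B0] B1 B2 span by auto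
    show "g u \<in> supp (B1 - B0) \<longleftrightarrow> u \<in> U" if "u \<in> F" for u using iff[OF that, of B1] B1 B2 span by auto
  qed (use B2 g in auto)
qed

text \<open>This presents \<open>V\<close> as a quotient of the free space on its carrier, so that
  bases can be chosen among chains and then passed down to \<open>V\<close>.\<close>

lemma evaluation:
  fixes V :: "('k::field, 'v) module"
  assumes V: "Module.module ground_field V"
  obtains ev :: "('v \<Rightarrow>\<^sub>0 'k) \<Rightarrow> 'v" where
    "\<And>u. u \<in> supp (carrier V) \<Longrightarrow> ev u \<in> carrier V" "\<And>x. x \<in> carrier V \<Longrightarrow> ev (word x) = x"
    "\<And>u v. u \<in> supp (carrier V) \<Longrightarrow> v \<in> supp (carrier V) \<Longrightarrow> ev (u + v) = ev u \<oplus>\<^bsub>V\<^esub> ev v"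
    "\<And>c u. u \<in> supp (carrier V) \<Longrightarrow> ev (c \<star> u) = c \<odot>\<^bsub>V\<^esub> ev u"
proof -
  interpret Module.module ground_field V by (rule V)
  note closed = ground_module_closed[OF V]
  have zero: "(0::'k) \<odot>\<^bsub>V\<^esub> x = \<zero>\<^bsub>V\<^esub>" if "x \<in> carrier V" for x
    using smult_l_null[OF that] by (simp add: ground_field_def)
  define ev where "ev u = finsum V (\<lambda>x. Poly_Mapping.lookup u x \<odot>\<^bsub>V\<^esub> x) (Poly_Mapping.keys u)" for u :: "'v \<Rightarrow>\<^sub>0 'k"
  have ev: "ev u = finsum V (\<lambda>x. Poly_Mapping.lookup u x \<odot>\<^bsub>V\<^esub> x) S"
    if "Poly_Mapping.keys u \<subseteq> S" "finite S" "S \<subseteq> carrier V" for u S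
    unfolding ev_def
    by (rule add.finprod_mono_neutral_cong_left) (use that in \<open>auto simp: in_keys_iff zero intro!: closed(2)\<close>)
  have keys: "Poly_Mapping.keys u \<subseteq> carrier V" if "u \<in> supp (carrier V)" for u :: "'v \<Rightarrow>\<^sub>0 'k"
    using that by (simp add: supp_def)
  show ?thesis
  proof (rule that[of ev])
    show "ev u \<in> carrier V" if "u \<in> supp (carrier V)" for u
      unfolding ev_def using keys[OF that] by (auto intro!: finsum_closed closed(2))
    show "ev (word x) = x" if "x \<in> carrier V" for x
    proof -
      have "finsum V h {x} = h x" if "h x \<in> carrier V" for h
        using that by (subst finsum_insert) auto
      then show ?thesis using that ground_smult(4)[OF V that] by (simp add: ev_def)
    qed
    show "ev (u + v) = ev u \<oplus>\<^bsub>V\<^esub> ev v" if uv: "u \<in> supp (carrier V)" "v \<in> supp (carrier V)" for u v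
    proof -
      let ?S = "Poly_Mapping.keys u \<union> Poly_Mapping.keys v"
      have S: "finite ?S" "?S \<subseteq> carrier V" using keys[OF uv(1)] keys[OF uv(2)] by auto
      have "ev (u + v) = finsum V (\<lambda>x. Poly_Mapping.lookup (u + v) x \<odot>\<^bsub>V\<^esub> x) ?S"
        by (rule ev[OF Poly_Mapping.keys_add S])
      also have "\<dots> = finsum V (\<lambda>x. Poly_Mapping.lookup u x \<odot>\<^bsub>V\<^esub> x \<oplus>\<^bsub>V\<^esub> Poly_Mapping.lookup v x \<odot>\<^bsub>V\<^esub> x) ?S"
        by (rule finsum_cong') (use S in \<open>auto simp: lookup_add ground_smult(1)[OF V] closed subset_iff\<close>)
      also have "\<dots> = ev u \<oplus>\<^bsub>V\<^esub> ev v"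
        by (subst finsum_addf) (use S ev[of u ?S] ev[of v ?S] in \<open>auto intro!: closed(2) simp: subset_iff\<close>)
      finally show ?thesis .
    qed
    show "ev (c \<star> u) = c \<odot>\<^bsub>V\<^esub> ev u" if u: "u \<in> supp (carrier V)" for c u
    proof -
      have "ev (c \<star> u) = finsum V (\<lambda>x. c \<odot>\<^bsub>V\<^esub> (Poly_Mapping.lookup u x \<odot>\<^bsub>V\<^esub> x)) (Poly_Mapping.keys u)"
        unfolding ev[OF keys_scale_chain finite_keys keys[OF u]]
        by (rule finsum_cong') (use keys[OF u] in \<open>auto simp: ground_smult(3)[OF V] closed subset_iff\<close>)
      also have "\<dots> = c \<odot>\<^bsub>V\<^esub> ev u"
        unfolding ev_def using keys[OF u]
        by (subst finsum_smult_ldistr) (auto intro!: closed(2) simp: ground_field_def subset_iff)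
      finally show ?thesis .
    qed
  qed
qed

lemma adapted_coord:
  fixes V :: "('k::field, 'v) module"
  assumes V: "Module.module ground_field V" and U: "U \<subseteq> carrier V" "\<zero>\<^bsub>V\<^esub> \<in> U"
    "\<And>x y. x \<in> U \<Longrightarrow> y \<in> U \<Longrightarrow> x \<oplus>\<^bsub>V\<^esub> y \<in> U" "\<And>c x. x \<in> U \<Longrightarrow> c \<odot>\<^bsub>V\<^esub> x \<in> U"
  obtains B C and \<kappa> :: "'v \<Rightarrow> (('v \<Rightarrow>\<^sub>0 'k) \<Rightarrow>\<^sub>0 'k)" where "coord V B \<kappa>" "C \<subseteq> B"
    "\<And>x. x \<in> carrier V \<Longrightarrow> \<kappa> x \<in> supp C \<longleftrightarrow> x \<in> U"
proof -
  interpret Module.module ground_field V by (rule V)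
  note closed = ground_module_closed[OF V]
  obtain ev :: "('v \<Rightarrow>\<^sub>0 'k) \<Rightarrow> 'v" where ev:
    "\<And>u. u \<in> supp (carrier V) \<Longrightarrow> ev u \<in> carrier V" "\<And>x. x \<in> carrier V \<Longrightarrow> ev (word x) = x"
    "\<And>u v. u \<in> supp (carrier V) \<Longrightarrow> v \<in> supp (carrier V) \<Longrightarrow> ev (u + v) = ev u \<oplus>\<^bsub>V\<^esub> ev v"
    "\<And>c u. u \<in> supp (carrier V) \<Longrightarrow> ev (c \<star> u) = c \<odot>\<^bsub>V\<^esub> ev u"
    using evaluation[OF V] by blast
  have ev0: "ev 0 = \<zero>\<^bsub>V\<^esub>" using ev(3)[of 0 0] ev(1)[of 0] by simp
  let ?F = "supp (carrier V) :: ('v \<Rightarrow>\<^sub>0 'k) set"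
  have sub: "chain.subspace {u \<in> ?F. ev u \<in> S}" if "\<zero>\<^bsub>V\<^esub> \<in> S"
    "\<And>x y. x \<in> S \<Longrightarrow> y \<in> S \<Longrightarrow> x \<oplus>\<^bsub>V\<^esub> y \<in> S" "\<And>c x. x \<in> S \<Longrightarrow> c \<odot>\<^bsub>V\<^esub> x \<in> S" for S
    using that by (auto simp: chain.subspace_def ev0 ev(3,4) intro: supp_intros)
  have s0: "chain.subspace {u \<in> ?F. ev u \<in> {\<zero>\<^bsub>V\<^esub>}}"
    by (rule sub) (auto, metis ev0 ev(4) chain.scale_zero_right supp_zero)
  have s1: "chain.subspace {u \<in> ?F. ev u \<in> U}" by (rule sub) (use U in auto)
  obtain g :: "('v \<Rightarrow>\<^sub>0 'k) \<Rightarrow> (('v \<Rightarrow>\<^sub>0 'k) \<Rightarrow>\<^sub>0 'k)" and B C where g: "lin g" "C \<subseteq> B" "g ` ?F = supp B"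
    "\<And>u. u \<in> ?F \<Longrightarrow> g u = 0 \<longleftrightarrow> u \<in> {u \<in> ?F. ev u \<in> {\<zero>\<^bsub>V\<^esub>}}"
    "\<And>u. u \<in> ?F \<Longrightarrow> g u \<in> supp C \<longleftrightarrow> u \<in> {u \<in> ?F. ev u \<in> U}"
    by (rule adapted_basis[OF s0 s1 subspace_supp]) (use U(2) in auto)
  \<comment> \<open>g factors through the evaluation: two chains with equal values differ by an
    element of its kernel, which g sends to 0.\<close>
  have eq: "g u = g v" if "u \<in> ?F" "v \<in> ?F" "ev u = ev v" for u v
  proof -
    have "ev (u + (- 1) \<star> v) = ev u \<oplus>\<^bsub>V\<^esub> (- 1) \<odot>\<^bsub>V\<^esub> ev u"
      using that by (simp only: ev(3,4) supp_scale)
    also have "\<dots> = (1 + (- 1)) \<odot>\<^bsub>V\<^esub> ev u" using ground_smult(1,4)[OF V ev(1)[OF that(1)]] by metis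
    also have "\<dots> = ev ((1 + (- 1)) \<star> u)" using ev(4)[OF that(1), of "1 + (- 1)"] by (simp only:)
    also have "\<dots> = \<zero>\<^bsub>V\<^esub>" by (simp add: ev0)
    finally have "g (u - v) = 0" using g(4)[of "u - v"] that by (auto intro: supp_diff)
    then show ?thesis by (simp add: chains.linear_diff[OF g(1)])
  qed
  have "coord V B (\<lambda>x. g (word x))"
    unfolding coord_def
  proof (intro conjI ballI allI)
    show "bij_betw (\<lambda>x. g (word x)) (carrier V) (supp B)"
      unfolding bij_betw_def
    proof
      show "inj_on (\<lambda>x. g (word x)) (carrier V)"
      proof (rule inj_onI)
        fix x y assume xy: "x \<in> carrier V" "y \<in> carrier V" "g (word x) = g (word y)"
        then have "g (word x - word y) = 0" by (simp add: chains.linear_diff[OF g(1)])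
        moreover have "word x - word y \<in> ?F" by (rule supp_diff) (use xy in simp_all)
        ultimately have d: "ev (word x - word y) = \<zero>\<^bsub>V\<^esub>" using g(4)[of "word x - word y"] by blast
        have "ev ((word x - word y) + word y) = ev (word x - word y) \<oplus>\<^bsub>V\<^esub> ev (word y)"
          by (rule ev(3)) (use xy in \<open>auto intro: supp_diff\<close>)
        then show "x = y" using xy d ev(2) by simp
      qed
      have "g u \<in> (\<lambda>x. g (word x)) ` carrier V" if "u \<in> ?F" for u
        by (rule image_eqI[of _ _ "ev u"]) (use that ev in \<open>auto intro!: eq\<close>)
      then show "(\<lambda>x. g (word x)) ` carrier V = supp B" unfolding g(3)[symmetric] by auto
    qed
    show "g (word (x \<oplus>\<^bsub>V\<^esub> y)) = g (word x) + g (word y)" if "x \<in> carrier V" "y \<in> carrier V" for x y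
      using that by (subst chains.linear_add[OF g(1), symmetric]) (intro eq; simp add: ev supp_add closed)
    show "g (word (c \<odot>\<^bsub>V\<^esub> x)) = c \<star> g (word x)" if "x \<in> carrier V" for c x
      using that by (subst chains.linear_scale[OF g(1), symmetric])
        (intro eq; simp add: ev supp_scale closed del: scale_chain_single)
  qed (rule V)
  then show ?thesis using that[of B "\<lambda>x. g (word x)" C] g(2,5) ev(2) by simp
qed

text \<open>Every \<open>v\<close> is uniquely f u + s (g v), so the bases of \<open>U\<close> and
  \<open>W\<close>, marked by \<open>Inl\<close> and \<open>Inr\<close>, together give a basis of
  \<open>V\<close> in which \<open>f\<close>, \<open>s\<close> and \<open>g\<close> are inclusions
  and a projection.\<close>

lemma split_coord:
  fixes U :: "('k::field, 'u) module" and V :: "('k, 'v) module" and W :: "('k, 'w) module"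
    and B :: "'b set" and B' :: "'d set"
  assumes U: "coord U B \<kappa>" and W: "coord W B' \<kappa>'" and V: "Module.module ground_field V"
    and ex: "short_exact U V W f g" and f: "linear_map U V f" and g: "linear_map V W g"
    and s: "linear_map W V s" "\<And>w. w \<in> carrier W \<Longrightarrow> g (s w) = w"
  obtains \<kappa>V where "coord V (Inl ` B \<union> Inr ` B') \<kappa>V" "\<And>u. u \<in> carrier U \<Longrightarrow> \<kappa>V (f u) = relabel Inl (\<kappa> u)"
    "\<And>w. w \<in> carrier W \<Longrightarrow> \<kappa>V (s w) = relabel Inr (\<kappa>' w)"
    "\<And>v. v \<in> carrier V \<Longrightarrow> restrict_chain (range Inr) (\<kappa>V v) = relabel Inr (\<kappa>' (g v))"
    "\<And>v. v \<in> carrier V \<Longrightarrow> g v = \<zero>\<^bsub>W\<^esub> \<Longrightarrow> v \<in> f ` carrier U"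
    "\<And>v. v \<in> carrier V \<Longrightarrow> \<exists>u\<in>carrier U. v = f u \<oplus>\<^bsub>V\<^esub> s (g v)"
proof -
  interpret V: Module.module ground_field V by (rule V)
  interpret U: Module.module ground_field U by (rule coord_module[OF U])
  interpret W: Module.module ground_field W by (rule coord_module[OF W])
  note cV = ground_module_closed[OF V] and cU = ground_module_closed[OF coord_module[OF U]] and cW = ground_module_closed[OF coord_module[OF W]]
  have F: "\<And>x. x \<in> carrier U \<Longrightarrow> f x \<in> carrier V" "\<And>x y. x \<in> carrier U \<Longrightarrow> y \<in> carrier U \<Longrightarrow> f (x \<oplus>\<^bsub>U\<^esub> y) = f x \<oplus>\<^bsub>V\<^esub> f y"
    "\<And>c x. x \<in> carrier U \<Longrightarrow> f (c \<odot>\<^bsub>U\<^esub> x) = c \<odot>\<^bsub>V\<^esub> f x"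
    using f by (auto simp: linear_map_def hom_def)
  have G: "\<And>x. x \<in> carrier V \<Longrightarrow> g x \<in> carrier W" "\<And>x y. x \<in> carrier V \<Longrightarrow> y \<in> carrier V \<Longrightarrow> g (x \<oplus>\<^bsub>V\<^esub> y) = g x \<oplus>\<^bsub>W\<^esub> g y"
    "\<And>c x. x \<in> carrier V \<Longrightarrow> g (c \<odot>\<^bsub>V\<^esub> x) = c \<odot>\<^bsub>W\<^esub> g x"
    using g by (auto simp: linear_map_def hom_def)
  have S: "\<And>x. x \<in> carrier W \<Longrightarrow> s x \<in> carrier V" "\<And>x y. x \<in> carrier W \<Longrightarrow> y \<in> carrier W \<Longrightarrow> s (x \<oplus>\<^bsub>W\<^esub> y) = s x \<oplus>\<^bsub>V\<^esub> s y"
    "\<And>c x. x \<in> carrier W \<Longrightarrow> s (c \<odot>\<^bsub>W\<^esub> x) = c \<odot>\<^bsub>V\<^esub> s x"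
    using s(1) by (auto simp: linear_map_def hom_def)
  have inj: "inj_on f (carrier U)" and ker: "f ` carrier U = {v \<in> carrier V. g v = \<zero>\<^bsub>W\<^esub>}"
    using ex by (auto simp: short_exact_def mon_def a_kernel_def kernel_def)
  have s0: "s \<zero>\<^bsub>W\<^esub> = \<zero>\<^bsub>V\<^esub>" using S(2)[of "\<zero>\<^bsub>W\<^esub>" "\<zero>\<^bsub>W\<^esub>"] S(1)[of "\<zero>\<^bsub>W\<^esub>"] by simp
  have gneg: "g (\<ominus>\<^bsub>V\<^esub> x) = \<ominus>\<^bsub>W\<^esub> g x" if "x \<in> carrier V" for x
  proof -
    have "g \<zero>\<^bsub>V\<^esub> = \<zero>\<^bsub>W\<^esub>" using G(2)[of "\<zero>\<^bsub>V\<^esub>" "\<zero>\<^bsub>V\<^esub>"] G(1)[of "\<zero>\<^bsub>V\<^esub>"] by simp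
    then have "g (\<ominus>\<^bsub>V\<^esub> x) \<oplus>\<^bsub>W\<^esub> g x = \<zero>\<^bsub>W\<^esub>" using G(2)[of "\<ominus>\<^bsub>V\<^esub> x" x] that by (simp add: V.M.l_neg)
    then show ?thesis using W.M.minus_equality[of "g (\<ominus>\<^bsub>V\<^esub> x)" "g x"] that G(1) by simp
  qed
  have dec: "\<exists>u\<in>carrier U. v = f u \<oplus>\<^bsub>V\<^esub> s (g v)" if v: "v \<in> carrier V" for v
  proof -
    have "g (v \<oplus>\<^bsub>V\<^esub> \<ominus>\<^bsub>V\<^esub> s (g v)) = \<zero>\<^bsub>W\<^esub>" using v by (simp add: G S gneg s W.M.r_neg)
    moreover have "v \<oplus>\<^bsub>V\<^esub> \<ominus>\<^bsub>V\<^esub> s (g v) \<in> carrier V" using v G S by simp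
    ultimately have "v \<oplus>\<^bsub>V\<^esub> \<ominus>\<^bsub>V\<^esub> s (g v) \<in> f ` carrier U" unfolding ker by simp
    then obtain u where "u \<in> carrier U" "f u = v \<oplus>\<^bsub>V\<^esub> \<ominus>\<^bsub>V\<^esub> s (g v)" by (metis imageE)
    moreover have "v \<oplus>\<^bsub>V\<^esub> \<ominus>\<^bsub>V\<^esub> s (g v) \<oplus>\<^bsub>V\<^esub> s (g v) = v" using v G S by (simp add: V.M.a_assoc V.M.l_neg)
    ultimately show ?thesis by (intro bexI[of _ u]) simp_all
  qed
  have gf: "g (f u) = \<zero>\<^bsub>W\<^esub>" if "u \<in> carrier U" for u using ker that by blast
  have uniq: "u = u'" if "u \<in> carrier U" "u' \<in> carrier U" "f u \<oplus>\<^bsub>V\<^esub> x = f u' \<oplus>\<^bsub>V\<^esub> x" "x \<in> carrier V" for u u' x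
    using that inj F(1) by (auto simp: inj_on_def)
  \<comment> \<open>The component of v in U with respect to this decomposition; it is unique because
    f is injective.\<close>
  define p where "p v = (THE u. u \<in> carrier U \<and> v = f u \<oplus>\<^bsub>V\<^esub> s (g v))" for v
  have p: "p v = u" if "u \<in> carrier U" "v \<in> carrier V" "v = f u \<oplus>\<^bsub>V\<^esub> s (g v)" for u v
    unfolding p_def
  proof (rule the_equality)
    fix u' assume u': "u' \<in> carrier U \<and> v = f u' \<oplus>\<^bsub>V\<^esub> s (g v)"
    show "u' = u" by (rule uniq[of u' u "s (g v)"]) (use that u' G(1) S(1) in simp_all)
  qed (use that in simp)
  have p': "p v \<in> carrier U \<and> v = f (p v) \<oplus>\<^bsub>V\<^esub> s (g v)" if v: "v \<in> carrier V" for v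
  proof -
    obtain u where u: "u \<in> carrier U" "v = f u \<oplus>\<^bsub>V\<^esub> s (g v)" using dec[OF v] by blast
    show ?thesis using p[OF u(1) v u(2)] u by simp
  qed
  note p'1 = conjunct1[OF p'] and p'2 = conjunct2[OF p']
  let ?k = "\<lambda>v. relabel Inl (\<kappa> (p v)) + relabel Inr (\<kappa>' (g v))"
  have "coord V (Inl ` B \<union> Inr ` B') ?k"
  proof (rule coord_sum[OF U W V])
    show "p v \<in> carrier U \<and> g v \<in> carrier W" if "v \<in> carrier V" for v using that p' G by simp
    show "p (x \<oplus>\<^bsub>V\<^esub> y) = p x \<oplus>\<^bsub>U\<^esub> p y \<and> g (x \<oplus>\<^bsub>V\<^esub> y) = g x \<oplus>\<^bsub>W\<^esub> g y" if xy: "x \<in> carrier V" "y \<in> carrier V" for x y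
    proof
      have "x \<oplus>\<^bsub>V\<^esub> y = (f (p x) \<oplus>\<^bsub>V\<^esub> s (g x)) \<oplus>\<^bsub>V\<^esub> (f (p y) \<oplus>\<^bsub>V\<^esub> s (g y))"
        using p'2[OF xy(1)] p'2[OF xy(2)] by simp
      also have "\<dots> = f (p x \<oplus>\<^bsub>U\<^esub> p y) \<oplus>\<^bsub>V\<^esub> s (g (x \<oplus>\<^bsub>V\<^esub> y))"
        using xy p'1 by (simp add: F G S V.M.a_ac)
      finally show "p (x \<oplus>\<^bsub>V\<^esub> y) = p x \<oplus>\<^bsub>U\<^esub> p y" by (intro p) (use xy p'1 in auto)
    qed (use xy G in simp)
    show "p (c \<odot>\<^bsub>V\<^esub> x) = c \<odot>\<^bsub>U\<^esub> p x \<and> g (c \<odot>\<^bsub>V\<^esub> x) = c \<odot>\<^bsub>W\<^esub> g x" if x: "x \<in> carrier V" for c x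
    proof
      have "c \<odot>\<^bsub>V\<^esub> x = c \<odot>\<^bsub>V\<^esub> (f (p x) \<oplus>\<^bsub>V\<^esub> s (g x))" using p'2[OF x] by simp
      also have "\<dots> = f (c \<odot>\<^bsub>U\<^esub> p x) \<oplus>\<^bsub>V\<^esub> s (g (c \<odot>\<^bsub>V\<^esub> x))"
        using x p'1 by (simp add: F G S ground_smult(2)[OF V])
      finally show "p (c \<odot>\<^bsub>V\<^esub> x) = c \<odot>\<^bsub>U\<^esub> p x" by (intro p) (use x p'1 cU cV in auto)
    qed (use x G in simp)
    show "x = y" if "x \<in> carrier V" "y \<in> carrier V" "p x = p y" "g x = g y" for x y
      using p'2[OF that(1)] p'2[OF that(2)] that(3,4) by simp
    show "\<exists>x\<in>carrier V. p x = u \<and> g x = n" if un: "u \<in> carrier U" "n \<in> carrier W" for u n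
    proof (intro bexI conjI)
      show x: "f u \<oplus>\<^bsub>V\<^esub> s n \<in> carrier V" using un F S by simp
      show gx: "g (f u \<oplus>\<^bsub>V\<^esub> s n) = n" using un by (simp add: F G S gf s)
      show "p (f u \<oplus>\<^bsub>V\<^esub> s n) = u" by (rule p[OF un(1) x]) (simp add: gx)
    qed
  qed auto
  moreover have "?k (f u) = relabel Inl (\<kappa> u)" if "u \<in> carrier U" for u
    using that p[OF that F(1)[OF that]] F(1)[OF that] by (simp add: gf s0 coord_zero[OF W])
  moreover have "?k (s w) = relabel Inr (\<kappa>' w)" if w: "w \<in> carrier W" for w
  proof -
    have "f \<zero>\<^bsub>U\<^esub> = \<zero>\<^bsub>V\<^esub>" using F(2)[of "\<zero>\<^bsub>U\<^esub>" "\<zero>\<^bsub>U\<^esub>"] F(1)[of "\<zero>\<^bsub>U\<^esub>"] by simp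
    then have "p (s w) = \<zero>\<^bsub>U\<^esub>" by (intro p) (use w S s in auto)
    then show ?thesis using s(2)[OF w] by (simp add: coord_zero[OF U])
  qed
  moreover have "restrict_chain (range Inr) (?k v) = relabel Inr (\<kappa>' (g v))" for v
  proof -
    have 1: "relabel Inr (\<kappa>' (g v)) \<in> supp (range Inr)" and 2: "relabel Inl (\<kappa> (p v)) \<in> supp (range Inl)"
      by (rule relabel_supp, simp)+
    have "range Inr \<inter> range (Inl :: 'b \<Rightarrow> 'b + 'd) = {}" by auto
    from restrict_chain_zero[OF 2 this] show ?thesis by (simp add: restrict_chain_add restrict_chain_id[OF 1])
  qed
  ultimately show ?thesis using that[of ?k] ker dec by auto
qed

section \<open>Letters for a split extension\<close>

lemma restrict_chain_closed: "u \<in> supp J \<Longrightarrow> restrict_chain B u \<in> supp J"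
  by (rule lin_supp[OF lin_restrict_chain]) (auto simp: restrict_chain_word)

lemma supp_add_disjoint:
  assumes "u \<in> supp B" "v \<in> supp B'" "B \<inter> B' = {}"
  shows "u + v \<in> supp J \<longleftrightarrow> u \<in> supp J \<and> v \<in> supp J"
proof
  assume "u + v \<in> supp J"
  then have *: "restrict_chain C (u + v) \<in> supp J" for C by (rule restrict_chain_closed)
  have "B' \<inter> B = {}" using assms(3) by blast
  then show "u \<in> supp J \<and> v \<in> supp J"
    using *[of B] *[of B'] by (simp add: restrict_chain_add restrict_chain_id[OF assms(1)] restrict_chain_id[OF assms(2)]
      restrict_chain_zero[OF assms(1)] restrict_chain_zero[OF assms(2)] assms(3))
qed (auto intro: supp_add)

lemma relabel_supp_iff:
  assumes "inj f" shows "relabel f u \<in> supp J \<longleftrightarrow> u \<in> supp (f -` J)"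
proof
  assume "relabel f u \<in> supp J"
  then have "unlabel f (relabel f u) \<in> supp (f -` J)"
    by (rule lin_supp[OF lin_unlabel]) (use assms in \<open>auto simp: unlabel_word\<close>)
  then show "u \<in> supp (f -` J)" by (simp add: unlabel_relabel[OF assms])
next
  assume "u \<in> supp (f -` J)"
  then show "relabel f u \<in> supp J" by (rule supp_mono[OF relabel_supp]) auto
qed

lemma relabel_restrict: "restrict_chain J (relabel f u) = relabel f (restrict_chain (f -` J) u)"
  by (rule lin_eqI[of "\<lambda>u. restrict_chain J (relabel f u)"])
    (auto intro!: lin_intros lin_comp[OF lin_restrict_chain] lin_comp[OF lin_relabel] simp: restrict_chain_word)

lemma range_Inr_Compl: "- range Inr = range Inl"
  by (auto simp: image_iff) (metis sum.exhaust)

subsection \<open>An ideal of the nerve\<close>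

lemma (in nonunital_algebra) zero_mult: "x \<in> carrier A \<Longrightarrow> \<zero> \<otimes> x = \<zero>" "x \<in> carrier A \<Longrightarrow> x \<otimes> \<zero> = \<zero>"
proof -
  have zero: "0 \<odot> y = \<zero>" if "y \<in> carrier A" for y using smult_l_null[OF that] by (simp add: ground_field_def)
  assume x: "x \<in> carrier A"
  show "\<zero> \<otimes> x = \<zero>" using smult_mult_l[of \<zero> x 0] x by (simp add: zero mult_closed)
  show "x \<otimes> \<zero> = \<zero>" using smult_mult_r[of x \<zero> 0] x by (simp add: zero mult_closed)
qed

lemma (in algebra_action) zero_act:
  assumes "a \<in> carrier A"
  shows "a \<rhd> \<zero>\<^bsub>R\<^esub> = \<zero>\<^bsub>R\<^esub>" "\<zero>\<^bsub>R\<^esub> \<lhd>\<^sub>r a = \<zero>\<^bsub>R\<^esub>"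
proof -
  have zero: "0 \<odot>\<^bsub>R\<^esub> y = \<zero>\<^bsub>R\<^esub>" if "y \<in> carrier R" for y using R.smult_l_null[OF that] by (simp add: ground_field_def)
  show "a \<rhd> \<zero>\<^bsub>R\<^esub> = \<zero>\<^bsub>R\<^esub>" using lact_smult_r[of a "\<zero>\<^bsub>R\<^esub>" 0] assms by (simp add: zero lact_closed)
  show "\<zero>\<^bsub>R\<^esub> \<lhd>\<^sub>r a = \<zero>\<^bsub>R\<^esub>" using ract_smult_r[of a "\<zero>\<^bsub>R\<^esub>" 0] assms by (simp add: zero ract_closed)
qed

lemma crossed_module_action: "crossed_module X \<Longrightarrow> algebra_action (cm_base X) (cm_top X) (cm_lact X) (cm_ract X)"
  by (simp add: crossed_module_def Let_def)

context
  fixes Y :: "('k::field, 's, 'b) crossed_mod" and Z :: "('k, 't, 'c) crossed_mod" and \<eta> \<theta>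
  assumes Y: "crossed_module Y" and Z: "crossed_module Z" and mor: "crossed_module_morphism Y Z \<eta> \<theta>"
begin

definition ker_top :: "'s set" where
  "ker_top = {s \<in> carrier (cm_top Y). \<eta> s = \<zero>\<^bsub>cm_top Z\<^esub>}"

text \<open>A description without coordinates of the span of the letters of type I, in which closure
  under multiplication can be checked.\<close>

definition nerve_ideal :: "'s list \<times> 'b \<Rightarrow> bool" where
  "nerve_ideal x \<longleftrightarrow> set (fst x) \<subseteq> ker_top \<and> snd x \<in> cm_map Y ` ker_top"

lemma nerve_ideal_simps [simp]:
  "nerve_ideal (tuple_cons s x) \<longleftrightarrow> s \<in> ker_top \<and> nerve_ideal x" "nerve_ideal ([], b) \<longleftrightarrow> b \<in> cm_map Y ` ker_top"
  by (auto simp: nerve_ideal_def tuple_cons_def)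

interpretation Y: algebra_action "cm_base Y" "cm_top Y" "cm_lact Y" "cm_ract Y" by (rule crossed_module_action[OF Y])
interpretation Z: algebra_action "cm_base Z" "cm_top Z" "cm_lact Z" "cm_ract Z" by (rule crossed_module_action[OF Z])

lemma ker_top_closed:
  shows "s \<in> ker_top \<Longrightarrow> s \<in> carrier (cm_top Y)"
    and "s \<in> ker_top \<Longrightarrow> s' \<in> ker_top \<Longrightarrow> s \<oplus>\<^bsub>cm_top Y\<^esub> s' \<in> ker_top"
    and "s \<in> ker_top \<Longrightarrow> s' \<in> carrier (cm_top Y) \<Longrightarrow> s \<otimes>\<^bsub>cm_top Y\<^esub> s' \<in> ker_top"
    and "s \<in> ker_top \<Longrightarrow> s' \<in> carrier (cm_top Y) \<Longrightarrow> s' \<otimes>\<^bsub>cm_top Y\<^esub> s \<in> ker_top"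
    and "s \<in> ker_top \<Longrightarrow> b \<in> carrier (cm_base Y) \<Longrightarrow> cm_lact Y b s \<in> ker_top"
    and "s \<in> ker_top \<Longrightarrow> b \<in> carrier (cm_base Y) \<Longrightarrow> cm_ract Y s b \<in> ker_top"
  using morphism_simps[OF Y Z mor]
  by (auto simp: ker_top_def Y.R.mult_closed Y.lact_closed Y.ract_closed Z.R.zero_mult Z.zero_act)

text \<open>The last two statements rest on the crossed module identity: the image of s acts as
  multiplication by s, so it carries the whole top algebra into the kernel.\<close>

lemma image_ker_top_closed:
  shows "b \<in> cm_map Y ` ker_top \<Longrightarrow> b' \<in> cm_map Y ` ker_top \<Longrightarrow> b \<oplus>\<^bsub>cm_base Y\<^esub> b' \<in> cm_map Y ` ker_top"
    and "b \<in> cm_map Y ` ker_top \<Longrightarrow> b' \<in> carrier (cm_base Y) \<Longrightarrow> b \<otimes>\<^bsub>cm_base Y\<^esub> b' \<in> cm_map Y ` ker_top"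
    and "b \<in> cm_map Y ` ker_top \<Longrightarrow> b' \<in> carrier (cm_base Y) \<Longrightarrow> b' \<otimes>\<^bsub>cm_base Y\<^esub> b \<in> cm_map Y ` ker_top"
    and "b \<in> cm_map Y ` ker_top \<Longrightarrow> s \<in> carrier (cm_top Y) \<Longrightarrow> cm_lact Y b s \<in> ker_top"
    and "b \<in> cm_map Y ` ker_top \<Longrightarrow> s \<in> carrier (cm_top Y) \<Longrightarrow> cm_ract Y s b \<in> ker_top"
  using map_hom[OF Y] ker_top_closed by (auto simp: image_iff) metis+

text \<open>The total belongs to the induction because a tuple acts on the first entry of the other
  factor through it; the image of the kernel then acts with values in the kernel.\<close>

lemma nerve_ideal_mult:
  "x \<in> carrier (nerve Y p) \<Longrightarrow> nerve_ideal x \<Longrightarrow> y \<in> carrier (nerve Y p) \<Longrightarrow>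
    nerve_ideal (x \<otimes>\<^bsub>nerve Y p\<^esub> y) \<and> nerve_ideal (y \<otimes>\<^bsub>nerve Y p\<^esub> x) \<and> nerve_total Y x \<in> cm_map Y ` ker_top"
proof (induction p arbitrary: x y)
  case 0
  then show ?case using image_ker_top_closed by auto
next
  case (Suc p)
  obtain s x' where x: "x = tuple_cons s x'" "s \<in> carrier (cm_top Y)" "x' \<in> carrier (nerve Y p)" using nerve_cases[OF Suc.prems(1)] .
  obtain r y' where y: "y = tuple_cons r y'" "r \<in> carrier (cm_top Y)" "y' \<in> carrier (nerve Y p)" using nerve_cases[OF Suc.prems(3)] .
  have s: "s \<in> ker_top" "nerve_ideal x'" using Suc.prems(2) x(1) by auto
  note IH = Suc.IH[OF x(3) s(2) y(3)]
  have "cm_map Y s \<in> cm_map Y ` ker_top" using s(1) by blast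
  then show ?case
    using IH s x y nerve_total_closed[OF Y x(3)] nerve_total_closed[OF Y y(3)]
    by (simp add: ker_top_closed image_ker_top_closed)
qed

end

text \<open>All three crossed modules of a split extension \<open>X \<rightarrow> Y \<rightarrow> Z\<close> have coordinates in the same letters:
  \<open>Inl\<close> marks basis vectors coming from \<open>X\<close>, \<open>Inr\<close> those lifted from \<open>Z\<close>.\<close>

locale split_coords =
  fixes X :: "('k::field, 'r, 'a) crossed_mod" and Y :: "('k, 's, 'b) crossed_mod" and Z :: "('k, 't, 'c) crossed_mod"
    and \<mu> \<nu> \<eta> \<theta> and \<beta>I \<beta>A :: "'x set" and \<beta>T :: "'y set" and \<beta>C :: "'z set"
    and \<kappa>S \<kappa>B \<kappa>T \<kappa>C and rm :: "'x + 'y \<Rightarrow> ('x + 'z \<Rightarrow>\<^sub>0 'k)"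
  assumes X: "crossed_module X" and Y: "crossed_module Y" and Z: "crossed_module Z"
    and XY: "crossed_module_morphism X Y \<mu> \<nu>" and YZ: "crossed_module_morphism Y Z \<eta> \<theta>"
    and \<beta>I: "\<beta>I \<subseteq> \<beta>A"
    and S: "coord (cm_top Y) (Inl ` \<beta>I \<union> Inr ` \<beta>T) \<kappa>S" and B: "coord (cm_base Y) (Inl ` \<beta>A \<union> Inr ` \<beta>C) \<kappa>B"
    and XS: "coord (cm_top X) (Inl ` \<beta>I) (\<lambda>i. \<kappa>S (\<mu> i))" and XB: "coord (cm_base X) (Inl ` \<beta>A) (\<lambda>a. \<kappa>B (\<nu> a))"
    and ZT: "coord (cm_top Z) (Inr ` \<beta>T) \<kappa>T" and ZC: "coord (cm_base Z) (Inr ` \<beta>C) \<kappa>C"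
    and \<eta>: "s \<in> carrier (cm_top Y) \<Longrightarrow> \<kappa>T (\<eta> s) = restrict_chain (range Inr) (\<kappa>S s)"
    and \<theta>: "b \<in> carrier (cm_base Y) \<Longrightarrow> \<kappa>C (\<theta> b) = restrict_chain (range Inr) (\<kappa>B b)"
    and rm: "s \<in> carrier (cm_top Y) \<Longrightarrow> \<kappa>B (cm_map Y s) = linear_extension rm (\<kappa>S s)"
    and rm_Inl: "rm (Inl x) = word (Inl x)" and rm_Inr: "y \<in> \<beta>T \<Longrightarrow> rm (Inr y) \<in> supp (Inr ` \<beta>C)"
    and ideal: "b \<in> carrier (cm_base Y) \<Longrightarrow> \<kappa>B b \<in> supp (Inl ` \<beta>I) \<Longrightarrow>
      \<exists>s\<in>carrier (cm_top Y). \<eta> s = \<zero>\<^bsub>cm_top Z\<^esub> \<and> b = cm_map Y s"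
begin

abbreviation "letters \<equiv> nerve_letters (Inl ` \<beta>I \<union> Inr ` \<beta>T :: ('x + 'y) set) (Inl ` \<beta>A \<union> Inr ` \<beta>C :: ('x + 'z) set)"
abbreviation "\<kappa> \<equiv> nerve_coord \<kappa>S \<kappa>B"
abbreviation "m \<equiv> \<lambda>p. struct_const (nerve Y p) (letters p) \<kappa>"
abbreviation "fc \<equiv> nerve_fc (Inl ` \<beta>I \<union> Inr ` \<beta>T :: ('x + 'y) set) (Inl ` \<beta>A \<union> Inr ` \<beta>C :: ('x + 'z) set) rm"

definition I_letters :: "((nat \<times> ('x + 'y)) + ('x + 'z)) set" where
  "I_letters = {Inl (i, Inl a) | i a. True} \<union> {Inr (Inl a) | a. a \<in> \<beta>I}"

definition W_letters :: "((nat \<times> ('x + 'y)) + ('x + 'z)) set" where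
  "W_letters = {Inr (Inl a) | a. a \<notin> \<beta>I}"

definition Z_letters :: "((nat \<times> ('x + 'y)) + ('x + 'z)) set" where
  "Z_letters = {Inl (i, Inr t) | i t. True} \<union> {Inr (Inr c) | c. True}"

lemma Z_letters: "- Z_letters = I_letters \<union> W_letters"
proof -
  have "b \<notin> Z_letters \<longleftrightarrow> b \<in> I_letters \<or> b \<in> W_letters" for b
  proof (cases b rule: shift_letter.cases)
    case (1 i x)
    then show ?thesis by (cases x) (auto simp: Z_letters_def I_letters_def W_letters_def)
  next
    case (2 x)
    then show ?thesis by (cases x) (auto simp: Z_letters_def I_letters_def W_letters_def)
  qed
  then show ?thesis by blast
qed

lemma rm_supp: "x \<in> Inl ` \<beta>I \<union> Inr ` \<beta>T \<Longrightarrow> rm x \<in> supp (Inl ` \<beta>A \<union> Inr ` \<beta>C)"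
  using \<beta>I supp_mono[OF rm_Inr] by (auto simp: rm_Inl)

lemma coord_Y: "coord (nerve Y p) (letters p) \<kappa>"
  by (rule coord_nerve[OF Y S B rm])

lemma coord_X: "coord (nerve X p) (nerve_letters (Inl ` \<beta>I) (Inl ` \<beta>A) p) (\<lambda>x. \<kappa> (nerve_map \<mu> \<nu> x))"
proof -
  have "\<kappa>B (\<nu> (cm_map X r)) = linear_extension rm (\<kappa>S (\<mu> r))" if "r \<in> carrier (cm_top X)" for r
    using rm[of "\<mu> r"] morphism_simps[OF X Y XY] that by simp
  from coord_nerve[OF X XS XB this]
  have "coord (nerve X p) (nerve_letters (Inl ` \<beta>I) (Inl ` \<beta>A) p) (nerve_coord (\<lambda>i. \<kappa>S (\<mu> i)) (\<lambda>a. \<kappa>B (\<nu> a)))" .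
  moreover have "\<kappa> (nerve_map \<mu> \<nu> x) = nerve_coord (\<lambda>i. \<kappa>S (\<mu> i)) (\<lambda>a. \<kappa>B (\<nu> a)) x" for x
    by (simp add: nerve_coord_def nerve_map_def foldr_map comp_def)
  ultimately show ?thesis by simp
qed

lemma letters_X: "nerve_letters (Inl ` \<beta>I) (Inl ` \<beta>A) p = letters p \<inter> (I_letters \<union> W_letters)"
  by (auto simp: nerve_letters_def I_letters_def W_letters_def)

lemma coord_Z: "coord (nerve Z p) (nerve_letters (Inr ` \<beta>T) (Inr ` \<beta>C) p) (nerve_coord \<kappa>T \<kappa>C :: _ \<Rightarrow> ((nat \<times> ('x + 'y)) + ('x + 'z) \<Rightarrow>\<^sub>0 'k))"
proof (rule coord_nerve[OF Z ZT ZC])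
  fix t assume t: "t \<in> carrier (cm_top Z)"
  \<comment> \<open>A lift of t, found as the element of the middle algebra with the same
    coordinates; the structure map of Z is read off from it.\<close>
  let ?s = "vec (cm_top Y) \<kappa>S (\<kappa>T t)"
  have k: "\<kappa>T t \<in> supp (Inl ` \<beta>I \<union> Inr ` \<beta>T)" by (rule supp_mono[OF coord_supp[OF ZT t]]) simp
  have s: "?s \<in> carrier (cm_top Y)" "\<kappa>S ?s = \<kappa>T t" using vec_closed[OF S k] coord_vec[OF S k] by auto
  have "\<kappa>T t \<in> supp (range Inr)" by (rule supp_mono[OF coord_supp[OF ZT t]]) auto
  then have "\<kappa>T (\<eta> ?s) = \<kappa>T t" using \<eta>[OF s(1)] s(2) by (simp add: restrict_chain_id)
  then have "\<eta> ?s = t" using morphism_simps(1)[OF Y Z YZ s(1)] t coord_inj[OF ZT] by blast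
  then have "\<kappa>C (cm_map Z t) = restrict_chain (range Inr) (linear_extension rm (\<kappa>T t))"
    using morphism_simps(9)[OF Y Z YZ s(1)] \<theta>[of "cm_map Y ?s"] map_hom(1)[OF Y s(1)] rm[OF s(1)] s(2) by simp
  also have "\<dots> = linear_extension (\<lambda>x. restrict_chain (range Inr) (rm x)) (\<kappa>T t)"
    by (rule linear_extension_lin[OF lin_restrict_chain, symmetric])
  finally show "\<kappa>C (cm_map Z t) = linear_extension (\<lambda>x. restrict_chain (range Inr) (rm x)) (\<kappa>T t)" .
qed

lemma coord_map_Z: "x \<in> carrier (nerve Y p) \<Longrightarrow> nerve_coord \<kappa>T \<kappa>C (nerve_map \<eta> \<theta> x) = restrict_chain Z_letters (\<kappa> x)"
proof (induction p arbitrary: x)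
  case 0
  then obtain b where "x = ([], b)" "b \<in> carrier (cm_base Y)" by auto
  moreover have "Inr -` Z_letters = range Inr" by (auto simp: Z_letters_def)
  ultimately show ?case by (simp add: \<theta> relabel_restrict)
next
  case (Suc p)
  obtain s y where x: "x = tuple_cons s y" "s \<in> carrier (cm_top Y)" "y \<in> carrier (nerve Y p)" using nerve_cases[OF Suc.prems] .
  have "first_letter -` Z_letters = range Inr" by (auto simp: Z_letters_def)
  moreover have "shift_letter -` Z_letters = Z_letters"
  proof (rule Set.set_eqI)
    fix b show "b \<in> shift_letter -` Z_letters \<longleftrightarrow> b \<in> Z_letters"
      by (cases b rule: shift_letter.cases) (auto simp: Z_letters_def)
  qed
  ultimately show ?case using Suc.IH[OF x(3)] x(2) by (simp add: x(1) \<eta> relabel_restrict restrict_chain_add)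
qed

end

text \<open>At level \<open>p\<close> put \<open>e\<^sub>i = entry i a\<close> for \<open>i \<le> p\<close> and \<open>e\<^bsub>p+1\<^esub> = Inr (Inl a)\<close>. For \<open>j \<le> p\<close> the map
  \<open>up_letter j\<close> sends \<open>e\<^sub>i\<close> to \<open>e\<^bsub>j+1\<^esub> - e\<^sub>j\<close> (at level \<open>p + 1\<close>) if \<open>i > j\<close>, and to 0 otherwise; the terms
  surviving in its homotopy formula telescope.\<close>

definition entry :: "nat \<Rightarrow> 'x \<Rightarrow> ((nat \<times> ('x + 'y)) + ('x + 'z) \<Rightarrow>\<^sub>0 'k::field)" where
  "entry i a = (if i = 0 then 0 else word (Inl (i, Inl a)))"

fun up_letter :: "nat \<Rightarrow> (nat \<times> ('x + 'y)) + ('x + 'z) \<Rightarrow> ((nat \<times> ('x + 'y)) + ('x + 'z) \<Rightarrow>\<^sub>0 'k::field)" where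
  "up_letter j (Inl (i, Inl a)) = (if j < i then entry (Suc j) a - entry j a else 0)"
| "up_letter j (Inr (Inl a)) = entry (Suc j) a - entry j a"
| "up_letter j _ = 0"

text \<open>The degeneracy s_i on letters, which inserts a zero behind the i-th entry.\<close>

fun slide_letter :: "nat \<Rightarrow> (nat \<times> 'x) + 'y \<Rightarrow> (nat \<times> 'x) + 'y" where
  "slide_letter i (Inl (j, x)) = Inl (if j \<le> i then j else Suc j, x)"
| "slide_letter i (Inr y) = Inr y"

text \<open>The iterated degeneracy of an element of level 0.\<close>

primrec base_tuple :: "('k::field, 's, 'b) crossed_mod \<Rightarrow> nat \<Rightarrow> 'b \<Rightarrow> 's list \<times> 'b" where
  "base_tuple Y 0 b = ([], b)"
| "base_tuple Y (Suc p) b = tuple_cons \<zero>\<^bsub>cm_top Y\<^esub> (base_tuple Y p b)"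

section \<open>Products, faces and contraction of the letters of a split extension\<close>

context split_coords
begin

interpretation Y: algebra_action "cm_base Y" "cm_top Y" "cm_lact Y" "cm_ract Y" by (rule crossed_module_action[OF Y])

lemma ker_top_iff: "s \<in> carrier (cm_top Y) \<Longrightarrow> s \<in> ker_top Y Z \<eta> \<longleftrightarrow> \<kappa>S s \<in> supp (range Inl)"
proof -
  assume s: "s \<in> carrier (cm_top Y)"
  have "\<eta> s = \<zero>\<^bsub>cm_top Z\<^esub> \<longleftrightarrow> \<kappa>T (\<eta> s) = 0"
    using coord_zero[OF ZT] coord_inj[OF ZT morphism_simps(1)[OF Y Z YZ s] ground_module_closed(3)[OF coord_module[OF ZT]]] by auto
  then show ?thesis
    using s by (simp add: ker_top_def[OF Y Z YZ] \<eta> restrict_chain_eq_0_iff range_Inr_Compl)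
qed

text \<open>The assumption \<open>ideal\<close> gives one direction; there it matters that X is an
  inclusion, so that base elements with coordinates in \<open>\<beta>I\<close> come from the top
  algebra. For the other direction \<open>rm\<close> is the identity on the letters from X.\<close>

lemma image_ker_top_iff: "b \<in> carrier (cm_base Y) \<Longrightarrow> b \<in> cm_map Y ` ker_top Y Z \<eta> \<longleftrightarrow> \<kappa>B b \<in> supp (Inl ` \<beta>I)"
proof
  assume "b \<in> cm_map Y ` ker_top Y Z \<eta>"
  then obtain s where s: "b = cm_map Y s" "s \<in> ker_top Y Z \<eta>" by blast
  have s': "s \<in> carrier (cm_top Y)" using ker_top_closed(1)[OF Y Z YZ s(2)] .
  have "\<kappa>S s \<in> supp ((Inl ` \<beta>I \<union> Inr ` \<beta>T) \<inter> range Inl)"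
    using coord_supp[OF S s'] iffD1[OF ker_top_iff[OF s'] s(2)] by (auto simp: supp_def)
  then have "linear_extension rm (\<kappa>S s) \<in> supp (Inl ` \<beta>I)"
    by (rule lin_supp[OF lin_linear_extension]) (auto simp: rm_Inl)
  then show "\<kappa>B b \<in> supp (Inl ` \<beta>I)" by (simp add: s(1) rm[OF s'])
next
  assume "b \<in> carrier (cm_base Y)" "\<kappa>B b \<in> supp (Inl ` \<beta>I)"
  from ideal[OF this] show "b \<in> cm_map Y ` ker_top Y Z \<eta>" by (auto simp: ker_top_def[OF Y Z YZ])
qed

lemma nerve_ideal_coord: "x \<in> carrier (nerve Y p) \<Longrightarrow> nerve_ideal Y Z \<eta> x \<longleftrightarrow> \<kappa> x \<in> supp I_letters"
proof (induction p arbitrary: x)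
  case 0
  then obtain b where "x = ([], b)" "b \<in> carrier (cm_base Y)" by auto
  moreover have "Inr -` I_letters = Inl ` \<beta>I" by (auto simp: I_letters_def)
  ultimately show ?case by (simp add: nerve_ideal_simps[OF Y Z YZ] image_ker_top_iff relabel_supp_iff)
next
  case (Suc p)
  obtain s y where x: "x = tuple_cons s y" "s \<in> carrier (cm_top Y)" "y \<in> carrier (nerve Y p)" using nerve_cases[OF Suc.prems] .
  have 1: "relabel first_letter (\<kappa>S s) \<in> supp (range first_letter)" by (rule relabel_supp) simp
  have 2: "relabel shift_letter (\<kappa> y) \<in> supp (shift_letter ` letters p)" by (rule relabel_supp[OF coord_supp[OF coord_Y x(3)]])
  have disj: "range first_letter \<inter> shift_letter ` letters p = {}" by (auto simp: nerve_letters_def)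
  have "first_letter -` I_letters = range Inl" by (auto simp: I_letters_def)
  moreover have "shift_letter -` I_letters = I_letters"
  proof (rule Set.set_eqI)
    fix b show "b \<in> shift_letter -` I_letters \<longleftrightarrow> b \<in> I_letters"
      by (cases b rule: shift_letter.cases) (auto simp: I_letters_def)
  qed
  moreover have "inj (first_letter :: 'x + 'y \<Rightarrow> (nat \<times> ('x + 'y)) + ('x + 'z))" by (auto simp: inj_def)
  ultimately show ?case
    using Suc.IH[OF x(3)] x(2)
    by (simp add: x(1) nerve_ideal_simps[OF Y Z YZ] ker_top_iff supp_add_disjoint[OF 1 2 disj] relabel_supp_iff inj_shift_letter)
qed

lemma m_I_letters:
  assumes "b \<in> I_letters \<or> b' \<in> I_letters"
  shows "m p b b' \<in> supp I_letters"
proof -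
  let ?e = "\<lambda>b. basis_vec (nerve Y p) (letters p) \<kappa> (word b)"
  have e: "?e b \<in> carrier (nerve Y p)" for b by (rule basis_vec_closed[OF coord_Y])
  have J: "nerve_ideal Y Z \<eta> (?e b)" if "b \<in> I_letters" for b
    unfolding nerve_ideal_coord[OF e] coord_basis_vec[OF coord_Y] by (rule restrict_chain_closed) (simp add: that)
  have "nerve_ideal Y Z \<eta> (?e b \<otimes>\<^bsub>nerve Y p\<^esub> ?e b')"
    using assms nerve_ideal_mult[OF Y Z YZ e J e] by blast
  then show ?thesis unfolding struct_const_def nerve_ideal_coord[OF nerve_mult_closed[OF Y e e]] .
qed

lemma nerve_map_zero_iff: "x \<in> carrier (nerve Y p) \<Longrightarrow> nerve_map \<eta> \<theta> x = \<zero>\<^bsub>nerve Z p\<^esub> \<longleftrightarrow> \<kappa> x \<in> supp (I_letters \<union> W_letters)"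
proof -
  assume x: "x \<in> carrier (nerve Y p)"
  have closed: "nerve_map \<eta> \<theta> x \<in> carrier (nerve Z p)" by (rule nerve_map_closed[OF Y Z YZ x])
  have "nerve_map \<eta> \<theta> x = \<zero>\<^bsub>nerve Z p\<^esub> \<longleftrightarrow> nerve_coord \<kappa>T \<kappa>C (nerve_map \<eta> \<theta> x) = (0 :: (nat \<times> ('x + 'y)) + ('x + 'z) \<Rightarrow>\<^sub>0 'k)"
    using coord_zero[OF coord_Z[of p]] coord_inj[OF coord_Z[of p] closed ground_module_closed(3)[OF nerve_module[OF Z]]] by metis
  then show ?thesis by (simp add: coord_map_Z[OF x] restrict_chain_eq_0_iff Z_letters)
qed

text \<open>The letters of type I or W span the kernel of the algebra homomorphism to the nerve of
  Z, and a kernel is an ideal.\<close>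

lemma m_X_letters:
  assumes "b \<in> I_letters \<union> W_letters \<or> b' \<in> I_letters \<union> W_letters"
  shows "m p b b' \<in> supp (I_letters \<union> W_letters)"
proof -
  interpret N: nonunital_algebra "nerve Z p" by (rule nerve_algebra[OF Z])
  let ?e = "\<lambda>b. basis_vec (nerve Y p) (letters p) \<kappa> (word b)"
  have e: "?e b \<in> carrier (nerve Y p)" for b by (rule basis_vec_closed[OF coord_Y])
  have J: "nerve_map \<eta> \<theta> (?e b) = \<zero>\<^bsub>nerve Z p\<^esub>" if "b \<in> I_letters \<union> W_letters" for b
    unfolding nerve_map_zero_iff[OF e] coord_basis_vec[OF coord_Y] by (rule restrict_chain_closed) (use that in simp)
  have c: "nerve_map \<eta> \<theta> (?e b) \<in> carrier (nerve Z p)" for b by (rule nerve_map_closed[OF Y Z YZ e])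
  have "nerve_map \<eta> \<theta> (?e b \<otimes>\<^bsub>nerve Y p\<^esub> ?e b') = nerve_map \<eta> \<theta> (?e b) \<otimes>\<^bsub>nerve Z p\<^esub> nerve_map \<eta> \<theta> (?e b')"
    by (rule nerve_map_mult[OF Y Z YZ e e])
  also have "\<dots> = \<zero>\<^bsub>nerve Z p\<^esub>" using assms J[of b] J[of b'] N.zero_mult[OF c] by auto
  finally show ?thesis unfolding struct_const_def nerve_map_zero_iff[OF nerve_mult_closed[OF Y e e]] .
qed

lemma base_tuple:
  shows base_tuple_closed: "b \<in> carrier (cm_base Y) \<Longrightarrow> base_tuple Y p b \<in> carrier (nerve Y p)"
    and base_tuple_coord: "\<kappa> (base_tuple Y p b) = relabel Inr (\<kappa>B b)"
proof -
  show "b \<in> carrier (cm_base Y) \<Longrightarrow> base_tuple Y p b \<in> carrier (nerve Y p)" by (induction p) auto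
  show "\<kappa> (base_tuple Y p b) = relabel Inr (\<kappa>B b)" by (induction p) (auto simp: coord_zero[OF S] relabel_comp)
qed

lemma base_tuple_mult:
  assumes "b \<in> carrier (cm_base Y)" "b' \<in> carrier (cm_base Y)"
  shows "base_tuple Y p b \<otimes>\<^bsub>nerve Y p\<^esub> base_tuple Y p b' = base_tuple Y p (b \<otimes>\<^bsub>cm_base Y\<^esub> b')"
  by (induction p) (simp_all add: Y.zero_act Y.R.zero_mult nerve_total_closed[OF Y base_tuple_closed] assms)

text \<open>Letters of the last entry multiply inside the image of the iterated degeneracies, which
  is a copy of the base algebra at every level.\<close>

lemma m_Inr: "m p (Inr y) (Inr y') = m 0 (Inr y) (Inr y')"
proof -
  let ?B = "Inl ` \<beta>A \<union> Inr ` \<beta>C"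
  let ?b = "\<lambda>y. basis_vec (cm_base Y) ?B \<kappa>B (word y)"
  have b: "?b y \<in> carrier (cm_base Y)" for y by (rule basis_vec_closed[OF B])
  have e: "basis_vec (nerve Y p) (letters p) \<kappa> (word (Inr y)) = base_tuple Y p (?b y)" for y p
  proof (rule coord_inj[OF coord_Y basis_vec_closed[OF coord_Y] base_tuple_closed[OF b]])
    have "Inr y \<in> letters p \<longleftrightarrow> y \<in> ?B" by (auto simp: nerve_letters_def)
    then show "\<kappa> (basis_vec (nerve Y p) (letters p) \<kappa> (word (Inr y))) = \<kappa> (base_tuple Y p (?b y))"
      by (simp add: coord_basis_vec[OF coord_Y] coord_basis_vec[OF B] base_tuple_coord restrict_chain_word)
  qed
  show ?thesis unfolding struct_const_def e base_tuple_mult[OF b b] base_tuple_coord ..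
qed

lemma fc_entry:
  assumes "a \<in> \<beta>I" "i \<le> Suc p"
  shows "linear_extension (fc (Suc p) j) (entry i a) =
    (if j < i then entry (i - 1) a else if i = Suc p then word (Inr (Inl a)) else entry i a)"
  using assms by (auto simp: entry_def nerve_fc_def nerve_letters_def rm_Inl chains.linear_0[OF lin_linear_extension])

lemma fc_entry_diff:
  "linear_extension (fc (Suc p) j) (entry i a - entry i' a) = linear_extension (fc (Suc p) j) (entry i a) - linear_extension (fc (Suc p) j) (entry i' a)"
  by (rule chains.linear_diff[OF lin_linear_extension])

lemma I_letter_cases:
  assumes "b \<in> letters p \<inter> I_letters"
  obtains i a where "b = Inl (i, Inl a)" "a \<in> \<beta>I" "1 \<le> i" "i \<le> p" | a where "b = Inr (Inl a)" "a \<in> \<beta>I"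
  using assms by (auto simp: nerve_letters_def I_letters_def)

lemma fc_letter: "b \<in> letters p \<Longrightarrow> fc p j b = face_letter rm p j b"
  by (simp add: nerve_fc_def)

lemma slide_letter_letters: "b \<in> letters p \<Longrightarrow> i \<le> p \<Longrightarrow> slide_letter i b \<in> letters (Suc p)"
  by (cases b rule: shift_letter.cases) (auto simp: nerve_letters_def)

sublocale coord_letters letters m fc I_letters W_letters "\<lambda>p. up_letter" slide_letter
proof
  fix p :: nat and b b' :: "(nat \<times> ('x + 'y)) + ('x + 'z)"
  show "m p b b' \<in> supp (letters p)" by (rule struct_const_supp[OF nerve_algebra[OF Y] coord_Y])
  show "bil (m p) (bil (m p) u v) w = bil (m p) u (bil (m p) v w)" for u v w
    by (rule struct_const_assoc[OF nerve_algebra[OF Y] coord_Y])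
  show "linear_extension (fc (Suc p) j) (bil (m (Suc p)) u v) =
       bil (m p) (linear_extension (fc (Suc p) j) u) (linear_extension (fc (Suc p) j) v)" if "j \<le> Suc p" for j u v
    by (rule nerve_fc_mult[OF Y S B rm rm_supp that])
  show "linear_extension (fc (Suc p) i) (fc (Suc (Suc p)) j b) = linear_extension (fc (Suc p) (j - 1)) (fc (Suc (Suc p)) i b)"
    if "i < j" "j \<le> Suc (Suc p)" for i j
    by (rule nerve_fc_fc[OF Y S B rm rm_supp that])
  show "I_letters \<inter> W_letters = {}" by (auto simp: I_letters_def W_letters_def)
  show "m p b b' \<in> supp I_letters" if "b \<in> I_letters \<or> b' \<in> I_letters" by (rule m_I_letters[OF that])
  show "m p b b' \<in> supp (I_letters \<union> W_letters)" if "b \<in> I_letters \<union> W_letters \<or> b' \<in> I_letters \<union> W_letters"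
    by (rule m_X_letters[OF that])
  show "restrict_chain W_letters (m p b b') = restrict_chain W_letters (m 0 b b')" if "b \<in> W_letters" "b' \<in> W_letters"
  proof -
    obtain y y' where "b = Inr y" "b' = Inr y'" using \<open>b \<in> W_letters\<close> \<open>b' \<in> W_letters\<close> by (auto simp: W_letters_def)
    then show ?thesis using m_Inr[of p y y'] by simp
  qed
  show "b \<in> letters p \<longleftrightarrow> b \<in> letters 0" if "b \<in> W_letters" using that by (auto simp: W_letters_def nerve_letters_def)
  show "fc (Suc p) j b \<in> supp (letters p \<inter> I_letters)" if b: "b \<in> letters (Suc p) \<inter> I_letters" and j: "j \<le> Suc p" for j
    using b by (rule I_letter_cases) (use b j \<beta>I in \<open>auto simp: fc_letter rm_Inl nerve_letters_def I_letters_def\<close>)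
  show "fc (Suc p) j b = word b" if "b \<in> letters (Suc p) \<inter> W_letters" for j
    using that by (auto simp: fc_letter W_letters_def)
  \<comment> \<open>Only the last face could leave the lifted letters, as it applies the structure
    map. That it does not is \<open>rm_Inr\<close>, the trace of a splitting that commutes with the
    structure maps.\<close>
  show "fc (Suc p) j b \<in> supp (letters p - I_letters - W_letters)" if b: "b \<in> letters (Suc p) - I_letters - W_letters" and j: "j \<le> Suc p" for j
  proof -
    have "b \<in> Z_letters" using b Z_letters by blast
    then consider i t where "b = Inl (i, Inr t)" | c where "b = Inr (Inr c)" by (auto simp: Z_letters_def)
    then have "fc (Suc p) j b \<in> supp Z_letters"
    proof cases
      case 1
      then have "t \<in> \<beta>T" using b by (auto simp: nerve_letters_def)
      from relabel_supp[OF rm_Inr[OF this], of "Inr :: _ \<Rightarrow> nat \<times> ('x + 'y) + _"]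
      have "relabel Inr (rm (Inr t)) \<in> supp Z_letters" by (rule supp_mono) (auto simp: Z_letters_def)
      then show ?thesis using b 1 by (auto simp: fc_letter Z_letters_def)
    next
      case 2
      then show ?thesis using b by (auto simp: fc_letter Z_letters_def)
    qed
    moreover have "fc (Suc p) j b \<in> supp (letters p)" by (rule nerve_fc_supp[OF Y S B rm rm_supp _ j]) (use b in auto)
    ultimately show ?thesis using Z_letters by (auto simp: supp_def)
  qed
  show "slide_letter i b \<in> letters (Suc p)" if "b \<in> letters p" "i \<le> p" for i by (rule slide_letter_letters[OF that])
  show "slide_letter i b \<in> I_letters \<longleftrightarrow> b \<in> I_letters" "slide_letter i b \<in> W_letters \<longleftrightarrow> b \<in> W_letters" for i
    by (cases b rule: shift_letter.cases; auto simp: I_letters_def W_letters_def)+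
  show "fc (Suc p) j (slide_letter i b) = relabel (slide_letter (i - 1)) (fc p j b)" if b: "b \<in> letters p" and "j < i" "i \<le> p" for i j
    using that slide_letter_letters[OF b \<open>i \<le> p\<close>]
    by (cases b rule: shift_letter.cases) (auto simp: fc_letter nerve_letters_def)
  show "fc (Suc p) (Suc i) (slide_letter i b) = word b" if b: "b \<in> letters p" and i: "i \<le> p" for i
    using slide_letter_letters[OF b i] b i
    by (cases b rule: shift_letter.cases) (auto simp: fc_letter nerve_letters_def)
  show "fc (Suc p) j (slide_letter i b) = relabel (slide_letter i) (fc p (j - 1) b)" if b: "b \<in> letters p" and "Suc i < j" "j \<le> Suc p" for i j
    using that slide_letter_letters[OF b, of i]
    by (cases b rule: shift_letter.cases) (auto simp: fc_letter nerve_letters_def relabel_comp)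
  show "up_letter i b \<in> supp (letters (Suc p) \<inter> I_letters)" if b: "b \<in> letters p \<inter> I_letters" and i: "i \<le> p" for i
  proof -
    have "entry k a \<in> supp (letters (Suc p) \<inter> I_letters)" if "a \<in> \<beta>I" "k \<le> Suc p" for k a
      using that by (auto simp: entry_def nerve_letters_def I_letters_def)
    with b i show ?thesis by (elim I_letter_cases) (auto intro!: supp_diff)
  qed
  show "linear_extension (fc (Suc p) j) (up_letter i b) = linear_extension (up_letter (i - 1)) (fc p j b)"
    if b: "b \<in> letters p \<inter> I_letters" and ij: "j < i" "i \<le> p" for i j
    using b
  proof (cases rule: I_letter_cases)
    case (1 k a)
    then show ?thesis using b ij
      by (auto simp: fc_entry_diff fc_entry fc_letter chains.linear_0[OF lin_linear_extension])
  next
    case (2 a)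
    then show ?thesis using b ij by (auto simp: fc_entry_diff fc_entry fc_letter)
  qed
  show "linear_extension (fc (Suc p) i) (up_letter i b) = 0" if b: "b \<in> letters p \<inter> I_letters" and i: "i \<le> p" for i
    using b by (rule I_letter_cases) (use i in \<open>auto simp: fc_entry_diff fc_entry chains.linear_0[OF lin_linear_extension]\<close>)
  show "linear_extension (fc (Suc p) j) (up_letter i b) = linear_extension (up_letter i) (fc p (j - 1) b)"
    if b: "b \<in> letters p \<inter> I_letters" and ij: "Suc i < j" "j \<le> Suc p" for i j
    using b
  proof (cases rule: I_letter_cases)
    case (1 k a)
    then show ?thesis using b ij
      by (auto simp: fc_entry_diff fc_entry fc_letter rm_Inl chains.linear_0[OF lin_linear_extension])
  next
    case (2 a)
    then show ?thesis using b ij by (auto simp: fc_entry_diff fc_entry fc_letter)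
  qed
  show "(\<Sum>i\<le>p. linear_extension (fc (Suc p) (Suc i)) (up_letter i b)) = word b" if b: "b \<in> letters p \<inter> I_letters"
    using b
  proof (cases rule: I_letter_cases)
    case (1 k a)
    \<comment> \<open>The letter sits in entry k, so \<open>up_letter i\<close> kills it for i \<ge>
      k and the telescope ends at k.\<close>
    have "(\<Sum>i\<le>p. linear_extension (fc (Suc p) (Suc i)) (up_letter i b)) = (\<Sum>i<k. entry (Suc i) a - entry i a)"
      by (rule sum.mono_neutral_cong_right)
        (use 1 in \<open>auto simp: fc_entry_diff fc_entry chains.linear_0[OF lin_linear_extension]\<close>)
    also have "\<dots> = entry k a - entry 0 a" by (rule sum_lessThan_telescope)
    also have "\<dots> = word b" using 1 by (simp add: entry_def)
    finally show ?thesis .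
  next
    case (2 a)
    \<comment> \<open>The summand i = p is special: the last face d_(p+1) carries the entry p + 1
      into the base, where it becomes the letter b.\<close>
    have "(\<Sum>i\<le>p. linear_extension (fc (Suc p) (Suc i)) (up_letter i b)) =
        (\<Sum>i<p. entry (Suc i) a - entry i a) + (word b - entry p a)"
      unfolding lessThan_Suc_atMost[symmetric] sum.lessThan_Suc
      using 2 by (auto simp: fc_entry_diff fc_entry intro!: sum.cong)
    also have "(\<Sum>i<p. entry (Suc i) a - entry i a) = entry p a - entry 0 a" by (rule sum_lessThan_telescope)
    also have "entry p a - entry 0 a + (word b - entry p a) = word b" by (simp add: entry_def)
    finally show ?thesis .
  qed
qed

end

section \<open>Excision\<close>

lemma tensor_zero: "0 \<in> set vs \<Longrightarrow> tensor vs = 0"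
  by (induction vs) (auto simp: chains.linear_0[OF lin_letter])

lemma thom_restrict: "thom (\<lambda>b. if b \<in> J then word b else 0) (word w) = (if set w \<subseteq> J then word w else 0)"
proof (cases "set w \<subseteq> J")
  case True
  then have "map (\<lambda>b. if b \<in> J then word b else 0) w = map (\<lambda>b. word b :: 'a \<Rightarrow>\<^sub>0 'b) w" by auto
  then show ?thesis using True by (simp add: tensor_words del: map_eq_conv)
next
  case False
  then have "(0 :: 'a \<Rightarrow>\<^sub>0 'b) \<in> set (map (\<lambda>b. if b \<in> J then word b else 0) w)" by (auto simp: image_iff)
  then show ?thesis using False by (simp add: tensor_zero del: set_map)
qed

lemma slicewise_thom_restrict:
  "slicewise (slicewise (thom (\<lambda>b. if b \<in> J then word b else 0))) u = restrict_chain {(p, c, w). set w \<subseteq> J} u"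
  by (rule lin_eqI[of "slicewise _" "restrict_chain _"])
    (auto intro!: lin_intros simp: slicewise_def thom_restrict restrict_chain_word chains.linear_0[OF lin_put] simp del: thom_word split: if_splits)

lemma slicewise_thom_id: "slicewise (slicewise (thom word)) u = u"
  by (rule lin_eqI[of "slicewise _" "\<lambda>u. u"]) (auto intro!: lin_intros simp: slicewise_def tensor_words)

context split_coords
begin

lemma alg_Y: "coord_alg (nerve Y p) (letters p) \<kappa> (m p)"
  by (rule coord_alg_struct_const[OF nerve_algebra[OF Y] coord_Y])

text \<open>The structure constants of Y serve for X as well, because X takes its coordinates from
  its image in Y. Hence the complexes of X and Y carry the same differential on chains, and the
  chain map is an inclusion of cells.\<close>

lemma alg_X: "coord_alg (nerve X p) (letters p \<inter> (I_letters \<union> W_letters)) (\<lambda>x. \<kappa> (nerve_map \<mu> \<nu> x)) (m p)"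
  unfolding coord_alg_def
proof (intro conjI ballI)
  show "coord (nerve X p) (letters p \<inter> (I_letters \<union> W_letters)) (\<lambda>x. \<kappa> (nerve_map \<mu> \<nu> x))"
    using coord_X letters_X by simp
  show "\<kappa> (nerve_map \<mu> \<nu> (x \<otimes>\<^bsub>nerve X p\<^esub> y)) = bil (m p) (\<kappa> (nerve_map \<mu> \<nu> x)) (\<kappa> (nerve_map \<mu> \<nu> y))"
    if "x \<in> carrier (nerve X p)" "y \<in> carrier (nerve X p)" for x y
    using that by (simp add: nerve_map_mult[OF X Y XY] nerve_map_closed[OF X Y XY] coord_algD(3)[OF alg_Y])
qed (rule nerve_algebra[OF X])

lemma face_X:
  assumes "x \<in> carrier (nerve X (Suc p))" "j \<le> Suc p"
  shows "\<kappa> (nerve_map \<mu> \<nu> (nerve_face X (Suc p) j x)) = linear_extension (fc (Suc p) j) (\<kappa> (nerve_map \<mu> \<nu> x))"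
proof -
  have "nerve_map \<mu> \<nu> x \<in> carrier (nerve Y (Suc p))" by (rule nerve_map_closed[OF X Y XY assms(1)])
  from nerve_coord_fc[OF Y S B rm rm_supp this assms(2)] show ?thesis
    by (simp add: nerve_map_face[OF X Y XY assms])
qed

lemma bar_cells_eq: "tcells (\<lambda>p q. words_on (letters p \<inter> (I_letters \<union> W_letters)) (Suc q)) = bar_cells"
  by (rule ext) (auto simp flip: length_greater_0_conv simp: tcells_def bar_cells_def words_on_def)

lemma X_cells_eq: "tcells (\<lambda>p. tcells (cc2_cells (letters p \<inter> (I_letters \<union> W_letters)))) = X_cells"
  by (rule ext) (auto simp flip: length_greater_0_conv simp: tcells_def cc2_cells_def X_cells_def cells_def words_on_def split: if_splits)

lemma cells_eq: "tcells (\<lambda>p. tcells (cc2_cells (letters p))) = cells"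
  by (rule ext) (auto simp flip: length_greater_0_conv simp: tcells_def cc2_cells_def cells_def words_on_def split: if_splits)

lemma pres_bar_X:
  "pres_complex (bar_complex_cm X) bar_cells (tphi (\<lambda>p q. fibre (nerve X p) (\<lambda>x. \<kappa> (nerve_map \<mu> \<nu> x)) (Suc q))) dbar"
proof -
  have dbar: "dbar = simp_tot (\<lambda>p j. thom (fc p j)) (\<lambda>p. bar (m p))" by (simp add: dbar_def face_def[abs_def])
  show ?thesis
    using pres_bar_complex_cm[OF X alg_X face_X] dbar_dbar unfolding bar_cells_eq dbar by blast
qed

lemma dtot_eq: "dtot = simp_tot (\<lambda>p j. slicewise (thom (fc p j))) (\<lambda>p. cc2D (m p))"
  by (simp add: dtot_def face_def[abs_def])

lemma pres_X:
  "pres_complex (cc2_complex_cm X) X_cells (tphi (\<lambda>p. tphi (cc2_fibre (nerve X p) (\<lambda>x. \<kappa> (nerve_map \<mu> \<nu> x))))) dtot"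
  using pres_cc2_complex_cm[OF X alg_X face_X] dtot_dtot unfolding X_cells_eq dtot_eq by blast

lemma pres_Y: "pres_complex (cc2_complex_cm Y) cells (tphi (\<lambda>p. tphi (cc2_fibre (nerve Y p) \<kappa>))) dtot"
  using pres_cc2_complex_cm[OF Y alg_Y nerve_coord_fc[OF Y S B rm rm_supp]] dtot_dtot unfolding cells_eq dtot_eq by blast

lemma restrict_cells:
  assumes "u \<in> supp (cells n)"
  shows "restrict_chain {(p, c, w). set w \<subseteq> Z_letters} u \<in>
      supp (tcells (\<lambda>p. tcells (cc2_cells (nerve_letters (Inr ` \<beta>T) (Inr ` \<beta>C) p))) n)"
    and "restrict_chain {(p, c, w). set w \<subseteq> Z_letters} u = 0 \<longleftrightarrow> u \<in> supp (K_cells n)"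
proof -
  have Zl: "letters p \<inter> Z_letters = nerve_letters (Inr ` \<beta>T) (Inr ` \<beta>C) p" for p
    by (auto simp: nerve_letters_def Z_letters_def)
  show "restrict_chain {(p, c, w). set w \<subseteq> Z_letters} u \<in>
      supp (tcells (\<lambda>p. tcells (cc2_cells (nerve_letters (Inr ` \<beta>T) (Inr ` \<beta>C) p))) n)"
    by (rule lin_supp[OF lin_restrict_chain assms])
      (auto simp flip: length_greater_0_conv Zl simp: restrict_chain_word tcells_def cc2_cells_def cells_def words_on_def)
  have "K_cells n = cells n \<inter> - {(p, c, w). set w \<subseteq> Z_letters}"
    using Z_letters by (auto simp: K_cells_def)
  then show "restrict_chain {(p, c, w). set w \<subseteq> Z_letters} u = 0 \<longleftrightarrow> u \<in> supp (K_cells n)"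
    using assms by (auto simp: restrict_chain_eq_0_iff supp_def)
qed

theorem quasi_isomorphism_kernel:
  assumes "\<And>n. trivial_group (bar_homology X n)"
  shows "quasi_isomorphism (cc2_complex_cm X)
    (kernel_complex (cc2_complex_cm Y) (cc2_complex_cm Z) (cc2_map_cm Z \<eta> \<theta>)) (cc2_map_cm Y \<mu> \<nu>)"
proof -
  have "\<exists>v\<in>supp (bar_cells (Suc n)). u = dbar v" if "u \<in> supp (bar_cells n)" "dbar u = 0" for n u
    using acyclic_of_trivial_homology[OF pres_bar_X _ that] assms[of n] by (simp add: bar_homology_def)
  from contraction_exists[OF this] obtain h where "contracted_letters letters m fc I_letters W_letters (\<lambda>p. up_letter) slide_letter h"
    by blast
  then interpret contracted_letters letters m fc I_letters W_letters "\<lambda>p. up_letter" slide_letter h .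
  let ?Zc = "\<lambda>p. nerve_letters (Inr ` \<beta>T) (Inr ` \<beta>C) p :: ((nat \<times> ('x + 'y)) + ('x + 'z)) set"
  let ?G = "restrict_chain {(p, c, w). set w \<subseteq> Z_letters}"
  let ?\<kappa>Z = "nerve_coord \<kappa>T \<kappa>C :: _ \<Rightarrow> ((nat \<times> ('x + 'y)) + ('x + 'z) \<Rightarrow>\<^sub>0 'k)"
  have Z_map: "nerve_map \<eta> \<theta> x \<in> carrier (nerve Z p) \<and>
      ?\<kappa>Z (nerve_map \<eta> \<theta> x) = linear_extension (\<lambda>b. if b \<in> Z_letters then word b else 0) (\<kappa> x)"
    if "x \<in> carrier (nerve Y p)" for p x
    using coord_map_Z[OF that] nerve_map_closed[OF Y Z YZ that] by (simp add: restrict_chain_def)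
  have Y_map: "nerve_map \<mu> \<nu> x \<in> carrier (nerve Y p) \<and> \<kappa> (nerve_map \<mu> \<nu> x) = linear_extension word (\<kappa> (nerve_map \<mu> \<nu> x))"
    if "x \<in> carrier (nerve X p)" for p x
    using nerve_map_closed[OF X Y XY that] by (simp add: linear_extension_id)
  have K: "pres_complex (kernel_complex (cc2_complex_cm Y) (cc2_complex_cm Z) (cc2_map_cm Z \<eta> \<theta>)) K_cells
      (tphi (\<lambda>p. tphi (cc2_fibre (nerve Y p) \<kappa>))) dtot"
  proof (rule pres_complex_kernel[OF pres_Y pres_cc2_complex_cm_grp[OF coord_Z]])
    fix n and u :: "nat \<times> nat \<times> ((nat \<times> ('x + 'y)) + ('x + 'z)) list \<Rightarrow>\<^sub>0 'k" assume u: "u \<in> supp (cells n)"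
    then have u': "u \<in> supp (tcells (\<lambda>p. tcells (cc2_cells (letters p))) n)" by (simp add: cells_eq)
    show "?G u \<in> supp (tcells (\<lambda>p. tcells (cc2_cells (?Zc p))) n) \<and>
        cc2_map_cm Z \<eta> \<theta> n (tphi (\<lambda>p. tphi (cc2_fibre (nerve Y p) \<kappa>)) n u) = tphi (\<lambda>p. tphi (cc2_fibre (nerve Z p) ?\<kappa>Z)) n (?G u)"
      using restrict_cells(1)[OF u] cc2_map_cm_tphi[OF coord_Y coord_Z Z_map u'] by (simp add: slicewise_thom_restrict)
    show "?G u = 0 \<longleftrightarrow> u \<in> supp (K_cells n)" by (rule restrict_cells(2)[OF u])
  next
    show "K_cells n \<subseteq> cells n" for n by (auto simp: K_cells_def)
    show "dtot u \<in> supp (K_cells n)" if "u \<in> supp (K_cells (Suc n))" for n u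
      by (rule lin_supp[OF lin_dtot that]) (rule supp_mono[OF dtot_cells], auto simp: K_cells_def)
  qed
  show ?thesis
  proof (rule quasi_iso_inclusion[OF pres_X K])
    show "X_cells n \<subseteq> K_cells n" for n
    proof
      fix e assume e: "e \<in> X_cells n"
      then obtain p c w where "e = (p, c, w)" "w \<noteq> []" "set w \<subseteq> I_letters \<union> W_letters" by (auto simp: X_cells_def cells_def)
      then show "e \<in> K_cells n" using e by (cases w) (auto simp: X_cells_def K_cells_def)
    qed
    fix n and u :: "nat \<times> nat \<times> ((nat \<times> ('x + 'y)) + ('x + 'z)) list \<Rightarrow>\<^sub>0 'k" assume "u \<in> supp (X_cells n)"
    then have u: "u \<in> supp (tcells (\<lambda>p. tcells (cc2_cells (letters p \<inter> (I_letters \<union> W_letters)))) n)" by (simp add: X_cells_eq)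
    show "cc2_map_cm Y \<mu> \<nu> n (tphi (\<lambda>p. tphi (cc2_fibre (nerve X p) (\<lambda>x. \<kappa> (nerve_map \<mu> \<nu> x)))) n u) =
        tphi (\<lambda>p. tphi (cc2_fibre (nerve Y p) \<kappa>)) n u"
      using cc2_map_cm_tphi[OF coord_algD(2)[OF alg_X] coord_Y Y_map u] by (simp add: slicewise_thom_id)
  qed (rule K_acyclic)
qed

end

section \<open>Bases for an extension of an inclusion crossed module\<close>

lemma coord_relabel: "coord V B \<kappa> \<Longrightarrow> inj f \<Longrightarrow> coord V (f ` B) (\<lambda>x. relabel f (\<kappa> x))"
  by (rule coord_transport[of V B \<kappa> V f "\<lambda>x. x"]) (auto simp: coord_module bij_betw_def)

lemma algebra_hom_linear: "algebra_hom A B f \<Longrightarrow> linear_map A B f"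
  by (simp add: algebra_hom_def)

theorem theorem3p4p1:
  fixes A :: "('k::field, 'a) module" and I :: "'a set"
  assumes "nonunital_algebra A"
    and "algebra_ideal I A"
    and "\<And>n. trivial_group (bar_homology (inclusion_crossed_module I A) n)"
  shows "excisive_HH TYPE('s) TYPE('b) TYPE('t) TYPE('c) (inclusion_crossed_module I A)"
  unfolding excisive_HH_def
proof (intro conjI allI impI)
  show "crossed_module (inclusion_crossed_module I A)" by (rule crossed_module_inclusion[OF assms(1,2)])
  fix Y :: "('k, 's, 'b) crossed_mod" and Z :: "('k, 't, 'c) crossed_mod" and \<mu> \<nu> \<eta> \<theta>
  assume ext: "linearly_split_extension (inclusion_crossed_module I A) Y Z \<mu> \<nu> \<eta> \<theta>"
  let ?X = "inclusion_crossed_module I A"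
  have X: "crossed_module ?X" and Y: "crossed_module Y" and Z: "crossed_module Z"
    and XY: "crossed_module_morphism ?X Y \<mu> \<nu>" and YZ: "crossed_module_morphism Y Z \<eta> \<theta>"
    and ex: "short_exact (cm_top ?X) (cm_top Y) (cm_top Z) \<mu> \<eta>" "short_exact (cm_base ?X) (cm_base Y) (cm_base Z) \<nu> \<theta>"
    using ext by (auto simp: linearly_split_extension_def)
  obtain \<gamma> \<delta> where split: "linear_map (cm_top Z) (cm_top Y) \<gamma>" "linear_map (cm_base Z) (cm_base Y) \<delta>"
    "\<And>t. t \<in> carrier (cm_top Z) \<Longrightarrow> \<eta> (\<gamma> t) = t" "\<And>c. c \<in> carrier (cm_base Z) \<Longrightarrow> \<theta> (\<delta> c) = c"
    "\<And>t. t \<in> carrier (cm_top Z) \<Longrightarrow> cm_map Y (\<gamma> t) = \<delta> (cm_map Z t)"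
    using ext unfolding linearly_split_extension_def by blast
  have X_simps: "cm_base ?X = A" "cm_top ?X = A\<lparr>carrier := I\<rparr>" "cm_map ?X x = x" for x
    by (simp_all add: inclusion_crossed_module_def)
  note lin_mor = XY[unfolded crossed_module_morphism_def, THEN conjunct1, THEN algebra_hom_linear]
    XY[unfolded crossed_module_morphism_def, THEN conjunct2, THEN conjunct1, THEN algebra_hom_linear]
    YZ[unfolded crossed_module_morphism_def, THEN conjunct1, THEN algebra_hom_linear]
    YZ[unfolded crossed_module_morphism_def, THEN conjunct2, THEN conjunct1, THEN algebra_hom_linear]
  have modules: "Module.module ground_field (cm_top M)" "Module.module ground_field (cm_base M)" if "crossed_module M"
    for M :: "('k, 'm, 'n) crossed_mod"
    using crossed_module_action[OF that] by (simp_all add: algebra_action_def nonunital_algebra_def)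
  have modA: "Module.module ground_field A" using assms(1) by (simp add: nonunital_algebra_def)
  interpret I: algebra_ideal I A by (rule assms(2))
  have I_sub: "I \<subseteq> carrier A" using I.subset by simp

  \<comment> \<open>A single basis of A that contains a basis of I serves for the base and for the
    top algebra, so that the inclusion is the identity on labels.\<close>
  obtain BA BI and \<kappa>A :: "'a \<Rightarrow> (('a \<Rightarrow>\<^sub>0 'k) \<Rightarrow>\<^sub>0 'k)" where \<kappa>A: "coord A BA \<kappa>A" "BI \<subseteq> BA"
    "\<And>x. x \<in> carrier A \<Longrightarrow> \<kappa>A x \<in> supp BI \<longleftrightarrow> x \<in> I"
  proof (rule adapted_coord[OF modA I_sub])
    show "\<zero>\<^bsub>A\<^esub> \<in> I" using ground_module_closed(3)[OF modules(1)[OF X]] by (simp add: X_simps)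
    show "x \<oplus>\<^bsub>A\<^esub> y \<in> I" if "x \<in> I" "y \<in> I" for x y using ground_module_closed(1)[OF modules(1)[OF X]] that by (simp add: X_simps)
    show "c \<odot>\<^bsub>A\<^esub> x \<in> I" if "x \<in> I" for c x using ground_module_closed(2)[OF modules(1)[OF X]] that by (simp add: X_simps)
  qed (rule that)
  \<comment> \<open>Here only a basis is wanted, so the subspace to which it is adapted is the whole
    module.\<close>
  obtain BT BT' and \<kappa>T :: "'t \<Rightarrow> (('t \<Rightarrow>\<^sub>0 'k) \<Rightarrow>\<^sub>0 'k)" where \<kappa>T: "coord (cm_top Z) BT \<kappa>T" "BT' \<subseteq> BT"
    using adapted_coord[OF modules(1)[OF Z] order_refl] ground_module_closed[OF modules(1)[OF Z]] by metis
  obtain BC BC' and \<kappa>C :: "'c \<Rightarrow> (('c \<Rightarrow>\<^sub>0 'k) \<Rightarrow>\<^sub>0 'k)" where \<kappa>C: "coord (cm_base Z) BC \<kappa>C" "BC' \<subseteq> BC"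
    using adapted_coord[OF modules(2)[OF Z] order_refl] ground_module_closed[OF modules(2)[OF Z]] by metis

  have \<kappa>I: "coord (cm_top ?X) BI \<kappa>A"
    unfolding coord_def X_simps
  proof (intro conjI ballI allI)
    show "bij_betw \<kappa>A (carrier (A\<lparr>carrier := I\<rparr>)) (supp BI)"
      unfolding bij_betw_def
    proof
      show "inj_on \<kappa>A (carrier (A\<lparr>carrier := I\<rparr>))"
        using coord_bij[OF \<kappa>A(1)] I_sub by (auto simp: bij_betw_def intro: inj_on_subset)
      have "v \<in> \<kappa>A ` I" if v: "v \<in> supp BI" for v
      proof -
        have "v \<in> supp BA" by (rule supp_mono[OF v \<kappa>A(2)])
        then show ?thesis using vec_closed[OF \<kappa>A(1)] coord_vec[OF \<kappa>A(1)] \<kappa>A(3) v by (metis image_eqI)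
      qed
      then show "\<kappa>A ` carrier (A\<lparr>carrier := I\<rparr>) = supp BI" using \<kappa>A(3) I_sub by auto
    qed
  qed (use modules(1)[OF X] in \<open>auto simp: X_simps coord_add[OF \<kappa>A(1)] coord_smult[OF \<kappa>A(1)] subsetD[OF I_sub]\<close>)
  have \<kappa>A': "coord (cm_base ?X) BA \<kappa>A" by (simp add: X_simps \<kappa>A(1))

  obtain \<kappa>S where S: "coord (cm_top Y) (Inl ` BI \<union> Inr ` BT) \<kappa>S" "\<And>u. u \<in> carrier (cm_top ?X) \<Longrightarrow> \<kappa>S (\<mu> u) = relabel Inl (\<kappa>A u)"
    "\<And>t. t \<in> carrier (cm_top Z) \<Longrightarrow> \<kappa>S (\<gamma> t) = relabel Inr (\<kappa>T t)"
    "\<And>s. s \<in> carrier (cm_top Y) \<Longrightarrow> restrict_chain (range Inr) (\<kappa>S s) = relabel Inr (\<kappa>T (\<eta> s))"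
    "\<And>s. s \<in> carrier (cm_top Y) \<Longrightarrow> \<exists>u\<in>carrier (cm_top ?X). s = \<mu> u \<oplus>\<^bsub>cm_top Y\<^esub> \<gamma> (\<eta> s)"
    by (rule split_coord[OF \<kappa>I \<kappa>T(1) modules(1)[OF Y] ex(1) lin_mor(1,3) split(1,3)]) blast+
  obtain \<kappa>B where B: "coord (cm_base Y) (Inl ` BA \<union> Inr ` BC) \<kappa>B" "\<And>a. a \<in> carrier (cm_base ?X) \<Longrightarrow> \<kappa>B (\<nu> a) = relabel Inl (\<kappa>A a)"
    "\<And>c. c \<in> carrier (cm_base Z) \<Longrightarrow> \<kappa>B (\<delta> c) = relabel Inr (\<kappa>C c)"
    "\<And>b. b \<in> carrier (cm_base Y) \<Longrightarrow> restrict_chain (range Inr) (\<kappa>B b) = relabel Inr (\<kappa>C (\<theta> b))"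
    "\<And>b. b \<in> carrier (cm_base Y) \<Longrightarrow> \<theta> b = \<zero>\<^bsub>cm_base Z\<^esub> \<Longrightarrow> b \<in> \<nu> ` carrier (cm_base ?X)"
    by (rule split_coord[OF \<kappa>A' \<kappa>C(1) modules(2)[OF Y] ex(2) lin_mor(2,4) split(2,4)]) blast+

  \<comment> \<open>The structure map of Z in coordinates.\<close>
  define \<tau> where "\<tau> v = \<kappa>C (cm_map Z (basis_vec (cm_top Z) BT \<kappa>T v))" for v
  have lin_\<tau>: "lin \<tau>"
    by (rule linI) (simp_all add: \<tau>_def basis_vec_linear[OF \<kappa>T(1)] basis_vec_closed[OF \<kappa>T(1)] map_hom[OF Z] coord_add[OF \<kappa>C(1)] coord_smult[OF \<kappa>C(1)])
  define rm :: "('a \<Rightarrow>\<^sub>0 'k) + ('t \<Rightarrow>\<^sub>0 'k) \<Rightarrow> (('a \<Rightarrow>\<^sub>0 'k) + ('c \<Rightarrow>\<^sub>0 'k) \<Rightarrow>\<^sub>0 'k)"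
    where "rm = case_sum (\<lambda>x. word (Inl x)) (\<lambda>y. relabel Inr (\<tau> (word y)))"

  interpret split_coords ?X Y Z \<mu> \<nu> \<eta> \<theta> BI BA BT BC \<kappa>S \<kappa>B "\<lambda>t. relabel Inr (\<kappa>T t)" "\<lambda>c. relabel Inr (\<kappa>C c)" rm
  proof
    show "coord (cm_top ?X) (Inl ` BI) (\<lambda>i. \<kappa>S (\<mu> i))" by (rule coord_cong[OF coord_relabel[OF \<kappa>I]]) (simp_all add: S(2))
    show "coord (cm_base ?X) (Inl ` BA) (\<lambda>a. \<kappa>B (\<nu> a))" by (rule coord_cong[OF coord_relabel[OF \<kappa>A']]) (simp_all add: B(2))
    show "coord (cm_top Z) (Inr ` BT) (\<lambda>t. relabel Inr (\<kappa>T t))" by (rule coord_relabel[OF \<kappa>T(1)]) simp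
    show "coord (cm_base Z) (Inr ` BC) (\<lambda>c. relabel Inr (\<kappa>C c))" by (rule coord_relabel[OF \<kappa>C(1)]) simp
    show "rm (Inl x) = word (Inl x)" for x by (simp add: rm_def)
    show "rm (Inr y) \<in> supp (Inr ` BC)" for y
      unfolding rm_def sum.case \<tau>_def by (intro relabel_supp coord_supp[OF \<kappa>C(1)] map_hom(1)[OF Z] basis_vec_closed[OF \<kappa>T(1)])
    \<comment> \<open>An element of the middle algebra is the sum of one from X, where the structure
      map is the inclusion, and of a lift, where it is a lift of the structure map of Z by
      compatibility of the splittings.\<close>
    show "\<kappa>B (cm_map Y s) = linear_extension rm (\<kappa>S s)" if s: "s \<in> carrier (cm_top Y)" for s
    proof -
      obtain u where u: "u \<in> carrier (cm_top ?X)" "s = \<mu> u \<oplus>\<^bsub>cm_top Y\<^esub> \<gamma> (\<eta> s)" using S(5)[OF s] by blast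
      have uA: "u \<in> carrier (cm_base ?X)" using u(1) I_sub by (auto simp: X_simps)
      have t: "\<eta> s \<in> carrier (cm_top Z)" by (rule morphism_simps(1)[OF Y Z YZ s])
      have \<gamma>t: "\<gamma> (\<eta> s) \<in> carrier (cm_top Y)" using split(1) t by (auto simp: linear_map_def hom_def)
      have \<mu>u: "\<mu> u \<in> carrier (cm_top Y)" by (rule morphism_simps(1)[OF X Y XY u(1)])
      have "cm_map Y s = cm_map Y (\<mu> u) \<oplus>\<^bsub>cm_base Y\<^esub> cm_map Y (\<gamma> (\<eta> s))"
        by (subst u(2)) (rule map_hom(2)[OF Y \<mu>u \<gamma>t])
      then have "\<kappa>B (cm_map Y s) = \<kappa>B (cm_map Y (\<mu> u)) + \<kappa>B (cm_map Y (\<gamma> (\<eta> s)))"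
        by (simp add: coord_add[OF B(1)] map_hom(1)[OF Y] \<mu>u \<gamma>t)
      also have "\<dots> = relabel Inl (\<kappa>A u) + relabel Inr (\<kappa>C (cm_map Z (\<eta> s)))"
        using morphism_simps(9)[OF X Y XY u(1)] uA
        by (simp add: X_simps(3) B(2) split(5)[OF t] B(3)[OF map_hom(1)[OF Z t]])
      also have "\<dots> = linear_extension rm (relabel Inl (\<kappa>A u) + relabel Inr (\<kappa>T (\<eta> s)))"
      proof -
        have "linear_extension rm (relabel Inl v) = relabel Inl v" for v
          by (simp add: linear_extension_relabel rm_def) (simp add: relabel_def)
        moreover have "linear_extension rm (relabel Inr v) = relabel Inr (\<tau> v)" for v
          by (simp add: linear_extension_relabel rm_def linear_extension_lin[OF lin_relabel] linear_extension_eqI[OF lin_\<tau>])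
        ultimately show ?thesis
          by (simp add: chains.linear_add[OF lin_linear_extension] \<tau>_def basis_vec_coord[OF \<kappa>T(1) t])
      qed
      also have "relabel Inl (\<kappa>A u) + relabel Inr (\<kappa>T (\<eta> s)) = \<kappa>S (\<mu> u) + \<kappa>S (\<gamma> (\<eta> s))"
        by (simp add: S(2)[OF u(1)] S(3)[OF t])
      also have "\<dots> = \<kappa>S s" by (subst (2) u(2)) (rule coord_add[OF S(1) \<mu>u \<gamma>t, symmetric])
      finally show ?thesis .
    qed
    \<comment> \<open>The coordinates show first that b maps to 0 in the base of Z, hence comes from
      some a in A, and then that a lies in I; the witness is the image of a under the map of top
      algebras.\<close>
    show "\<exists>s\<in>carrier (cm_top Y). \<eta> s = \<zero>\<^bsub>cm_top Z\<^esub> \<and> b = cm_map Y s"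
      if b: "b \<in> carrier (cm_base Y)" and bI: "\<kappa>B b \<in> supp (Inl ` BI)" for b
    proof -
      have "restrict_chain (range Inr) (\<kappa>B b) = 0" by (rule restrict_chain_zero[OF bI]) auto
      then have "relabel Inr (\<kappa>C (\<theta> b)) = (relabel Inr 0 :: ('a \<Rightarrow>\<^sub>0 'k) + ('c \<Rightarrow>\<^sub>0 'k) \<Rightarrow>\<^sub>0 'k)" using B(4)[OF b] by simp
      then have "\<kappa>C (\<theta> b) = \<kappa>C \<zero>\<^bsub>cm_base Z\<^esub>" using relabel_inj[of Inr "\<kappa>C (\<theta> b)" 0] by (simp add: coord_zero[OF \<kappa>C(1)])
      then have "\<theta> b = \<zero>\<^bsub>cm_base Z\<^esub>"
        by (rule coord_inj[OF \<kappa>C(1) morphism_simps(5)[OF Y Z YZ b] ground_module_closed(3)[OF modules(2)[OF Z]]])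
      then obtain a where a: "a \<in> carrier (cm_base ?X)" "b = \<nu> a" using B(5)[OF b] by blast
      have "\<kappa>A a \<in> supp BI" using bI B(2)[OF a(1)] by (simp add: a(2) relabel_supp_iff inj_vimage_image_eq)
      then have aI: "a \<in> carrier (cm_top ?X)" using \<kappa>A(3) a(1) by (simp add: X_simps)
      then have "\<mu> a \<in> a_kernel (cm_top Y) (cm_top Z) \<eta>" using ex(1) by (auto simp: short_exact_def)
      then have "\<mu> a \<in> carrier (cm_top Y)" "\<eta> (\<mu> a) = \<zero>\<^bsub>cm_top Z\<^esub>" by (auto simp: a_kernel_def kernel_def)
      moreover have "b = cm_map Y (\<mu> a)" using morphism_simps(9)[OF X Y XY aI] by (simp add: a(2) X_simps)
      ultimately show ?thesis by blast
    qed
  qed (use X Y Z XY YZ \<kappa>A(2) S(1,4) B(1,4) in auto)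
  show "quasi_isomorphism (cc2_complex_cm ?X)
      (kernel_complex (cc2_complex_cm Y) (cc2_complex_cm Z) (cc2_map_cm Z \<eta> \<theta>)) (cc2_map_cm Y \<mu> \<nu>)"
    by (rule quasi_isomorphism_kernel[OF assms(3)])
qed

end
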